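(* Let $q=p^k$ be a prime power, $t\geq 2$ an integer, and let $T=\{(A_i,a_i): i=1,\dots,j\}$ be a generic $j$-element set of vertices of the projective norm graph $\mathrm{NG}(q,t)$. (a) If $j=2$, then $\deg(T)=\frac{q^{t-1}-1}{q-1}-\xi(T)$. (b) Suppose $j=3$ and $q$ is odd, and put $c_1=c_1(T)=\frac{a_1}{a_3}N\!\left(\frac{A_2-A_3}{A_1-A_2}\right)\in\mathbb{F}_q$ and $c_2=c_2(T)=\frac{a_2}{a_3}N\!\left(\frac{A_1-A_3}{A_1-A_2}\right)\in\mathbb{F}_q$. Then: - if $t=3$, $\deg(T)=1-\eta_{\mathbb{F}_q}\big((1+c_1-c_2)^2-4c_1\big)-\xi(T)$; - if $t=4$ and $(c_1,c_2)=(1,-1)$, $\deg(T)=2q+1-\eta_{\mathbb{F}_q}(-3)-\xi(T)$; - in all other cases (i.e. $t\geq 4$ and not ($t=4$ and $(c_1,c_2)=(1,-1)$)), $\deg(T)=q^{t-3}+O(q^{t-3.5})$, where for each fixed $t$ the implied constant is independent of $q$ and $T$. (c) If $j=4$ and $t\geq 4$, then $\deg(T)\leq 6(q^{t-4}+q^{t-5}+\cdots+q+1)$.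
   Context: For a prime power $q$ and integer $t\geq 2$, $N:\mathbb{F}_{q^{t-1}}\to\mathbb{F}_q$ is the norm $N(A)=A\cdot A^q\cdots A^{q^{t-2}}$. The projective norm graph $\mathrm{NG}(q,t)$ has vertex set $\mathbb{F}_{q^{t-1}}\times\mathbb{F}_q^*$, and vertices $(A,a)$ and $(B,b)$ are adjacent iff $N(A+B)=ab$; here loops are kept, i.e. a vertex $(A,a)$ with $N(2A)=a^2$ is adjacent to itself. For a vertex $v$, $\mathcal{N}(v)$ is the set of vertices adjacent to $v$ (including $v$ itself if it has a loop); for a vertex set $T$, $\deg(T)=|\bigcap_{v\in T}\mathcal{N}(v)|$. A vertex set is generic if the first coordinates of its elements are pairwise distinct, and aligned if all its elements have the same second coordinate; $\xi(T)=1$ if $T$ is aligned and $\xi(T)=0$ otherwise. For odd $q$, $\eta_{\mathbb{F}_q}$ is the quadratic character of $\mathbb{F}_q$ ($1$ on nonzero squares, $-1$ on nonsquares), extended by $\eta_{\mathbb{F}_q}(0)=0$. *)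

theory Defs
  imports Complex_Main "HOL-Algebra.Subrings" "HOL-Number_Theory.Prime_Powers"
begin

text \<open>The extension of finite fields of order \<open>q ^ (t - 1)\<close> over order \<open>q\<close> is modelled by a
  HOL-Algebra field \<open>L\<close> together with its subfield \<open>K\<close> with \<open>q\<close> elements. Working with carriers
  rather than with a type per field allows one to quantify over all such fields in the scope of an
  existential quantifier, as is needed for error constants that do not depend on \<open>q\<close>. Every finite
  field is isomorphic to one whose carrier is contained in a given infinite type, such as
  \<open>nat\<close>, so a statement about all \<open>L :: nat ring\<close> covers all finite fields at once.\<close>

definition finite_field_ext :: "('a, 'b) ring_scheme \<Rightarrow> 'a set \<Rightarrow> nat \<Rightarrow> nat \<Rightarrow> bool" where
  "finite_field_ext L K q t \<longleftrightarrow>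
     field L \<and> finite (carrier L) \<and> card (carrier L) = q ^ (t - 1) \<and> subfield K L \<and> card K = q"

definition field_norm :: "('a, 'b) ring_scheme \<Rightarrow> nat \<Rightarrow> nat \<Rightarrow> 'a \<Rightarrow> 'a" where
  "field_norm L q t A = (\<Otimes>\<^bsub>L\<^esub>i\<in>{..<t - 1}. A [^]\<^bsub>L\<^esub> (q ^ i))"

definition field_div :: "('a, 'b) ring_scheme \<Rightarrow> 'a \<Rightarrow> 'a \<Rightarrow> 'a" where
  "field_div L x y = x \<otimes>\<^bsub>L\<^esub> inv\<^bsub>L\<^esub> y"

definition quad_char :: "('a, 'b) ring_scheme \<Rightarrow> 'a set \<Rightarrow> 'a \<Rightarrow> int" where
  "quad_char L K x =
     (if x = \<zero>\<^bsub>L\<^esub> then 0 else if \<exists>y\<in>K. x = y \<otimes>\<^bsub>L\<^esub> y then 1 else - 1)"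

definition ng_verts :: "('a, 'b) ring_scheme \<Rightarrow> 'a set \<Rightarrow> ('a \<times> 'a) set" where
  "ng_verts L K = carrier L \<times> (K - {\<zero>\<^bsub>L\<^esub>})"

definition ng_adj :: "('a, 'b) ring_scheme \<Rightarrow> nat \<Rightarrow> nat \<Rightarrow> 'a \<times> 'a \<Rightarrow> 'a \<times> 'a \<Rightarrow> bool" where
  "ng_adj L q t u v \<longleftrightarrow> field_norm L q t (fst u \<oplus>\<^bsub>L\<^esub> fst v) = snd u \<otimes>\<^bsub>L\<^esub> snd v"

definition ng_nbhd :: "('a, 'b) ring_scheme \<Rightarrow> 'a set \<Rightarrow> nat \<Rightarrow> nat \<Rightarrow> 'a \<times> 'a \<Rightarrow> ('a \<times> 'a) set" where
  "ng_nbhd L K q t v = {w \<in> ng_verts L K. ng_adj L q t v w}"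

definition ng_deg :: "('a, 'b) ring_scheme \<Rightarrow> 'a set \<Rightarrow> nat \<Rightarrow> nat \<Rightarrow> ('a \<times> 'a) set \<Rightarrow> nat" where
  "ng_deg L K q t T = card (\<Inter>v\<in>T. ng_nbhd L K q t v)"

definition generic :: "('a \<times> 'a) set \<Rightarrow> bool" where
  "generic T \<longleftrightarrow> inj_on fst T"

definition aligned :: "('a \<times> 'a) set \<Rightarrow> bool" where
  "aligned T \<longleftrightarrow> (\<forall>u\<in>T. \<forall>v\<in>T. snd u = snd v)"

definition xi :: "('a \<times> 'a) set \<Rightarrow> int" where
  "xi T = (if aligned T then 1 else 0)"

definition ng_c1 ::
  "('a, 'b) ring_scheme \<Rightarrow> nat \<Rightarrow> nat \<Rightarrow> 'a \<times> 'a \<Rightarrow> 'a \<times> 'a \<Rightarrow> 'a \<times> 'a \<Rightarrow> 'a" where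
  "ng_c1 L q t v1 v2 v3 =
     field_div L (snd v1) (snd v3) \<otimes>\<^bsub>L\<^esub>
     field_norm L q t (field_div L (fst v2 \<ominus>\<^bsub>L\<^esub> fst v3) (fst v1 \<ominus>\<^bsub>L\<^esub> fst v2))"

definition ng_c2 ::
  "('a, 'b) ring_scheme \<Rightarrow> nat \<Rightarrow> nat \<Rightarrow> 'a \<times> 'a \<Rightarrow> 'a \<times> 'a \<Rightarrow> 'a \<times> 'a \<Rightarrow> 'a" where
  "ng_c2 L q t v1 v2 v3 =
     field_div L (snd v2) (snd v3) \<otimes>\<^bsub>L\<^esub>
     field_norm L q t (field_div L (fst v1 \<ominus>\<^bsub>L\<^esub> fst v3) (fst v1 \<ominus>\<^bsub>L\<^esub> fst v2))"

end

theory Submission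
  imports Defs "HOL-Algebra.UnivPoly" "HOL-Algebra.Multiplicative_Group" "HOL-Decision_Procs.Commutative_Ring"
begin

text \<open>Write \<open>n = t - 1\<close>. The substitution \<open>U = 1 / (X + A)\<close> turns the common neighbourhood of two, three
  or four vertices into a set of field elements with one, two or three prescribed norms; the value
  \<open>U = 0\<close>, present iff \<open>T\<close> is aligned, accounts for \<open>\<xi>(T)\<close>. For three vertices the conditions become
  \<open>N(Z) = c\<^sub>1\<close> and \<open>N(Z + 1) = c\<^sub>2\<close>.

  If \<open>n = 2\<close>, then \<open>Z\<close> is a root of a fixed quadratic. If \<open>n = 3\<close>, then \<open>Z\<close> is a root of a member of the
  pencil \<open>x\<^sup>3 - s x\<^sup>2 + (e - s) x - c\<^sub>1\<close> with \<open>e = c\<^sub>2 - c\<^sub>1 - 1\<close>, and the quadratic character of the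
  discriminant decides how the members split; the discriminant is a quartic in \<open>s\<close>, a square only if
  \<open>(c\<^sub>1, c\<^sub>2) = (1, -1)\<close>. If \<open>n = 4\<close>, the case \<open>n = 2\<close> over the intermediate field of order \<open>q\<^sup>2\<close>
  leaves character sums over the circles \<open>v\<^sup>q\<^sup>+\<^sup>1 = c\<^sub>2\<close>, which the rational parametrisation of the
  circle turns into character sums of quartics over \<open>K\<close>. These quartic sums are \<open>O(\<surd>q)\<close> by
  Stepanov's method. If \<open>n \<ge> 5\<close>, the second moment of the counts over all \<open>(c\<^sub>1, c\<^sub>2)\<close> already gives
  an error of \<open>O(q\<^sup>n\<^sup>/\<^sup>2)\<close>.

  For four vertices one eliminates two of the conjugates of \<open>Z\<close> from the three norm equations, and
  the degree of the resulting polynomial bounds the count.\<close>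

section \<open>Polynomial functions\<close>

text \<open>The admissible error is q^(n - 5/2), so a deviation of size q^(n/2) is affordable
  exactly when n \<ge> 5; the small degrees n = 3 and n = 4 need square-root cancellation. The
  obstruction to cancellation is a quartic that is a constant multiple of a square. For n = 3 it
  isolates the exceptional pair, for n = 4 it costs at most three values of an outer variable, which
  are bounded trivially. None of the resulting constants depends on t, so a single one serves for
  all t.

  Polynomials occur in two guises. Where zeros are merely counted, functions with a degree bound
  suffice; \<open>polyfun\<close> encodes them by a Horner scheme. Stepanov's method needs formal
  polynomials, because its degrees exceed q and zeros count with multiplicity. These multiplicities
  can exceed the characteristic, so Taylor coefficients take the place of derivatives. Counting
  arguments stand in for generators of the multiplicative group, for splitting fields and for
  dimension counts.\<close>

fun polyfun :: "('a, 'b) ring_scheme \<Rightarrow> nat \<Rightarrow> ('a \<Rightarrow> 'a) \<Rightarrow> bool" where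
  "polyfun R 0 f \<longleftrightarrow> (\<exists>c\<in>carrier R. \<forall>x\<in>carrier R. f x = c)"
| "polyfun R (Suc d) f \<longleftrightarrow>
     (\<exists>c\<in>carrier R. \<exists>g. polyfun R d g \<and> (\<forall>x\<in>carrier R. f x = c \<oplus>\<^bsub>R\<^esub> x \<otimes>\<^bsub>R\<^esub> g x))"

section \<open>Ring identities decided by normal forms\<close>

context cring
begin

definition lookup :: "'a list \<Rightarrow> nat \<Rightarrow> 'a \<Rightarrow> bool" where
  "lookup l n x \<longleftrightarrow> head (drop n l) = x"

text \<open>Reification by resolution: with schematic expressions and a schematic, open-ended list of
  atoms, these rules, tried in order, translate both sides of an equation into expressions over
  the same list. The equation then reduces to equality of normal forms, which the simplifier computes.\<close>

lemma reify:
  "Ipolex l P = x \<Longrightarrow> Ipolex l Q = y \<Longrightarrow> Ipolex l (Add P Q) = x \<oplus> y"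
  "Ipolex l P = x \<Longrightarrow> Ipolex l Q = y \<Longrightarrow> Ipolex l (Sub P Q) = x \<ominus> y"
  "Ipolex l P = x \<Longrightarrow> Ipolex l Q = y \<Longrightarrow> Ipolex l (Mul P Q) = x \<otimes> y"
  "Ipolex l P = x \<Longrightarrow> Ipolex l (Neg P) = \<ominus> x"
  "Ipolex l P = x \<Longrightarrow> Ipolex l (Pow P k) = x [^] k"
  "Ipolex l (Const 0) = \<zero>"
  "Ipolex l (Const 1) = \<one>"
  "Ipolex l (Const i) = \<guillemotleft>i\<guillemotright>"
  "lookup l n x \<Longrightarrow> Ipolex l (Var n) = x"
  "lookup (x # l) 0 x"
  "lookup l n x \<Longrightarrow> lookup (y # l) (Suc n) x"
  "in_carrier []"
  "in_carrier l \<Longrightarrow> x \<in> carrier R \<Longrightarrow> in_carrier (x # l)"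
  by (simp_all add: lookup_def in_carrier_Nil in_carrier_Cons)

lemma ring_eqI:
  "Ipolex l P = x \<Longrightarrow> Ipolex l Q = y \<Longrightarrow> in_carrier l \<Longrightarrow> norm P = norm Q \<Longrightarrow> x = y"
  using norm_eq by blast

end

declare mkPinj_def [simp] mkPX_def [simp] sub_def [simp]

section \<open>Closure properties, factorisation and number of polynomial functions\<close>

context cring
begin

lemma polyfun_closed: "polyfun R d f \<Longrightarrow> x \<in> carrier R \<Longrightarrow> f x \<in> carrier R"
proof (induction d arbitrary: f)
  case (Suc d)
  then obtain c g where "c \<in> carrier R" "polyfun R d g" "f x = c \<oplus> x \<otimes> g x"
    by auto
  with Suc show ?case by simp
qed auto

lemma polyfun_cong: "polyfun R d f \<Longrightarrow> (\<And>x. x \<in> carrier R \<Longrightarrow> g x = f x) \<Longrightarrow> polyfun R d g"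
  by (cases d) auto

lemma polyfun_const: "c \<in> carrier R \<Longrightarrow> polyfun R d (\<lambda>x. c)"
proof (induction d arbitrary: c)
  case (Suc d)
  have "polyfun R d (\<lambda>x. \<zero>)" by (rule Suc) simp
  then show ?case using Suc.prems by (auto intro!: bexI[of _ c] exI[of _ "\<lambda>x. \<zero>"])
qed auto

lemma polyfun_Suc: "polyfun R d f \<Longrightarrow> polyfun R (Suc d) f"
proof (induction d arbitrary: f)
  case 0
  then obtain c where c: "c \<in> carrier R" "\<And>x. x \<in> carrier R \<Longrightarrow> f x = c" by auto
  moreover have "polyfun R 0 (\<lambda>x. \<zero>)" by (rule polyfun_const) simp
  ultimately show ?case by (subst polyfun.simps) (force simp del: polyfun.simps)
next
  case (Suc d)
  then obtain c g where "c \<in> carrier R" "polyfun R d g" "\<And>x. x \<in> carrier R \<Longrightarrow> f x = c \<oplus> x \<otimes> g x"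
    by auto
  with Suc.IH[of g] show ?case by (subst polyfun.simps) blast
qed

lemma polyfun_mono: "polyfun R d f \<Longrightarrow> d \<le> e \<Longrightarrow> polyfun R e f"
  by (rotate_tac 1, induction rule: dec_induct) (auto simp del: polyfun.simps intro: polyfun_Suc)

lemma polyfun_add:
  "polyfun R d f \<Longrightarrow> polyfun R d g \<Longrightarrow> polyfun R d (\<lambda>x. f x \<oplus> g x)"
proof (induction d arbitrary: f g)
  case 0
  then show ?case by auto
next
  case (Suc d)
  from Suc.prems obtain c f' where f: "c \<in> carrier R" "polyfun R d f'"
      "\<And>x. x \<in> carrier R \<Longrightarrow> f x = c \<oplus> x \<otimes> f' x"
    by auto
  from Suc.prems obtain e g' where g: "e \<in> carrier R" "polyfun R d g'"
      "\<And>x. x \<in> carrier R \<Longrightarrow> g x = e \<oplus> x \<otimes> g' x"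
    by auto
  have "f x \<oplus> g x = (c \<oplus> e) \<oplus> x \<otimes> (f' x \<oplus> g' x)" if x: "x \<in> carrier R" for x
  proof -
    have "f' x \<in> carrier R" "g' x \<in> carrier R"
      using f g x polyfun_closed by auto
    then show ?thesis using f(1) g(1) x unfolding f(3)[OF x] g(3)[OF x] by algebra
  qed
  moreover have "polyfun R d (\<lambda>x. f' x \<oplus> g' x)" by (rule Suc.IH[OF f(2) g(2)])
  moreover have "c \<oplus> e \<in> carrier R" using f(1) g(1) by simp
  ultimately show ?case by (subst polyfun.simps) blast
qed

lemma polyfun_xmult: "polyfun R d f \<Longrightarrow> polyfun R (Suc d) (\<lambda>x. x \<otimes> f x)"
  by (subst polyfun.simps) (auto intro!: bexI[of _ \<zero>] exI[of _ f] simp: polyfun_closed)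

lemma polyfun_smult: "polyfun R d f \<Longrightarrow> a \<in> carrier R \<Longrightarrow> polyfun R d (\<lambda>x. a \<otimes> f x)"
proof (induction d arbitrary: f)
  case (Suc d)
  then obtain c g where f: "c \<in> carrier R" "polyfun R d g" "\<And>x. x \<in> carrier R \<Longrightarrow> f x = c \<oplus> x \<otimes> g x"
    by auto
  have "a \<otimes> f x = a \<otimes> c \<oplus> x \<otimes> (a \<otimes> g x)" if x: "x \<in> carrier R" for x
    using f(1) Suc.prems(2) x polyfun_closed[OF f(2) x] unfolding f(3)[OF x] by algebra
  with Suc.IH[OF f(2) Suc.prems(2)] Suc.prems(2) f(1) show ?case
    by (subst polyfun.simps) blast
qed auto

lemma polyfun_mult:
  "polyfun R d f \<Longrightarrow> polyfun R e g \<Longrightarrow> polyfun R (d + e) (\<lambda>x. f x \<otimes> g x)"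
proof (induction d arbitrary: f)
  case 0
  then obtain c where "c \<in> carrier R" "\<And>x. x \<in> carrier R \<Longrightarrow> f x = c" by auto
  then show ?case using polyfun_smult[OF 0(2), of c]  by (auto elim: polyfun_cong)
next
  case (Suc d)
  then obtain c f' where f: "c \<in> carrier R" "polyfun R d f'" "\<And>x. x \<in> carrier R \<Longrightarrow> f x = c \<oplus> x \<otimes> f' x"
    by auto
  have "polyfun R (Suc d + e) (\<lambda>x. c \<otimes> g x \<oplus> x \<otimes> (f' x \<otimes> g x))"
    using polyfun_add[OF polyfun_mono[OF polyfun_smult[OF Suc.prems(2) f(1)], of "Suc d + e"]
        polyfun_xmult[OF Suc.IH[OF f(2) Suc.prems(2)], folded add_Suc]] by simp
  then show ?case
  proof (rule polyfun_cong)
    fix x assume x: "x \<in> carrier R"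
    show "f x \<otimes> g x = c \<otimes> g x \<oplus> x \<otimes> (f' x \<otimes> g x)"
      using f(1) x polyfun_closed[OF f(2) x] polyfun_closed[OF Suc.prems(2) x]
      unfolding f(3)[OF x] by algebra
  qed
qed

lemma polyfun_id: "polyfun R (Suc 0) (\<lambda>x. x)"
  using polyfun_xmult[OF polyfun_const[OF one_closed, of 0]] by (rule polyfun_cong) simp

lemma polyfun_pow: "polyfun R d f \<Longrightarrow> polyfun R (d * n) (\<lambda>x. f x [^] (n::nat))"
proof (induction n)
  case 0
  show ?case using polyfun_const[of \<one> 0] by simp
next
  case (Suc n)
  from polyfun_mult[OF Suc.IH[OF Suc.prems] Suc.prems] show ?case
    by (simp add: add.commute)
qed

lemma polyfun_power: "polyfun R n (\<lambda>x. x [^] (n::nat))"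
  using polyfun_pow[OF polyfun_id, of n] by simp

lemma polyfun_minus:
  assumes "polyfun R d f" "polyfun R d g"
  shows "polyfun R d (\<lambda>x. f x \<ominus> g x)"
proof -
  have "polyfun R d (\<lambda>x. f x \<oplus> (\<ominus> \<one>) \<otimes> g x)"
    by (intro polyfun_add polyfun_smult assms) simp
  then show ?thesis
    by (rule polyfun_cong) (use assms polyfun_closed in \<open>auto simp: minus_eq l_minus\<close>)
qed

text \<open>Division by a linear factor on the Horner scheme: if f(x) = c + x g(x) and g(x) = g(a) +
  (x - a) h(x), then x g(x) - a g(a) = (x - a) (g(x) + a h(x)).\<close>

lemma polyfun_factor:
  "polyfun R (Suc d) f \<Longrightarrow> a \<in> carrier R \<Longrightarrow>
    \<exists>g. polyfun R d g \<and> (\<forall>x\<in>carrier R. f x = f a \<oplus> (x \<ominus> a) \<otimes> g x)"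
proof (induction d arbitrary: f)
  case 0
  then obtain c e where f: "c \<in> carrier R" "e \<in> carrier R" "\<And>x. x \<in> carrier R \<Longrightarrow> f x = c \<oplus> x \<otimes> e"
    by auto
  have "f x = f a \<oplus> (x \<ominus> a) \<otimes> e" if x: "x \<in> carrier R" for x
    unfolding f(3)[OF x] f(3)[OF 0(2)] using x 0(2) f(1,2) by algebra
  moreover have "polyfun R 0 (\<lambda>x. e)" using f(2) by auto
  ultimately show ?case by blast
next
  case (Suc d)
  from Suc.prems(1) obtain c g where f: "c \<in> carrier R" "polyfun R (Suc d) g"
      "\<And>x. x \<in> carrier R \<Longrightarrow> f x = c \<oplus> x \<otimes> g x"
    unfolding polyfun.simps(2)[of R "Suc d" f] by blast
  from Suc.IH[OF f(2) Suc.prems(2)] obtain h where h: "polyfun R d h"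
    "\<And>x. x \<in> carrier R \<Longrightarrow> g x = g a \<oplus> (x \<ominus> a) \<otimes> h x" by blast
  have "f x = f a \<oplus> (x \<ominus> a) \<otimes> (g x \<oplus> a \<otimes> h x)" if x: "x \<in> carrier R" for x
  proof -
    have c: "h x \<in> carrier R" "g x \<in> carrier R" "g a \<in> carrier R"
      using polyfun_closed[OF h(1) x] polyfun_closed[OF f(2) x] polyfun_closed[OF f(2) Suc.prems(2)] by blast+
    obtain G H K where G: "g a = G" "h x = H" "g x = K" by blast
    have K: "K = G \<oplus> (x \<ominus> a) \<otimes> H" using h(2)[OF x] G by simp
    have cl: "G \<in> carrier R" "H \<in> carrier R" using c G by auto
    have "c \<oplus> x \<otimes> K = c \<oplus> a \<otimes> G \<oplus> (x \<ominus> a) \<otimes> (K \<oplus> a \<otimes> H)"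
      unfolding K using x f(1) Suc.prems(2) cl by - (rule ring_eqI, (rule reify)+, simp_all)
    then show ?thesis
      unfolding f(3)[OF x] f(3)[OF Suc.prems(2)] G .
  qed
  moreover have "polyfun R (Suc d) (\<lambda>x. g x \<oplus> a \<otimes> h x)"
    by (rule polyfun_add[OF f(2) polyfun_Suc[OF polyfun_smult[OF h(1) Suc.prems(2)]]])
  ultimately show ?case by blast
qed

text \<open>Supplies the number of pigeonholes in Stepanov's method: a function of degree at most d
  is given by d + 1 Horner coefficients. Restricting to \<open>S\<close> makes the functions
  extensional, and only their values on \<open>S\<close> are under control there.\<close>

lemma card_restrict_polyfun:
  assumes "finite (carrier R)" "S \<subseteq> carrier R"
  shows "finite {restrict f S | f. polyfun R d f} \<and>
    card {restrict f S | f. polyfun R d f} \<le> card (carrier R) ^ Suc d"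
proof (induction d)
  case 0
  have eq: "{restrict f S | f. polyfun R 0 f} = (\<lambda>c. restrict (\<lambda>x. c) S) ` carrier R"
    using assms(2) by (force simp: image_def restrict_def)
  show ?case unfolding eq using assms(1) by (simp add: card_image_le)
next
  case (Suc d)
  let ?A = "{restrict f S | f. polyfun R d f}"
  let ?h = "\<lambda>(c, g). restrict (\<lambda>x. c \<oplus> x \<otimes> g x) S"
  have sub: "{restrict f S | f. polyfun R (Suc d) f} \<subseteq> ?h ` (carrier R \<times> ?A)"
  proof
    fix u assume "u \<in> {restrict f S | f. polyfun R (Suc d) f}"
    then obtain f c g where u: "u = restrict f S" "c \<in> carrier R" "polyfun R d g"
      "\<And>x. x \<in> carrier R \<Longrightarrow> f x = c \<oplus> x \<otimes> g x" by auto
    have "u = ?h (c, restrict g S)"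
      using assms(2) u(4) unfolding u(1) by (auto simp: restrict_def fun_eq_iff)
    moreover have "restrict g S \<in> ?A" using u(3) by blast
    ultimately show "u \<in> ?h ` (carrier R \<times> ?A)" using u(2) by blast
  qed
  have fin: "finite (carrier R \<times> ?A)" by (rule finite_cartesian_product[OF assms(1)]) (use Suc in blast)
  have "card {restrict f S | f. polyfun R (Suc d) f} \<le> card (?h ` (carrier R \<times> ?A))"
    by (rule card_mono[OF finite_imageI[OF fin] sub])
  also have "\<dots> \<le> card (carrier R \<times> ?A)" by (rule card_image_le[OF fin])
  also have "\<dots> = card (carrier R) * card ?A" by (rule card_cartesian_product)
  also have "\<dots> \<le> card (carrier R) * card (carrier R) ^ Suc d"
    by (rule mult_le_mono2) (use Suc in blast)
  finally show ?case using finite_subset[OF sub finite_imageI[OF fin]] unfolding power_Suc by blast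
qed

subsection \<open>The Frobenius endomorphism\<close>

lemma binomial:
  assumes [simp]: "x \<in> carrier R" "y \<in> carrier R"
  shows "(x \<oplus> y) [^] n = (\<Oplus>k\<in>{..n}. [(n choose k)] \<cdot> (x [^] k \<otimes> y [^] (n - k)))"
proof (induction n)
  case (Suc n)
  let ?t = "\<lambda>n k. [(n choose k)] \<cdot> (x [^] k \<otimes> y [^] (n - k))"
  let ?u = "\<lambda>k. [(n choose Suc k)] \<cdot> (x [^] Suc k \<otimes> y [^] (n - k))"
  have y: "y \<otimes> (\<Oplus>k\<in>{..n}. ?t n k) = (\<Oplus>k\<in>{..n}. ?u k) \<oplus> y [^] Suc n"
  proof -
    have "y \<otimes> (\<Oplus>k\<in>{..n}. ?t n k) = (\<Oplus>k\<in>{..n}. y \<otimes> ?t n k)"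
      by (rule finsum_rdistr) auto
    also have "\<dots> = (\<Oplus>k\<in>{..n}. [(n choose k)] \<cdot> (x [^] k \<otimes> y [^] (Suc n - k)))"
    proof (rule finsum_cong'[OF refl])
      fix k assume "k \<in> {..n}"
      then have "Suc n - k = Suc (n - k)" by auto
      then show "y \<otimes> ?t n k = [(n choose k)] \<cdot> (x [^] k \<otimes> y [^] (Suc n - k))"
        by (simp add: add_pow_rdistr m_ac)
    qed auto
    also have "\<dots> = (\<Oplus>k\<in>{..Suc n}. [(n choose k)] \<cdot> (x [^] k \<otimes> y [^] (Suc n - k)))"
      by (subst finsum_Suc) (auto simp: binomial_eq_0)
    also have "\<dots> = (\<Oplus>k\<in>{..n}. ?u k) \<oplus> y [^] Suc n"
      by (subst finsum_Suc2) (auto simp: binomial_eq_0)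
    finally show ?thesis .
  qed
  have x: "x \<otimes> (\<Oplus>k\<in>{..n}. ?t n k) = (\<Oplus>k\<in>{..n}. [(n choose k)] \<cdot> (x [^] Suc k \<otimes> y [^] (n - k)))"
  proof -
    have "x \<otimes> (\<Oplus>k\<in>{..n}. ?t n k) = (\<Oplus>k\<in>{..n}. x \<otimes> ?t n k)"
      by (rule finsum_rdistr) auto
    also have "\<dots> = (\<Oplus>k\<in>{..n}. [(n choose k)] \<cdot> (x [^] Suc k \<otimes> y [^] (n - k)))"
      by (rule finsum_cong'[OF refl]) (auto simp: add_pow_rdistr m_ac)
    finally show ?thesis .
  qed
  have "(x \<oplus> y) [^] Suc n = x \<otimes> (\<Oplus>k\<in>{..n}. ?t n k) \<oplus> y \<otimes> (\<Oplus>k\<in>{..n}. ?t n k)"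
    by (simp add: Suc r_distr l_distr m_comm)
  also have "\<dots> = (\<Oplus>k\<in>{..n}. [(n choose k)] \<cdot> (x [^] Suc k \<otimes> y [^] (n - k))) \<oplus> ((\<Oplus>k\<in>{..n}. ?u k) \<oplus> y [^] Suc n)"
    unfolding x y ..
  also have "\<dots> = (\<Oplus>k\<in>{..n}. [(n choose k)] \<cdot> (x [^] Suc k \<otimes> y [^] (n - k)) \<oplus> ?u k) \<oplus> y [^] Suc n"
    by (subst finsum_addf) (auto simp: a_assoc)
  also have "\<dots> = (\<Oplus>k\<in>{..n}. ?t (Suc n) (Suc k)) \<oplus> ?t (Suc n) 0"
  proof -
    have "(\<Oplus>k\<in>{..n}. [(n choose k)] \<cdot> (x [^] Suc k \<otimes> y [^] (n - k)) \<oplus> ?u k) = (\<Oplus>k\<in>{..n}. ?t (Suc n) (Suc k))"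
      by (rule finsum_cong'[OF refl]) (auto simp: add.nat_pow_mult)
    then show ?thesis by simp
  qed
  also have "\<dots> = (\<Oplus>k\<in>{..Suc n}. ?t (Suc n) k)"
    by (rule finsum_Suc2[symmetric]) auto
  finally show ?case .
qed simp

lemma frobenius_prime:
  assumes p: "prime (p::nat)" and ch: "[p] \<cdot> \<one> = \<zero>"
    and [simp]: "x \<in> carrier R" "y \<in> carrier R"
  shows "(x \<oplus> y) [^] p = x [^] p \<oplus> y [^] p"
proof -
  obtain m where m: "p = Suc (Suc m)" using prime_ge_2_nat[OF p] by (metis add_2_eq_Suc le_Suc_ex)
  let ?t = "\<lambda>k. [(p choose k)] \<cdot> (x [^] k \<otimes> y [^] (p - k))"
  have pz: "[p] \<cdot> z = \<zero>" if z: "z \<in> carrier R" for z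
    using add_pow_ldistr[of \<one> z p] ch z by simp
  have "(\<Oplus>k\<in>{..m}. ?t (Suc k)) = (\<Oplus>k\<in>{..m}. \<zero>)"
  proof (rule finsum_cong'[OF refl])
    fix k assume "k \<in> {..m}"
    then have "p dvd (p choose Suc k)" using p m by (intro dvd_choose_prime) (auto intro!: Nat.gr0I)
    then obtain j where "p choose Suc k = p * j" by auto
    then show "?t (Suc k) = \<zero>"
      by (simp add: add.nat_pow_pow[symmetric] pz del: nat_pow_Suc)
  qed auto
  then have z: "(\<Oplus>k\<in>{..m}. ?t (Suc k)) = \<zero>" by simp
  have "(x \<oplus> y) [^] p = (\<Oplus>k\<in>{..Suc (Suc m)}. ?t k)"
    unfolding binomial[OF assms(3,4)] m ..
  also have "\<dots> = (\<Oplus>k\<in>{..Suc m}. ?t (Suc k)) \<oplus> ?t 0"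
    by (rule finsum_Suc2) auto
  also have "(\<Oplus>k\<in>{..Suc m}. ?t (Suc k)) = ?t (Suc (Suc m)) \<oplus> (\<Oplus>k\<in>{..m}. ?t (Suc k))"
    by (rule finsum_Suc) auto
  also have "\<dots> = x [^] p" unfolding z using m by (simp del: nat_pow_Suc)
  finally show ?thesis by simp
qed

text \<open>Stated for commutative rings because it is applied both to the field and to the
  polynomial ring over it.\<close>

lemma frobenius:
  assumes p: "prime (p::nat)" and ch: "[p] \<cdot> \<one> = \<zero>"
    and [simp]: "x \<in> carrier R" "y \<in> carrier R"
  shows "(x \<oplus> y) [^] (p ^ k) = x [^] (p ^ k) \<oplus> y [^] (p ^ k)"
proof (induction k)
  case (Suc k)
  then show ?case
    using frobenius_prime[OF p ch, of "x [^] (p ^ k)" "y [^] (p ^ k)"]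
    by (simp add: nat_pow_pow[symmetric] power_Suc2 del: power_Suc)
qed simp

lemma frobenius_minus:
  assumes p: "prime (p::nat)" and ch: "[p] \<cdot> \<one> = \<zero>"
    and [simp]: "x \<in> carrier R" "y \<in> carrier R"
  shows "(x \<ominus> y) [^] (p ^ k) = x [^] (p ^ k) \<ominus> y [^] (p ^ k)"
proof -
  have "x [^] (p ^ k) = (x \<ominus> y) [^] (p ^ k) \<oplus> y [^] (p ^ k)"
    using frobenius[OF p ch, of "x \<ominus> y" y k] by (simp add: minus_eq a_assoc l_neg)
  then show ?thesis
    by (simp add: minus_eq a_assoc r_neg)
qed

end

text \<open>The point \<open>a\<close> expresses that f is non-zero, since a function carries no
  coefficients to inspect. Splitting off a linear factor at a zero leaves a cofactor that is still
  non-zero at \<open>a\<close>.\<close>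

lemma (in domain) polyfun_roots:
  assumes fin: "finite (carrier R)"
  shows "polyfun R d f \<Longrightarrow> a \<in> carrier R \<Longrightarrow> f a \<noteq> \<zero> \<Longrightarrow> card {x \<in> carrier R. f x = \<zero>} \<le> d"
proof (induction d arbitrary: f)
  case 0
  then have e: "{x \<in> carrier R. f x = \<zero>} = {}" by auto
  show ?case unfolding e by simp
next
  case (Suc d)
  show ?case
  proof (cases "{x \<in> carrier R. f x = \<zero>} = {}")
    case True
    show ?thesis unfolding True by simp
  next
    case False
    then obtain r where r: "r \<in> carrier R" "f r = \<zero>" by auto
    from polyfun_factor[OF Suc.prems(1) r(1)] obtain g where g: "polyfun R d g"
      "\<And>x. x \<in> carrier R \<Longrightarrow> f x = f r \<oplus> (x \<ominus> r) \<otimes> g x" by blast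
    have fg: "f x = (x \<ominus> r) \<otimes> g x" if "x \<in> carrier R" for x
      using g(2)[OF that] polyfun_closed[OF g(1) that] r that by simp
    have "g a \<noteq> \<zero>" using fg[OF Suc.prems(2)] Suc.prems(2,3) r(1) by auto
    from Suc.IH[OF g(1) Suc.prems(2) this] have "card {x \<in> carrier R. g x = \<zero>} \<le> d" .
    moreover have "{x \<in> carrier R. f x = \<zero>} \<subseteq> insert r {x \<in> carrier R. g x = \<zero>}"
    proof
      fix x assume "x \<in> {x \<in> carrier R. f x = \<zero>}"
      then have x: "x \<in> carrier R" "f x = \<zero>" by auto
      have "x \<ominus> r = \<zero> \<or> g x = \<zero>"
        using fg[OF x(1)] x integral[of "x \<ominus> r" "g x"] polyfun_closed[OF g(1) x(1)] r(1) by auto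
      then show "x \<in> insert r {x \<in> carrier R. g x = \<zero>}" using x(1) r(1) by auto
    qed
    then have "card {x \<in> carrier R. f x = \<zero>} \<le> card (insert r {x \<in> carrier R. g x = \<zero>})"
      by (rule card_mono[rotated]) (use fin in auto)
    ultimately show ?thesis using card_insert_le_m1[of "Suc d" "{x \<in> carrier R. g x = \<zero>}" r]
      by simp
  qed
qed

section \<open>Finite fields\<close>

locale finite_field = field +
  assumes finite_carrier: "finite (carrier R)"
begin

lemma pow_card_minus_1:
  assumes "x \<in> carrier R" "x \<noteq> \<zero>"
  shows "x [^] (card (carrier R) - 1) = \<one>"
proof -
  interpret G: group "mult_of R" by (rule field_mult_group)
  have "x [^]\<^bsub>mult_of R\<^esub> order (mult_of R) = \<one>\<^bsub>mult_of R\<^esub>"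
    by (rule G.pow_order_eq_1) (use assms in auto)
  then show ?thesis using order_mult_of[OF finite_carrier] by (simp add: nat_pow_mult_of order_def)
qed

lemma card_carrier_ge_2: "card (carrier R) \<ge> 2"
proof -
  have "card {\<zero>, \<one>} \<le> card (carrier R)"
    by (rule card_mono) (auto simp: finite_carrier)
  then show ?thesis by simp
qed

lemma pow_card: "x \<in> carrier R \<Longrightarrow> x [^] card (carrier R) = x"
proof (cases "x = \<zero>")
  case False
  assume x: "x \<in> carrier R"
  have "x [^] Suc (card (carrier R) - 1) = x"
    using pow_card_minus_1[OF x False] x by simp
  then show ?thesis using card_carrier_ge_2 by simp
qed (use card_carrier_ge_2 in \<open>simp add: nat_pow_zero\<close>)

section \<open>Fibres of power maps\<close>

lemma card_pow_eq_le:
  assumes "b \<in> carrier R" "b \<noteq> \<zero>" "m > 0"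
  shows "card {x \<in> carrier R. x [^] (m::nat) = b} \<le> m"
proof -
  have "card {x \<in> carrier R. x [^] m \<ominus> b = \<zero>} \<le> m"
    by (rule polyfun_roots[OF finite_carrier, where a = \<zero>])
       (use assms in \<open>auto intro!: polyfun_minus polyfun_power polyfun_const simp: nat_pow_zero\<close>)
  moreover have "{x \<in> carrier R. x [^] m \<ominus> b = \<zero>} = {x \<in> carrier R. x [^] m = b}"
    using assms by auto
  ultimately show ?thesis by simp
qed

text \<open>Every non-zero x has its m-th power among the solutions of b^k = 1. There are at most k
  such b with at most m preimages each, and they have to cover m k elements, so all these bounds are
  attained. Instances are square roots, norms, and the circles of elements with a given power q +
  1.\<close>

lemma card_pow_fibre:
  assumes N: "card (carrier R) - 1 = m * k" and b: "b \<in> carrier R" "b \<noteq> \<zero>"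
  shows "card {x \<in> carrier R. x [^] m = b} = (if b [^] k = \<one> then m else 0)"
proof -
  have pos: "m > 0" "k > 0" using N card_carrier_ge_2 by (auto intro: Nat.gr0I)
  define B where "B = {x \<in> carrier R. x [^] k = \<one>}"
  define F where "F = (\<lambda>b. {x \<in> carrier R. x [^] m = b})"
  have nz: "x \<noteq> \<zero>" if "x \<in> B" for x
    using that pos unfolding B_def by (auto simp: nat_pow_zero)
  have cB: "card B \<le> k" unfolding B_def by (rule card_pow_eq_le) (use pos in auto)
  have finB: "finite B" "finite (F b)" for b
    unfolding B_def F_def by (rule finite_subset[OF _ finite_carrier], blast)+
  have cF: "card (F b) \<le> m" if "b \<in> B" for b
    unfolding F_def by (rule card_pow_eq_le) (use that pos nz in \<open>auto simp: B_def\<close>)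
  have mk: "(x [^] m) [^] k = \<one>" if "x \<in> carrier R" "x \<noteq> \<zero>" for x
    using pow_card_minus_1[OF that] that N by (simp add: nat_pow_pow)
  have "carrier R - {\<zero>} = (\<Union>b\<in>B. F b)"
  proof (intro equalityI subsetI)
    fix x assume "x \<in> carrier R - {\<zero>}"
    then show "x \<in> (\<Union>b\<in>B. F b)" using mk[of x] unfolding B_def F_def by auto
  next
    fix x assume "x \<in> (\<Union>b\<in>B. F b)"
    then obtain b where "b \<in> B" "x \<in> carrier R" "x [^] m = b" unfolding F_def by auto
    then show "x \<in> carrier R - {\<zero>}" using nz[of b] pos by (auto simp: nat_pow_zero)
  qed
  then have "card (carrier R) - 1 = card (\<Union>b\<in>B. F b)"
    by (metis card_Diff_singleton zero_closed)
  also have "\<dots> = (\<Sum>b\<in>B. card (F b))"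
    by (rule card_UN_disjoint) (use finB in blast, use finB in blast, auto simp: F_def)
  finally have s: "m * k = (\<Sum>b\<in>B. card (F b))" using N by simp
  show ?thesis
  proof (cases "b [^] k = \<one>")
    case True
    then have bB: "b \<in> B" using b unfolding B_def by simp
    have "(\<Sum>b\<in>B. card (F b)) = card (F b) + (\<Sum>b\<in>B - {b}. card (F b))"
      by (rule sum.remove[OF finB(1) bB])
    also have "(\<Sum>b\<in>B - {b}. card (F b)) \<le> (\<Sum>b\<in>B - {b}. m)"
      by (rule sum_mono) (use cF in auto)
    also have "\<dots> \<le> (k - 1) * m" using cB bB finB by (simp add: diff_le_mono)
    finally have "m * k \<le> card (F b) + (k - 1) * m" using s by simp
    moreover have "m * k = (k - 1) * m + m" using pos by (cases k) (auto simp: algebra_simps)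
    ultimately have "m \<le> card (F b)" by simp
    with cF[OF bB] True show ?thesis by (simp add: F_def)
  next
    case False
    have "F b = {}"
    proof -
      have "b [^] k = \<one>" if x: "x \<in> carrier R" "x [^] m = b" for x
        using mk[OF x(1)] x b pos by (cases "x = \<zero>") (auto simp: nat_pow_zero)
      with False show ?thesis unfolding F_def by auto
    qed
    then have "card (F b) = 0" by (simp only: card.empty)
    then show ?thesis using False unfolding F_def by simp
  qed
qed


lemma finite_field_subfield:
  assumes "subfield K R"
  shows "finite_field (R\<lparr>carrier := K\<rparr>)"
proof -
  have "finite K" using subfieldE(3)[OF assms] finite_carrier by (rule finite_subset)
  then show ?thesis
    using subfield_iff(2)[OF assms] by (intro finite_field.intro finite_field_axioms.intro) simp_all
qed

end

section \<open>Taylor expansions of formal polynomials\<close>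

context UP_cring
begin

definition const :: "'a \<Rightarrow> (nat \<Rightarrow> 'a)" where "const c = monom P c 0"

definition indet :: "nat \<Rightarrow> 'a" where "indet = monom P \<one> 1"

lemma const_closed [simp, intro]: "c \<in> carrier R \<Longrightarrow> const c \<in> carrier P"
  by (simp add: const_def)

lemma indet_closed [simp, intro]: "indet \<in> carrier P"
  by (simp add: indet_def)

lemma coeff_const: "c \<in> carrier R \<Longrightarrow> coeff P (const c) k = (if k = 0 then c else \<zero>)"
  by (simp add: const_def)

lemma const_ring_hom_P: "const \<in> ring_hom R P"
  using const_ring_hom unfolding const_def[abs_def] .

lemma const_zero [simp]: "const \<zero> = \<zero>\<^bsub>P\<^esub>"
  by (simp add: const_def)

lemma const_one [simp]: "const \<one> = \<one>\<^bsub>P\<^esub>"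
  by (simp add: const_def)

lemma const_pow: "c \<in> carrier R \<Longrightarrow> const c [^]\<^bsub>P\<^esub> (n::nat) = const (c [^] n)"
  by (simp add: const_def monom_pow)

lemma const_mult: "a \<in> carrier R \<Longrightarrow> b \<in> carrier R \<Longrightarrow> const a \<otimes>\<^bsub>P\<^esub> const b = const (a \<otimes> b)"
  using ring_hom_mult[OF const_ring_hom_P] by simp

lemma const_add: "a \<in> carrier R \<Longrightarrow> b \<in> carrier R \<Longrightarrow> const a \<oplus>\<^bsub>P\<^esub> const b = const (a \<oplus> b)"
  using ring_hom_add[OF const_ring_hom_P] by simp

lemma coeff_const_mult:
  "c \<in> carrier R \<Longrightarrow> p \<in> carrier P \<Longrightarrow> coeff P (const c \<otimes>\<^bsub>P\<^esub> p) k = c \<otimes> coeff P p k"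
  by (simp add: const_def monom_mult_is_smult del: coeff_mult)

lemma indet_pow: "indet [^]\<^bsub>P\<^esub> (n::nat) = monom P \<one> n"
  by (simp add: indet_def monom_pow)

lemma coeff_indet_pow_mult:
  assumes p: "p \<in> carrier P"
  shows "coeff P (indet [^]\<^bsub>P\<^esub> n \<otimes>\<^bsub>P\<^esub> p) k = (if k < n then \<zero> else coeff P p (k - n))"
proof (cases "k < n")
  case True
  have "coeff P (monom P \<one> n \<otimes>\<^bsub>P\<^esub> p) k = (\<Oplus>i\<in>{..k}. \<zero>)"
    unfolding coeff_mult[OF monom_closed[OF R.one_closed] p]
    by (rule R.finsum_cong'[OF refl]) (use True p in auto)
  with True show ?thesis by (simp add: indet_pow del: coeff_mult)
next
  case False
  then show ?thesis
    using coeff_monom_mult[OF R.one_closed p, of n "k - n"] p by (simp add: indet_pow del: coeff_mult)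
qed

lemma coeff_indet_mult:
  "p \<in> carrier P \<Longrightarrow> coeff P (indet \<otimes>\<^bsub>P\<^esub> p) k = (if k = 0 then \<zero> else coeff P p (k - 1))"
  using coeff_indet_pow_mult[of p 1 k] by (simp del: coeff_mult add: P.nat_pow_eone)

lemma horner_decomp:
  assumes p: "p \<in> carrier P"
  obtains p' where "p' \<in> carrier P" "p = const (coeff P p 0) \<oplus>\<^bsub>P\<^esub> indet \<otimes>\<^bsub>P\<^esub> p'"
    "\<And>d. deg R p \<le> Suc d \<Longrightarrow> deg R p' \<le> d" "\<And>n. coeff P p' n = coeff P p (Suc n)"
proof -
  have up: "p \<in> up R" using p by (simp add: UP_def P_def)
  define p' where "p' = (\<lambda>n. p (Suc n))"
  have p'up: "p' \<in> up R"
  proof (rule mem_upI)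
    obtain n where "bound \<zero> n p" using up by (auto simp: up_def)
    then have "bound \<zero> n p'" unfolding p'_def bound_def by simp
    then show "\<exists>n. bound \<zero> n p'" ..
  next
    show "p' n \<in> carrier R" for n using up by (auto simp: p'_def up_def)
  qed
  then have p': "p' \<in> carrier P" by (simp add: UP_def P_def)
  have c: "coeff P p' n = coeff P p (Suc n)" for n
    using p'up up by (simp add: UP_def P_def p'_def)
  have "p = const (coeff P p 0) \<oplus>\<^bsub>P\<^esub> indet \<otimes>\<^bsub>P\<^esub> p'"
    by (rule up_eqI) (use p p' in \<open>auto simp: coeff_const coeff_indet_mult c simp del: coeff_mult\<close>)
  moreover have "deg R p' \<le> d" if "deg R p \<le> Suc d" for d
    by (rule deg_aboveI) (use that p p' in \<open>auto simp: c intro!: deg_aboveD\<close>)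
  ultimately show thesis using that p' c by blast
qed

lemma up_horner_induct [consumes 1, case_names const step]:
  assumes "p \<in> carrier P"
    and "\<And>c. c \<in> carrier R \<Longrightarrow> Q (const c)"
    and "\<And>c p. c \<in> carrier R \<Longrightarrow> p \<in> carrier P \<Longrightarrow> Q p \<Longrightarrow> Q (const c \<oplus>\<^bsub>P\<^esub> indet \<otimes>\<^bsub>P\<^esub> p)"
  shows "Q p"
proof -
  have "p \<in> carrier P \<Longrightarrow> deg R p \<le> d \<Longrightarrow> Q p" for d
  proof (induction d arbitrary: p)
    case 0
    then have "p = const (coeff P p 0)"
      by (intro up_eqI) (auto simp: coeff_const intro!: deg_aboveD)
    then show ?case using assms(2)[of "coeff P p 0"] 0 by simp
  next
    case (Suc d)
    from horner_decomp[OF Suc.prems(1)] obtain p' where p': "p' \<in> carrier P"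
      "p = const (coeff P p 0) \<oplus>\<^bsub>P\<^esub> indet \<otimes>\<^bsub>P\<^esub> p'" "deg R p' \<le> d"
      using Suc.prems(2) by metis
    then show ?case using assms(3)[OF _ p'(1) Suc.IH[OF p'(1,3)], of "coeff P p 0"] Suc.prems
      by simp
  qed
  then show ?thesis using assms(1) by blast
qed

text \<open>The substitution X -> X + x. The k-th coefficient of the result is the Hasse derivative
  of order k at x, which detects multiplicities beyond the characteristic, where iterated
  derivatives vanish identically.\<close>

definition shift :: "'a \<Rightarrow> (nat \<Rightarrow> 'a) \<Rightarrow> (nat \<Rightarrow> 'a)" where
  "shift x = eval R P const (indet \<oplus>\<^bsub>P\<^esub> const x)"

lemma shift_hom: "x \<in> carrier R \<Longrightarrow> shift x \<in> ring_hom P P"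
proof -
  assume x: "x \<in> carrier R"
  interpret UP_pre_univ_prop R P const P
    by (rule UP_pre_univ_propI, rule R.is_cring, rule UP_cring, rule const_ring_hom_P, rule P_def)
  show ?thesis unfolding shift_def by (rule eval_ring_hom) (use x in simp)
qed

lemma shift_const: "x \<in> carrier R \<Longrightarrow> c \<in> carrier R \<Longrightarrow> shift x (const c) = const c"
proof -
  assume x: "x \<in> carrier R" "c \<in> carrier R"
  interpret UP_pre_univ_prop R P const P
    by (rule UP_pre_univ_propI, rule R.is_cring, rule UP_cring, rule const_ring_hom_P, rule P_def)
  show ?thesis unfolding shift_def using eval_const[of "indet \<oplus>\<^bsub>P\<^esub> const x" c] x
    by (simp add: const_def)
qed

lemma shift_indet: "x \<in> carrier R \<Longrightarrow> shift x indet = indet \<oplus>\<^bsub>P\<^esub> const x"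
proof -
  assume x: "x \<in> carrier R"
  interpret UP_pre_univ_prop R P const P
    by (rule UP_pre_univ_propI, rule R.is_cring, rule UP_cring, rule const_ring_hom_P, rule P_def)
  show ?thesis unfolding shift_def using eval_monom1[of "indet \<oplus>\<^bsub>P\<^esub> const x"] x
    by (simp add: indet_def)
qed

context
  fixes x assumes x [simp]: "x \<in> carrier R"
begin

interpretation S: ring_hom_cring P P "shift x"
  by (rule ring_hom_cringI[OF P.is_cring P.is_cring shift_hom[OF x]])

lemma shift_closed [simp]: "p \<in> carrier P \<Longrightarrow> shift x p \<in> carrier P"
  by (rule S.hom_closed)

lemma shift_add: "p \<in> carrier P \<Longrightarrow> r \<in> carrier P \<Longrightarrow> shift x (p \<oplus>\<^bsub>P\<^esub> r) = shift x p \<oplus>\<^bsub>P\<^esub> shift x r"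
  by (rule S.hom_add)

lemma shift_mult: "p \<in> carrier P \<Longrightarrow> r \<in> carrier P \<Longrightarrow> shift x (p \<otimes>\<^bsub>P\<^esub> r) = shift x p \<otimes>\<^bsub>P\<^esub> shift x r"
  by (rule S.hom_mult)

lemma shift_minus: "p \<in> carrier P \<Longrightarrow> r \<in> carrier P \<Longrightarrow> shift x (p \<ominus>\<^bsub>P\<^esub> r) = shift x p \<ominus>\<^bsub>P\<^esub> shift x r"
  by (simp add: a_minus_def)

lemma shift_pow: "p \<in> carrier P \<Longrightarrow> shift x (p [^]\<^bsub>P\<^esub> (n::nat)) = shift x p [^]\<^bsub>P\<^esub> n"
  by (rule S.hom_pow)

lemma shift_zero [simp]: "shift x \<zero>\<^bsub>P\<^esub> = \<zero>\<^bsub>P\<^esub>"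
  by (rule S.hom_zero)

lemma shift_horner: "c \<in> carrier R \<Longrightarrow> p \<in> carrier P \<Longrightarrow>
  shift x (const c \<oplus>\<^bsub>P\<^esub> indet \<otimes>\<^bsub>P\<^esub> p) = const c \<oplus>\<^bsub>P\<^esub> (indet \<oplus>\<^bsub>P\<^esub> const x) \<otimes>\<^bsub>P\<^esub> shift x p"
  by (simp add: shift_add shift_mult shift_const shift_indet)

lemma coeff_shift_horner: "c \<in> carrier R \<Longrightarrow> p \<in> carrier P \<Longrightarrow>
  coeff P (shift x (const c \<oplus>\<^bsub>P\<^esub> indet \<otimes>\<^bsub>P\<^esub> p)) k =
    (if k = 0 then c else coeff P (shift x p) (k - 1)) \<oplus> x \<otimes> coeff P (shift x p) k"
  unfolding shift_horner by (simp add: P.l_distr coeff_const coeff_indet_mult coeff_const_mult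
      P.a_assoc R.a_assoc[symmetric] del: coeff_mult)

end

lemma shift_shift:
  assumes "x \<in> carrier R" "y \<in> carrier R" "p \<in> carrier P"
  shows "shift y (shift x p) = shift (x \<oplus> y) p"
  using assms(3)
proof (induction p rule: up_horner_induct)
  case (const c)
  then show ?case using assms by (simp add: shift_const)
next
  case (step c p)
  have "indet \<oplus>\<^bsub>P\<^esub> const y \<oplus>\<^bsub>P\<^esub> const x = indet \<oplus>\<^bsub>P\<^esub> const (x \<oplus> y)"
    using assms by (simp add: P.a_assoc const_add R.a_comm)
  then show ?case
    using step assms by (simp add: shift_horner shift_add shift_mult shift_const shift_indet)
qed

lemma shift_by_zero: "p \<in> carrier P \<Longrightarrow> shift \<zero> p = p"
proof (induction p rule: up_horner_induct)
  case (const c)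
  then show ?case by (simp add: shift_const)
next
  case (step c p)
  then show ?case by (simp add: shift_horner)
qed

lemma shift_shift_cancel:
  "x \<in> carrier R \<Longrightarrow> p \<in> carrier P \<Longrightarrow> shift (\<ominus> x) (shift x p) = p"
  "x \<in> carrier R \<Longrightarrow> p \<in> carrier P \<Longrightarrow> shift x (shift (\<ominus> x) p) = p"
  by (simp_all add: shift_shift shift_by_zero R.r_neg R.l_neg)

abbreviation value_at :: "(nat \<Rightarrow> 'a) \<Rightarrow> 'a \<Rightarrow> 'a" where
  "value_at p x \<equiv> coeff P (shift x p) 0"

lemma value_at_const: "x \<in> carrier R \<Longrightarrow> c \<in> carrier R \<Longrightarrow> value_at (const c) x = c"
  by (simp add: shift_const coeff_const)

lemma value_at_horner: "x \<in> carrier R \<Longrightarrow> c \<in> carrier R \<Longrightarrow> p \<in> carrier P \<Longrightarrow>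
    value_at (const c \<oplus>\<^bsub>P\<^esub> indet \<otimes>\<^bsub>P\<^esub> p) x = c \<oplus> x \<otimes> value_at p x"
  by (simp add: coeff_shift_horner)

text \<open>The passage from formal polynomials to functions: as x varies, each Taylor coefficient
  at x is a polynomial function of no larger degree.\<close>

lemma polyfun_coeff_shift:
  "p \<in> carrier P \<Longrightarrow> deg R p \<le> d \<Longrightarrow> polyfun R d (\<lambda>x. coeff P (shift x p) k)"
proof (induction d arbitrary: p k)
  case 0
  then have p: "p = const (coeff P p 0)"
    by (intro up_eqI) (auto simp: coeff_const intro!: deg_aboveD)
  have "polyfun R 0 (\<lambda>x. if k = 0 then coeff P p 0 else \<zero>)"
    by (rule R.polyfun_const) (use 0 in auto)
  then show ?case
    by (rule R.polyfun_cong) (subst p, use 0 in \<open>simp add: shift_const coeff_const\<close>)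
next
  case (Suc d)
  from horner_decomp[OF Suc.prems(1)] obtain p' where p': "p' \<in> carrier P"
    "p = const (coeff P p 0) \<oplus>\<^bsub>P\<^esub> indet \<otimes>\<^bsub>P\<^esub> p'" "deg R p' \<le> d"
    using Suc.prems(2) by metis
  note IH = Suc.IH[OF p'(1,3)]
  have "polyfun R (Suc d) (\<lambda>x. (if k = 0 then coeff P p 0 else coeff P (shift x p') (k - 1)))"
    by (cases "k = 0") (use Suc.prems R.polyfun_const R.polyfun_Suc[OF IH] in \<open>auto simp del: polyfun.simps\<close>)
  then have "polyfun R (Suc d) (\<lambda>x. (if k = 0 then coeff P p 0 else coeff P (shift x p') (k - 1))
      \<oplus> x \<otimes> coeff P (shift x p') k)"
    by (rule R.polyfun_add[OF _ R.polyfun_xmult[OF IH]])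
  then show ?case
    by (rule R.polyfun_cong)
       (subst p'(2), use Suc.prems p'(1) in \<open>simp add: coeff_shift_horner\<close>)
qed

lemma divisible_indet_pow:
  "p \<in> carrier P \<Longrightarrow> (\<And>k. k < l \<Longrightarrow> coeff P p k = \<zero>) \<Longrightarrow>
    \<exists>s\<in>carrier P. p = indet [^]\<^bsub>P\<^esub> l \<otimes>\<^bsub>P\<^esub> s"
proof (induction l arbitrary: p)
  case (Suc l)
  from horner_decomp[OF Suc.prems(1)] obtain p' where p': "p' \<in> carrier P"
    "p = const (coeff P p 0) \<oplus>\<^bsub>P\<^esub> indet \<otimes>\<^bsub>P\<^esub> p'" "\<And>n. coeff P p' n = coeff P p (Suc n)"
    by metis
  have z: "coeff P p 0 = \<zero>" using Suc.prems(2)[of 0] by simp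
  have p: "p = indet \<otimes>\<^bsub>P\<^esub> p'"
    by (subst p'(2)[unfolded z]) (use p'(1) in simp)
  have "coeff P p' k = \<zero>" if "k < l" for k
    using p'(3)[of k] Suc.prems(2)[of "Suc k"] that by simp
  from Suc.IH[OF p'(1) this] obtain s where s: "s \<in> carrier P" "p' = indet [^]\<^bsub>P\<^esub> l \<otimes>\<^bsub>P\<^esub> s"
    by blast
  have "indet \<otimes>\<^bsub>P\<^esub> (indet [^]\<^bsub>P\<^esub> l \<otimes>\<^bsub>P\<^esub> s) = indet [^]\<^bsub>P\<^esub> Suc l \<otimes>\<^bsub>P\<^esub> s"
    using s(1) by (simp add: P.m_ac)
  then show ?case using s(1) unfolding p s(2) by blast
next
  case 0
  then show ?case by (intro bexI[of _ p]) simp_all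
qed

lemma const_add_pow:
  "[n] \<cdot>\<^bsub>P\<^esub> \<one>\<^bsub>P\<^esub> = const ([(n::nat)] \<cdot> \<one>)"
  by (induction n) (simp_all add: const_add[symmetric])

end

section \<open>Zeros of prescribed multiplicity\<close>

context UP_domain
begin

text \<open>For e non-zero, X + e is invertible modulo X^l, so removing its powers preserves
  divisibility by X^l. The inner induction solves r_(j-1) + e r_j = 0 upwards from j = 0.\<close>

lemma coeff_zero_cancel:
  assumes e: "e \<in> carrier R" "e \<noteq> \<zero>" and p: "p \<in> carrier P"
    and z: "\<And>k. k < l \<Longrightarrow> coeff P ((indet \<oplus>\<^bsub>P\<^esub> const e) [^]\<^bsub>P\<^esub> (n::nat) \<otimes>\<^bsub>P\<^esub> p) k = \<zero>"
  shows "k < l \<Longrightarrow> coeff P p k = \<zero>"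
  using z
proof (induction n arbitrary: k)
  case 0
  then show ?case using p by (simp del: coeff_mult)
next
  case (Suc n)
  define r where "r = (indet \<oplus>\<^bsub>P\<^esub> const e) [^]\<^bsub>P\<^esub> n \<otimes>\<^bsub>P\<^esub> p"
  have r: "r \<in> carrier P" unfolding r_def using e p by simp
  have rr: "(indet \<oplus>\<^bsub>P\<^esub> const e) [^]\<^bsub>P\<^esub> Suc n \<otimes>\<^bsub>P\<^esub> p = indet \<otimes>\<^bsub>P\<^esub> r \<oplus>\<^bsub>P\<^esub> const e \<otimes>\<^bsub>P\<^esub> r"
    unfolding r_def using e p by (simp add: P.m_ac P.l_distr P.r_distr)
  have c: "(if j = 0 then \<zero> else coeff P r (j - 1)) \<oplus> e \<otimes> coeff P r j = \<zero>" if "j < l" for j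
    using Suc.prems(2)[OF that] r e unfolding rr
    by (simp add: coeff_indet_mult coeff_const_mult del: coeff_mult)
  have "coeff P r j = \<zero>" if "j < l" for j
    using that
  proof (induction j rule: less_induct)
    case (less j)
    have "(if j = 0 then \<zero> else coeff P r (j - 1)) = \<zero>" using less by auto
    then have "e \<otimes> coeff P r j = \<zero>" using c[OF less.prems] r e by simp
    then show ?case using e r R.integral[of e "coeff P r j"] by simp
  qed
  then show ?case by (intro Suc.IH[OF Suc.prems(1)]) (simp only: r_def[symmetric])
qed

text \<open>Split off (X - x)^l for one point x of \<open>S\<close> and continue with the cofactor.
  At any other point y the removed factor becomes a power of X + (y - x), which does not affect the
  order of vanishing by \<open>coeff_zero_cancel\<close>.\<close>

lemma sum_multiplicities_le_deg:
  assumes "finite S"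
  shows "S \<subseteq> carrier R \<Longrightarrow> r \<in> carrier P \<Longrightarrow> r \<noteq> \<zero>\<^bsub>P\<^esub> \<Longrightarrow>
    (\<And>x k. x \<in> S \<Longrightarrow> k < l \<Longrightarrow> coeff P (shift x r) k = \<zero>) \<Longrightarrow> l * card S \<le> deg R r"
  using assms
proof (induction S arbitrary: r rule: finite_induct)
  case (insert x S)
  then have x: "x \<in> carrier R" by auto
  from divisible_indet_pow[of "shift x r" l] insert.prems x obtain s where s: "s \<in> carrier P"
    "shift x r = indet [^]\<^bsub>P\<^esub> l \<otimes>\<^bsub>P\<^esub> s" by auto
  define s' where "s' = shift (\<ominus> x) s"
  have s': "s' \<in> carrier P" unfolding s'_def using s x by simp
  define w where "w = indet \<oplus>\<^bsub>P\<^esub> const (\<ominus> x)"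
  have w: "w \<in> carrier P" unfolding w_def using x by simp
  have "r = shift (\<ominus> x) (shift x r)" using shift_shift_cancel x insert.prems by simp
  also have "\<dots> = w [^]\<^bsub>P\<^esub> l \<otimes>\<^bsub>P\<^esub> s'"
    unfolding s(2) s'_def w_def using s x by (simp add: shift_mult shift_pow shift_indet)
  finally have r: "r = w [^]\<^bsub>P\<^esub> l \<otimes>\<^bsub>P\<^esub> s'" .
  have s'0: "s' \<noteq> \<zero>\<^bsub>P\<^esub>" using insert.prems(3) w unfolding r by auto
  have "coeff P w 1 = \<one>" unfolding w_def using x by (simp add: coeff_const indet_def)
  then have dw1: "deg R w \<ge> 1" using w by (intro deg_belowI) auto
  have w0: "w \<noteq> \<zero>\<^bsub>P\<^esub>" using dw1 by auto
  have dw: "deg R (w [^]\<^bsub>P\<^esub> n) \<ge> n \<and> w [^]\<^bsub>P\<^esub> n \<noteq> \<zero>\<^bsub>P\<^esub>" for n :: nat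
  proof (induction n)
    case (Suc n)
    then show ?case using w w0 dw1 by (auto simp: deg_mult dest: UP_integral)
  qed simp
  have "l * card S \<le> deg R s'"
  proof (rule insert.IH[OF _ s' s'0])
    show "S \<subseteq> carrier R" using insert.prems by auto
    fix y k assume y: "y \<in> S" "k < l"
    then have yR: "y \<in> carrier R" using insert.prems by auto
    define e where "e = y \<ominus> x"
    have e: "e \<in> carrier R" "e \<noteq> \<zero>" unfolding e_def using yR x y insert.hyps by auto
    have "shift y w = indet \<oplus>\<^bsub>P\<^esub> const e"
      unfolding w_def e_def using x yR
      by (simp add: shift_add shift_indet shift_const P.a_assoc const_add a_minus_def)
    then have "shift y r = (indet \<oplus>\<^bsub>P\<^esub> const e) [^]\<^bsub>P\<^esub> l \<otimes>\<^bsub>P\<^esub> shift y s'"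
      unfolding r using w s' yR by (simp add: shift_mult shift_pow)
    then show "coeff P (shift y s') k = \<zero>"
      using coeff_zero_cancel[OF e, of "shift y s'" l l k] insert.prems(4)[of y] y yR s'
      by (simp del: coeff_mult)
  qed
  moreover have "deg R r = deg R (w [^]\<^bsub>P\<^esub> l) + deg R s'"
    unfolding r using dw[of l] s' s'0 w by (intro deg_mult) auto
  moreover have "l \<le> deg R (w [^]\<^bsub>P\<^esub> l)" using dw by blast
  ultimately show ?case using insert.hyps by simp
qed simp

end

section \<open>Stepanov's method for the equation \<open>y\<^sup>2 = f(x)\<close>\<close>

lemma (in cring) polyfun_finsum:
  "finite A \<Longrightarrow> (\<And>i. i \<in> A \<Longrightarrow> polyfun R d (h i)) \<Longrightarrow> polyfun R d (\<lambda>x. \<Oplus>i\<in>A. h i x)"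
proof (induction A rule: finite_induct)
  case empty
  then show ?case using polyfun_const[of \<zero> d] by simp
next
  case (insert i A)
  have "polyfun R d (\<lambda>x. h i x \<oplus> (\<Oplus>i\<in>A. h i x))"
    by (rule polyfun_add) (use insert in auto)
  then show ?case
  proof (rule polyfun_cong)
    fix x assume "x \<in> carrier R"
    then show "(\<Oplus>i\<in>insert i A. h i x) = h i x \<oplus> (\<Oplus>i\<in>A. h i x)"
      using insert polyfun_closed by (intro finsum_insert) auto
  qed
qed

lemma (in domain) pow_eq_zeroD:
  "x [^] (n::nat) = \<zero> \<Longrightarrow> x \<in> carrier R \<Longrightarrow> x = \<zero>"
proof (induction n)
  case (Suc n)
  then show ?case using integral[of "x [^] n" x] by auto
qed simp

context finite_field
begin

text \<open>The order of the additive group gives p^k * 1 = 0. This element is the k-th power of p *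
  1, so p * 1 = 0 in a domain.\<close>

lemma primepow_char:
  assumes "primepow (card (carrier R))"
  obtains p k where "prime (p::nat)" "card (carrier R) = p ^ k" "[p] \<cdot> \<one> = \<zero>"
proof -
  obtain p k where pk: "prime p" "card (carrier R) = p ^ k"
    using assms unfolding primepow_def by auto
  have z: "[(p ^ k)] \<cdot> \<one> = \<zero>"
    using add.pow_order_eq_1[of \<one>] pk by (simp add: add_pow_def order_def)
  have "[(p ^ j)] \<cdot> \<one> = ([p] \<cdot> \<one>) [^] j" for j
  proof (induction j)
    case (Suc j)
    have "[(p ^ Suc j)] \<cdot> \<one> = [(p ^ j)] \<cdot> ([p] \<cdot> \<one>)"
      by (simp add: add.nat_pow_pow mult.commute)
    also have "\<dots> = ([(p ^ j)] \<cdot> \<one>) \<otimes> ([p] \<cdot> \<one>)"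
      by (simp add: add_pow_ldistr)
    finally show ?case using Suc by simp
  qed simp
  with z have "([p] \<cdot> \<one>) [^] k = \<zero>" by simp
  then have "[p] \<cdot> \<one> = \<zero>" using pow_eq_zeroD[of "[p] \<cdot> \<one>" k] by simp
  with pk that show thesis by blast
qed

end

locale UP_finite_field = UP + R?: finite_field R

sublocale UP_finite_field < UP_domain
  by intro_locales [1] (rule P_def)

context UP_finite_field
begin

lemma deg_linear_pow:
  assumes e: "e \<in> carrier R"
  shows "deg R ((indet \<oplus>\<^bsub>P\<^esub> const e) [^]\<^bsub>P\<^esub> (n::nat)) = n" "(indet \<oplus>\<^bsub>P\<^esub> const e) [^]\<^bsub>P\<^esub> n \<noteq> \<zero>\<^bsub>P\<^esub>"
proof -
  define w where "w = indet \<oplus>\<^bsub>P\<^esub> const e"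
  have w: "w \<in> carrier P" unfolding w_def using e by simp
  have c: "coeff P w k = (if k = 1 then \<one> else if k = 0 then e else \<zero>)" for k
    unfolding w_def using e by (simp add: coeff_const indet_def)
  have d: "deg R w = 1"
    by (rule le_antisym[OF deg_aboveI deg_belowI]) (use w in \<open>auto simp: c\<close>)
  then have w0: "w \<noteq> \<zero>\<^bsub>P\<^esub>" by auto
  have "deg R (w [^]\<^bsub>P\<^esub> n) = n \<and> w [^]\<^bsub>P\<^esub> n \<noteq> \<zero>\<^bsub>P\<^esub>"
  proof (induction n)
    case (Suc n)
    then show ?case using w w0 d by (auto simp: deg_mult dest: UP_integral)
  qed simp
  then show "deg R ((indet \<oplus>\<^bsub>P\<^esub> const e) [^]\<^bsub>P\<^esub> n) = n" "(indet \<oplus>\<^bsub>P\<^esub> const e) [^]\<^bsub>P\<^esub> n \<noteq> \<zero>\<^bsub>P\<^esub>"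
    unfolding w_def by auto
qed

section \<open>Multiples of squares and the independence of 1 and a power of f\<close>

text \<open>The constant \<open>b\<close> admits non-square multiples of squares as well: off the
  zeros of \<open>Q\<close> the quadratic character of such an f is constant, so its sum cannot
  cancel.\<close>

definition square_multiple :: "(nat \<Rightarrow> 'a) \<Rightarrow> bool" where
  "square_multiple f \<longleftrightarrow> (\<exists>b\<in>carrier R. \<exists>Q\<in>carrier P. f = const b \<otimes>\<^bsub>P\<^esub> (Q \<otimes>\<^bsub>P\<^esub> Q))"

text \<open>The classical irrationality argument: dividing \<open>B\<close> by \<open>A\<close> with remainder represents the
  square root of \<open>f\<close> up to constants by a fraction with smaller denominator.\<close>

lemma square_multipleI:
  assumes "f \<in> carrier P" "b \<in> carrier R" "b \<noteq> \<zero>" "A \<in> carrier P" "B \<in> carrier P" "A \<noteq> \<zero>\<^bsub>P\<^esub>"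
    "f \<otimes>\<^bsub>P\<^esub> (A \<otimes>\<^bsub>P\<^esub> A) = const b \<otimes>\<^bsub>P\<^esub> (B \<otimes>\<^bsub>P\<^esub> B)"
  shows "square_multiple f"
  using assms(2-)
proof (induction "deg R A" arbitrary: A B b rule: less_induct)
  case less
  note f [simp] = assms(1)
  note A [simp] = \<open>A \<in> carrier P\<close> and B [simp] = \<open>B \<in> carrier P\<close> and b [simp] = \<open>b \<in> carrier R\<close>
  from long_div_theorem[OF A B less.prems(5)] obtain Q S and k :: nat where
    Q [simp]: "Q \<in> carrier P" and S [simp]: "S \<in> carrier P" and
    eq: "(lcoeff A) [^] k \<odot>\<^bsub>P\<^esub> B = A \<otimes>\<^bsub>P\<^esub> Q \<oplus>\<^bsub>P\<^esub> S"
    and dS: "S = \<zero>\<^bsub>P\<^esub> \<or> deg R S < deg R A" by blast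
  define l where "l = (lcoeff A) [^] k"
  have lR [simp]: "l \<in> carrier R" unfolding l_def by simp
  have l0: "l \<noteq> \<zero>" unfolding l_def using lcoeff_nonzero2[OF A less.prems(5)]
    using R.pow_eq_zeroD[of "lcoeff A" k] by auto
  obtain L where L: "L = const l" and Lc [simp]: "L \<in> carrier P" using lR by blast
  obtain Kb where Kb: "Kb = const b" and Kbc [simp]: "Kb \<in> carrier P" using b by blast
  have eqL: "L \<otimes>\<^bsub>P\<^esub> B = A \<otimes>\<^bsub>P\<^esub> Q \<oplus>\<^bsub>P\<^esub> S"
    using eq unfolding L l_def[symmetric] const_def by (simp add: monom_mult_is_smult)
  have eq0: "f \<otimes>\<^bsub>P\<^esub> (A \<otimes>\<^bsub>P\<^esub> A) = Kb \<otimes>\<^bsub>P\<^esub> (B \<otimes>\<^bsub>P\<^esub> B)" using less.prems(6) Kb by simp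
  have AA: "A \<otimes>\<^bsub>P\<^esub> A \<noteq> \<zero>\<^bsub>P\<^esub>" using less.prems(5) UP_integral[OF _ A A] by blast
  show ?case
  proof (cases "S = \<zero>\<^bsub>P\<^esub>")
    case True
    have "(A \<otimes>\<^bsub>P\<^esub> A) \<otimes>\<^bsub>P\<^esub> (L \<otimes>\<^bsub>P\<^esub> L \<otimes>\<^bsub>P\<^esub> f) = L \<otimes>\<^bsub>P\<^esub> L \<otimes>\<^bsub>P\<^esub> (f \<otimes>\<^bsub>P\<^esub> (A \<otimes>\<^bsub>P\<^esub> A))"
      by (rule P.ring_eqI, (rule P.reify)+, simp_all)
    also have "\<dots> = Kb \<otimes>\<^bsub>P\<^esub> ((L \<otimes>\<^bsub>P\<^esub> B) \<otimes>\<^bsub>P\<^esub> (L \<otimes>\<^bsub>P\<^esub> B))"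
      unfolding eq0 by (rule P.ring_eqI, (rule P.reify)+, simp_all)
    also have "\<dots> = (A \<otimes>\<^bsub>P\<^esub> A) \<otimes>\<^bsub>P\<^esub> (Kb \<otimes>\<^bsub>P\<^esub> (Q \<otimes>\<^bsub>P\<^esub> Q))"
      unfolding eqL True by (rule P.ring_eqI, (rule P.reify)+, simp_all)
    finally have "L \<otimes>\<^bsub>P\<^esub> L \<otimes>\<^bsub>P\<^esub> f = Kb \<otimes>\<^bsub>P\<^esub> (Q \<otimes>\<^bsub>P\<^esub> Q)"
      using AA by (simp add: domain.m_lcancel[OF UP_domain])
    then have LLf: "const (l \<otimes> l) \<otimes>\<^bsub>P\<^esub> f = const b \<otimes>\<^bsub>P\<^esub> (Q \<otimes>\<^bsub>P\<^esub> Q)"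
      unfolding L Kb by (simp add: const_mult)
    have ll: "l \<otimes> l \<in> Units R" using l0 R.integral[of l l] by (auto simp: field_Units)
    then have i: "inv (l \<otimes> l) \<in> carrier R" by simp
    have "f = const (inv (l \<otimes> l) \<otimes> (l \<otimes> l)) \<otimes>\<^bsub>P\<^esub> f" using R.Units_l_inv[OF ll] by simp
    also have "\<dots> = const (inv (l \<otimes> l)) \<otimes>\<^bsub>P\<^esub> (const (l \<otimes> l) \<otimes>\<^bsub>P\<^esub> f)"
      using i by (simp add: const_mult[symmetric] P.m_assoc)
    also have "\<dots> = const (inv (l \<otimes> l) \<otimes> b) \<otimes>\<^bsub>P\<^esub> (Q \<otimes>\<^bsub>P\<^esub> Q)"
      unfolding LLf using i by (simp add: const_mult[symmetric] P.m_assoc)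
    finally show ?thesis unfolding square_multiple_def
      by (intro bexI[of _ "inv (l \<otimes> l) \<otimes> b"] bexI[of _ Q]) (use i in simp_all)
  next
    case False
    \<comment> \<open>\<open>S\<close> and \<open>T\<close> form the smaller pair: A T = b B S,
      hence T^2 = b f S^2. This is the given relation with the inverse of \<open>b\<close> in place
      of \<open>b\<close>, and deg S < deg A.\<close>
    define T where "T = L \<otimes>\<^bsub>P\<^esub> f \<otimes>\<^bsub>P\<^esub> A \<ominus>\<^bsub>P\<^esub> Kb \<otimes>\<^bsub>P\<^esub> B \<otimes>\<^bsub>P\<^esub> Q"
    have T [simp]: "T \<in> carrier P" unfolding T_def by simp
    have "A \<otimes>\<^bsub>P\<^esub> T = L \<otimes>\<^bsub>P\<^esub> (f \<otimes>\<^bsub>P\<^esub> (A \<otimes>\<^bsub>P\<^esub> A)) \<ominus>\<^bsub>P\<^esub> Kb \<otimes>\<^bsub>P\<^esub> B \<otimes>\<^bsub>P\<^esub> Q \<otimes>\<^bsub>P\<^esub> A"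
      unfolding T_def by (rule P.ring_eqI, (rule P.reify)+, simp_all)
    also have "\<dots> = Kb \<otimes>\<^bsub>P\<^esub> B \<otimes>\<^bsub>P\<^esub> (L \<otimes>\<^bsub>P\<^esub> B) \<ominus>\<^bsub>P\<^esub> Kb \<otimes>\<^bsub>P\<^esub> B \<otimes>\<^bsub>P\<^esub> Q \<otimes>\<^bsub>P\<^esub> A"
      unfolding eq0 by (rule P.ring_eqI, (rule P.reify)+, simp_all)
    also have "\<dots> = Kb \<otimes>\<^bsub>P\<^esub> B \<otimes>\<^bsub>P\<^esub> S"
      unfolding eqL by (rule P.ring_eqI, (rule P.reify)+, simp_all)
    finally have AT: "A \<otimes>\<^bsub>P\<^esub> T = Kb \<otimes>\<^bsub>P\<^esub> B \<otimes>\<^bsub>P\<^esub> S" .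
    have "(A \<otimes>\<^bsub>P\<^esub> A) \<otimes>\<^bsub>P\<^esub> (T \<otimes>\<^bsub>P\<^esub> T) = (A \<otimes>\<^bsub>P\<^esub> T) \<otimes>\<^bsub>P\<^esub> (A \<otimes>\<^bsub>P\<^esub> T)"
      by (rule P.ring_eqI, (rule P.reify)+, simp_all)
    also have "\<dots> = Kb \<otimes>\<^bsub>P\<^esub> (Kb \<otimes>\<^bsub>P\<^esub> (B \<otimes>\<^bsub>P\<^esub> B)) \<otimes>\<^bsub>P\<^esub> (S \<otimes>\<^bsub>P\<^esub> S)"
      unfolding AT by (rule P.ring_eqI, (rule P.reify)+, simp_all)
    also have "\<dots> = (A \<otimes>\<^bsub>P\<^esub> A) \<otimes>\<^bsub>P\<^esub> (Kb \<otimes>\<^bsub>P\<^esub> f \<otimes>\<^bsub>P\<^esub> (S \<otimes>\<^bsub>P\<^esub> S))"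
      unfolding eq0[symmetric] by (rule P.ring_eqI, (rule P.reify)+, simp_all)
    finally have "T \<otimes>\<^bsub>P\<^esub> T = Kb \<otimes>\<^bsub>P\<^esub> f \<otimes>\<^bsub>P\<^esub> (S \<otimes>\<^bsub>P\<^esub> S)"
      using AA by (simp add: domain.m_lcancel[OF UP_domain])
    then have TT: "T \<otimes>\<^bsub>P\<^esub> T = const b \<otimes>\<^bsub>P\<^esub> (f \<otimes>\<^bsub>P\<^esub> (S \<otimes>\<^bsub>P\<^esub> S))"
      by (simp add: Kb[symmetric] P.m_assoc)
    have bU: "b \<in> Units R" using less.prems(2) by (simp add: field_Units)
    then have ib: "inv b \<in> carrier R" "inv b \<noteq> \<zero>"
      using R.Units_inv_Units[OF bU] by (auto simp: field_Units)
    have "const (inv b) \<otimes>\<^bsub>P\<^esub> (T \<otimes>\<^bsub>P\<^esub> T) = const (inv b \<otimes> b) \<otimes>\<^bsub>P\<^esub> (f \<otimes>\<^bsub>P\<^esub> (S \<otimes>\<^bsub>P\<^esub> S))"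
      unfolding TT using ib by (simp add: const_mult[symmetric] P.m_assoc)
    then have "f \<otimes>\<^bsub>P\<^esub> (S \<otimes>\<^bsub>P\<^esub> S) = const (inv b) \<otimes>\<^bsub>P\<^esub> (T \<otimes>\<^bsub>P\<^esub> T)"
      using R.Units_l_inv[OF bU] by simp
    with less.hyps[of S "inv b" T] dS False ib show ?thesis by simp
  qed
qed

text \<open>With \<open>g = f\<^sup>c\<close> and \<open>q = 2c + 1\<close>, squaring \<open>u = - v g\<close> modulo \<open>(X - z)\<^sup>q\<close> gives
  \<open>f u\<^sup>2 = f(z) v\<^sup>2\<close> there, hence everywhere by degree.\<close>

lemma stepanov_independent:
  assumes f: "f \<in> carrier P" "deg R f \<le> 4" "\<not> square_multiple f"
    and z: "z \<in> carrier R" "value_at f z \<noteq> \<zero>"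
    and q: "primepow (card (carrier R))" "card (carrier R) = 2 * c + 1" "2 * d + 4 < card (carrier R)"
    and u: "u \<in> carrier P" "deg R u \<le> d" and v: "v \<in> carrier P" "deg R v \<le> d"
    and B: "B \<in> carrier P"
    and eq: "u \<oplus>\<^bsub>P\<^esub> v \<otimes>\<^bsub>P\<^esub> f [^]\<^bsub>P\<^esub> c = (indet \<oplus>\<^bsub>P\<^esub> const (\<ominus> z)) [^]\<^bsub>P\<^esub> card (carrier R) \<otimes>\<^bsub>P\<^esub> B"
  shows "u = \<zero>\<^bsub>P\<^esub> \<and> v = \<zero>\<^bsub>P\<^esub>"
proof -
  let ?q = "card (carrier R)"
  obtain p e where p: "prime (p::nat)" "?q = p ^ e" "[p] \<cdot> \<one> = \<zero>" by (rule primepow_char[OF q(1)])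
  have chP: "[p] \<cdot>\<^bsub>P\<^esub> \<one>\<^bsub>P\<^esub> = \<zero>\<^bsub>P\<^esub>" using p(3) by (simp add: const_add_pow)
  define y where "y = indet \<oplus>\<^bsub>P\<^esub> const (\<ominus> z)"
  have y: "y \<in> carrier P" unfolding y_def using z by simp
  define w where "w = y [^]\<^bsub>P\<^esub> ?q"
  have w: "w \<in> carrier P" "deg R w = ?q" "w \<noteq> \<zero>\<^bsub>P\<^esub>"
    unfolding w_def y_def using deg_linear_pow[of "\<ominus> z" ?q] z by auto
  define g where "g = f [^]\<^bsub>P\<^esub> c"
  have g: "g \<in> carrier P" unfolding g_def using f by simp
  have sf: "shift z f \<in> carrier P" using f z by simp
  obtain a where a: "a = value_at f z" by blast
  \<comment> \<open>Expanding at z gives f = f(z) + (X - z) \<open>phi\<close>. The power q is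
    additive and fixes constants, so f^q = f(z) + \<open>w\<close> \<open>phi\<close>^q; on the
    other hand f^q = f g^2 as q = 2c + 1.\<close>
  from horner_decomp[OF sf] obtain s where s: "s \<in> carrier P"
    "shift z f = const a \<oplus>\<^bsub>P\<^esub> indet \<otimes>\<^bsub>P\<^esub> s" unfolding a by metis
  define phi where "phi = shift (\<ominus> z) s"
  have phi: "phi \<in> carrier P" unfolding phi_def using s z by simp
  have vz: "a \<in> carrier R" using f z a by simp
  define K where "K = const a"
  have K: "K \<in> carrier P" unfolding K_def using vz by simp
  have "f = shift (\<ominus> z) (shift z f)" using f z by (simp add: shift_shift_cancel)
  also have "\<dots> = K \<oplus>\<^bsub>P\<^esub> y \<otimes>\<^bsub>P\<^esub> phi"
    unfolding s(2) y_def phi_def K_def using z s(1) vz by (simp add: shift_horner)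
  finally have fK: "f = K \<oplus>\<^bsub>P\<^esub> y \<otimes>\<^bsub>P\<^esub> phi" .
  have "f [^]\<^bsub>P\<^esub> ?q = K [^]\<^bsub>P\<^esub> ?q \<oplus>\<^bsub>P\<^esub> (y \<otimes>\<^bsub>P\<^esub> phi) [^]\<^bsub>P\<^esub> ?q"
    unfolding p(2) by (subst fK, rule P.frobenius[OF p(1) chP]) (use K y phi in auto)
  also have "K [^]\<^bsub>P\<^esub> ?q = K" unfolding K_def using vz by (simp add: const_pow pow_card)
  also have "(y \<otimes>\<^bsub>P\<^esub> phi) [^]\<^bsub>P\<^esub> ?q = w \<otimes>\<^bsub>P\<^esub> phi [^]\<^bsub>P\<^esub> ?q"
    unfolding w_def using y phi by (rule P.nat_pow_distrib)
  finally have fq: "f [^]\<^bsub>P\<^esub> ?q = K \<oplus>\<^bsub>P\<^esub> w \<otimes>\<^bsub>P\<^esub> phi [^]\<^bsub>P\<^esub> ?q" .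
  obtain \<psi> where psi: "\<psi> = phi [^]\<^bsub>P\<^esub> ?q" "\<psi> \<in> carrier P" using phi by blast
  have "f \<otimes>\<^bsub>P\<^esub> g \<otimes>\<^bsub>P\<^esub> g = f [^]\<^bsub>P\<^esub> ?q"
    unfolding g_def q(2) using f by (simp add: P.nat_pow_mult[symmetric] mult_2 P.m_ac)
  then have fgg: "f \<otimes>\<^bsub>P\<^esub> g \<otimes>\<^bsub>P\<^esub> g = K \<oplus>\<^bsub>P\<^esub> w \<otimes>\<^bsub>P\<^esub> \<psi>" using fq psi by simp
  have u': "u = w \<otimes>\<^bsub>P\<^esub> B \<ominus>\<^bsub>P\<^esub> v \<otimes>\<^bsub>P\<^esub> g"
  proof -
    have "w \<otimes>\<^bsub>P\<^esub> B = u \<oplus>\<^bsub>P\<^esub> v \<otimes>\<^bsub>P\<^esub> g" using eq unfolding w_def y_def g_def by simp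
    then show ?thesis using u v g by (simp add: a_minus_def P.a_assoc P.r_neg)
  qed
  define W where "W = f \<otimes>\<^bsub>P\<^esub> (w \<otimes>\<^bsub>P\<^esub> B \<otimes>\<^bsub>P\<^esub> B \<ominus>\<^bsub>P\<^esub> B \<otimes>\<^bsub>P\<^esub> v \<otimes>\<^bsub>P\<^esub> g \<ominus>\<^bsub>P\<^esub> B \<otimes>\<^bsub>P\<^esub> v \<otimes>\<^bsub>P\<^esub> g) \<oplus>\<^bsub>P\<^esub> v \<otimes>\<^bsub>P\<^esub> v \<otimes>\<^bsub>P\<^esub> \<psi>"
  have W: "W \<in> carrier P" unfolding W_def using f w B v g psi by simp
  have "f \<otimes>\<^bsub>P\<^esub> (u \<otimes>\<^bsub>P\<^esub> u) = w \<otimes>\<^bsub>P\<^esub> (f \<otimes>\<^bsub>P\<^esub> (w \<otimes>\<^bsub>P\<^esub> B \<otimes>\<^bsub>P\<^esub> B \<ominus>\<^bsub>P\<^esub> B \<otimes>\<^bsub>P\<^esub> v \<otimes>\<^bsub>P\<^esub> g \<ominus>\<^bsub>P\<^esub> B \<otimes>\<^bsub>P\<^esub> v \<otimes>\<^bsub>P\<^esub> g)) \<oplus>\<^bsub>P\<^esub> v \<otimes>\<^bsub>P\<^esub> v \<otimes>\<^bsub>P\<^esub> (f \<otimes>\<^bsub>P\<^esub> g \<otimes>\<^bsub>P\<^esub> g)"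
    unfolding u' using f(1) w(1) B v(1) g by - (rule P.ring_eqI, (rule P.reify)+, simp_all)
  also have "\<dots> = K \<otimes>\<^bsub>P\<^esub> (v \<otimes>\<^bsub>P\<^esub> v) \<oplus>\<^bsub>P\<^esub> w \<otimes>\<^bsub>P\<^esub> W"
    unfolding fgg W_def using f(1) w(1) B v(1) g psi(2) K by - (rule P.ring_eqI, (rule P.reify)+, simp_all)
  finally have fuu: "f \<otimes>\<^bsub>P\<^esub> (u \<otimes>\<^bsub>P\<^esub> u) = K \<otimes>\<^bsub>P\<^esub> (v \<otimes>\<^bsub>P\<^esub> v) \<oplus>\<^bsub>P\<^esub> w \<otimes>\<^bsub>P\<^esub> W" .
  have "w \<otimes>\<^bsub>P\<^esub> W = f \<otimes>\<^bsub>P\<^esub> (u \<otimes>\<^bsub>P\<^esub> u) \<ominus>\<^bsub>P\<^esub> K \<otimes>\<^bsub>P\<^esub> (v \<otimes>\<^bsub>P\<^esub> v)"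
    unfolding fuu using K v(1) w(1) W by - (rule P.ring_eqI, (rule P.reify)+, simp_all)
  \<comment> \<open>A non-zero \<open>W\<close> would give w W degree at least q, while the other
    side has degree at most 2d + 4 < q. So the congruence modulo \<open>w\<close> is an
    equality.\<close>
  moreover have "deg R (f \<otimes>\<^bsub>P\<^esub> (u \<otimes>\<^bsub>P\<^esub> u) \<ominus>\<^bsub>P\<^esub> K \<otimes>\<^bsub>P\<^esub> (v \<otimes>\<^bsub>P\<^esub> v)) \<le> 2 * d + 4"
  proof -
    have "deg R (f \<otimes>\<^bsub>P\<^esub> (u \<otimes>\<^bsub>P\<^esub> u)) \<le> 4 + (d + d)"
      using deg_mult_ring[of f "u \<otimes>\<^bsub>P\<^esub> u"] deg_mult_ring[of u u] f u by simp
    moreover have "deg R (K \<otimes>\<^bsub>P\<^esub> (v \<otimes>\<^bsub>P\<^esub> v)) \<le> 0 + (d + d)"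
      using deg_mult_ring[of K "v \<otimes>\<^bsub>P\<^esub> v"] deg_mult_ring[of v v] v K vz
      by (simp add: K_def const_def)
    ultimately show ?thesis
      using deg_add[of "f \<otimes>\<^bsub>P\<^esub> (u \<otimes>\<^bsub>P\<^esub> u)" "\<ominus>\<^bsub>P\<^esub> (K \<otimes>\<^bsub>P\<^esub> (v \<otimes>\<^bsub>P\<^esub> v))"] f u v K
      by (simp add: a_minus_def)
  qed
  ultimately have "deg R (w \<otimes>\<^bsub>P\<^esub> W) < ?q" using q(3) by simp
  then have "W = \<zero>\<^bsub>P\<^esub>" using deg_mult[of w W] w W by (cases "W = \<zero>\<^bsub>P\<^esub>") auto
  with fuu w K v have fin: "f \<otimes>\<^bsub>P\<^esub> (u \<otimes>\<^bsub>P\<^esub> u) = const a \<otimes>\<^bsub>P\<^esub> (v \<otimes>\<^bsub>P\<^esub> v)"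
    by (simp add: K_def)
  have u0: "u = \<zero>\<^bsub>P\<^esub>"
    using square_multipleI[OF f(1) vz z(2)[folded a] u(1) v(1) _ fin] f(3) by blast
  have "K \<otimes>\<^bsub>P\<^esub> (v \<otimes>\<^bsub>P\<^esub> v) = \<zero>\<^bsub>P\<^esub>" using fin u0 f K_def by simp
  moreover have "K \<noteq> \<zero>\<^bsub>P\<^esub>"
  proof
    assume "K = \<zero>\<^bsub>P\<^esub>"
    then have "coeff P K 0 = \<zero>" by simp
    then show False using z(2)[folded a] vz by (simp add: K_def coeff_const)
  qed
  ultimately have "v \<otimes>\<^bsub>P\<^esub> v = \<zero>\<^bsub>P\<^esub>" using UP_integral[of K "v \<otimes>\<^bsub>P\<^esub> v"] K v by auto
  then have "v = \<zero>\<^bsub>P\<^esub>" using UP_integral[of v v] v by auto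
  with u0 show ?thesis by blast
qed

section \<open>The auxiliary polynomial and its Taylor coefficients\<close>

text \<open>The Taylor coefficient of order k of f^N is f(x)^(N - k) times a polynomial in x whose
  degree depends on k but not on N; the factor f(x)^k keeps the exponents non-negative. Because of
  this, vanishing conditions remain cheap although f^c itself has degree of order q.\<close>

lemma power_shift_coeff:
  assumes f: "f \<in> carrier P" "deg R f \<le> m"
  shows "\<exists>H. polyfun R (m * k) H \<and> (\<forall>x\<in>carrier R.
    value_at f x [^] k \<otimes> coeff P (shift x f [^]\<^bsub>P\<^esub> (N::nat)) k = value_at f x [^] N \<otimes> H x)"
proof (induction N arbitrary: k)
  case 0
  have "polyfun R (m * k) (\<lambda>x. if k = 0 then \<one> else \<zero>)"
    by (rule R.polyfun_const) auto
  moreover have "value_at f x [^] k \<otimes> coeff P (shift x f [^]\<^bsub>P\<^esub> (0::nat)) k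
      = value_at f x [^] (0::nat) \<otimes> (if k = 0 then \<one> else \<zero>)" if "x \<in> carrier R" for x
    using f that by simp
  ultimately show ?case by blast
next
  case (Suc N)
  then obtain H where H: "\<And>i. polyfun R (m * i) (H i)" "\<And>i x. x \<in> carrier R \<Longrightarrow>
      value_at f x [^] i \<otimes> coeff P (shift x f [^]\<^bsub>P\<^esub> N) i = value_at f x [^] N \<otimes> H i x"
    by metis
  \<comment> \<open>In the product of f^N and f, the term i = k takes the constant coefficient f(x)
    from the last factor, which supplies the additional power. For i < k one of the k - i left-over
    factors f(x) supplies it, and k - i - 1 of them stay in \<open>G\<close>.\<close>
  define G where "G i x = (if i = k then H k x
    else H i x \<otimes> value_at f x [^] (k - i - 1) \<otimes> coeff P (shift x f) (k - i))" for i x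
  note pf = polyfun_coeff_shift[OF f]
  have G: "polyfun R (m * k) (G i)" if "i \<in> {..k}" for i
  proof (cases "i = k")
    case True
    then show ?thesis using H(1)[of k] R.polyfun_cong[of "m * k" "H k" "G i"] unfolding G_def by auto
  next
    case False
    with that obtain j where j: "k = i + Suc j" by (metis atMost_iff le_neq_implies_less less_iff_Suc_add add_Suc_right)
    have "polyfun R (m * i + m * j + m) (\<lambda>x. H i x \<otimes> value_at f x [^] j \<otimes> coeff P (shift x f) (k - i))"
      by (intro R.polyfun_mult R.polyfun_pow pf H(1))
    then show ?thesis
      using R.polyfun_cong[of "m * k" _ "G i"] False j unfolding G_def by (simp add: algebra_simps)
  qed
  have "polyfun R (m * k) (\<lambda>x. \<Oplus>i\<in>{..k}. G i x)"
    by (rule R.polyfun_finsum) (use G in auto)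
  moreover have "value_at f x [^] k \<otimes> coeff P (shift x f [^]\<^bsub>P\<^esub> Suc N) k
      = value_at f x [^] Suc N \<otimes> (\<Oplus>i\<in>{..k}. G i x)" if x: "x \<in> carrier R" for x
  proof -
    have Gc: "G i x \<in> carrier R" if "i \<in> {..k}" for i using R.polyfun_closed[OF G[OF that] x] .
    define F where "F = value_at f x"
    define a where "a = coeff P (shift x f [^]\<^bsub>P\<^esub> N)"
    define b where "b = coeff P (shift x f)"
    have cl: "F \<in> carrier R" "a i \<in> carrier R" "b i \<in> carrier R" "H i x \<in> carrier R" for i
      unfolding F_def a_def b_def using f x R.polyfun_closed[OF H(1) x] by auto
    have "coeff P (shift x f [^]\<^bsub>P\<^esub> Suc N) k = (\<Oplus>i\<in>{..k}. a i \<otimes> b (k - i))"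
      unfolding a_def b_def using f x by simp
    then have "F [^] k \<otimes> coeff P (shift x f [^]\<^bsub>P\<^esub> Suc N) k = (\<Oplus>i\<in>{..k}. F [^] k \<otimes> (a i \<otimes> b (k - i)))"
      using cl by (simp add: R.finsum_rdistr)
    also have "\<dots> = (\<Oplus>i\<in>{..k}. F [^] Suc N \<otimes> G i x)"
    proof (rule R.finsum_cong'[OF refl])
      fix i assume i: "i \<in> {..k}"
      have Fa: "F [^] i \<otimes> a i = F [^] N \<otimes> H i x" using H(2)[OF x] unfolding F_def a_def by simp
      show "F [^] k \<otimes> (a i \<otimes> b (k - i)) = F [^] Suc N \<otimes> G i x"
      proof (cases "i = k")
        case True
        have "F [^] k \<otimes> (a k \<otimes> F) = (F [^] k \<otimes> a k) \<otimes> F" using cl by (simp add: R.m_assoc)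
        also have "\<dots> = F [^] Suc N \<otimes> H k x"
          using Fa True cl by (simp add: R.m_ac)
        finally show ?thesis using True by (simp add: G_def b_def F_def)
      next
        case False
        with i obtain j where j: "k = i + Suc j" by (metis atMost_iff le_neq_implies_less less_iff_Suc_add add_Suc_right)
        have "F [^] k = F [^] i \<otimes> (F [^] j \<otimes> F)" using cl j by (simp add: R.nat_pow_mult[symmetric] R.m_assoc)
        then have "F [^] k \<otimes> (a i \<otimes> b (k - i)) = (F [^] i \<otimes> a i) \<otimes> (F [^] j \<otimes> F \<otimes> b (k - i))"
          using cl by (simp add: R.m_ac)
        also have "\<dots> = F [^] Suc N \<otimes> (H i x \<otimes> F [^] j \<otimes> b (k - i))"
          unfolding Fa using cl by (simp add: R.m_ac)
        also have "H i x \<otimes> F [^] j \<otimes> b (k - i) = G i x"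
          using False j by (simp add: G_def F_def b_def)
        finally show ?thesis .
      qed
    qed (use cl Gc in auto)
    also have "\<dots> = F [^] Suc N \<otimes> (\<Oplus>i\<in>{..k}. G i x)"
      using cl Gc by (intro R.finsum_rdistr[symmetric]) auto
    finally show ?thesis unfolding F_def .
  qed
  ultimately show ?case by blast
qed

text \<open>Stepanov's auxiliary polynomial, the sum of (u_j + v_j g) w^j over the list positions j,
  in Horner form. It is used with g = f^c and w = (X - z)^q, where f(z) is non-zero.\<close>

primrec comb :: "(nat \<Rightarrow> 'a) \<Rightarrow> (nat \<Rightarrow> 'a) \<Rightarrow> ((nat \<Rightarrow> 'a) \<times> (nat \<Rightarrow> 'a)) list \<Rightarrow> (nat \<Rightarrow> 'a)" where
  "comb g w [] = \<zero>\<^bsub>P\<^esub>"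
| "comb g w (uv # xs) = (fst uv \<oplus>\<^bsub>P\<^esub> snd uv \<otimes>\<^bsub>P\<^esub> g) \<oplus>\<^bsub>P\<^esub> w \<otimes>\<^bsub>P\<^esub> comb g w xs"

definition low_deg :: "nat \<Rightarrow> (nat \<Rightarrow> 'a) set" where
  "low_deg d = {p \<in> carrier P. deg R p \<le> d}"

lemma low_degD: "p \<in> low_deg d \<Longrightarrow> p \<in> carrier P" "p \<in> low_deg d \<Longrightarrow> deg R p \<le> d"
  by (auto simp: low_deg_def)

lemma card_low_deg: "finite (low_deg d)" "card (low_deg d) = card (carrier R) ^ Suc d"
proof -
  define h where "h p = restrict (coeff P p) {..d}" for p
  have "bij_betw h (low_deg d) ({..d} \<rightarrow>\<^sub>E carrier R)"
  proof (rule bij_betwI')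
    fix p r assume pr: "p \<in> low_deg d" "r \<in> low_deg d"
    have "p = r" if "h p = h r"
    proof (rule up_eqI)
      fix n show "coeff P p n = coeff P r n"
      proof (cases "n \<le> d")
        case True
        then show ?thesis using fun_cong[OF that, of n] by (simp add: h_def)
      next
        case False
        then have "deg R p < n" "deg R r < n" using low_degD(2)[OF pr(1)] low_degD(2)[OF pr(2)] by auto
        then show ?thesis using pr low_degD(1) by (simp add: deg_aboveD)
      qed
    qed (use pr low_degD in auto)
    then show "(h p = h r) = (p = r)" by blast
  next
    fix p assume "p \<in> low_deg d"
    then show "h p \<in> {..d} \<rightarrow>\<^sub>E carrier R" unfolding h_def using low_degD by auto
  next
    fix a assume a: "a \<in> {..d} \<rightarrow>\<^sub>E carrier R"
    define p where "p = (\<lambda>n. if n \<le> d then a n else \<zero>)"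
    have up: "p \<in> up R"
    proof (rule mem_upI)
      show "p n \<in> carrier R" for n using a by (auto simp: p_def)
      have "bound \<zero> d p" unfolding bound_def p_def by simp
      then show "\<exists>n. bound \<zero> n p" ..
    qed
    then have p: "p \<in> carrier P" "coeff P p n = p n" for n by (simp_all add: UP_def P_def)
    have "deg R p \<le> d" by (rule deg_aboveI) (use p in \<open>auto simp: p_def\<close>)
    then have "p \<in> low_deg d" using p by (simp add: low_deg_def)
    moreover have "a = h p"
    proof
      fix n show "a n = h p n"
      proof (cases "n \<le> d")
        case True
        then have "h p n = p n" by (simp add: h_def p(2))
        then show ?thesis using True by (simp add: p_def)
      next
        case False
        then show ?thesis using PiE_arb[OF a, of n] by (simp add: h_def)
      qed
    qed
    ultimately show "\<exists>p\<in>low_deg d. a = h p" by blast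
  qed
  then have "finite (low_deg d) = finite ({..d} \<rightarrow>\<^sub>E carrier R)"
    "card (low_deg d) = card ({..d} \<rightarrow>\<^sub>E carrier R)"
    by (auto dest: bij_betw_finite bij_betw_same_card)
  then show "finite (low_deg d)" "card (low_deg d) = card (carrier R) ^ Suc d"
    using finite_carrier by (auto simp: card_PiE intro!: finite_PiE)
qed

lemma comb_closed: "g \<in> carrier P \<Longrightarrow> w \<in> carrier P \<Longrightarrow> set xs \<subseteq> low_deg d \<times> low_deg d \<Longrightarrow> comb g w xs \<in> carrier P"
  by (induction xs) (auto simp: low_deg_def)

lemma deg_comb:
  assumes g: "g \<in> carrier P" "deg R g \<le> e" and w: "w \<in> carrier P" "deg R w \<le> n"
  shows "set xs \<subseteq> low_deg d \<times> low_deg d \<Longrightarrow> deg R (comb g w xs) \<le> d + e + n * length xs"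
proof (induction xs)
  case (Cons uv xs)
  obtain u v where uv: "uv = (u, v)" by fastforce
  have u: "u \<in> carrier P" "deg R u \<le> d" and v: "v \<in> carrier P" "deg R v \<le> d"
    using Cons.prems uv low_degD by auto
  have c: "comb g w xs \<in> carrier P" using comb_closed g w Cons.prems by auto
  have "deg R (v \<otimes>\<^bsub>P\<^esub> g) \<le> d + e" using deg_mult_ring[of v g] v g by simp
  then have "deg R (u \<oplus>\<^bsub>P\<^esub> v \<otimes>\<^bsub>P\<^esub> g) \<le> d + e" 
    by (intro order.trans[OF deg_add]) (use u v g in auto)
  moreover have "deg R (w \<otimes>\<^bsub>P\<^esub> comb g w xs) \<le> n + (d + e + n * length xs)"
    using deg_mult_ring[of w "comb g w xs"] w c Cons by simp
  ultimately show ?case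
    unfolding comb.simps by (intro order.trans[OF deg_add]) (use u v g w c uv in auto)
qed simp

text \<open>Two facts keep the degree small on \<open>S\<close>. There f^c has the constant value
  \<open>a\<close>, so \<open>power_shift_coeff\<close> reduces the part v f^c to degree d + m k.
  And \<open>w\<close> translated to x is X^q + (x - z), so below order q each factor
  \<open>w\<close> contributes only the linear factor x - z.\<close>

lemma coeff_comb_polyfun:
  assumes f: "f \<in> carrier P" "deg R f \<le> m" and z: "z \<in> carrier R"
    and q: "primepow (card (carrier R))" and k: "k < card (carrier R)"
    and S: "S \<subseteq> carrier R" "\<And>x. x \<in> S \<Longrightarrow> value_at f x [^] (c::nat) = a" and a: "a \<in> carrier R"
  defines "w \<equiv> (indet \<oplus>\<^bsub>P\<^esub> const (\<ominus> z)) [^]\<^bsub>P\<^esub> card (carrier R)"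
  shows "set xs \<subseteq> low_deg d \<times> low_deg d \<Longrightarrow> \<exists>h. polyfun R (length xs + d + m * k) h \<and>
    (\<forall>x\<in>S. value_at f x [^] k \<otimes> coeff P (shift x (comb (f [^]\<^bsub>P\<^esub> c) w xs)) k = h x)"
proof (induction xs)
  case Nil
  have "polyfun R (length [] + d + m * k) (\<lambda>x. \<zero>)" by (rule R.polyfun_const) auto
  moreover have "value_at f x [^] k \<otimes> coeff P (shift x (comb (f [^]\<^bsub>P\<^esub> c) w [])) k = \<zero>" if "x \<in> S" for x
    using that S f by (auto simp: subset_iff)
  ultimately show ?case by blast
next
  case (Cons uv xs)
  let ?q = "card (carrier R)"
  let ?g = "f [^]\<^bsub>P\<^esub> c"
  obtain p e where p: "prime (p::nat)" "?q = p ^ e" "[p] \<cdot> \<one> = \<zero>" by (rule primepow_char[OF q])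
  have chP: "[p] \<cdot>\<^bsub>P\<^esub> \<one>\<^bsub>P\<^esub> = \<zero>\<^bsub>P\<^esub>" using p(3) by (simp add: const_add_pow)
  obtain u v where uv: "uv = (u, v)" by fastforce
  have u: "u \<in> carrier P" "deg R u \<le> d" and v: "v \<in> carrier P" "deg R v \<le> d"
    using Cons.prems uv low_degD by auto
  have w: "w \<in> carrier P" unfolding w_def using z by simp
  have A: "comb ?g w xs \<in> carrier P" 
    by (rule comb_closed[where d = d]) (use f w Cons.prems in simp_all)
  have "set xs \<subseteq> low_deg d \<times> low_deg d" using Cons.prems by simp
  from Cons.IH[OF this] obtain h where h: "polyfun R (length xs + d + m * k) h"
    "\<And>x. x \<in> S \<Longrightarrow> value_at f x [^] k \<otimes> coeff P (shift x (comb ?g w xs)) k = h x" by blast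
  obtain H where H: "\<And>i. polyfun R (m * i) (H i)" "\<And>i x. x \<in> carrier R \<Longrightarrow>
      value_at f x [^] i \<otimes> coeff P (shift x f [^]\<^bsub>P\<^esub> c) i = value_at f x [^] c \<otimes> H i x"
    using power_shift_coeff[OF f, of _ c] by metis
  note Fp = R.polyfun_pow[OF polyfun_coeff_shift[OF f]]
  define h1 where "h1 x = value_at f x [^] k \<otimes> coeff P (shift x u) k" for x
  \<comment> \<open>The Leibniz rule for v f^c: the weight of order k is shared between the factors
    as i and k - i, and f^c is replaced by its value \<open>a\<close>.\<close>
  define h2 where "h2 x = a \<otimes> (\<Oplus>i\<in>{..k}. value_at f x [^] i \<otimes> coeff P (shift x v) i \<otimes> H (k - i) x)" for x
  have h1: "polyfun R (m * k + d) h1"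
    unfolding h1_def[abs_def] by (intro R.polyfun_mult Fp polyfun_coeff_shift u)
  have h2: "polyfun R (m * k + d) h2"
    unfolding h2_def[abs_def]
  proof (intro R.polyfun_smult[OF _ a] R.polyfun_finsum)
    fix i assume "i \<in> {..k}"
    then have "m * i + d + m * (k - i) = m * k + d" by (auto simp: add_mult_distrib2[symmetric])
    moreover have "polyfun R (m * i + d + m * (k - i))
        (\<lambda>x. value_at f x [^] i \<otimes> coeff P (shift x v) i \<otimes> H (k - i) x)"
      by (intro R.polyfun_mult Fp polyfun_coeff_shift v H)
    ultimately show "polyfun R (m * k + d)
        (\<lambda>x. value_at f x [^] i \<otimes> coeff P (shift x v) i \<otimes> H (k - i) x)" by (simp only:)
  qed simp
  have xz: "polyfun R 1 (\<lambda>x. x \<ominus> z)"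
    using R.polyfun_minus[OF R.polyfun_id R.polyfun_const[OF z]] by simp
  have h3: "polyfun R (1 + (length xs + d + m * k)) (\<lambda>x. (x \<ominus> z) \<otimes> h x)"
    by (rule R.polyfun_mult[OF xz h(1)])
  have "polyfun R (length (uv # xs) + d + m * k) (\<lambda>x. (h1 x \<oplus> h2 x) \<oplus> (x \<ominus> z) \<otimes> h x)"
    by (intro R.polyfun_add R.polyfun_mono[OF h1] R.polyfun_mono[OF h2] R.polyfun_mono[OF h3]) auto
  moreover have "value_at f x [^] k \<otimes> coeff P (shift x (comb ?g w (uv # xs))) k
      = (h1 x \<oplus> h2 x) \<oplus> (x \<ominus> z) \<otimes> h x" if xS: "x \<in> S" for x
  proof -
    have x: "x \<in> carrier R" using xS S by auto
    define F where "F = value_at f x"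
    have F: "F \<in> carrier R" unfolding F_def using f x by simp
    define y where "y = x \<ominus> z"
    have y: "y \<in> carrier R" unfolding y_def using x z by simp
    define A' where "A' = shift x (comb ?g w xs)"
    have A': "A' \<in> carrier P" unfolding A'_def using A x by simp
    have "shift x w = (indet \<oplus>\<^bsub>P\<^esub> const y) [^]\<^bsub>P\<^esub> ?q"
      unfolding w_def y_def using x z
      by (simp add: shift_pow shift_add shift_indet shift_const P.a_assoc const_add a_minus_def)
    also have "\<dots> = indet [^]\<^bsub>P\<^esub> ?q \<oplus>\<^bsub>P\<^esub> const y [^]\<^bsub>P\<^esub> ?q"
      unfolding p(2) by (rule P.frobenius[OF p(1) chP]) (use y in auto)
    also have "const y [^]\<^bsub>P\<^esub> ?q = const y" using y by (simp add: const_pow pow_card)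
    finally have sw: "shift x w = indet [^]\<^bsub>P\<^esub> ?q \<oplus>\<^bsub>P\<^esub> const y" .
    have c3: "coeff P (shift x (w \<otimes>\<^bsub>P\<^esub> comb ?g w xs)) k = y \<otimes> coeff P A' k"
    proof -
      have "shift x (w \<otimes>\<^bsub>P\<^esub> comb ?g w xs) = indet [^]\<^bsub>P\<^esub> ?q \<otimes>\<^bsub>P\<^esub> A' \<oplus>\<^bsub>P\<^esub> const y \<otimes>\<^bsub>P\<^esub> A'"
        using x w A y A' by (simp add: shift_mult sw A'_def P.l_distr)
      then show ?thesis using k y A'
        by (simp add: coeff_indet_pow_mult coeff_const_mult del: coeff_mult)
    qed
    define sv where "sv = coeff P (shift x v)"
    define b where "b = coeff P (shift x f [^]\<^bsub>P\<^esub> c)"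
    have cl: "sv i \<in> carrier R" "b i \<in> carrier R" "H i x \<in> carrier R" for i
      unfolding sv_def b_def using v f x R.polyfun_closed[OF H(1) x] by auto
    have c2: "F [^] k \<otimes> coeff P (shift x (v \<otimes>\<^bsub>P\<^esub> ?g)) k = h2 x"
    proof -
      have "coeff P (shift x (v \<otimes>\<^bsub>P\<^esub> ?g)) k = (\<Oplus>i\<in>{..k}. sv i \<otimes> b (k - i))"
        using x v f by (simp add: shift_mult shift_pow sv_def b_def)
      then have "F [^] k \<otimes> coeff P (shift x (v \<otimes>\<^bsub>P\<^esub> ?g)) k = (\<Oplus>i\<in>{..k}. F [^] k \<otimes> (sv i \<otimes> b (k - i)))"
        using cl F by (simp add: R.finsum_rdistr)
      also have "\<dots> = (\<Oplus>i\<in>{..k}. a \<otimes> (F [^] i \<otimes> sv i \<otimes> H (k - i) x))"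
      proof (rule R.finsum_cong'[OF refl])
        fix i assume i: "i \<in> {..k}"
        have "F [^] k = F [^] i \<otimes> F [^] (k - i)" using F i by (simp add: R.nat_pow_mult)
        then have "F [^] k \<otimes> (sv i \<otimes> b (k - i)) = F [^] i \<otimes> sv i \<otimes> (F [^] (k - i) \<otimes> b (k - i))"
          using cl F by (simp add: R.m_ac)
        also have "F [^] (k - i) \<otimes> b (k - i) = a \<otimes> H (k - i) x"
          using H(2)[OF x, of "k - i"] S(2)[OF xS] unfolding F_def b_def by simp
        finally show "F [^] k \<otimes> (sv i \<otimes> b (k - i)) = a \<otimes> (F [^] i \<otimes> sv i \<otimes> H (k - i) x)"
          using cl F a by (simp add: R.m_ac)
      qed (use cl F a in auto)
      also have "\<dots> = h2 x"
        unfolding h2_def F_def[symmetric] sv_def[symmetric] using cl F a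
        by (intro R.finsum_rdistr[symmetric]) auto
      finally show ?thesis .
    qed
    have "coeff P (shift x (comb ?g w (uv # xs))) k =
        (coeff P (shift x u) k \<oplus> coeff P (shift x (v \<otimes>\<^bsub>P\<^esub> ?g)) k) \<oplus> y \<otimes> coeff P A' k"
      using x u v f w A c3 uv by (simp add: shift_add del: coeff_mult)
    then have "F [^] k \<otimes> coeff P (shift x (comb ?g w (uv # xs))) k =
        (F [^] k \<otimes> coeff P (shift x u) k \<oplus> F [^] k \<otimes> coeff P (shift x (v \<otimes>\<^bsub>P\<^esub> ?g)) k)
        \<oplus> y \<otimes> (F [^] k \<otimes> coeff P A' k)"
      using x u v f y F A' by (simp add: R.r_distr R.m_lcomm del: coeff_mult)
    then show ?thesis
      unfolding c2 using h(2)[OF xS] by (simp add: h1_def F_def A'_def y_def)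
  qed
  ultimately show ?case by blast
qed

text \<open>Injectivity plays the role of linear independence. The difference of two equal values is
  a relation modulo \<open>w\<close>, so \<open>stepanov_independent\<close> identifies the first
  pairs; then \<open>w\<close> cancels and the remaining lists are compared.\<close>

lemma comb_inj:
  assumes f: "f \<in> carrier P" "deg R f \<le> 4" "\<not> square_multiple f"
    and z: "z \<in> carrier R" "value_at f z \<noteq> \<zero>"
    and q: "primepow (card (carrier R))" "card (carrier R) = 2 * c + 1" "2 * d + 4 < card (carrier R)"
  defines "w \<equiv> (indet \<oplus>\<^bsub>P\<^esub> const (\<ominus> z)) [^]\<^bsub>P\<^esub> card (carrier R)"
  shows "length xs = length ys \<Longrightarrow> set xs \<subseteq> low_deg d \<times> low_deg d \<Longrightarrow> set ys \<subseteq> low_deg d \<times> low_deg d \<Longrightarrow>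
    comb (f [^]\<^bsub>P\<^esub> c) w xs = comb (f [^]\<^bsub>P\<^esub> c) w ys \<Longrightarrow> xs = ys"
proof (induction xs ys rule: list_induct2)
  case (Cons x xs y ys)
  obtain g where g: "g = f [^]\<^bsub>P\<^esub> c" "g \<in> carrier P" using f by blast
  have w: "w \<in> carrier P" "w \<noteq> \<zero>\<^bsub>P\<^esub>"
    unfolding w_def using z(1) deg_linear_pow(2)[of "\<ominus> z" "card (carrier R)"] by simp_all
  obtain u v where uv: "x = (u, v)" by fastforce
  obtain u' v' where uv': "y = (u', v')" by fastforce
  have mem: "u \<in> carrier P" "v \<in> carrier P" "u' \<in> carrier P" "v' \<in> carrier P"
    and dg: "deg R u \<le> d" "deg R v \<le> d" "deg R u' \<le> d" "deg R v' \<le> d"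
    using Cons.prems uv uv' low_degD by auto
  obtain A where A: "A = comb g w xs" "A \<in> carrier P" using comb_closed[of g w xs d] g w Cons.prems by auto
  obtain B where B: "B = comb g w ys" "B \<in> carrier P" using comb_closed[of g w ys d] g w Cons.prems by auto
  have eq: "(u \<oplus>\<^bsub>P\<^esub> v \<otimes>\<^bsub>P\<^esub> g) \<oplus>\<^bsub>P\<^esub> w \<otimes>\<^bsub>P\<^esub> A = (u' \<oplus>\<^bsub>P\<^esub> v' \<otimes>\<^bsub>P\<^esub> g) \<oplus>\<^bsub>P\<^esub> w \<otimes>\<^bsub>P\<^esub> B"
    using Cons.prems uv uv' g A B by simp
  note [simp] = mem g(2) w(1) A(2) B(2)
  have "(u \<ominus>\<^bsub>P\<^esub> u') \<oplus>\<^bsub>P\<^esub> (v \<ominus>\<^bsub>P\<^esub> v') \<otimes>\<^bsub>P\<^esub> g =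
      ((u \<oplus>\<^bsub>P\<^esub> v \<otimes>\<^bsub>P\<^esub> g) \<oplus>\<^bsub>P\<^esub> w \<otimes>\<^bsub>P\<^esub> A) \<ominus>\<^bsub>P\<^esub> (u' \<oplus>\<^bsub>P\<^esub> v' \<otimes>\<^bsub>P\<^esub> g) \<ominus>\<^bsub>P\<^esub> w \<otimes>\<^bsub>P\<^esub> A"
    by (rule P.ring_eqI, (rule P.reify)+, simp_all)
  also have "\<dots> = w \<otimes>\<^bsub>P\<^esub> (B \<ominus>\<^bsub>P\<^esub> A)"
    unfolding eq by (rule P.ring_eqI, (rule P.reify)+, simp_all)
  finally have e: "(u \<ominus>\<^bsub>P\<^esub> u') \<oplus>\<^bsub>P\<^esub> (v \<ominus>\<^bsub>P\<^esub> v') \<otimes>\<^bsub>P\<^esub> g = w \<otimes>\<^bsub>P\<^esub> (B \<ominus>\<^bsub>P\<^esub> A)" .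
  have "deg R (u \<ominus>\<^bsub>P\<^esub> u') \<le> d" "deg R (v \<ominus>\<^bsub>P\<^esub> v') \<le> d"
    using deg_add[of u "\<ominus>\<^bsub>P\<^esub> u'"] deg_add[of v "\<ominus>\<^bsub>P\<^esub> v'"] dg by (simp_all add: a_minus_def)
  then have "u \<ominus>\<^bsub>P\<^esub> u' = \<zero>\<^bsub>P\<^esub> \<and> v \<ominus>\<^bsub>P\<^esub> v' = \<zero>\<^bsub>P\<^esub>"
    using stepanov_independent[OF f z q, of "u \<ominus>\<^bsub>P\<^esub> u'" "v \<ominus>\<^bsub>P\<^esub> v'" "B \<ominus>\<^bsub>P\<^esub> A"] e g unfolding w_def by simp
  then have uv_eq: "u = u'" "v = v'" by simp_all
  then have "w \<otimes>\<^bsub>P\<^esub> (B \<ominus>\<^bsub>P\<^esub> A) = \<zero>\<^bsub>P\<^esub>" using e by (simp add: P.r_neg a_minus_def)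
  then have "B = A" using UP_integral[of w "B \<ominus>\<^bsub>P\<^esub> A"] w by simp
  then have "comb g w xs = comb g w ys" using A B by simp
  then have "xs = ys" by (intro Cons.IH) (use Cons.prems g(1) in simp_all)
  then show ?case using uv uv' uv_eq by simp
qed simp

text \<open>There are q^(2 (d + 1) J) lists of J pairs, and the hypothesis on the sum says that
  fewer tuples of weighted Taylor functions on the level set are available. Two lists collide; the
  difference of their auxiliary polynomials is non-zero by \<open>comb_inj\<close>, vanishes to
  order l on the level set, and has degree at most the right-hand side. The bound l \<le> q makes
  every order k < l admissible in \<open>coeff_comb_polyfun\<close>.\<close>

lemma stepanov_count:
  assumes f: "f \<in> carrier P" "deg R f \<le> 4" "\<not> square_multiple f"
    and z: "z \<in> carrier R" "value_at f z \<noteq> \<zero>"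
    and q: "primepow (card (carrier R))" "card (carrier R) = 2 * c + 1" "2 * d + 4 < card (carrier R)"
    and a: "a \<in> carrier R" "a \<noteq> \<zero>" and c: "c > 0"
    and l: "l \<le> card (carrier R)" "(\<Sum>k<l. J + d + 4 * k + 1) < 2 * (d + 1) * J"
  shows "l * card {x \<in> carrier R. value_at f x [^] c = a} \<le> d + 4 * c + card (carrier R) * J"
proof -
  let ?q = "card (carrier R)"
  define S where "S = {x \<in> carrier R. value_at f x [^] c = a}"
  have S: "S \<subseteq> carrier R" "finite S" unfolding S_def using finite_carrier by auto
  define w where "w = (indet \<oplus>\<^bsub>P\<^esub> const (\<ominus> z)) [^]\<^bsub>P\<^esub> ?q"
  have w: "w \<in> carrier P" "deg R w \<le> ?q" unfolding w_def using z deg_linear_pow(1)[of "\<ominus> z" ?q] by auto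
  define g where "g = f [^]\<^bsub>P\<^esub> c"
  have g: "g \<in> carrier P" unfolding g_def using f by simp
  have dg: "deg R g \<le> 4 * c"
  proof -
    have "deg R (f [^]\<^bsub>P\<^esub> n) \<le> 4 * n" for n :: nat
    proof (induction n)
      case (Suc n)
      then show ?case using deg_mult_ring[of "f [^]\<^bsub>P\<^esub> n" f] f by simp
    qed simp
    then show ?thesis unfolding g_def .
  qed
  define M where "M = {xs. set xs \<subseteq> low_deg d \<times> low_deg d \<and> length xs = J}"
  have M: "finite M" "card M = ?q ^ (2 * (d + 1) * J)"
    unfolding M_def using card_low_deg[of d]
    by (simp_all add: finite_lists_length_eq card_lists_length_eq card_cartesian_product
        power_add[symmetric] power_mult[symmetric] del: power_Suc)
       (intro arg_cong2[where f = power] refl, simp)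
  define Bk where "Bk k = {restrict h S | h. polyfun R (J + d + 4 * k) h}" for k
  have Bk: "finite (Bk k)" "card (Bk k) \<le> ?q ^ (J + d + 4 * k + 1)" for k
    unfolding Bk_def using R.card_restrict_polyfun[OF finite_carrier S(1), of "J + d + 4 * k"] by auto
  define Phi where "Phi xs = (\<lambda>k\<in>{..<l}. restrict (\<lambda>x. value_at f x [^] k \<otimes> coeff P (shift x (comb g w xs)) k) S)" for xs
  have "Phi ` M \<subseteq> Pi\<^sub>E {..<l} Bk"
  proof
    fix y assume "y \<in> Phi ` M"
    then obtain xs where xs: "xs \<in> M" "y = Phi xs" by blast
    show "y \<in> Pi\<^sub>E {..<l} Bk"
    proof (rule PiE_I)
      fix k assume k: "k \<in> {..<l}"
      then have k': "k < ?q" using l(1) by simp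
      obtain h where h: "polyfun R (J + d + 4 * k) h"
        "\<And>x. x \<in> S \<Longrightarrow> value_at f x [^] k \<otimes> coeff P (shift x (comb g w xs)) k = h x"
        using coeff_comb_polyfun[OF f(1,2) z(1) q(1) k' S(1), of c a xs d] a xs(1)
        unfolding M_def w_def[symmetric] g_def[symmetric] by (auto simp: S_def)
      have "y k = restrict h S"
        using k h(2) unfolding xs(2) Phi_def by (auto simp: restrict_def)
      then show "y k \<in> Bk k" using h(1) unfolding Bk_def by blast
    qed (simp add: xs(2) Phi_def)
  qed
  moreover have finP: "finite (Pi\<^sub>E {..<l} Bk)" using Bk by (intro finite_PiE) auto
  moreover have "card (Pi\<^sub>E {..<l} Bk) < card M"
  proof -
    have "card (Pi\<^sub>E {..<l} Bk) = (\<Prod>k<l. card (Bk k))" by (simp add: card_PiE)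
    also have "\<dots> \<le> (\<Prod>k<l. ?q ^ (J + d + 4 * k + 1))" by (rule prod_mono) (use Bk in auto)
    also have "\<dots> = ?q ^ (\<Sum>k<l. J + d + 4 * k + 1)" by (simp add: power_sum)
    also have "\<dots> < card M"
      unfolding M(2) using l(2) card_carrier_ge_2 by (intro power_strict_increasing) auto
    finally show ?thesis .
  qed
  ultimately have "card (Phi ` M) < card M" by (meson card_mono le_less_trans)
  then have "\<not> inj_on Phi M" using card_image[of Phi M] by auto
  then obtain xs ys where xy: "xs \<in> M" "ys \<in> M" "xs \<noteq> ys" "Phi xs = Phi ys" unfolding inj_on_def by blast
  have cc: "comb g w xs \<in> carrier P" "comb g w ys \<in> carrier P"
    using comb_closed[OF g w(1)] xy unfolding M_def by auto
  define r where "r = comb g w xs \<ominus>\<^bsub>P\<^esub> comb g w ys"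
  have r: "r \<in> carrier P" unfolding r_def using cc by simp
  have "r \<noteq> \<zero>\<^bsub>P\<^esub>"
  proof
    assume "r = \<zero>\<^bsub>P\<^esub>"
    then have "comb g w xs = comb g w ys" unfolding r_def using cc by simp
    then have "xs = ys"
      using comb_inj[OF f z q, of xs ys] xy unfolding M_def g_def w_def by simp
    with xy show False by blast
  qed
  moreover have "coeff P (shift x r) k = \<zero>" if "x \<in> S" "k < l" for x k
  proof -
    have x: "x \<in> carrier R" using that S by auto
    let ?F = "value_at f x"
    have F: "?F \<in> carrier R" using f x by simp
    \<comment> \<open>On \<open>S\<close> the value f(x) is non-zero because f(x)^c = a with c > 0,
      so the weight can be cancelled.\<close>
    have "?F \<noteq> \<zero>" using that a c unfolding S_def by (auto simp: nat_pow_zero)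
    then have Fk: "?F [^] k \<noteq> \<zero>" using R.pow_eq_zeroD F by blast
    have "?F [^] k \<otimes> coeff P (shift x (comb g w xs)) k = ?F [^] k \<otimes> coeff P (shift x (comb g w ys)) k"
      using fun_cong[OF fun_cong[OF xy(4)], of k x] that unfolding Phi_def by simp
    then have "coeff P (shift x (comb g w xs)) k = coeff P (shift x (comb g w ys)) k"
      using Fk F x cc by (simp add: R.m_lcancel)
    then show ?thesis unfolding r_def using cc x by (simp add: shift_minus)
  qed
  ultimately have "l * card S \<le> deg R r"
    using sum_multiplicities_le_deg[OF S(2) S(1) r] by blast
  also have "deg R r \<le> d + 4 * c + ?q * J"
    using deg_add[of "comb g w xs" "\<ominus>\<^bsub>P\<^esub> comb g w ys"] cc
      deg_comb[OF g dg w, of xs d] deg_comb[OF g dg w, of ys d] xy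
    unfolding r_def M_def by (simp add: a_minus_def)
  finally show ?thesis unfolding S_def .
qed

end

section \<open>Quadratic character sums\<close>

context finite_field
begin

abbreviation eta :: "'a \<Rightarrow> int" where "eta \<equiv> quad_char R (carrier R)"

lemma abs_eta_le: "\<bar>eta x\<bar> \<le> 1"
  by (simp add: quad_char_def)

lemma card_sqrt:
  assumes q: "odd (card (carrier R))" and x: "x \<in> carrier R"
  shows "int (card {y \<in> carrier R. y \<otimes> y = x}) = 1 + eta x"
proof (cases "x = \<zero>")
  case True
  have "{y \<in> carrier R. y \<otimes> y = x} = {\<zero>}" using True integral by auto
  then show ?thesis using True by (simp add: quad_char_def)
next
  case False
  from q obtain c where c: "card (carrier R) - 1 = 2 * c" by (elim oddE) simp
  have s: "{y \<in> carrier R. y \<otimes> y = x} = {y \<in> carrier R. y [^] (2::nat) = x}"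
    by (auto simp: numeral_2_eq_2)
  have card: "card {y \<in> carrier R. y \<otimes> y = x} = (if x [^] c = \<one> then 2 else 0)"
    unfolding s by (rule card_pow_fibre[OF c x False])
  show ?thesis
  proof (cases "x [^] c = \<one>")
    case True
    then have "{y \<in> carrier R. y \<otimes> y = x} \<noteq> {}" using card by (intro notI) simp
    then have "\<exists>y\<in>carrier R. x = y \<otimes> y" by blast
    then show ?thesis using True False card by (simp add: quad_char_def)
  next
    case 2: False
    then have "{y \<in> carrier R. y \<otimes> y = x} = {}" using card finite_carrier by simp
    then have "\<not> (\<exists>y\<in>carrier R. x = y \<otimes> y)" by blast
    then show ?thesis using 2 False card by (simp add: quad_char_def)
  qed
qed

text \<open>In odd order the element 1 has two square roots by \<open>card_sqrt\<close>; if 1 = -1,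
  then y^2 - 1 = (y - 1)^2 leaves only one.\<close>

lemma one_neq_minus_one:
  assumes q: "odd (card (carrier R))"
  shows "\<one> \<noteq> \<ominus> \<one>"
proof
  assume e: "\<one> = \<ominus> \<one>"
  have "int (card {y \<in> carrier R. y \<otimes> y = \<one>}) = 2"
    using card_sqrt[OF q one_closed] by (auto simp: quad_char_def intro!: bexI[of _ \<one>])
  moreover have "{y \<in> carrier R. y \<otimes> y = \<one>} \<subseteq> {\<one>}"
  proof safe
    fix y assume y: "y \<in> carrier R" "y \<otimes> y = \<one>"
    have "(y \<ominus> \<one>) \<otimes> (y \<oplus> \<one>) = y \<otimes> y \<ominus> \<one>"
      using y(1) by - (rule ring_eqI, (rule reify)+, simp_all)
    then have "(y \<ominus> \<one>) \<otimes> (y \<oplus> \<one>) = \<zero>" using y by simp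
    then have "y \<ominus> \<one> = \<zero> \<or> y \<oplus> \<one> = \<zero>" 
      using integral[of "y \<ominus> \<one>" "y \<oplus> \<one>"] y by auto
    moreover have "y \<oplus> \<one> = y \<ominus> \<one>" using e by (simp add: a_minus_def)
    ultimately show "y = \<one>" using y by simp
  qed
  then have "card {y \<in> carrier R. y \<otimes> y = \<one>} \<le> card {\<one>}" by (intro card_mono) auto
  ultimately show False by simp
qed

lemma euler_criterion:
  assumes q: "card (carrier R) = 2 * c + 1" and x: "x \<in> carrier R" "x \<noteq> \<zero>"
  shows "eta x = 1 \<longleftrightarrow> x [^] c = \<one>" "eta x = - 1 \<longleftrightarrow> x [^] c = \<ominus> \<one>"
proof -
  have odd: "odd (card (carrier R))" using q by simp
  have s: "{y \<in> carrier R. y \<otimes> y = x} = {y \<in> carrier R. y [^] (2::nat) = x}"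
    by (auto simp: numeral_2_eq_2)
  have card: "card {y \<in> carrier R. y \<otimes> y = x} = (if x [^] c = \<one> then 2 else 0)"
    unfolding s by (rule card_pow_fibre) (use q x in auto)
  then show 1: "eta x = 1 \<longleftrightarrow> x [^] c = \<one>"
    using card_sqrt[OF odd x(1)] by (auto split: if_splits)
  have xc: "x [^] c \<in> carrier R" using x by simp
  obtain y where y: "y = x [^] c" "y \<in> carrier R" using x by simp
  have "(y \<ominus> \<one>) \<otimes> (y \<oplus> \<one>) = y \<otimes> y \<ominus> \<one>"
    using y(2) by - (rule ring_eqI, (rule reify)+, simp_all)
  also have "y \<otimes> y = x [^] (card (carrier R) - 1)"
    unfolding y(1) q using x by (simp add: nat_pow_mult mult_2)
  also have "\<dots> = \<one>" using pow_card_minus_1 x by simp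
  finally have "(y \<ominus> \<one>) \<otimes> (y \<oplus> \<one>) = \<zero>" by simp
  then have "y \<ominus> \<one> = \<zero> \<or> y \<oplus> \<one> = \<zero>" 
    using integral[of "y \<ominus> \<one>" "y \<oplus> \<one>"] y by auto
  then have "y = \<one> \<or> y = \<ominus> \<one>" using y minus_equality[of y \<one>] by auto
  moreover have "eta x = 1 \<or> eta x = - 1" using x by (simp add: quad_char_def)
  ultimately show "eta x = - 1 \<longleftrightarrow> x [^] c = \<ominus> \<one>"
    using 1 one_neq_minus_one[OF odd] y(1) by auto
qed

text \<open>The relation f = b (q0 + q1 x + q2 x^2)^2 coefficient by coefficient, with the sums left
  in convolution order. As in \<open>square_multiple\<close>, b need not be a square.\<close>

definition quartic_square :: "'a \<Rightarrow> 'a \<Rightarrow> 'a \<Rightarrow> 'a \<Rightarrow> 'a \<Rightarrow> bool" where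
  "quartic_square a0 a1 a2 a3 a4 \<longleftrightarrow> (\<exists>b\<in>carrier R. \<exists>q0\<in>carrier R. \<exists>q1\<in>carrier R. \<exists>q2\<in>carrier R.
      a0 = b \<otimes> (q0 \<otimes> q0) \<and> a1 = b \<otimes> (q1 \<otimes> q0 \<oplus> q0 \<otimes> q1) \<and>
      a2 = b \<otimes> (q2 \<otimes> q0 \<oplus> (q1 \<otimes> q1 \<oplus> q0 \<otimes> q2)) \<and> a3 = b \<otimes> (q2 \<otimes> q1 \<oplus> q1 \<otimes> q2) \<and>
      a4 = b \<otimes> (q2 \<otimes> q2))"

text \<open>Stepanov's bound with explicit parameters. The assumption q \<ge> 16 guarantees a point
  where f does not vanish and makes the rounding of the square root of q harmless.\<close>

lemma quartic_value_count:
  assumes a: "a0 \<in> carrier R" "a1 \<in> carrier R" "a2 \<in> carrier R" "a3 \<in> carrier R" "a4 \<in> carrier R" "a4 \<noteq> \<zero>"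
    and nonsq: "\<not> quartic_square a0 a1 a2 a3 a4"
    and q: "primepow (card (carrier R))" "card (carrier R) = 2 * c + 1" "card (carrier R) \<ge> 16"
  defines "F \<equiv> \<lambda>x. a0 \<oplus> x \<otimes> (a1 \<oplus> x \<otimes> (a2 \<oplus> x \<otimes> (a3 \<oplus> x \<otimes> a4)))"
  shows "card {x \<in> carrier R. F x = \<zero>} \<le> 4"
    "e \<in> carrier R \<Longrightarrow> e \<noteq> \<zero> \<Longrightarrow>
      real (card {x \<in> carrier R. F x [^] c = e}) \<le> real (card (carrier R)) / 2 + 14 * sqrt (real (card (carrier R)))"
proof -
  interpret UP_finite_field R "UP R" by unfold_locales
  let ?P = "UP R"
  let ?q = "card (carrier R)"
  define f3 where "f3 = const a3 \<oplus>\<^bsub>?P\<^esub> indet \<otimes>\<^bsub>?P\<^esub> const a4"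
  define f2 where "f2 = const a2 \<oplus>\<^bsub>?P\<^esub> indet \<otimes>\<^bsub>?P\<^esub> f3"
  define f1 where "f1 = const a1 \<oplus>\<^bsub>?P\<^esub> indet \<otimes>\<^bsub>?P\<^esub> f2"
  define f where "f = const a0 \<oplus>\<^bsub>?P\<^esub> indet \<otimes>\<^bsub>?P\<^esub> f1"
  have f3: "f3 \<in> carrier ?P" unfolding f3_def using a by simp
  have f2: "f2 \<in> carrier ?P" unfolding f2_def using a f3 by simp
  have f1: "f1 \<in> carrier ?P" unfolding f1_def using a f2 by simp
  have f: "f \<in> carrier ?P" unfolding f_def using a f1 by simp
  have val: "value_at f x = F x" if x: "x \<in> carrier R" for x
    unfolding f_def f1_def f2_def f3_def F_def using a x f1 f2 f3
    by (simp add: value_at_horner value_at_const)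
  have co: "coeff ?P f k = (if k = 0 then a0 else if k = 1 then a1 else if k = 2 then a2
      else if k = 3 then a3 else if k = 4 then a4 else \<zero>)" for k
    unfolding f_def f1_def f2_def f3_def using a f1 f2 f3
    by (auto simp: coeff_const coeff_indet_mult numeral_eq_Suc simp del: coeff_mult)
  have deg: "deg R f = 4"
    by (rule le_antisym[OF deg_aboveI deg_belowI]) (use f a in \<open>auto simp: co\<close>)
  have f0: "f \<noteq> \<zero>\<^bsub>?P\<^esub>" using deg by auto
  have nsq: "\<not> square_multiple f"
  proof
    assume "square_multiple f"
    then obtain b Q where bQ: "b \<in> carrier R" "Q \<in> carrier ?P" "f = const b \<otimes>\<^bsub>?P\<^esub> (Q \<otimes>\<^bsub>?P\<^esub> Q)"
      unfolding square_multiple_def by blast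
    have nz: "const b \<noteq> \<zero>\<^bsub>?P\<^esub>" "Q \<noteq> \<zero>\<^bsub>?P\<^esub>" using f0 bQ by auto
    have "deg R f = deg R (const b) + (deg R Q + deg R Q)"
    proof -
      have QQ: "Q \<otimes>\<^bsub>?P\<^esub> Q \<noteq> \<zero>\<^bsub>?P\<^esub>" using bQ nz UP_integral[of Q Q] by blast
      have "deg R (const b \<otimes>\<^bsub>?P\<^esub> (Q \<otimes>\<^bsub>?P\<^esub> Q)) = deg R (const b) + deg R (Q \<otimes>\<^bsub>?P\<^esub> Q)"
        by (rule deg_mult) (use bQ nz QQ in auto)
      also have "deg R (Q \<otimes>\<^bsub>?P\<^esub> Q) = deg R Q + deg R Q"
        by (rule deg_mult) (use bQ nz in auto)
      finally show ?thesis unfolding bQ(3) .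
    qed
    \<comment> \<open>Degree four of f leaves degree two for \<open>Q\<close>, so comparing five
      coefficients yields exactly \<open>quartic_square\<close>.\<close>
    then have "deg R Q = 2" using deg bQ(1) by (simp add: const_def)
    then have Q0: "coeff ?P Q k = \<zero>" if "k > 2" for k using that bQ by (simp add: deg_aboveD)
    define u where "u = coeff ?P Q"
    have u: "u k \<in> carrier R" for k unfolding u_def using bQ by simp
    have u0: "u (Suc (Suc (Suc k))) = \<zero>" for k unfolding u_def by (rule Q0) simp
    have cf: "coeff ?P f k = b \<otimes> (\<Oplus>i\<in>{..k}. u i \<otimes> u (k - i))" for k
      unfolding bQ(3) u_def using bQ by (subst coeff_const_mult) auto
      have "a0 = b \<otimes> (u 0 \<otimes> u 0)" using cf[of 0] co[of 0] u by simp
      moreover have "a1 = b \<otimes> (u 1 \<otimes> u 0 \<oplus> u 0 \<otimes> u 1)" using cf[of 1] co[of 1] u bQ(1) by simp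
      moreover have "a2 = b \<otimes> (u 2 \<otimes> u 0 \<oplus> (u 1 \<otimes> u 1 \<oplus> u 0 \<otimes> u 2))" using cf[of 2] co[of 2] u bQ(1)
        by (simp add: numeral_eq_Suc)
      moreover have "a3 = b \<otimes> (u 2 \<otimes> u 1 \<oplus> u 1 \<otimes> u 2)" using cf[of 3] co[of 3] u bQ(1)
        by (simp add: numeral_eq_Suc u0)
      moreover have "a4 = b \<otimes> (u 2 \<otimes> u 2)" using cf[of 4] co[of 4] u bQ(1)
        by (simp add: numeral_eq_Suc u0)
      ultimately show False
        using nonsq u[of 0] u[of 1] u[of 2] bQ(1) unfolding quartic_square_def by blast
  qed
  have Z: "{x \<in> carrier R. F x = \<zero>} = {x \<in> carrier R. value_at f x = \<zero>}" using val by auto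
  have "1 * card {x \<in> carrier R. value_at f x = \<zero>} \<le> deg R f"
    by (rule sum_multiplicities_le_deg[OF _ _ f f0]) (use finite_carrier in auto)
  then show z4: "card {x \<in> carrier R. F x = \<zero>} \<le> 4" unfolding Z deg by simp
  have "\<exists>z\<in>carrier R. value_at f z \<noteq> \<zero>"
  proof (rule ccontr)
    assume "\<not> ?thesis"
    then have "{x \<in> carrier R. F x = \<zero>} = carrier R" unfolding Z by blast
    with z4 q(3) show False by simp
  qed
  then obtain z where z: "z \<in> carrier R" "value_at f z \<noteq> \<zero>" by blast
  assume e: "e \<in> carrier R" "e \<noteq> \<zero>"
  \<comment> \<open>The order of vanishing will be 2h, about sqrt q, which balances the number of
    conditions against the error term.\<close>
  define h where "h = nat \<lfloor>sqrt (real ?q) / 2\<rfloor>"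
  define s where "s = sqrt (real ?q)"
  have s: "s * s = real ?q" "s \<ge> 4"
    unfolding s_def using q(3) real_le_rsqrt[of 4 "real ?q"] by auto
  have h: "real h \<le> s / 2" "s / 2 < real h + 1" 
  proof -
    have "real h = of_int \<lfloor>s / 2\<rfloor>" unfolding h_def s_def by simp
    then show "real h \<le> s / 2" "s / 2 < real h + 1" by linarith+
  qed
  have h4: "4 * h * h \<le> ?q"
  proof -
    have "real h * real h \<le> (s / 2) * (s / 2)" by (rule mult_mono) (use h s in auto)
    then have "real (4 * h * h) \<le> real ?q" using s by simp
    then show ?thesis by (simp only: of_nat_le_iff)
  qed
  \<comment> \<open>\<open>d = c - 2\<close> is the largest degree with 2d + 4 < q. Between
    parameters and conditions the terms 2h (d + 1) cancel; the summand 4 of \<open>J\<close> leaves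
    8 (d + 1), about 4q, against 10 h^2 + 4h with h^2 \<le> q/4. Half of this inequality is
    \<open>key\<close>.\<close>
  define J where "J = h + 4"
  define d where "d = c - 2"
  have c: "c \<ge> 7" "d + 2 = c" using q unfolding d_def by auto
  have key: "5 * h * h + 2 * h < 4 * c - 4"
  proof -
    have "real h * real h * 4 \<le> real ?q" 
    proof -
      have "real (4 * h * h) \<le> real ?q" using h4 by (simp only: of_nat_le_iff)
      then show ?thesis by simp
    qed
    moreover have "s * 4 \<le> s * s" using s by (intro mult_left_mono) auto
    ultimately have "5 * (real h * real h) + 2 * real h < 2 * real ?q - 6"
      using h s by linarith
    then have "5 * (real h * real h) + 2 * real h < 4 * real c - 4" using q(2) by simp
    then have "real (5 * h * h + 2 * h) < real (4 * c - 4)" using c by (simp add: of_nat_diff)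
    then show ?thesis by (simp only: of_nat_less_iff)
  qed
  \<comment> \<open>The number of conditions is l (J + d + 1) + 2l (l - 1); moving 2l to the left
    avoids truncated subtraction.\<close>
  have sum: "(\<Sum>k<l. J + d + 4 * k + 1) + 2 * l = l * (J + d + 1) + 2 * l * l" for l
    by (induction l) (auto simp: algebra_simps)
  have l2: "(\<Sum>k<2 * h. J + d + 4 * k + 1) < 2 * (d + 1) * J"
  proof -
    have "c \<ge> 1" using c by simp
    then obtain c' where c': "c = Suc c'" by (cases c) auto
    have d1: "d + 1 = c'" using c c' by simp
    have "(\<Sum>k<2 * h. J + d + 4 * k + 1) + 4 * h = 2 * h * (J + c') + 8 * h * h"
      using sum[of "2 * h"] unfolding d1[symmetric] by (simp add: algebra_simps)
    moreover have "2 * h * (J + c') + 8 * h * h < 2 * c' * J + 4 * h"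
      using key unfolding J_def c' by (simp add: algebra_simps)
    ultimately show ?thesis unfolding d1 by (simp add: algebra_simps)
  qed
  have lq: "2 * h \<le> ?q" using h4 by (cases h) auto
  have "2 * h * card {x \<in> carrier R. value_at f x [^] c = e} \<le> d + 4 * c + ?q * J"
    by (rule stepanov_count[OF f _ nsq z q(1,2)]) (use deg e c lq l2 q in auto)
  moreover have "{x \<in> carrier R. value_at f x [^] c = e} = {x \<in> carrier R. F x [^] c = e}"
    using val by auto
  ultimately have "2 * h * card {x \<in> carrier R. F x [^] c = e} \<le> d + 4 * c + ?q * J" by simp
  also have "\<dots> \<le> 7 * ?q + ?q * h" using c q(2) unfolding J_def by (simp add: algebra_simps)
  finally have "real (2 * h * card {x \<in> carrier R. F x [^] c = e}) \<le> real (7 * ?q + ?q * h)"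
    by (simp only: of_nat_le_iff)
  then have main: "2 * real h * real (card {x \<in> carrier R. F x [^] c = e}) \<le> 7 * (s * s) + s * s * real h"
    by (simp add: s(1))
  show "real (card {x \<in> carrier R. F x [^] c = e}) \<le> real ?q / 2 + 14 * sqrt (real ?q)"
  proof -
    define N where "N = real (card {x \<in> carrier R. F x [^] c = e})"
    \<comment> \<open>From h > s/2 - 1 and s \<ge> 4 follows s \<le> 4h, which turns 7q / (2h) into
      at most 14 sqrt q.\<close>
    have h0: "real h > 0" "s \<le> 4 * real h" using h s by linarith+
    have "7 * (s * s) \<le> 7 * (s * (4 * real h))"
      using h0(2) s(2) by (intro mult_left_mono) auto
    then have "(2 * real h) * N \<le> (2 * real h) * (s * s / 2 + 14 * s)"
      using main unfolding N_def by (simp add: algebra_simps)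
    then have "N \<le> s * s / 2 + 14 * s"
      using h0(1) by (subst (asm) mult_le_cancel_left_pos) auto
    then show ?thesis unfolding N_def s(1) unfolding s_def .
  qed
qed

text \<open>Upper bounds for the two non-zero values suffice, as all three values together occur q
  times: the sum is 2 N1 - q + N0 \<le> 28 sqrt q + 4, symmetrically for the other sign, and 4 \<le>
  sqrt q. For q < 16 the trivial bound q \<le> 4 sqrt q does.\<close>

theorem quartic_char_sum:
  assumes a: "a0 \<in> carrier R" "a1 \<in> carrier R" "a2 \<in> carrier R" "a3 \<in> carrier R" "a4 \<in> carrier R" "a4 \<noteq> \<zero>"
    and nonsq: "\<not> quartic_square a0 a1 a2 a3 a4"
    and q: "primepow (card (carrier R))" "odd (card (carrier R))"
  shows "\<bar>real_of_int (\<Sum>x\<in>carrier R. eta (a0 \<oplus> x \<otimes> (a1 \<oplus> x \<otimes> (a2 \<oplus> x \<otimes> (a3 \<oplus> x \<otimes> a4)))))\<bar>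
    \<le> 29 * sqrt (real (card (carrier R)))"
proof -
  let ?q = "card (carrier R)"
  define F where "F = (\<lambda>x. a0 \<oplus> x \<otimes> (a1 \<oplus> x \<otimes> (a2 \<oplus> x \<otimes> (a3 \<oplus> x \<otimes> a4))))"
  define s where "s = sqrt (real ?q)"
  have s: "s * s = real ?q" "s \<ge> 0" unfolding s_def by auto
  have "\<bar>real_of_int (\<Sum>x\<in>carrier R. eta (F x))\<bar> \<le> 29 * s"
  proof (cases "?q \<ge> 16")
    case False
    have "\<bar>\<Sum>x\<in>carrier R. eta (F x)\<bar> \<le> (\<Sum>x\<in>carrier R. \<bar>eta (F x)\<bar>)" by (rule sum_abs)
    also have "\<dots> \<le> (\<Sum>x\<in>carrier R. 1)" by (rule sum_mono) (rule abs_eta_le)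
    finally have "\<bar>real_of_int (\<Sum>x\<in>carrier R. eta (F x))\<bar> \<le> s * s"
      unfolding s by (simp del: of_int_sum flip: of_int_abs)
    also have "s \<le> sqrt 16" unfolding s_def using False by (intro real_sqrt_le_mono) simp
    then have "s \<le> 4" by simp
    then have "s * s \<le> 29 * s" using s(2) by (intro mult_right_mono) auto
    finally show ?thesis .
  next
    case True
    from q(2) obtain c where c: "?q = 2 * c + 1" by (elim oddE)
    have s4: "s \<ge> 4" unfolding s_def using True real_le_rsqrt[of 4 "real ?q"] by auto
    have FR: "F x \<in> carrier R" if "x \<in> carrier R" for x unfolding F_def using a that by simp
    have c0: "c > 0" using True c by simp
    note count = quartic_value_count[OF a nonsq q(1) c True, folded F_def]
    define N1 where "N1 = card {x \<in> carrier R. F x [^] c = \<one>}"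
    define N2 where "N2 = card {x \<in> carrier R. F x [^] c = \<ominus> \<one>}"
    define N0 where "N0 = card {x \<in> carrier R. F x = \<zero>}"
    have mo: "\<ominus> \<one> \<noteq> \<zero>" "\<zero> \<noteq> \<ominus> \<one>" by (metis minus_minus minus_zero one_closed one_not_zero)+
    have N: "N0 \<le> 4" "real N1 \<le> s * s / 2 + 14 * s" "real N2 \<le> s * s / 2 + 14 * s"
      unfolding N0_def N1_def N2_def s(1) unfolding s_def F_def
      using count(1) count(2)[OF one_closed one_not_zero] count(2)[OF _ mo(1)] by auto
    have e1: "F x [^] c = \<one> \<longleftrightarrow> eta (F x) = 1" if "x \<in> carrier R" for x
      using euler_criterion(1)[OF c FR[OF that]] c0 by (cases "F x = \<zero>") (auto simp: quad_char_def nat_pow_zero)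
    have e2: "F x [^] c = \<ominus> \<one> \<longleftrightarrow> eta (F x) = - 1" if "x \<in> carrier R" for x
      using euler_criterion(2)[OF c FR[OF that]] c0 mo by (cases "F x = \<zero>") (auto simp: quad_char_def nat_pow_zero)
    have e0: "F x = \<zero> \<longleftrightarrow> eta (F x) = 0" if "x \<in> carrier R" for x
      by (auto simp: quad_char_def)
    have tri: "eta (F x) = 1 \<or> eta (F x) = - 1 \<or> eta (F x) = 0" for x by (auto simp: quad_char_def)
    have sum1: "(\<Sum>x\<in>carrier R. eta (F x)) = int N1 - int N2"
    proof -
      have "(\<Sum>x\<in>carrier R. eta (F x)) = (\<Sum>x\<in>carrier R. of_bool (F x [^] c = \<one>) - of_bool (F x [^] c = \<ominus> \<one>))"
        by (rule sum.cong[OF refl]) (use e1 e2 tri in force)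
      then show ?thesis unfolding N1_def N2_def
        using finite_carrier by (simp add: sum_subtractf sum_of_bool_eq Int_def)
    qed
    have sum2: "int ?q = int N1 + int N2 + int N0"
    proof -
      have "(\<Sum>x\<in>carrier R. 1::int) = (\<Sum>x\<in>carrier R. of_bool (F x [^] c = \<one>) + of_bool (F x [^] c = \<ominus> \<one>) + of_bool (F x = \<zero>))"
        by (rule sum.cong[OF refl]) (use e1 e2 e0 tri in force)
      then show ?thesis unfolding N1_def N2_def N0_def
        using finite_carrier by (simp add: sum.distrib sum_of_bool_eq Int_def)
    qed
    have "real ?q = real N1 + real N2 + real N0" using sum2 by linarith
    moreover have "real N0 \<le> 4" using N(1) by simp
    moreover have "real_of_int (\<Sum>x\<in>carrier R. eta (F x)) = real N1 - real N2" unfolding sum1 by simp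
    ultimately show ?thesis using N(2,3) s(1) s4 by linarith
  qed
  then show ?thesis unfolding F_def s_def .
qed

end

section \<open>Norms and common neighbourhoods\<close>

lemma (in field) inv_nonzero:
  assumes "x \<in> carrier R" "x \<noteq> \<zero>"
  shows "inv x \<in> carrier R" "inv x \<noteq> \<zero>" "x \<otimes> inv x = \<one>" "inv x \<otimes> x = \<one>" "inv (inv x) = x"
proof -
  have u: "x \<in> Units R" using assms by (simp add: field_Units)
  then show "inv x \<in> carrier R" "x \<otimes> inv x = \<one>" "inv x \<otimes> x = \<one>" "inv (inv x) = x" by simp_all
  show "inv x \<noteq> \<zero>" using Units_inv_Units[OF u] by (auto simp: field_Units)
qed

lemma (in field) m_lcancel_iff:
  "a \<in> carrier R \<Longrightarrow> a \<noteq> \<zero> \<Longrightarrow> b \<in> carrier R \<Longrightarrow> c \<in> carrier R \<Longrightarrow> a \<otimes> b = a \<otimes> c \<longleftrightarrow> b = c"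
  by (simp add: m_lcancel)

lemma (in field) eq_div_iff:
  assumes "a \<in> carrier R" "a \<noteq> \<zero>" "x \<in> carrier R" "b \<in> carrier R"
  shows "x \<otimes> a = b \<longleftrightarrow> x = b \<otimes> inv a"
proof -
  obtain i where i: "inv a = i" "i \<in> carrier R" "a \<otimes> i = \<one>" using inv_nonzero[OF assms(1,2)] by blast
  have "x \<otimes> a \<otimes> i = x" using assms i by (simp add: m_assoc)
  moreover have "b \<otimes> i \<otimes> a = b" using assms i by (simp add: m_assoc m_comm[of i a])
  ultimately show ?thesis unfolding i(1) by auto
qed

context finite_field
begin

lemma affine_bij:
  assumes a: "a \<in> carrier R" "a \<noteq> \<zero>" and b: "b \<in> carrier R"
  shows "bij_betw (\<lambda>x. a \<otimes> x \<oplus> b) (carrier R) (carrier R)"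
proof -
  have "inj_on (\<lambda>x. a \<otimes> x \<oplus> b) (carrier R)"
    by (rule inj_onI) (use a b in \<open>simp add: m_lcancel\<close>)
  moreover have "(\<lambda>x. a \<otimes> x \<oplus> b) ` carrier R = carrier R"
    by (rule endo_inj_surj[OF finite_carrier _ \<open>inj_on _ _\<close>]) (use a b in auto)
  ultimately show ?thesis unfolding bij_betw_def by blast
qed

lemma card_affine:
  assumes a: "a \<in> carrier R" "a \<noteq> \<zero>" and b: "b \<in> carrier R"
  shows "card {x \<in> carrier R. Q (a \<otimes> x \<oplus> b)} = card {x \<in> carrier R. Q x}"
proof -
  note bij = affine_bij[OF assms]
  have "bij_betw (\<lambda>x. a \<otimes> x \<oplus> b) {x \<in> carrier R. Q (a \<otimes> x \<oplus> b)} {x \<in> carrier R. Q x}"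
  proof (rule bij_betw_imageI)
    show "inj_on (\<lambda>x. a \<otimes> x \<oplus> b) {x \<in> carrier R. Q (a \<otimes> x \<oplus> b)}"
      using bij by (auto simp: bij_betw_def intro: inj_on_subset)
    have "\<exists>x\<in>carrier R. y = a \<otimes> x \<oplus> b" if "y \<in> carrier R" for y
      using bij that by (auto simp: bij_betw_def)
    then show "(\<lambda>x. a \<otimes> x \<oplus> b) ` {x \<in> carrier R. Q (a \<otimes> x \<oplus> b)} = {x \<in> carrier R. Q x}"
      using assms by (auto simp: image_iff)
  qed
  then show ?thesis by (rule bij_betw_same_card)
qed

end

text \<open>Here n = t - 1. Subfield, order and degree are parameters because for n = 4 the locale
  is interpreted a second time, over the intermediate field with order \<open>q * q\<close> and
  degree 2.\<close>

locale norm_ext = finite_field +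
  fixes K :: "'a set" and q n :: nat
  assumes subK: "subfield K R" and cardK: "card K = q" and cardL: "card (carrier R) = q ^ n"
    and n_pos: "n > 0" and pp: "primepow q"
begin

lemma K_carrier: "x \<in> K \<Longrightarrow> x \<in> carrier R"
  using subfieldE(3)[OF subK] by auto

lemma q_ge_2: "q \<ge> 2"
  using pp primepow_gt_Suc_0[of q] by simp

lemma K_closed:
  "\<zero> \<in> K" "\<one> \<in> K" "x \<in> K \<Longrightarrow> y \<in> K \<Longrightarrow> x \<oplus> y \<in> K" "x \<in> K \<Longrightarrow> y \<in> K \<Longrightarrow> x \<otimes> y \<in> K"
  "x \<in> K \<Longrightarrow> \<ominus> x \<in> K" "x \<in> K \<Longrightarrow> y \<in> K \<Longrightarrow> x \<ominus> y \<in> K"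
  "x \<in> K \<Longrightarrow> x \<noteq> \<zero> \<Longrightarrow> inv x \<in> K"
  using subringE[OF subfieldE(1)[OF subK]] subfield_m_inv(1)[OF subK, of x]
  by (auto simp: a_minus_def)

lemma finite_K: "finite K"
  using finite_carrier subfieldE(3)[OF subK] by (rule finite_subset[rotated])

text \<open>The characteristic comes from the order q^n of the large field; it is the prime
  underlying q because it divides a power of that prime.\<close>

lemma frob_char: obtains p k where "prime (p::nat)" "q = p ^ k" "[p] \<cdot> \<one> = \<zero>"
proof -
  obtain p' k' where p': "prime p'" "k' > 0" "q = p' ^ k'"
    using pp unfolding primepow_def by auto
  have c: "card (carrier R) = p' ^ (k' * n)" unfolding cardL p'(3) by (simp add: power_mult)
  then have "primepow (card (carrier R))"
    unfolding primepow_def using p' n_pos by (intro exI[of _ p'] exI[of _ "k' * n"]) auto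
  then obtain p k where p: "prime (p::nat)" "card (carrier R) = p ^ k" "[p] \<cdot> \<one> = \<zero>"
    using primepow_char by blast
  have "k \<noteq> 0" using p(2) card_carrier_ge_2 by (intro notI) simp
  then have "p dvd p' ^ (k' * n)" unfolding c[symmetric] p(2) by simp
  then have "p dvd p'" using p(1) prime_dvd_power_nat by blast
  then have "p = p'" using p(1) p'(1) primes_dvd_imp_eq by blast
  with p p' that show thesis by blast
qed

lemma frob_add:
  "x \<in> carrier R \<Longrightarrow> y \<in> carrier R \<Longrightarrow> (x \<oplus> y) [^] (q ^ i) = x [^] (q ^ i) \<oplus> y [^] (q ^ i)"
  by (rule frob_char) (simp add: power_mult[symmetric] frobenius)

lemma frob_minus:
  "x \<in> carrier R \<Longrightarrow> y \<in> carrier R \<Longrightarrow> (x \<ominus> y) [^] (q ^ i) = x [^] (q ^ i) \<ominus> y [^] (q ^ i)"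
  by (rule frob_char) (simp add: power_mult[symmetric] frobenius_minus)

text \<open>The q - 1 non-zero elements of \<open>K\<close> solve y^(q - 1) = 1, which has at most q
  - 1 solutions, so they are all of them: \<open>K\<close> is the fixed field of the Frobenius
  map.\<close>

lemma K_iff: "x \<in> carrier R \<Longrightarrow> x \<in> K \<longleftrightarrow> x [^] q = x"
proof -
  interpret F: finite_field "R\<lparr>carrier := K\<rparr>" by (rule finite_field_subfield[OF subK])
  have pk: "y [^] q = y" if "y \<in> K" for y
    using F.pow_card[of y] that cardK by (simp add: nat_pow_consistent[symmetric])
  have "K - {\<zero>} \<subseteq> {y \<in> carrier R. y [^] (q - 1) = \<one>}"
  proof
    fix y assume y: "y \<in> K - {\<zero>}"
    then have "y [^] (q - 1) = \<one>"
      using F.pow_card_minus_1[of y] cardK by (simp add: nat_pow_consistent[symmetric])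
    with y show "y \<in> {y \<in> carrier R. y [^] (q - 1) = \<one>}" using K_carrier by auto
  qed
  moreover have "card {y \<in> carrier R. y [^] (q - 1) = \<one>} \<le> card (K - {\<zero>})"
    using card_pow_eq_le[of \<one> "q - 1"] q_ge_2 cardK finite_K K_closed(1) by simp
  ultimately have eq: "K - {\<zero>} = {y \<in> carrier R. y [^] (q - 1) = \<one>}"
    using finite_carrier by (intro card_seteq) auto
  assume x: "x \<in> carrier R"
  have "x \<in> K" if "x [^] q = x" "x \<noteq> \<zero>"
  proof -
    have "x \<otimes> x [^] (q - 1) = x \<otimes> \<one>"
      using that(1) x q_ge_2 by (metis Suc_diff_1 less_le_trans nat_pow_Suc2 pos2 r_one)
    then have "x [^] (q - 1) = \<one>" using x that(2) m_lcancel_iff[of x "x [^] (q - 1)" \<one>] by simp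
    with eq x show ?thesis by auto
  qed
  then show ?thesis using pk K_closed(1) by blast
qed

text \<open>This is (q^n - 1) / (q - 1), so the norm is a single power map and the results on fibres
  of power maps apply to it.\<close>

definition norm_exp :: nat where "norm_exp = (\<Sum>i<n. q ^ i)"

definition nm :: "'a \<Rightarrow> 'a" where "nm x = x [^] norm_exp"

lemma geometric: "(\<Sum>i<k. q ^ i) * (q - 1) + 1 = q ^ k"
proof (induction k)
  case (Suc k)
  obtain r where "q = Suc r" using q_ge_2 by (cases q) auto
  with Suc show ?case by (simp add: algebra_simps)
qed simp

lemma norm_exp: "card (carrier R) - 1 = norm_exp * (q - 1)" "norm_exp > 0"
  using geometric[of n] n_pos q_ge_2 unfolding cardL norm_exp_def
  by (auto intro!: sum_pos)

lemma field_norm_eq: "x \<in> carrier R \<Longrightarrow> field_norm R q (Suc n) x = nm x"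
proof -
  assume x: "x \<in> carrier R"
  have "(\<Otimes>i\<in>{..<k}. x [^] (q ^ i)) = x [^] (\<Sum>i<k. q ^ i)" for k
    by (induction k) (use x in \<open>simp_all add: lessThan_Suc nat_pow_mult m_comm add.commute\<close>)
  then show ?thesis by (simp add: field_norm_def nm_def norm_exp_def)
qed

lemma nm_closed [simp]: "x \<in> carrier R \<Longrightarrow> nm x \<in> carrier R"
  by (simp add: nm_def)

lemma nm_mult: "x \<in> carrier R \<Longrightarrow> y \<in> carrier R \<Longrightarrow> nm (x \<otimes> y) = nm x \<otimes> nm y"
  by (simp add: nm_def nat_pow_distrib)

lemma nm_one [simp]: "nm \<one> = \<one>"
  by (simp add: nm_def)

lemma nm_eq_zero_iff: "x \<in> carrier R \<Longrightarrow> nm x = \<zero> \<longleftrightarrow> x = \<zero>"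
  using pow_eq_zeroD[of x norm_exp] norm_exp(2) by (auto simp: nm_def nat_pow_zero)

lemma nm_in_K: "x \<in> carrier R \<Longrightarrow> nm x \<in> K"
proof (cases "x = \<zero>")
  case True
  then show ?thesis using nm_eq_zero_iff[of x] K_closed(1) by simp
next
  case False
  assume x: "x \<in> carrier R"
  have "nm x [^] (q - 1) = \<one>"
    using pow_card_minus_1[OF x False] x norm_exp(1) by (simp add: nm_def nat_pow_pow)
  then have "nm x [^] Suc (q - 1) = nm x" using x by simp
  then show ?thesis using K_iff[of "nm x"] x q_ge_2 by simp
qed

lemma nm_inv: "x \<in> carrier R \<Longrightarrow> x \<noteq> \<zero> \<Longrightarrow> nm x \<otimes> nm (inv x) = \<one>"
  using nm_mult[of x "inv x"] inv_nonzero[of x] by simp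

lemma card_nm_fibre:
  assumes "b \<in> K" "b \<noteq> \<zero>"
  shows "card {x \<in> carrier R. nm x = b} = norm_exp"
proof -
  have b: "b \<in> carrier R" using assms K_carrier by simp
  have "b \<otimes> b [^] (q - 1) = b \<otimes> \<one>"
    using K_iff[OF b] assms b q_ge_2 by (metis Suc_diff_1 less_le_trans nat_pow_Suc2 pos2 r_one)
  then have "b [^] (q - 1) = \<one>" using b assms m_lcancel_iff[of b "b [^] (q - 1)" \<one>] by simp
  then show ?thesis
    unfolding nm_def using card_pow_fibre[OF norm_exp(1) b assms(2)] by simp
qed

text \<open>For a neighbour \<open>(X, x)\<close> of \<open>(A, a)\<close> the coordinate \<open>x\<close> is determined by \<open>X\<close>, and one
  substitutes \<open>U = 1 / (X + A)\<close>. The value \<open>U = 0\<close> satisfies the equations iff \<open>T\<close> is aligned.\<close>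

lemma ng_deg_eq:
  assumes v: "(A, a) \<in> T" and T: "T \<subseteq> ng_verts R K"
  shows "int (ng_deg R K q (Suc n) T) =
    int (card {U \<in> carrier R. \<forall>(B, b)\<in>T. nm (\<one> \<oplus> (B \<ominus> A) \<otimes> U) \<otimes> a = b}) - xi T"
proof -
  define D where "D = {U \<in> carrier R. \<forall>(B, b)\<in>T. nm (\<one> \<oplus> (B \<ominus> A) \<otimes> U) \<otimes> a = b}"
  define C where "C = (\<Inter>v\<in>T. ng_nbhd R K q (Suc n) v)"
  have T': "B \<in> carrier R" "b \<in> K" "b \<noteq> \<zero>" "b \<in> carrier R" if "(B, b) \<in> T" for B b
    using T that K_carrier unfolding ng_verts_def by auto
  note A = T'[OF v]
  have ia: "inv a \<in> K" "inv a \<in> carrier R" "inv a \<noteq> \<zero>" "a \<otimes> inv a = \<one>"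
    using A K_closed(7) inv_nonzero[of a] by auto
  have C_iff: "(X, x) \<in> C \<longleftrightarrow> X \<in> carrier R \<and> x \<in> K \<and> x \<noteq> \<zero> \<and> (\<forall>(B, b)\<in>T. nm (B \<oplus> X) = b \<otimes> x)" for X x
  proof -
    have "(X, x) \<in> C \<longleftrightarrow> X \<in> carrier R \<and> x \<in> K \<and> x \<noteq> \<zero> \<and> (\<forall>(B, b)\<in>T. field_norm R q (Suc n) (B \<oplus> X) = b \<otimes> x)"
      unfolding C_def ng_nbhd_def ng_verts_def ng_adj_def using v by (auto split: prod.splits)
    also have "\<dots> \<longleftrightarrow> X \<in> carrier R \<and> x \<in> K \<and> x \<noteq> \<zero> \<and> (\<forall>(B, b)\<in>T. nm (B \<oplus> X) = b \<otimes> x)"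
      using T' by (intro conj_cong refl ball_cong) (auto simp: field_norm_eq)
    finally show ?thesis .
  qed
  \<comment> \<open>The inverse substitution X = 1/U - A; the second coordinate is forced by the
    equation at the vertex (A, a).\<close>
  define f where "f U = (inv U \<ominus> A, nm (inv U) \<otimes> inv a)" for U
  define g where "g = (\<lambda>(X :: 'a, x :: 'a). inv (X \<oplus> A))"
  have "bij_betw f (D - {\<zero>}) C"
  proof (rule bij_betw_byWitness[where f' = g])
    have D: "U \<in> carrier R \<and> U \<noteq> \<zero>" if "U \<in> D - {\<zero>}" for U using that unfolding D_def by auto
    show "\<forall>U\<in>D - {\<zero>}. g (f U) = U"
    proof
      fix U assume "U \<in> D - {\<zero>}"
      from D[OF this] inv_nonzero[of U] A(1) show "g (f U) = U"
        unfolding f_def g_def by (simp add: a_minus_def a_assoc l_neg)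
    qed
    have Cx: "X \<in> carrier R \<and> x \<in> carrier R \<and> x \<noteq> \<zero> \<and> X \<oplus> A \<noteq> \<zero> \<and> X \<oplus> A \<in> carrier R \<and> nm (X \<oplus> A) = a \<otimes> x"
      if "(X, x) \<in> C" for X x
    proof -
      have X: "X \<in> carrier R" "x \<in> carrier R" "x \<noteq> \<zero>" "nm (A \<oplus> X) = a \<otimes> x"
        using that v K_carrier unfolding C_iff by auto
      then have "nm (X \<oplus> A) = a \<otimes> x" using A by (simp add: a_comm)
      moreover have "a \<otimes> x \<noteq> \<zero>" using X A integral[of a x] by blast
      ultimately show ?thesis using X A nm_eq_zero_iff[of "X \<oplus> A"] by auto
    qed
    show "\<forall>w\<in>C. f (g w) = w"
    proof safe
      fix X x assume "(X, x) \<in> C"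
      note X = Cx[OF this]
      have "inv (inv (X \<oplus> A)) = X \<oplus> A" using X inv_nonzero[of "X \<oplus> A"] by simp
      moreover have "X \<oplus> A \<ominus> A = X" using X A by (simp add: a_minus_def a_assoc r_neg)
      moreover have "nm (X \<oplus> A) \<otimes> inv a = x"
      proof -
        obtain i where i: "i = inv a" "i \<in> carrier R" using ia(2) by blast
        have "a \<otimes> x \<otimes> i = (a \<otimes> i) \<otimes> x" using X A i(2) by (simp add: m_ac)
        then show ?thesis unfolding i(1) ia(4) using X by simp
      qed
      ultimately show "f (g (X, x)) = (X, x)" unfolding f_def g_def by simp
    qed
    show "f ` (D - {\<zero>}) \<subseteq> C"
    proof (rule image_subsetI)
      fix U assume "U \<in> D - {\<zero>}"
      then have U: "U \<in> D" and U0: "U \<noteq> \<zero>" by auto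
      show "f U \<in> C"
      proof -
        have UR: "U \<in> carrier R" using U unfolding D_def by auto
        note iU = inv_nonzero[OF UR U0]
        have niU: "nm (inv U) \<in> K" "nm (inv U) \<noteq> \<zero>" "nm (inv U) \<in> carrier R"
          using iU nm_in_K[OF iU(1)] nm_eq_zero_iff[OF iU(1)] by auto
        have "nm (B \<oplus> (inv U \<ominus> A)) = b \<otimes> (nm (inv U) \<otimes> inv a)" if B: "(B, b) \<in> T" for B b
        proof -
          obtain V where V: "V = inv U" "V \<in> carrier R" "V \<otimes> U = \<one>" using iU by blast
          note BR = T'[OF B]
          \<comment> \<open>Pulling V = 1/U out of the norm turns B + X into 1 + (B - A) U.\<close>
          have "V \<otimes> (\<one> \<oplus> (B \<ominus> A) \<otimes> U) = V \<oplus> (B \<ominus> A) \<otimes> (V \<otimes> U)"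
            using V(2) BR(1) A(1) UR by - (rule ring_eqI, (rule reify)+, simp_all)
          also have "\<dots> = B \<oplus> (V \<ominus> A)"
            unfolding V(3) using V(2) BR(1) A(1) by - (rule ring_eqI, (rule reify)+, simp_all)
          finally have "B \<oplus> (V \<ominus> A) = V \<otimes> (\<one> \<oplus> (B \<ominus> A) \<otimes> U)" ..
          then have 1: "nm (B \<oplus> (V \<ominus> A)) = nm V \<otimes> nm (\<one> \<oplus> (B \<ominus> A) \<otimes> U)"
            using V(2) BR(1) A(1) UR by (simp add: nm_mult)
          have 2: "nm (\<one> \<oplus> (B \<ominus> A) \<otimes> U) \<otimes> a = b" using U B unfolding D_def by auto
          obtain W where W: "nm (\<one> \<oplus> (B \<ominus> A) \<otimes> U) = W" "W \<in> carrier R"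
            using BR(1) A(1) UR by simp
          obtain i where i: "inv a = i" "i \<in> carrier R" using ia(2) by blast
          obtain N where N: "nm V = N" "N \<in> carrier R" using V(2) by simp
          have "b \<otimes> (N \<otimes> i) = N \<otimes> W \<otimes> (a \<otimes> i)"
            unfolding 2[symmetric] W(1) using N W i A(4) by (simp add: m_ac)
          also have "\<dots> = N \<otimes> W" unfolding i(1)[symmetric] ia(4) using N W by simp
          finally show ?thesis unfolding V(1)[symmetric] 1 W(1) N(1) i(1) ..
        qed
        moreover have "nm (inv U) \<otimes> inv a \<in> K" using niU(1) ia(1) by (rule K_closed(4))
        moreover have "nm (inv U) \<otimes> inv a \<noteq> \<zero>" using niU ia integral[of "nm (inv U)" "inv a"] by blast
        moreover have "inv U \<ominus> A \<in> carrier R" using iU(1) A(1) by simp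
        ultimately show ?thesis unfolding f_def C_iff by blast
      qed
    qed
    show "g ` C \<subseteq> D - {\<zero>}"
    proof (rule image_subsetI)
      fix w assume "w \<in> C"
      then obtain X x where w: "w = (X, x)" and C: "(X, x) \<in> C" by (cases w) auto
      have X: "X \<in> carrier R" "x \<in> carrier R" "x \<noteq> \<zero>" "X \<oplus> A \<noteq> \<zero>" "X \<oplus> A \<in> carrier R"
        "nm (X \<oplus> A) = a \<otimes> x"
        using Cx[OF C] by blast+
      define Y where "Y = X \<oplus> A"
      have Y: "Y \<in> carrier R" "Y \<noteq> \<zero>" "nm Y = a \<otimes> x" unfolding Y_def using X by blast+
      obtain V where V: "V = inv Y" "V \<in> carrier R" "V \<noteq> \<zero>" "V \<otimes> Y = \<one>" "Y \<otimes> V = \<one>"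
        using inv_nonzero[OF Y(1,2)] by blast
      have "nm (\<one> \<oplus> (B \<ominus> A) \<otimes> V) \<otimes> a = b" if B: "(B, b) \<in> T" for B b
      proof -
        note BR = T'[OF B]
        have "\<one> \<oplus> (B \<ominus> A) \<otimes> V = V \<otimes> Y \<oplus> (B \<ominus> A) \<otimes> V" using V by simp
        also have "\<dots> = V \<otimes> (B \<oplus> X)"
          unfolding Y_def using V(2) BR(1) A(1) X(1) by - (rule ring_eqI, (rule reify)+, simp_all)
        finally have e: "\<one> \<oplus> (B \<ominus> A) \<otimes> V = V \<otimes> (B \<oplus> X)" .
        have "nm (B \<oplus> X) = b \<otimes> x" using C B unfolding C_iff by blast
        then have "nm (\<one> \<oplus> (B \<ominus> A) \<otimes> V) = nm V \<otimes> (b \<otimes> x)"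
          unfolding e using V(2) BR(1) X(1) by (simp add: nm_mult)
        then have "nm (\<one> \<oplus> (B \<ominus> A) \<otimes> V) \<otimes> a = b \<otimes> (nm V \<otimes> nm Y)"
          unfolding Y(3) using V(2) BR(4) A(4) X(2) nm_closed[OF V(2)] by (simp add: m_ac)
        also have "nm V \<otimes> nm Y = \<one>" using nm_mult[OF V(2) Y(1)] V(4) by simp
        finally show ?thesis using BR by simp
      qed
      then have "V \<in> D" unfolding D_def using V(2) by blast
      then show "g w \<in> D - {\<zero>}" unfolding w g_def using V(1,3) Y_def by simp
    qed
  qed
  then have CD: "card C = card (D - {\<zero>})" by (rule bij_betw_same_card[symmetric])
  have finD: "finite D" unfolding D_def using finite_carrier by simp
  have zD: "\<zero> \<in> D \<longleftrightarrow> aligned T"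
  proof -
    have "\<zero> \<in> D \<longleftrightarrow> (\<forall>(B, b)\<in>T. a = b)" unfolding D_def using T' A by auto
    also have "\<dots> \<longleftrightarrow> aligned T" unfolding aligned_def using v by (auto split: prod.splits; metis)
    finally show ?thesis .
  qed
  have "int (card (D - {\<zero>})) = int (card D) - xi T"
  proof (cases "\<zero> \<in> D")
    case True
    then have "card D > 0" using finD by (auto simp: card_gt_0_iff)
    then show ?thesis using zD True finD by (simp add: xi_def of_nat_diff)
  next
    case False
    then show ?thesis using zD by (simp add: xi_def)
  qed
  then show ?thesis unfolding ng_deg_def C_def[symmetric] CD D_def .
qed

section \<open>Two and three vertices\<close>

text \<open>The equation at the base vertex is void, which leaves one norm condition on an affine
  image of U; its solutions are counted by a norm fibre.\<close>

lemma ng_deg_2: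
  assumes T: "T \<subseteq> ng_verts R K" "generic T" "card T = 2"
  shows "int (ng_deg R K q (Suc n) T) = int norm_exp - xi T"
proof -
  obtain v w where vw: "T = {v, w}" "v \<noteq> w" using T(3) by (auto simp: card_2_iff)
  obtain A a where v: "v = (A, a)" by fastforce
  obtain B b where w: "w = (B, b)" by fastforce
  have AB: "A \<in> carrier R" "a \<in> K" "a \<noteq> \<zero>" "B \<in> carrier R" "b \<in> K" "b \<noteq> \<zero>" "a \<in> carrier R" "b \<in> carrier R"
    using T(1) K_carrier unfolding ng_verts_def vw v w by auto
  have "A \<noteq> B" 
  proof
    assume "A = B"
    then have "fst v = fst w" by (simp add: v w)
    moreover have "inj_on fst {v, w}" using T(2) vw(1) by (simp add: generic_def)
    ultimately show False using vw(2) inj_onD[of fst "{v, w}" v w] by blast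
  qed
  then have BA: "B \<ominus> A \<noteq> \<zero>" "B \<ominus> A \<in> carrier R" using AB(1,4) by simp_all
  note ia = inv_nonzero[OF AB(7,3)]
  note iff = eq_div_iff[OF AB(7,3) _ AB(8)]
  have bK: "b \<otimes> inv a \<in> K" "b \<otimes> inv a \<noteq> \<zero>"
    using K_closed(4)[OF AB(5) K_closed(7)[OF AB(2,3)]] integral[of b "inv a"] ia(1,2) AB(6,8) by blast+
  have ba: "b \<otimes> inv a \<in> carrier R" using ia AB by simp
  have "{U \<in> carrier R. \<forall>(B, b)\<in>T. nm (\<one> \<oplus> (B \<ominus> A) \<otimes> U) \<otimes> a = b} = {U \<in> carrier R. nm ((B \<ominus> A) \<otimes> U \<oplus> \<one>) = b \<otimes> inv a}"
  proof -
    have "nm (\<one> \<oplus> (A \<ominus> A) \<otimes> U) \<otimes> a = a" if "U \<in> carrier R" for U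
      using that AB(1,7) by (simp add: a_minus_def r_neg)
    moreover have "nm (\<one> \<oplus> (B \<ominus> A) \<otimes> U) \<otimes> a = b \<longleftrightarrow> nm ((B \<ominus> A) \<otimes> U \<oplus> \<one>) = b \<otimes> inv a"
      if "U \<in> carrier R" for U
      using iff[of "nm (\<one> \<oplus> (B \<ominus> A) \<otimes> U)"] that BA(2) a_comm[of \<one> "(B \<ominus> A) \<otimes> U"] by simp
    ultimately show ?thesis unfolding vw v w by auto
  qed
  then have "card {U \<in> carrier R. \<forall>(B, b)\<in>T. nm (\<one> \<oplus> (B \<ominus> A) \<otimes> U) \<otimes> a = b} = card {x \<in> carrier R. nm x = b \<otimes> inv a}"
    using card_affine[OF BA(2,1) one_closed, of "\<lambda>x. nm x = b \<otimes> inv a"] by simp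
  also have "\<dots> = norm_exp" by (rule card_nm_fibre[OF bK])
  finally show ?thesis using ng_deg_eq[of A a T] T(1) vw v by simp
qed

definition norm_count :: "'a \<Rightarrow> 'a \<Rightarrow> nat" where
  "norm_count c1 c2 = card {Z \<in> carrier R. nm Z = c1 \<and> nm (Z \<oplus> \<one>) = c2}"

lemma nm_rescale:
  assumes "a \<in> carrier R" "a \<noteq> \<zero>" "b \<in> carrier R" "V \<in> carrier R" "w \<in> carrier R" "w \<noteq> \<zero>"
  shows "nm V \<otimes> a = b \<longleftrightarrow> nm (V \<otimes> w) = b \<otimes> inv a \<otimes> nm w"
proof -
  have i: "inv a \<in> carrier R" using inv_nonzero assms by blast
  have w: "nm w \<in> carrier R" "nm w \<noteq> \<zero>" using assms nm_eq_zero_iff by auto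
  have "nm V \<otimes> a = b \<longleftrightarrow> nm V = b \<otimes> inv a" using eq_div_iff assms by simp
  also have "\<dots> \<longleftrightarrow> nm w \<otimes> nm V = nm w \<otimes> (b \<otimes> inv a)"
    using m_lcancel_iff[OF w, of "nm V" "b \<otimes> inv a"] assms i by simp
  also have "\<dots> \<longleftrightarrow> nm (V \<otimes> w) = b \<otimes> inv a \<otimes> nm w"
    using assms i w by (simp add: nm_mult m_comm)
  finally show ?thesis .
qed

lemma div_mult_nonzero:
  assumes "a \<in> K" "a \<noteq> \<zero>" "b \<in> K" "b \<noteq> \<zero>" "w \<in> carrier R" "w \<noteq> \<zero>"
  shows "b \<otimes> inv a \<otimes> nm w \<in> K" "b \<otimes> inv a \<otimes> nm w \<noteq> \<zero>"
proof -
  have i: "inv a \<in> K" "inv a \<noteq> \<zero>" using inv_nonzero[of a] K_closed(7) K_carrier assms by auto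
  have w: "nm w \<in> K" "nm w \<noteq> \<zero>" using assms nm_in_K nm_eq_zero_iff by auto
  have bi: "b \<otimes> inv a \<in> K" by (rule K_closed(4)[OF assms(3) i(1)])
  show "b \<otimes> inv a \<otimes> nm w \<in> K" by (rule K_closed(4)[OF bi w(1)])
  have "b \<otimes> inv a \<noteq> \<zero>" using integral[of b "inv a"] assms i K_carrier by blast
  then show "b \<otimes> inv a \<otimes> nm w \<noteq> \<zero>" using integral[of "b \<otimes> inv a" "nm w"] w bi K_carrier by blast
qed

text \<open>Let \<beta>1 and \<beta>2 be the differences of A1 and A2 to A3, and i the inverse of
  \<beta>1 - \<beta>2. Then Z = \<beta>2 i (1 + \<beta>1 U) satisfies Z + 1 = \<beta>1 i (1 +
  \<beta>2 U), because \<beta>1 i - \<beta>2 i = 1. So both conditions concern one variable and its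
  translate by 1, and the rescaled right-hand sides are c1 and c2.\<close>

lemma ng_deg_3:
  assumes T: "T \<subseteq> ng_verts R K" "generic T" "card T = 3" "T = {v1, v2, v3}"
  defines "c1 \<equiv> ng_c1 R q (Suc n) v1 v2 v3" and "c2 \<equiv> ng_c2 R q (Suc n) v1 v2 v3"
  shows "c1 \<in> K" "c1 \<noteq> \<zero>" "c2 \<in> K" "c2 \<noteq> \<zero>"
    "int (ng_deg R K q (Suc n) T) = int (norm_count c1 c2) - xi T"
proof -
  obtain A1 a1 where v1: "v1 = (A1, a1)" by fastforce
  obtain A2 a2 where v2: "v2 = (A2, a2)" by fastforce
  obtain A3 a3 where v3: "v3 = (A3, a3)" by fastforce
  have mem: "A1 \<in> carrier R" "A2 \<in> carrier R" "A3 \<in> carrier R" "a1 \<in> K" "a2 \<in> K" "a3 \<in> K"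
    "a1 \<noteq> \<zero>" "a2 \<noteq> \<zero>" "a3 \<noteq> \<zero>"
    using T(1) unfolding ng_verts_def T(4) v1 v2 v3 by auto
  have aR: "a1 \<in> carrier R" "a2 \<in> carrier R" "a3 \<in> carrier R" using mem K_carrier by blast+
  have dist: "v1 \<noteq> v2" "v1 \<noteq> v3" "v2 \<noteq> v3" using T(3) unfolding T(4) by (auto simp: card_insert_if split: if_splits)
  have inj: "inj_on fst {v1, v2, v3}" using T(2,4) by (simp add: generic_def)
  have An: "A1 \<noteq> A2" "A1 \<noteq> A3" "A2 \<noteq> A3"
    using inj_onD[OF inj, of v1 v2] inj_onD[OF inj, of v1 v3] inj_onD[OF inj, of v2 v3] dist v1 v2 v3 by auto
  obtain \<beta>1 where b1: "\<beta>1 = A1 \<ominus> A3" "\<beta>1 \<in> carrier R" "\<beta>1 \<noteq> \<zero>" using mem An by simp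
  obtain \<beta>2 where b2: "\<beta>2 = A2 \<ominus> A3" "\<beta>2 \<in> carrier R" "\<beta>2 \<noteq> \<zero>" using mem An by simp
  obtain \<delta> where d: "\<delta> = A1 \<ominus> A2" "\<delta> \<in> carrier R" "\<delta> \<noteq> \<zero>" using mem An by simp
  have d': "\<delta> = \<beta>1 \<ominus> \<beta>2" unfolding d(1) b1(1) b2(1) using mem(1-3) by - (rule ring_eqI, (rule reify)+, simp_all)
  obtain i where i: "i = inv \<delta>" "i \<in> carrier R" "i \<noteq> \<zero>" "\<delta> \<otimes> i = \<one>" using inv_nonzero[OF d(2,3)] by blast
  have w1: "\<beta>2 \<otimes> i \<in> carrier R" "\<beta>2 \<otimes> i \<noteq> \<zero>" using b2 i integral[of \<beta>2 i] by auto
  have w2: "\<beta>1 \<otimes> i \<in> carrier R" "\<beta>1 \<otimes> i \<noteq> \<zero>" using b1 i integral[of \<beta>1 i] by auto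
  have c1: "c1 = a1 \<otimes> inv a3 \<otimes> nm (\<beta>2 \<otimes> i)"
    unfolding c1_def ng_c1_def field_div_def v1 v2 v3 using w1 by (simp add: b2(1)[symmetric] d(1)[symmetric] i(1)[symmetric] field_norm_eq)
  have c2: "c2 = a2 \<otimes> inv a3 \<otimes> nm (\<beta>1 \<otimes> i)"
    unfolding c2_def ng_c2_def field_div_def v1 v2 v3 using w2 by (simp add: b1(1)[symmetric] d(1)[symmetric] i(1)[symmetric] field_norm_eq)
  show "c1 \<in> K" "c1 \<noteq> \<zero>" unfolding c1 using div_mult_nonzero mem w1 by auto
  show "c2 \<in> K" "c2 \<noteq> \<zero>" unfolding c2 using div_mult_nonzero mem w2 by auto
  have bb: "\<beta>1 \<otimes> (\<beta>2 \<otimes> i) \<in> carrier R" "\<beta>1 \<otimes> (\<beta>2 \<otimes> i) \<noteq> \<zero>" using b1 w1 integral[of \<beta>1 "\<beta>2 \<otimes> i"] by auto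
  have e1: "(\<one> \<oplus> \<beta>1 \<otimes> U) \<otimes> (\<beta>2 \<otimes> i) = \<beta>1 \<otimes> (\<beta>2 \<otimes> i) \<otimes> U \<oplus> \<beta>2 \<otimes> i" if U: "U \<in> carrier R" for U
    using U b1(2) b2(2) i(2) by - (rule ring_eqI, (rule reify)+, simp_all)
  have e2: "(\<one> \<oplus> \<beta>2 \<otimes> U) \<otimes> (\<beta>1 \<otimes> i) = (\<beta>1 \<otimes> (\<beta>2 \<otimes> i) \<otimes> U \<oplus> \<beta>2 \<otimes> i) \<oplus> \<one>" if U: "U \<in> carrier R" for U
  proof -
    have "(\<one> \<oplus> \<beta>2 \<otimes> U) \<otimes> (\<beta>1 \<otimes> i) = (\<beta>1 \<otimes> (\<beta>2 \<otimes> i) \<otimes> U \<oplus> \<beta>2 \<otimes> i) \<oplus> (\<beta>1 \<ominus> \<beta>2) \<otimes> i"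
      using U b1(2) b2(2) i(2) by - (rule ring_eqI, (rule reify)+, simp_all)
    then show ?thesis using i(4) d' by simp
  qed
  have "{U \<in> carrier R. \<forall>(B, b)\<in>T. nm (\<one> \<oplus> (B \<ominus> A3) \<otimes> U) \<otimes> a3 = b} =
      {U \<in> carrier R. nm (\<beta>1 \<otimes> (\<beta>2 \<otimes> i) \<otimes> U \<oplus> \<beta>2 \<otimes> i) = c1 \<and> nm ((\<beta>1 \<otimes> (\<beta>2 \<otimes> i) \<otimes> U \<oplus> \<beta>2 \<otimes> i) \<oplus> \<one>) = c2}"
  proof (intro Collect_cong conj_cong refl)
    fix U assume U: "U \<in> carrier R"
    have "(\<forall>(B, b)\<in>T. nm (\<one> \<oplus> (B \<ominus> A3) \<otimes> U) \<otimes> a3 = b) \<longleftrightarrow>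
        nm (\<one> \<oplus> \<beta>1 \<otimes> U) \<otimes> a3 = a1 \<and> nm (\<one> \<oplus> \<beta>2 \<otimes> U) \<otimes> a3 = a2 \<and> nm (\<one> \<oplus> (A3 \<ominus> A3) \<otimes> U) \<otimes> a3 = a3"
      unfolding T(4) v1 v2 v3 b1(1) b2(1) by simp
    also have "nm (\<one> \<oplus> (A3 \<ominus> A3) \<otimes> U) \<otimes> a3 = a3" using U mem(3) aR(3) by (simp add: a_minus_def r_neg)
    also have "nm (\<one> \<oplus> \<beta>1 \<otimes> U) \<otimes> a3 = a1 \<longleftrightarrow> nm (\<beta>1 \<otimes> (\<beta>2 \<otimes> i) \<otimes> U \<oplus> \<beta>2 \<otimes> i) = c1"
      unfolding c1 e1[OF U, symmetric] by (rule nm_rescale) (use U b1 aR mem w1 in auto)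
    also have "nm (\<one> \<oplus> \<beta>2 \<otimes> U) \<otimes> a3 = a2 \<longleftrightarrow> nm ((\<beta>1 \<otimes> (\<beta>2 \<otimes> i) \<otimes> U \<oplus> \<beta>2 \<otimes> i) \<oplus> \<one>) = c2"
      unfolding c2 e2[OF U, symmetric] by (rule nm_rescale) (use U b2 aR mem w2 in auto)
    finally show "(\<forall>(B, b)\<in>T. nm (\<one> \<oplus> (B \<ominus> A3) \<otimes> U) \<otimes> a3 = b) \<longleftrightarrow>
        nm (\<beta>1 \<otimes> (\<beta>2 \<otimes> i) \<otimes> U \<oplus> \<beta>2 \<otimes> i) = c1 \<and> nm ((\<beta>1 \<otimes> (\<beta>2 \<otimes> i) \<otimes> U \<oplus> \<beta>2 \<otimes> i) \<oplus> \<one>) = c2"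
      by simp
  qed
  also have "card \<dots> = norm_count c1 c2"
    unfolding norm_count_def by (rule card_affine[OF bb w1(1), of "\<lambda>Z. nm Z = c1 \<and> nm (Z \<oplus> \<one>) = c2"])
  finally show "int (ng_deg R K q (Suc n) T) = int (norm_count c1 c2) - xi T"
    using ng_deg_eq[of A3 a3 T] T(1,4) v3 by simp
qed

text \<open>Among the conjugates of \<open>Z\<close> the last two, \<open>x\<close> and \<open>y\<close>, enter the three equations
  linearly through \<open>x y\<close>, \<open>x\<close> and \<open>y\<close>. Eliminating them leaves one polynomial equation for \<open>Z\<close>,
  which does not hold at \<open>Z = 0\<close>.\<close>

lemma three_norms_bound:
  assumes b: "b1 \<in> carrier R" "b2 \<in> carrier R" "b3 \<in> carrier R" "b1 \<noteq> \<zero>"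
    and B: "B \<in> carrier R" "B \<noteq> \<zero>" "B \<noteq> \<one>" and n: "n = Suc (Suc k)" "k > 0"
  shows "card {Z \<in> carrier R. nm Z = b1 \<and> nm (Z \<oplus> \<one>) = b2 \<and> nm (Z \<oplus> B) = b3} \<le> 6 * (\<Sum>i<k. q ^ i)"
proof -
  define m where "m = (\<Sum>i<k. q ^ i)"
  \<comment> \<open>\<open>m\<close> is the exponent of the product of the first k conjugates. It is
    positive because k > 0, so \<open>P1\<close> vanishes at zero.\<close>
  have m0: "m > 0" unfolding m_def using n(2) q_ge_2 by (intro sum_pos) auto
  obtain B' where B': "B' = B [^] (q ^ k)" "B' \<in> carrier R" using B by simp
  obtain B'' where B'': "B'' = B [^] (q ^ Suc k)" "B'' \<in> carrier R" using B by simp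
  have nm_split: "nm Z = Z [^] m \<otimes> (Z [^] (q ^ k) \<otimes> Z [^] (q ^ Suc k))" if "Z \<in> carrier R" for Z
  proof -
    have "norm_exp = m + (q ^ k + q ^ Suc k)" unfolding norm_exp_def m_def by (simp add: n(1))
    then show ?thesis using that by (simp add: nm_def nat_pow_mult)
  qed
  have frobB1: "B [^] (q ^ j) \<ominus> \<one> \<noteq> \<zero>" for j
  proof -
    have "B [^] (q ^ j) \<ominus> \<one> = (B \<ominus> \<one>) [^] (q ^ j)" using frob_minus[of B \<one> j] B by simp
    moreover have "B \<ominus> \<one> \<noteq> \<zero>" using B by simp
    ultimately show ?thesis using pow_eq_zeroD[of "B \<ominus> \<one>" "q ^ j"] B by auto
  qed
  define P1 where "P1 Z = Z [^] m" for Z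
  define P2 where "P2 Z = (Z \<oplus> \<one>) [^] m" for Z
  define P3 where "P3 Z = (Z \<oplus> B) [^] m" for Z
  have P: "polyfun R m P1" "polyfun R m P2" "polyfun R m P3"
  proof -
    have l: "polyfun R (Suc 0) (\<lambda>Z. Z \<oplus> c)" if "c \<in> carrier R" for c
      by (intro polyfun_add polyfun_id polyfun_const that)
    show "polyfun R m P1" unfolding P1_def[abs_def] by (rule polyfun_power)
    show "polyfun R m P2" unfolding P2_def[abs_def] using polyfun_pow[OF l[OF one_closed], of m] by simp
    show "polyfun R m P3" unfolding P3_def[abs_def] using polyfun_pow[OF l[OF B(1)], of m] by simp
  qed
  have PR: "P1 Z \<in> carrier R" "P2 Z \<in> carrier R" "P3 Z \<in> carrier R" if "Z \<in> carrier R" for Z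
    using that B by (simp_all add: P1_def P2_def P3_def)
  have P0: "P1 \<zero> = \<zero>" "P2 \<zero> = \<one>" "P3 \<zero> \<noteq> \<zero>"
    using m0 B pow_eq_zeroD[of B m] by (auto simp: P1_def P2_def P3_def nat_pow_zero)
  \<comment> \<open>For the last two conjugates x and y of a solution, the equations give E w = P1
    P2 P3 ((B'' - w) x + (B' - w) y). Thus w = B' isolates x, and w = B'' isolates y.\<close>
  define E where "E w Z = b3 \<otimes> (P1 Z \<otimes> P2 Z) \<ominus> b1 \<otimes> (P2 Z \<otimes> P3 Z) \<ominus> B' \<otimes> B'' \<otimes> (P1 Z \<otimes> P2 Z \<otimes> P3 Z)
     \<ominus> w \<otimes> (b2 \<otimes> (P1 Z \<otimes> P3 Z) \<ominus> b1 \<otimes> (P2 Z \<otimes> P3 Z) \<ominus> P1 Z \<otimes> P2 Z \<otimes> P3 Z)" for w Z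
  have Ep: "polyfun R (3 * m) (E w)" if w: "w \<in> carrier R" for w
  proof -
    have 2: "polyfun R (3 * m) (\<lambda>Z. c \<otimes> (f Z \<otimes> g Z))" if "c \<in> carrier R" "polyfun R m f" "polyfun R m g" for c f g
      by (rule polyfun_mono[OF polyfun_smult[OF polyfun_mult[OF that(2,3)] that(1)]]) simp
    have 3: "polyfun R (3 * m) (\<lambda>Z. P1 Z \<otimes> P2 Z \<otimes> P3 Z)"
      by (rule polyfun_mono[OF polyfun_mult[OF polyfun_mult[OF P(1,2)] P(3)]]) simp
    show ?thesis unfolding E_def[abs_def]
      by (intro polyfun_minus 2 b P polyfun_smult 3 w m_closed B'(2) B''(2))
  qed
  have ER: "E w Z \<in> carrier R" if "w \<in> carrier R" "Z \<in> carrier R" for w Z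
    using polyfun_closed[OF Ep] that by simp
  have E0: "E w \<zero> = (w \<ominus> \<one>) \<otimes> b1 \<otimes> P3 \<zero>" if w: "w \<in> carrier R" for w
  proof -
    obtain p where p: "p = P3 \<zero>" "p \<in> carrier R" using PR by simp
    show ?thesis unfolding E_def P0(1,2) p(1)[symmetric]
      using p(2) w b(1-3) B'(2) B''(2) by - (rule ring_eqI, (rule reify)+, simp_all)
  qed
  have E0nz: "E w \<zero> \<noteq> \<zero>" if "w \<in> carrier R" "w \<ominus> \<one> \<noteq> \<zero>" for w
    unfolding E0[OF that(1)] using that b(1,4) P0(3) PR(3)[OF zero_closed]
      integral[of "w \<ominus> \<one>" b1] integral[of "(w \<ominus> \<one>) \<otimes> b1" "P3 \<zero>"] by auto
  note B1 = frobB1[of k, folded B'(1)] frobB1[of "Suc k", folded B''(1)]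
  have main: "\<exists>x\<in>carrier R. \<exists>y\<in>carrier R. P1 Z \<otimes> (x \<otimes> y) = b1 \<and> P2 Z \<otimes> ((x \<oplus> \<one>) \<otimes> (y \<oplus> \<one>)) = b2 \<and>
      P3 Z \<otimes> ((x \<oplus> B') \<otimes> (y \<oplus> B'')) = b3"
    if "Z \<in> carrier R" "nm Z = b1" "nm (Z \<oplus> \<one>) = b2" "nm (Z \<oplus> B) = b3" for Z
  proof (intro bexI conjI)
    show "P1 Z \<otimes> (Z [^] (q ^ k) \<otimes> Z [^] (q ^ Suc k)) = b1" using nm_split that by (simp add: P1_def)
    show "P2 Z \<otimes> ((Z [^] (q ^ k) \<oplus> \<one>) \<otimes> (Z [^] (q ^ Suc k) \<oplus> \<one>)) = b2"
      using nm_split[of "Z \<oplus> \<one>"] that frob_add[of Z \<one> k] frob_add[of Z \<one> "Suc k"] by (simp add: P2_def)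
    show "P3 Z \<otimes> ((Z [^] (q ^ k) \<oplus> B') \<otimes> (Z [^] (q ^ Suc k) \<oplus> B'')) = b3"
      using nm_split[of "Z \<oplus> B"] that frob_add[of Z B k] frob_add[of Z B "Suc k"] B by (simp add: P3_def B'(1) B''(1))
  qed (use that in auto)
  have Ex: "E B' Z = P1 Z \<otimes> P2 Z \<otimes> P3 Z \<otimes> ((B'' \<ominus> B') \<otimes> x) \<and> E B'' Z = P1 Z \<otimes> P2 Z \<otimes> P3 Z \<otimes> ((B' \<ominus> B'') \<otimes> y)"
    if Z: "Z \<in> carrier R" and xy: "x \<in> carrier R" "y \<in> carrier R"
      and eqs: "P1 Z \<otimes> (x \<otimes> y) = b1" "P2 Z \<otimes> ((x \<oplus> \<one>) \<otimes> (y \<oplus> \<one>)) = b2" "P3 Z \<otimes> ((x \<oplus> B') \<otimes> (y \<oplus> B'')) = b3" for Z x y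
  proof -
    obtain p1 where p1: "p1 = P1 Z" "p1 \<in> carrier R" using PR[OF Z] by simp
    obtain p2 where p2: "p2 = P2 Z" "p2 \<in> carrier R" using PR[OF Z] by simp
    obtain p3 where p3: "p3 = P3 Z" "p3 \<in> carrier R" using PR[OF Z] by simp
    note cl = p1(2) p2(2) p3(2) xy B'(2) B''(2)
    show ?thesis
      unfolding E_def eqs[symmetric] p1(1)[symmetric] p2(1)[symmetric] p3(1)[symmetric]
      using cl by - (rule conjI; (rule ring_eqI, (rule reify)+, simp_all))
  qed
  show ?thesis
  proof (cases "B' = B''")
    \<comment> \<open>Here the relation for w = B' already has right-hand side zero, and degree 3m
      is enough.\<close>
    case True
    have "card {Z \<in> carrier R. E B' Z = \<zero>} \<le> 3 * m"
      by (rule polyfun_roots[OF finite_carrier Ep, of _ \<zero>]) (use B' B1 E0nz in auto)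
    moreover have "{Z \<in> carrier R. nm Z = b1 \<and> nm (Z \<oplus> \<one>) = b2 \<and> nm (Z \<oplus> B) = b3} \<subseteq> {Z \<in> carrier R. E B' Z = \<zero>}"
    proof safe
      fix Z assume Z: "Z \<in> carrier R" "b1 = nm Z" "b2 = nm (Z \<oplus> \<one>)" "b3 = nm (Z \<oplus> B)"
      then obtain x y where xy: "x \<in> carrier R" "y \<in> carrier R" "E B' Z = P1 Z \<otimes> P2 Z \<otimes> P3 Z \<otimes> ((B'' \<ominus> B') \<otimes> x)"
        using main[OF Z(1)] Ex[OF Z(1)] by metis
      have "B'' \<ominus> B' = \<zero>" using True B' by simp
      then show "E B' Z = \<zero>" unfolding xy(3) using xy PR[OF Z(1)] by simp
    qed
    moreover have "finite {Z \<in> carrier R. E B' Z = \<zero>}" using finite_carrier by simp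
    ultimately have "card {Z \<in> carrier R. nm Z = b1 \<and> nm (Z \<oplus> \<one>) = b2 \<and> nm (Z \<oplus> B) = b3} \<le> 3 * m"
      by (meson card_mono order.trans)
    then show ?thesis unfolding m_def by simp
  next
    case False
    \<comment> \<open>The product of the two relations contains x y, which is eliminated by P1 x y =
      b1. Its degree is 6m, and the correction term has the factor \<open>P1\<close>, so at zero
      only the product of the two values of \<open>E\<close> survives.\<close>
    define F where "F Z = E B' Z \<otimes> E B'' Z \<oplus> ((B'' \<ominus> B') \<otimes> (B'' \<ominus> B') \<otimes> b1) \<otimes> (P1 Z \<otimes> ((P2 Z \<otimes> P2 Z) \<otimes> (P3 Z \<otimes> P3 Z)))" for Z
    have Fp: "polyfun R (6 * m) F"
    proof -
      have "polyfun R (3 * m + 3 * m) (\<lambda>Z. E B' Z \<otimes> E B'' Z)" by (rule polyfun_mult[OF Ep Ep]) (use B' B'' in auto)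
      then have 1: "polyfun R (6 * m) (\<lambda>Z. E B' Z \<otimes> E B'' Z)" by simp
      have "polyfun R (m + ((m + m) + (m + m))) (\<lambda>Z. ((B'' \<ominus> B') \<otimes> (B'' \<ominus> B') \<otimes> b1) \<otimes> (P1 Z \<otimes> ((P2 Z \<otimes> P2 Z) \<otimes> (P3 Z \<otimes> P3 Z))))"
        by (intro polyfun_smult polyfun_mult P) (use B' B'' b in auto)
      then have 2: "polyfun R (6 * m) (\<lambda>Z. ((B'' \<ominus> B') \<otimes> (B'' \<ominus> B') \<otimes> b1) \<otimes> (P1 Z \<otimes> ((P2 Z \<otimes> P2 Z) \<otimes> (P3 Z \<otimes> P3 Z))))"
        by (rule polyfun_mono) simp
      show ?thesis unfolding F_def[abs_def] by (rule polyfun_add[OF 1 2])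
    qed
    have F0: "F \<zero> \<noteq> \<zero>"
    proof -
      have "F \<zero> = E B' \<zero> \<otimes> E B'' \<zero>"
        unfolding F_def P0(1) using ER[OF B'(2) zero_closed] ER[OF B''(2) zero_closed] B'(2) B''(2) b
          PR(2,3)[OF zero_closed] by simp
      then show ?thesis using E0nz[OF B'(2) B1(1)] E0nz[OF B''(2) B1(2)]
        ER[OF B'(2) zero_closed] ER[OF B''(2) zero_closed] integral[of "E B' \<zero>" "E B'' \<zero>"] by metis
    qed
    have "card {Z \<in> carrier R. F Z = \<zero>} \<le> 6 * m"
      by (rule polyfun_roots[OF finite_carrier Fp zero_closed F0])
    moreover have "{Z \<in> carrier R. nm Z = b1 \<and> nm (Z \<oplus> \<one>) = b2 \<and> nm (Z \<oplus> B) = b3} \<subseteq> {Z \<in> carrier R. F Z = \<zero>}"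
    proof
      fix Z assume "Z \<in> {Z \<in> carrier R. nm Z = b1 \<and> nm (Z \<oplus> \<one>) = b2 \<and> nm (Z \<oplus> B) = b3}"
      then have Z: "Z \<in> carrier R" "nm Z = b1" "nm (Z \<oplus> \<one>) = b2" "nm (Z \<oplus> B) = b3" by auto
      from main[OF Z] obtain x y where xy: "x \<in> carrier R" "y \<in> carrier R" and
        eqs: "P1 Z \<otimes> (x \<otimes> y) = b1" "P2 Z \<otimes> ((x \<oplus> \<one>) \<otimes> (y \<oplus> \<one>)) = b2" "P3 Z \<otimes> ((x \<oplus> B') \<otimes> (y \<oplus> B'')) = b3"
        by blast
      note e = Ex[OF Z(1) xy eqs]
      obtain p1 where p1: "p1 = P1 Z" "p1 \<in> carrier R" using PR[OF Z(1)] by simp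
      obtain p2 where p2: "p2 = P2 Z" "p2 \<in> carrier R" using PR[OF Z(1)] by simp
      obtain p3 where p3: "p3 = P3 Z" "p3 \<in> carrier R" using PR[OF Z(1)] by simp
      note cl = p1(2) p2(2) p3(2) xy(1) xy(2) B'(2) B''(2)
      have "F Z = \<zero>"
        unfolding F_def conjunct1[OF e] conjunct2[OF e] eqs(1)[symmetric]
          p1(1)[symmetric] p2(1)[symmetric] p3(1)[symmetric] using cl by - (rule ring_eqI, (rule reify)+, simp_all)
      then show "Z \<in> {Z \<in> carrier R. F Z = \<zero>}" using Z(1) by simp
    qed
    moreover have "finite {Z \<in> carrier R. F Z = \<zero>}" using finite_carrier by simp
    ultimately show ?thesis unfolding m_def by (meson card_mono order.trans)
  qed
qed

end

lemma real_square_diff: "(a - b)\<^sup>2 = a * a - 2 * b * a + b\<^sup>2" for a b :: real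
  by (simp add: power2_eq_square algebra_simps)

context norm_ext
begin

text \<open>The normalisation used for three vertices turns the remaining condition into one on a
  further translate Z + B, so \<open>three_norms_bound\<close> applies; subtracting \<xi>(T) \<ge> 0
  only helps.\<close>

lemma ng_deg_4:
  assumes T: "T \<subseteq> ng_verts R K" "generic T" "card T = 4" and n: "n = Suc (Suc k)" "k > 0"
  shows "ng_deg R K q (Suc n) T \<le> 6 * (\<Sum>i<k. q ^ i)"
proof -
  obtain v1 v2 v3 v4 where T4: "T = {v1, v2, v3, v4}"
    and dist: "v1 \<noteq> v2" "v1 \<noteq> v3" "v1 \<noteq> v4" "v2 \<noteq> v3" "v2 \<noteq> v4" "v3 \<noteq> v4"
  proof -
    obtain v1 T1 where 1: "T = insert v1 T1" "v1 \<notin> T1" "card T1 = 3"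
      using T(3) card_eq_SucD[of T 3] by auto
    then obtain v2 v3 v4 where "T1 = {v2, v3, v4}" "v2 \<noteq> v3" "v3 \<noteq> v4" "v2 \<noteq> v4"
      unfolding card_3_iff by blast
    then show thesis using that[of v1 v2 v3 v4] 1 by simp
  qed
  obtain A1 a1 where v1: "v1 = (A1, a1)" by fastforce
  obtain A2 a2 where v2: "v2 = (A2, a2)" by fastforce
  obtain A3 a3 where v3: "v3 = (A3, a3)" by fastforce
  obtain A4 a4 where v4: "v4 = (A4, a4)" by fastforce
  have mem: "A1 \<in> carrier R" "A2 \<in> carrier R" "A3 \<in> carrier R" "A4 \<in> carrier R"
    "a1 \<in> K" "a2 \<in> K" "a3 \<in> K" "a4 \<in> K" "a1 \<noteq> \<zero>" "a2 \<noteq> \<zero>" "a3 \<noteq> \<zero>" "a4 \<noteq> \<zero>"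
    using T(1) unfolding ng_verts_def T4 v1 v2 v3 v4 by auto
  have aR: "a1 \<in> carrier R" "a2 \<in> carrier R" "a3 \<in> carrier R" "a4 \<in> carrier R" using mem K_carrier by blast+
  have inj: "inj_on fst {v1, v2, v3, v4}" using T(2) T4 by (simp add: generic_def)
  have An: "A1 \<noteq> A2" "A1 \<noteq> A3" "A2 \<noteq> A3" "A1 \<noteq> A4" "A2 \<noteq> A4" "A3 \<noteq> A4"
    using inj_onD[OF inj, of v1 v2] inj_onD[OF inj, of v1 v3] inj_onD[OF inj, of v2 v3]
      inj_onD[OF inj, of v1 v4] inj_onD[OF inj, of v2 v4] inj_onD[OF inj, of v3 v4] dist v1 v2 v3 v4 by auto
  obtain \<beta>1 where b1: "\<beta>1 = A1 \<ominus> A4" "\<beta>1 \<in> carrier R" "\<beta>1 \<noteq> \<zero>" using mem An by simp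
  obtain \<beta>2 where b2: "\<beta>2 = A2 \<ominus> A4" "\<beta>2 \<in> carrier R" "\<beta>2 \<noteq> \<zero>" using mem An by simp
  obtain \<beta>3 where b3: "\<beta>3 = A3 \<ominus> A4" "\<beta>3 \<in> carrier R" "\<beta>3 \<noteq> \<zero>" using mem An by simp
  have bd: "\<beta>1 \<ominus> \<beta>2 = A1 \<ominus> A2" "\<beta>1 \<ominus> \<beta>3 = A1 \<ominus> A3" "\<beta>2 \<ominus> \<beta>3 = A2 \<ominus> A3"
    unfolding b1(1) b2(1) b3(1) using mem(1-4) by - (rule ring_eqI, (rule reify)+, simp_all)+
  have ne: "\<beta>1 \<ominus> \<beta>2 \<noteq> \<zero>" "\<beta>1 \<ominus> \<beta>3 \<noteq> \<zero>" "\<beta>2 \<ominus> \<beta>3 \<noteq> \<zero>"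
    unfolding bd using An mem(1-4) by simp_all
  have bn: "\<beta>1 \<ominus> \<beta>2 \<noteq> \<zero>" "\<beta>1 \<noteq> \<beta>3" "\<beta>2 \<noteq> \<beta>3"
    using ne r_right_minus_eq[OF b1(2) b3(2)] r_right_minus_eq[OF b2(2) b3(2)] by simp_all
  have dR: "\<beta>1 \<ominus> \<beta>2 \<in> carrier R" using b1(2) b2(2) by simp
  obtain i where i: "i \<in> carrier R" "i \<noteq> \<zero>" "(\<beta>1 \<ominus> \<beta>2) \<otimes> i = \<one>"
    using inv_nonzero[OF dR bn(1)] by blast
  obtain j where j: "j \<in> carrier R" "j \<noteq> \<zero>" "\<beta>3 \<otimes> j = \<one>" using inv_nonzero[OF b3(2,3)] by blast
  have w1: "\<beta>2 \<otimes> i \<in> carrier R" "\<beta>2 \<otimes> i \<noteq> \<zero>" using b2(2,3) i(1,2) integral[of \<beta>2 i] by auto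
  have w2: "\<beta>1 \<otimes> i \<in> carrier R" "\<beta>1 \<otimes> i \<noteq> \<zero>" using b1(2,3) i(1,2) integral[of \<beta>1 i] by auto
  have bb: "\<beta>1 \<otimes> (\<beta>2 \<otimes> i) \<in> carrier R" "\<beta>1 \<otimes> (\<beta>2 \<otimes> i) \<noteq> \<zero>" using b1(2,3) w1 integral[of \<beta>1 "\<beta>2 \<otimes> i"] by auto
  have w3: "\<beta>1 \<otimes> (\<beta>2 \<otimes> i) \<otimes> j \<in> carrier R" "\<beta>1 \<otimes> (\<beta>2 \<otimes> i) \<otimes> j \<noteq> \<zero>"
    using bb j(1,2) integral[of "\<beta>1 \<otimes> (\<beta>2 \<otimes> i)" j] by auto
  \<comment> \<open>With j the inverse of \<beta>3, scaling 1 + \<beta>3 U by \<beta>1 \<beta>2 i j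
    produces the leading term of Z, hence a translate of Z. The shift differs from 0 and from 1
    because \<beta>3 differs from \<beta>1 and from \<beta>2.\<close>
  obtain B where B: "B = \<beta>1 \<otimes> (\<beta>2 \<otimes> i) \<otimes> j \<ominus> \<beta>2 \<otimes> i" "B \<in> carrier R" using w3 w1 by simp
  have bj: "\<beta>1 \<otimes> j \<ominus> \<one> \<noteq> \<zero>" "\<beta>2 \<otimes> j \<ominus> \<one> \<noteq> \<zero>"
  proof -
    have "\<beta> = \<beta>3" if "\<beta> \<in> carrier R" "\<beta> \<otimes> j = \<one>" for \<beta>
      using m_lcancel_iff[of j \<beta> \<beta>3] that j b3(2,3) by (simp add: m_comm)
    then show "\<beta>1 \<otimes> j \<ominus> \<one> \<noteq> \<zero>" "\<beta>2 \<otimes> j \<ominus> \<one> \<noteq> \<zero>" 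
      using bn b1(2) b2(2) j(1) by auto
  qed
  have "B = (\<beta>2 \<otimes> i) \<otimes> (\<beta>1 \<otimes> j \<ominus> \<one>)"
    unfolding B(1) using b1(2) b2(2) i(1) j(1) by - (rule ring_eqI, (rule reify)+, simp_all)
  then have B0: "B \<noteq> \<zero>" using integral[of "\<beta>2 \<otimes> i" "\<beta>1 \<otimes> j \<ominus> \<one>"] w1 bj(1) b1(2) j(1) by auto
  have "B \<ominus> (\<beta>1 \<ominus> \<beta>2) \<otimes> i = (\<beta>1 \<otimes> i) \<otimes> (\<beta>2 \<otimes> j \<ominus> \<one>)"
    unfolding B(1) using b1(2) b2(2) i(1) j(1) by - (rule ring_eqI, (rule reify)+, simp_all)
  then have "B \<ominus> \<one> \<noteq> \<zero>" unfolding i(3) using integral[of "\<beta>1 \<otimes> i" "\<beta>2 \<otimes> j \<ominus> \<one>"] w2 bj(2) b2(2) j(1) by auto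
  then have B1: "B \<noteq> \<one>" using B(2) by auto
  define Z where "Z U = \<beta>1 \<otimes> (\<beta>2 \<otimes> i) \<otimes> U \<oplus> \<beta>2 \<otimes> i" for U
  have e1: "(\<one> \<oplus> \<beta>1 \<otimes> U) \<otimes> (\<beta>2 \<otimes> i) = Z U" if U: "U \<in> carrier R" for U
    unfolding Z_def using U b1(2) b2(2) i(1) by - (rule ring_eqI, (rule reify)+, simp_all)
  have e2: "(\<one> \<oplus> \<beta>2 \<otimes> U) \<otimes> (\<beta>1 \<otimes> i) = Z U \<oplus> \<one>" if U: "U \<in> carrier R" for U
  proof -
    have "(\<one> \<oplus> \<beta>2 \<otimes> U) \<otimes> (\<beta>1 \<otimes> i) = (\<beta>1 \<otimes> (\<beta>2 \<otimes> i) \<otimes> U \<oplus> \<beta>2 \<otimes> i) \<oplus> (\<beta>1 \<ominus> \<beta>2) \<otimes> i"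
      using U b1(2) b2(2) i(1) by - (rule ring_eqI, (rule reify)+, simp_all)
    then show ?thesis unfolding Z_def i(3) .
  qed
  have e3: "(\<one> \<oplus> \<beta>3 \<otimes> U) \<otimes> (\<beta>1 \<otimes> (\<beta>2 \<otimes> i) \<otimes> j) = Z U \<oplus> B" if U: "U \<in> carrier R" for U
  proof -
    have "(\<one> \<oplus> \<beta>3 \<otimes> U) \<otimes> (\<beta>1 \<otimes> (\<beta>2 \<otimes> i) \<otimes> j)
        = \<beta>1 \<otimes> (\<beta>2 \<otimes> i) \<otimes> U \<otimes> (\<beta>3 \<otimes> j) \<oplus> \<beta>1 \<otimes> (\<beta>2 \<otimes> i) \<otimes> j"
      using U b1(2) b2(2) b3(2) i(1) j(1) by - (rule ring_eqI, (rule reify)+, simp_all)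
    also have "\<dots> = Z U \<oplus> B"
      unfolding Z_def B(1) j(3) using U b1(2) b2(2) b3(2) i(1) j(1) by - (rule ring_eqI, (rule reify)+, simp_all)
    finally show ?thesis .
  qed
  define d1 where "d1 = a1 \<otimes> inv a4 \<otimes> nm (\<beta>2 \<otimes> i)"
  define d2 where "d2 = a2 \<otimes> inv a4 \<otimes> nm (\<beta>1 \<otimes> i)"
  define d3 where "d3 = a3 \<otimes> inv a4 \<otimes> nm (\<beta>1 \<otimes> (\<beta>2 \<otimes> i) \<otimes> j)"
  have d1: "d1 \<in> K" "d1 \<noteq> \<zero>" unfolding d1_def by (rule div_mult_nonzero[OF mem(8,12,5,9) w1])+
  have d2: "d2 \<in> K" unfolding d2_def by (rule div_mult_nonzero[OF mem(8,12,6,10) w2])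
  have d3: "d3 \<in> K" unfolding d3_def by (rule div_mult_nonzero[OF mem(8,12,7,11) w3])
  let ?Q = "\<lambda>Z. nm Z = d1 \<and> nm (Z \<oplus> \<one>) = d2 \<and> nm (Z \<oplus> B) = d3"
  have "{U \<in> carrier R. \<forall>(B, b)\<in>T. nm (\<one> \<oplus> (B \<ominus> A4) \<otimes> U) \<otimes> a4 = b} \<subseteq> {U \<in> carrier R. ?Q (Z U)}"
  proof
    fix U assume "U \<in> {U \<in> carrier R. \<forall>(B, b)\<in>T. nm (\<one> \<oplus> (B \<ominus> A4) \<otimes> U) \<otimes> a4 = b}"
    then have U: "U \<in> carrier R" and h: "nm (\<one> \<oplus> \<beta>1 \<otimes> U) \<otimes> a4 = a1" "nm (\<one> \<oplus> \<beta>2 \<otimes> U) \<otimes> a4 = a2"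
      "nm (\<one> \<oplus> \<beta>3 \<otimes> U) \<otimes> a4 = a3"
      unfolding T4 v1 v2 v3 b1(1) b2(1) b3(1) by auto
    have V: "\<one> \<oplus> \<beta>1 \<otimes> U \<in> carrier R" "\<one> \<oplus> \<beta>2 \<otimes> U \<in> carrier R" "\<one> \<oplus> \<beta>3 \<otimes> U \<in> carrier R"
      using U b1(2) b2(2) b3(2) by auto
    have "?Q (Z U)"
      using h nm_rescale[OF aR(4) mem(12) aR(1) V(1) w1] nm_rescale[OF aR(4) mem(12) aR(2) V(2) w2]
        nm_rescale[OF aR(4) mem(12) aR(3) V(3) w3]
      unfolding e1[OF U] e2[OF U] e3[OF U] d1_def[symmetric] d2_def[symmetric] d3_def[symmetric] by blast
    then show "U \<in> {U \<in> carrier R. ?Q (Z U)}" using U by blast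
  qed
  then have "card {U \<in> carrier R. \<forall>(B, b)\<in>T. nm (\<one> \<oplus> (B \<ominus> A4) \<otimes> U) \<otimes> a4 = b} \<le> card {U \<in> carrier R. ?Q (Z U)}"
    using finite_carrier by (intro card_mono) auto
  also have "card {U \<in> carrier R. ?Q (Z U)} = card {Z \<in> carrier R. ?Q Z}"
    unfolding Z_def by (rule card_affine[OF bb w1(1)])
  also have "\<dots> \<le> 6 * (\<Sum>i<k. q ^ i)"
    by (rule three_norms_bound) (use d1 d2 d3 K_carrier B(2) B0 B1 n in auto)
  finally have "int (card {U \<in> carrier R. \<forall>(B, b)\<in>T. nm (\<one> \<oplus> (B \<ominus> A4) \<otimes> U) \<otimes> a4 = b}) \<le> int (6 * (\<Sum>i<k. q ^ i))"
    by (simp only: of_nat_le_iff)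
  moreover have "int (ng_deg R K q (Suc n) T) = int (card {U \<in> carrier R. \<forall>(B, b)\<in>T. nm (\<one> \<oplus> (B \<ominus> A4) \<otimes> U) \<otimes> a4 = b}) - xi T"
    by (rule ng_deg_eq) (use T T4 v4 in auto)
  moreover have "xi T \<ge> 0" by (simp add: xi_def)
  ultimately have "int (ng_deg R K q (Suc n) T) \<le> int (6 * (\<Sum>i<k. q ^ i))" by linarith
  then show ?thesis by (simp only: of_nat_le_iff)
qed

lemma odd_q_facts:
  assumes "odd q"
  shows "odd (card (carrier R))" "\<one> \<oplus> \<one> \<noteq> \<zero>" "\<one> \<oplus> \<one> \<in> K"
proof -
  show o: "odd (card (carrier R))" using assms unfolding cardL by simp
  show "\<one> \<oplus> \<one> \<noteq> \<zero>" using one_neq_minus_one[OF o] minus_equality[of \<one> \<one>] by auto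
  show "\<one> \<oplus> \<one> \<in> K" using K_closed by blast
qed

section \<open>Quadratic extensions and second moments\<close>

text \<open>With \<tau> = c2 - c1 - 1 the conditions say that Z and its conjugate have sum \<tau>
  and product c1. Completing the square by w = 2Z - \<tau> leaves w^2 = D and w^q = -w. A square
  root of D in \<open>K\<close> is fixed by Frobenius and so excluded unless it is 0; a non-square D
  has two roots in the extension, and Frobenius negates both.\<close>

lemma norm_count_quadratic:
  assumes n: "n = 2" and q: "odd q" and c: "c1 \<in> K" "c2 \<in> K"
  shows "int (norm_count c1 c2) = 1 - quad_char R K
    ((\<one> \<oplus> c1 \<ominus> c2) \<otimes> (\<one> \<oplus> c1 \<ominus> c2) \<ominus> (\<one> \<oplus> \<one>) \<otimes> (\<one> \<oplus> \<one>) \<otimes> c1)"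
proof -
  note two = odd_q_facts[OF q]
  define T where "T = \<one> \<oplus> \<one>"
  have T: "T \<in> carrier R" "T \<noteq> \<zero>" "T \<in> K" unfolding T_def using two by auto
  have cR: "c1 \<in> carrier R" "c2 \<in> carrier R" using c K_carrier by auto
  define \<tau> where "\<tau> = c2 \<ominus> c1 \<ominus> \<one>"
  have t: "\<tau> \<in> K" "\<tau> \<in> carrier R" unfolding \<tau>_def using c K_closed K_carrier cR by auto
  define D where "D = (\<one> \<oplus> c1 \<ominus> c2) \<otimes> (\<one> \<oplus> c1 \<ominus> c2) \<ominus> (\<one> \<oplus> \<one>) \<otimes> (\<one> \<oplus> \<one>) \<otimes> c1"
  have DK: "D \<in> K" unfolding D_def by (intro K_closed c)
  have DR: "D \<in> carrier R" using DK K_carrier by auto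
  have D: "D = \<tau> \<otimes> \<tau> \<ominus> T \<otimes> T \<otimes> c1"
    unfolding D_def \<tau>_def T_def using cR by - (rule ring_eqI, (rule reify)+, simp_all)
  have nm2: "nm Z = Z \<otimes> Z [^] q" if "Z \<in> carrier R" for Z
  proof -
    have "norm_exp = Suc q" unfolding norm_exp_def by (simp add: n numeral_2_eq_2)
    then show ?thesis using that by (simp add: nm_def m_comm)
  qed
  let ?Q = "\<lambda>w. w \<otimes> w = D \<and> w [^] q = \<ominus> w"
  have "{Z \<in> carrier R. nm Z = c1 \<and> nm (Z \<oplus> \<one>) = c2} = {Z \<in> carrier R. ?Q (T \<otimes> Z \<oplus> \<ominus> \<tau>)}"
  proof (rule Collect_cong, rule conj_cong[OF refl])
    fix Z assume Z: "Z \<in> carrier R"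
    obtain Y where Y: "Y = Z [^] q" "Y \<in> carrier R" using Z by simp
    have "(Z \<oplus> \<one>) [^] q = Y \<oplus> \<one>" using frob_add[OF Z one_closed, of 1] Y by simp
    then have l: "nm Z = c1 \<and> nm (Z \<oplus> \<one>) = c2 \<longleftrightarrow> Z \<otimes> Y = c1 \<and> (Z \<oplus> \<one>) \<otimes> (Y \<oplus> \<one>) = c2"
      using Z Y by (simp add: nm2)
    have s: "(Z \<oplus> \<one>) \<otimes> (Y \<oplus> \<one>) \<ominus> c2 = (Z \<oplus> Y \<ominus> \<tau>) \<oplus> (Z \<otimes> Y \<ominus> c1)"
      unfolding \<tau>_def using Z Y(2) cR by - (rule ring_eqI, (rule reify)+, simp_all)
    have l2: "Z \<otimes> Y = c1 \<and> (Z \<oplus> \<one>) \<otimes> (Y \<oplus> \<one>) = c2 \<longleftrightarrow> Z \<otimes> Y = c1 \<and> Z \<oplus> Y = \<tau>"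
    proof (rule conj_cong[OF refl])
      assume "Z \<otimes> Y = c1"
      then have "(Z \<oplus> \<one>) \<otimes> (Y \<oplus> \<one>) \<ominus> c2 = Z \<oplus> Y \<ominus> \<tau>" using s Z Y(2) cR t by simp
      then show "(Z \<oplus> \<one>) \<otimes> (Y \<oplus> \<one>) = c2 \<longleftrightarrow> Z \<oplus> Y = \<tau>"
        using r_right_minus_eq[of "(Z \<oplus> \<one>) \<otimes> (Y \<oplus> \<one>)" c2] r_right_minus_eq[of "Z \<oplus> Y" \<tau>] Z Y(2) cR t by simp
    qed
    have "T [^] q = T" "(\<ominus> \<tau>) [^] q = \<ominus> \<tau>" using K_iff T t K_closed(5) by auto
    then have wq: "(T \<otimes> Z \<oplus> \<ominus> \<tau>) [^] q = T \<otimes> Y \<oplus> \<ominus> \<tau>"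
      using frob_add[of "T \<otimes> Z" "\<ominus> \<tau>" 1] T Z Y t by (simp add: nat_pow_distrib)
    have i1: "T \<otimes> Y \<oplus> \<ominus> \<tau> \<ominus> (\<ominus> (T \<otimes> Z \<oplus> \<ominus> \<tau>)) = T \<otimes> (Z \<oplus> Y \<ominus> \<tau>)"
      unfolding T_def using Z Y(2) t(2) by - (rule ring_eqI, (rule reify)+, simp_all)
    have e1: "T \<otimes> Y \<oplus> \<ominus> \<tau> = \<ominus> (T \<otimes> Z \<oplus> \<ominus> \<tau>) \<longleftrightarrow> Z \<oplus> Y = \<tau>"
    proof -
      have "T \<otimes> Y \<oplus> \<ominus> \<tau> = \<ominus> (T \<otimes> Z \<oplus> \<ominus> \<tau>) \<longleftrightarrow> T \<otimes> (Z \<oplus> Y \<ominus> \<tau>) = \<zero>"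
      proof -
        have cl: "T \<otimes> Y \<oplus> \<ominus> \<tau> \<in> carrier R" "\<ominus> (T \<otimes> Z \<oplus> \<ominus> \<tau>) \<in> carrier R"
          using T(1) Z Y(2) t(2) by simp_all
        show ?thesis using r_right_minus_eq[OF cl] unfolding i1 by blast
      qed
      also have "\<dots> \<longleftrightarrow> Z \<oplus> Y \<ominus> \<tau> = \<zero>"
        using integral_iff[of T "Z \<oplus> Y \<ominus> \<tau>"] T(1,2) Z Y(2) t(2) by (metis a_closed minus_closed)
      finally show ?thesis using Z Y(2) t by simp
    qed
    have e2: "(T \<otimes> Z \<oplus> \<ominus> \<tau>) \<otimes> (T \<otimes> Z \<oplus> \<ominus> \<tau>) = D \<longleftrightarrow> Z \<otimes> Y = c1" if zy: "Z \<oplus> Y = \<tau>"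
    proof -
      have "(T \<otimes> Z \<oplus> \<ominus> \<tau>) \<otimes> (T \<otimes> Z \<oplus> \<ominus> \<tau>) \<ominus> D = (T \<otimes> T) \<otimes> (c1 \<ominus> Z \<otimes> Y)"
        unfolding D zy[symmetric] unfolding T_def using Z Y(2) cR by - (rule ring_eqI, (rule reify)+, simp_all)
      moreover have "(T \<otimes> Z \<oplus> \<ominus> \<tau>) \<otimes> (T \<otimes> Z \<oplus> \<ominus> \<tau>) \<in> carrier R" using T Z t by simp
      ultimately have "(T \<otimes> Z \<oplus> \<ominus> \<tau>) \<otimes> (T \<otimes> Z \<oplus> \<ominus> \<tau>) = D \<longleftrightarrow> (T \<otimes> T) \<otimes> (c1 \<ominus> Z \<otimes> Y) = \<zero>"
        using DR r_right_minus_eq by metis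
      also have "\<dots> \<longleftrightarrow> c1 \<ominus> Z \<otimes> Y = \<zero>"
        using integral_iff[of "T \<otimes> T" "c1 \<ominus> Z \<otimes> Y"] integral_iff[of T T] T(1,2) Z Y(2) cR(1)
        by (metis m_closed minus_closed)
      also have "\<dots> \<longleftrightarrow> Z \<otimes> Y = c1" using Z Y(2) cR by auto
      finally show ?thesis .
    qed
    show "nm Z = c1 \<and> nm (Z \<oplus> \<one>) = c2 \<longleftrightarrow> ?Q (T \<otimes> Z \<oplus> \<ominus> \<tau>)"
      unfolding l l2 wq e1 using e2 by blast
  qed
  then have "norm_count c1 c2 = card {w \<in> carrier R. ?Q w}"
    unfolding norm_count_def using card_affine[OF T(1,2), of "\<ominus> \<tau>" ?Q] t by simp
  moreover have "int (card {w \<in> carrier R. ?Q w}) = 1 - quad_char R K D"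
  proof -
    have sq: "w = y \<or> w = \<ominus> y" if "w \<in> carrier R" "y \<in> carrier R" "w \<otimes> w = y \<otimes> y" for w y
    proof -
      have "(w \<ominus> y) \<otimes> (w \<oplus> y) = w \<otimes> w \<ominus> y \<otimes> y"
        using that(1,2) by - (rule ring_eqI, (rule reify)+, simp_all)
      then have "(w \<ominus> y) \<otimes> (w \<oplus> y) = \<zero>" using that by simp
      then have "w \<ominus> y = \<zero> \<or> w \<oplus> y = \<zero>" using integral[of "w \<ominus> y" "w \<oplus> y"] that by auto
      then show ?thesis using that minus_equality[of w y] by auto
    qed
    have neg: "w = \<zero>" if "w \<in> carrier R" "w = \<ominus> w" for w
    proof -
      have "T \<otimes> w = w \<oplus> w" unfolding T_def using that(1) by (simp add: l_distr)
      also have "\<dots> = \<zero>" by (subst (2) that(2)) (use that(1) in \<open>simp add: r_neg\<close>)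
      finally show ?thesis using integral[of T w] T that by auto
    qed
    show ?thesis
    proof (cases "D = \<zero>")
      case True
      have "{w \<in> carrier R. ?Q w} = {\<zero>}"
        using True integral q_ge_2 by (auto simp: nat_pow_zero)
      then show ?thesis using True by (simp add: quad_char_def)
    next
      case D0: False
      show ?thesis
      proof (cases "\<exists>y\<in>K. D = y \<otimes> y")
        case True
        then obtain y where y: "y \<in> K" "D = y \<otimes> y" "y \<in> carrier R" using K_carrier by blast
        have False if w: "w \<in> carrier R" "w \<otimes> w = D" "w [^] q = \<ominus> w" for w
        proof -
          have "w \<in> K" using sq[OF w(1) y(3)] w(2) y K_closed(5) by auto
          then have "w = \<ominus> w" using w K_iff by auto
          then have "w = \<zero>" using neg w by blast
          then show False using w D0 by simp
        qed
        then have e: "{w \<in> carrier R. ?Q w} = {}" by blast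
        show ?thesis unfolding e using True D0 by (simp add: quad_char_def)
      next
        case False
        have w: "w [^] q = \<ominus> w" if w: "w \<in> carrier R" "w \<otimes> w = D" for w
        proof -
          have "(w [^] q) \<otimes> (w [^] q) = D [^] q" unfolding w(2)[symmetric] using w(1) by (simp add: nat_pow_distrib)
          also have "\<dots> = w \<otimes> w" using DK DR K_iff w by simp
          finally have "w [^] q = w \<or> w [^] q = \<ominus> w" using sq[of "w [^] q" w] w by simp
          moreover have "w [^] q \<noteq> w" using K_iff[OF w(1)] False w(2) by auto
          ultimately show ?thesis by blast
        qed
        then have "{w \<in> carrier R. ?Q w} = {w \<in> carrier R. w \<otimes> w = D}" by blast
        moreover have "eta D = 1"
        proof -
          \<comment> \<open>In the field of order q^2 the Euler exponent (q^2 - 1)/2 = 2r (r + 1) is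
            a multiple of q - 1 = 2r, so non-zero elements of \<open>K\<close> are squares
            there.\<close>
          obtain r where r: "q = 2 * r + 1" using q by (elim oddE)
          have c: "card (carrier R) = 2 * (2 * r * (r + 1)) + 1"
            unfolding cardL n r by (simp add: monoid_mult_class.power2_eq_square algebra_simps)
          have "D \<otimes> D [^] (2 * r) = D \<otimes> \<one>" using K_iff[OF DR] DK DR r by (simp add: m_comm)
          then have "D [^] (2 * r) = \<one>" using m_lcancel_iff[OF DR D0, of "D [^] (2 * r)" \<one>] DR by simp
          moreover have "D [^] (2 * r * (r + 1)) = (D [^] (2 * r)) [^] (r + 1)"
            using DR by (simp only: nat_pow_pow)
          ultimately have "D [^] (2 * r * (r + 1)) = \<one>" by simp
          then show ?thesis using euler_criterion(1)[OF c DR D0] by simp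
        qed
        ultimately have "int (card {w \<in> carrier R. ?Q w}) = 2" using card_sqrt[OF two(1) DR] by simp
        then show ?thesis using False D0 by (simp add: quad_char_def)
      qed
    qed
  qed
  ultimately show ?thesis unfolding D_def by simp
qed

text \<open>Two solutions \<open>Z \<noteq> W\<close> for the same pair of norms are determined by the two elements
  \<open>W / Z \<noteq> (W + 1) / (Z + 1)\<close> of norm 1, so the second moment of the counts is nearly minimal.\<close>

lemma norm_count_variance:
  assumes c: "c1 \<in> K" "c1 \<noteq> \<zero>" "c2 \<in> K" "c2 \<noteq> \<zero>"
  shows "(real (norm_count c1 c2) - (real q ^ n - 2) / (real q - 1)\<^sup>2)\<^sup>2 \<le> real q ^ n"
proof -
  \<comment> \<open>The removed elements 0 and -1 are those at which one of the two norms
    vanishes.\<close>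
  define D where "D = carrier R - {\<zero>, \<ominus> \<one>}"
  define \<phi> where "\<phi> Z = (nm Z, nm (Z \<oplus> \<one>))" for Z
  define C where "C = (K - {\<zero>}) \<times> (K - {\<zero>})"
  define cnt where "cnt c = card {Z \<in> D. \<phi> Z = c}" for c
  define E where "E = {(Z, W) \<in> D \<times> D. \<phi> Z = \<phi> W}"
  have fin: "finite D" "finite C" "finite E"
  proof -
    show D: "finite D" unfolding D_def using finite_carrier by simp
    show "finite C" unfolding C_def using finite_K by simp
    show "finite E" by (rule finite_subset[of _ "D \<times> D"]) (use D in \<open>auto simp: E_def\<close>)
  qed
  have m1: "\<ominus> \<one> \<noteq> \<zero>" by (metis minus_minus minus_zero one_closed one_not_zero)
  have p1: "Z \<oplus> \<one> = \<zero> \<longleftrightarrow> Z = \<ominus> \<one>" if "Z \<in> carrier R" for Z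
    using that minus_equality[of Z \<one>] by (auto simp: l_neg)
  have Dmem: "Z \<in> carrier R" "Z \<noteq> \<zero>" "Z \<oplus> \<one> \<noteq> \<zero>" "Z \<oplus> \<one> \<in> carrier R" if "Z \<in> D" for Z
    using that p1 unfolding D_def by auto
  have \<phi>C: "\<phi> Z \<in> C" if "Z \<in> D" for Z
    using Dmem[OF that] nm_in_K nm_eq_zero_iff unfolding \<phi>_def C_def by auto
  have cardD: "card D = q ^ n - 2"
  proof -
    have "card {\<zero>, \<ominus> \<one>} = 2" using m1[symmetric] by simp
    then show ?thesis unfolding D_def using cardL by (simp add: card_Diff_subset)
  qed
  have qn: "q ^ n \<ge> 2" using card_carrier_ge_2 cardL by simp
  have cardC: "card C = (q - 1) * (q - 1)"
    unfolding C_def using finite_K K_closed(1) cardK by (simp add: card_cartesian_product)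
  have nc: "norm_count c1 c2 = cnt (c1, c2)"
  proof -
    have "{Z \<in> carrier R. nm Z = c1 \<and> nm (Z \<oplus> \<one>) = c2} = {Z \<in> D. \<phi> Z = (c1, c2)}"
      unfolding D_def \<phi>_def using c nm_eq_zero_iff p1 by auto
    then show ?thesis unfolding norm_count_def cnt_def by simp
  qed
  have sum1: "(\<Sum>c\<in>C. cnt c) = q ^ n - 2"
  proof -
    have "(\<Sum>c\<in>C. cnt c) = card (\<Union>c\<in>C. {Z \<in> D. \<phi> Z = c})"
      unfolding cnt_def using fin by (intro card_UN_disjoint[symmetric]) auto
    also have "(\<Union>c\<in>C. {Z \<in> D. \<phi> Z = c}) = D" using \<phi>C by auto
    finally show ?thesis using cardD by simp
  qed
  have sum2: "(\<Sum>c\<in>C. cnt c * cnt c) = card E"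
  proof -
    have "(\<Sum>c\<in>C. cnt c * cnt c) = (\<Sum>c\<in>C. card ({Z \<in> D. \<phi> Z = c} \<times> {Z \<in> D. \<phi> Z = c}))"
      unfolding cnt_def by (simp add: card_cartesian_product)
    also have "\<dots> = card (\<Union>c\<in>C. {Z \<in> D. \<phi> Z = c} \<times> {Z \<in> D. \<phi> Z = c})"
      using fin by (intro card_UN_disjoint[symmetric]) auto
    also have "(\<Union>c\<in>C. {Z \<in> D. \<phi> Z = c} \<times> {Z \<in> D. \<phi> Z = c}) = E"
      unfolding E_def using \<phi>C by auto
    finally show ?thesis .
  qed
  define M1 where "M1 = {x \<in> carrier R. nm x = \<one>}"
  have M1: "card M1 = norm_exp" "finite M1" "\<one> \<in> M1"
    unfolding M1_def using card_nm_fibre[of \<one>] K_closed(2) finite_carrier by auto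
  define S where "S = (SIGMA u:M1 - {\<one>}. M1 - {\<one>, u})"
  have cardS: "card S = (norm_exp - 1) * (norm_exp - 2)"
  proof -
    have "card (M1 - {\<one>, u}) = norm_exp - 2" if "u \<in> M1 - {\<one>}" for u
      using that M1 by (subst card_Diff_subset) auto
    then have "card S = (\<Sum>u\<in>M1 - {\<one>}. norm_exp - 2)" unfolding S_def using M1 by (subst card_SigmaI) auto
    then show ?thesis using M1 by simp
  qed
  have finS: "finite S" unfolding S_def using M1 by auto
  define Off where "Off = {(Z, W) \<in> E. Z \<noteq> W}"
  have "card Off \<le> card S"
  proof (rule card_inj_on_le[OF _ _ finS])
    let ?f = "\<lambda>(Z, W). (W \<otimes> inv Z, (W \<oplus> \<one>) \<otimes> inv (Z \<oplus> \<one>))"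
    have key: "\<exists>u v. u \<in> M1 \<and> v \<in> M1 \<and> u \<noteq> \<one> \<and> v \<noteq> \<one> \<and> u \<noteq> v \<and> ?f (Z, W) = (u, v) \<and> W = u \<otimes> Z \<and> Z = (v \<ominus> \<one>) \<otimes> inv (u \<ominus> v)"
      if ZW: "(Z, W) \<in> Off" for Z W
    proof -
      have D: "Z \<in> D" "W \<in> D" "nm Z = nm W" "nm (Z \<oplus> \<one>) = nm (W \<oplus> \<one>)" "Z \<noteq> W"
        using ZW unfolding Off_def E_def \<phi>_def by auto
      note Z = Dmem[OF D(1)] and W = Dmem[OF D(2)]
      have ratio: "\<exists>u\<in>M1. y \<otimes> inv x = u \<and> y = u \<otimes> x" if xy: "x \<in> carrier R" "x \<noteq> \<zero>" "y \<in> carrier R" "nm x = nm y" for x y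
      proof -
        obtain i where i: "i = inv x" "i \<in> carrier R" "i \<otimes> x = \<one>" "x \<otimes> i = \<one>" using inv_nonzero[OF xy(1,2)] by blast
        have "nm (y \<otimes> i) = nm x \<otimes> nm i" using xy i(2) by (simp add: nm_mult)
        also have "\<dots> = \<one>" using nm_inv[OF xy(1,2)] i(1) by simp
        finally have "y \<otimes> i \<in> M1" unfolding M1_def using xy i(2) by simp
        moreover have "y = y \<otimes> i \<otimes> x" using xy(1,3) i(2,3) by (simp add: m_assoc)
        ultimately show ?thesis using i(1) by blast
      qed
      obtain u where u: "u \<in> M1" "W \<otimes> inv Z = u" "W = u \<otimes> Z" using ratio[OF Z(1,2) W(1) D(3)] by blast
      obtain v where v: "v \<in> M1" "(W \<oplus> \<one>) \<otimes> inv (Z \<oplus> \<one>) = v" "W \<oplus> \<one> = v \<otimes> (Z \<oplus> \<one>)"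
        using ratio[OF Z(4,3) W(4) D(4)] by blast
      have uR: "u \<in> carrier R" "v \<in> carrier R" using u v unfolding M1_def by auto
      have u1: "u \<noteq> \<one>" using u(3) D(5) Z by auto
      have v1: "v \<noteq> \<one>"
      proof
        assume "v = \<one>"
        then have "W \<oplus> \<one> = Z \<oplus> \<one>" using v(3) Z by simp
        then show False using D(5) Z W by simp
      qed
      \<comment> \<open>Comparing W = u Z with W + 1 = v (Z + 1) recovers Z from the two ratios,
        which makes the map into \<open>S\<close> injective.\<close>
      have lin: "(u \<ominus> v) \<otimes> Z = v \<ominus> \<one>"
      proof -
        have "(u \<ominus> v) \<otimes> Z = (u \<otimes> Z \<oplus> \<one>) \<ominus> v \<otimes> (Z \<oplus> \<one>) \<oplus> (v \<ominus> \<one>)"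
          using uR Z(1) by - (rule ring_eqI, (rule reify)+, simp_all)
        also have "u \<otimes> Z \<oplus> \<one> = v \<otimes> (Z \<oplus> \<one>)" using u(3) v(3) by simp
        finally show ?thesis using uR Z(1) by simp
      qed
      have uv: "u \<noteq> v"
      proof
        assume "u = v"
        then have "u \<ominus> v = \<zero>" using uR by simp
        then have "v \<ominus> \<one> = \<zero>" using lin Z(1) by simp
        then show False using v1 uR by simp
      qed
      have "Z = (v \<ominus> \<one>) \<otimes> inv (u \<ominus> v)"
        using eq_div_iff[of "u \<ominus> v" Z "v \<ominus> \<one>"] uv uR Z lin by (simp add: m_comm)
      then show ?thesis using u v u1 v1 uv by auto
    qed
    show "inj_on ?f Off"
    proof (rule inj_onI)
      fix x y assume xy: "x \<in> Off" "y \<in> Off" "?f x = ?f y"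
      obtain Z W Z' W' where x: "x = (Z, W)" "y = (Z', W')" by fastforce
      show "x = y" using key[of Z W] key[of Z' W'] xy unfolding x by force
    qed
    show "?f ` Off \<subseteq> S"
    proof (rule image_subsetI)
      fix x assume x: "x \<in> Off"
      obtain Z W where "x = (Z, W)" by fastforce
      then show "?f x \<in> S" using key[of Z W] x unfolding S_def by force
    qed
  qed
  moreover have "card E \<le> card D + card Off"
  proof -
    have "E \<subseteq> (\<lambda>Z. (Z, Z)) ` D \<union> Off" unfolding Off_def E_def by auto
    moreover have "finite Off" unfolding Off_def using fin by (auto intro: finite_subset[of _ E])
    ultimately have "card E \<le> card ((\<lambda>Z. (Z, Z)) ` D \<union> Off)" using fin by (intro card_mono) auto
    also have "\<dots> \<le> card ((\<lambda>Z. (Z, Z)) ` D) + card Off" by (rule card_Un_le)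
    also have "card ((\<lambda>Z. (Z, Z)) ` D) \<le> card D" by (rule card_image_le[OF fin(1)])
    finally show ?thesis by simp
  qed
  ultimately have cardE: "card E \<le> (q ^ n - 2) + (norm_exp - 1) * (norm_exp - 2)"
    using cardS cardD by linarith
  define M where "M = real norm_exp"
  define r where "r = real q - 1"
  have r: "r \<ge> 1" unfolding r_def using q_ge_2 by simp
  have M: "M \<ge> 1" unfolding M_def using norm_exp(2) by linarith
  have rM: "real q ^ n - 1 = r * M"
  proof -
    have "norm_exp * (q - 1) + 1 = q ^ n" using geometric[of n] unfolding norm_exp_def .
    then have "real (norm_exp * (q - 1) + 1) = real (q ^ n)" by (simp only:)
    then show ?thesis unfolding r_def M_def using q_ge_2 by (simp add: of_nat_diff algebra_simps)
  qed
  have off: "real ((norm_exp - 1) * (norm_exp - 2)) = (M - 1) * (M - 2)"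
  proof (cases "norm_exp = 1")
    case False
    then show ?thesis unfolding M_def using norm_exp(2) by (simp add: of_nat_diff)
  qed (simp add: M_def)
  have A: "real (q ^ n - 2) = r * M - 1" using rM qn by (simp add: of_nat_diff)
  have E: "real (card E) \<le> (r * M - 1) + (M - 1) * (M - 2)"
  proof -
    have "real (card E) \<le> real ((q ^ n - 2) + (norm_exp - 1) * (norm_exp - 2))"
      using cardE by (simp only: of_nat_le_iff)
    then show ?thesis using A off by (simp only: of_nat_add)
  qed
  \<comment> \<open>As r M = q^n - 1, this is the mean of the counts over the r^2 pairs of norms.
    The mean accounts for (M - 1/r)^2 of the second moment, and the excess is at most r M + 1 =
    q^n.\<close>
  define \<mu> where "\<mu> = (r * M - 1) / r\<^sup>2"
  have "(\<Sum>c\<in>C. (real (cnt c) - \<mu>)\<^sup>2) = (\<Sum>c\<in>C. real (cnt c * cnt c)) - 2 * \<mu> * (\<Sum>c\<in>C. real (cnt c)) + real (card C) * \<mu>\<^sup>2"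
  proof -
    have "(\<Sum>c\<in>C. (real (cnt c) - \<mu>)\<^sup>2) = (\<Sum>c\<in>C. real (cnt c * cnt c) - 2 * \<mu> * real (cnt c) + \<mu>\<^sup>2)"
      by (rule sum.cong[OF refl]) (simp only: real_square_diff semiring_1_class.of_nat_mult)
    then show ?thesis by (simp add: sum.distrib sum_subtractf sum_distrib_left)
  qed
  also have "(\<Sum>c\<in>C. real (cnt c * cnt c)) = real (card E)" unfolding sum2[symmetric] by simp
  also have "(\<Sum>c\<in>C. real (cnt c)) = r * M - 1" unfolding A[symmetric] sum1[symmetric] by simp
  also have "real (card C) = r\<^sup>2" unfolding cardC r_def using q_ge_2 by (simp add: of_nat_diff monoid_mult_class.power2_eq_square)
  also have "real (card E) - 2 * \<mu> * (r * M - 1) + r\<^sup>2 * \<mu>\<^sup>2 = real (card E) - (M - 1 / r)\<^sup>2"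
    unfolding \<mu>_def using r by (simp add: monoid_mult_class.power2_eq_square field_simps)
  also have "\<dots> \<le> r * M + 1"
  proof -
    define x where "x = M / r"
    have "(M - 1 / r)\<^sup>2 = M * M - 2 * x + (1 / r)\<^sup>2"
      unfolding x_def using r by (simp add: monoid_mult_class.power2_eq_square field_simps)
    moreover have "x \<le> M" unfolding x_def using r M by (simp add: divide_le_eq)
    moreover have "(1 / r)\<^sup>2 \<ge> 0" by simp
    moreover have "real (card E) \<le> r * M - 3 * M + 1 + M * M" using E by (simp add: algebra_simps)
    ultimately show ?thesis using M by linarith
  qed
  finally have var: "(\<Sum>c\<in>C. (real (cnt c) - \<mu>)\<^sup>2) \<le> real q ^ n" using rM by simp
  \<comment> \<open>One squared deviation is at most the sum of all of them, so the estimate holds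
    for every pair of norms and not merely on average.\<close>
  have "(c1, c2) \<in> C" unfolding C_def using c by simp
  then have "(real (cnt (c1, c2)) - \<mu>)\<^sup>2 \<le> (\<Sum>c\<in>C. (real (cnt c) - \<mu>)\<^sup>2)"
    using fin by (intro member_le_sum) auto
  with var have "(real (cnt (c1, c2)) - \<mu>)\<^sup>2 \<le> real q ^ n" by simp
  then show ?thesis unfolding nc \<mu>_def r_def[symmetric] using rM by (simp add: algebra_simps)
qed

end

section \<open>Cubic extensions\<close>

context norm_ext
begin

definition cubic :: "'a \<Rightarrow> 'a \<Rightarrow> 'a \<Rightarrow> 'a \<Rightarrow> 'a" where
  "cubic a b c x = x \<otimes> x \<otimes> x \<ominus> a \<otimes> x \<otimes> x \<oplus> b \<otimes> x \<ominus> c"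

definition cubic_disc :: "'a \<Rightarrow> 'a \<Rightarrow> 'a \<Rightarrow> 'a" where
  "cubic_disc a b c = a \<otimes> a \<otimes> b \<otimes> b \<ominus> \<guillemotleft>4\<guillemotright> \<otimes> b \<otimes> b \<otimes> b \<ominus> \<guillemotleft>4\<guillemotright> \<otimes> a \<otimes> a \<otimes> a \<otimes> c
     \<ominus> \<guillemotleft>27\<guillemotright> \<otimes> c \<otimes> c \<oplus> \<guillemotleft>18\<guillemotright> \<otimes> a \<otimes> b \<otimes> c"

definition sym3 :: "'a \<Rightarrow> 'a \<Rightarrow> 'a \<Rightarrow> 'a \<times> 'a \<times> 'a" where
  "sym3 x y z = (x \<oplus> y \<oplus> z, x \<otimes> y \<oplus> y \<otimes> z \<oplus> z \<otimes> x, x \<otimes> y \<otimes> z)"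

lemma cubic_sym3:
  assumes "x \<in> carrier R" "y \<in> carrier R" "z \<in> carrier R" "w \<in> carrier R" "(a, b, c) = sym3 x y z"
  shows "cubic a b c w = (w \<ominus> x) \<otimes> (w \<ominus> y) \<otimes> (w \<ominus> z)"
proof -
  have e: "a = x \<oplus> y \<oplus> z" "b = x \<otimes> y \<oplus> y \<otimes> z \<oplus> z \<otimes> x" "c = x \<otimes> y \<otimes> z"
    using assms(5) by (simp_all add: sym3_def)
  show ?thesis unfolding cubic_def e using assms(1-4) by - (rule ring_eqI, (rule reify)+, simp_all)
qed

lemma cubic_disc_sym3:
  assumes "x \<in> carrier R" "y \<in> carrier R" "z \<in> carrier R" "(a, b, c) = sym3 x y z"
  shows "cubic_disc a b c = ((x \<ominus> y) \<otimes> (y \<ominus> z) \<otimes> (z \<ominus> x)) \<otimes> ((x \<ominus> y) \<otimes> (y \<ominus> z) \<otimes> (z \<ominus> x))"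
proof -
  have e: "a = x \<oplus> y \<oplus> z" "b = x \<otimes> y \<oplus> y \<otimes> z \<oplus> z \<otimes> x" "c = x \<otimes> y \<otimes> z"
    using assms(4) by (simp_all add: sym3_def)
  show ?thesis unfolding cubic_disc_def e using assms(1-3) by - (rule ring_eqI, (rule reify)+, simp_all)
qed

lemma cubic_sym3_root:
  assumes "x \<in> carrier R" "y \<in> carrier R" "z \<in> carrier R" "w \<in> carrier R" "(a, b, c) = sym3 x y z"
  shows "cubic a b c w = \<zero> \<longleftrightarrow> w = x \<or> w = y \<or> w = z"
proof -
  have "(w \<ominus> x) \<otimes> (w \<ominus> y) \<otimes> (w \<ominus> z) = \<zero> \<longleftrightarrow> w \<ominus> x = \<zero> \<or> w \<ominus> y = \<zero> \<or> w \<ominus> z = \<zero>"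
    using integral_iff[of "(w \<ominus> x) \<otimes> (w \<ominus> y)" "w \<ominus> z"] integral_iff[of "w \<ominus> x" "w \<ominus> y"] assms(1-4) by simp
  then show ?thesis unfolding cubic_sym3[OF assms] using assms(1-4) by simp
qed

text \<open>The sum of the roots defines the third one; subtracting the two equations and cancelling
  x - y then yields b, and either equation yields c.\<close>

lemma cubic_two_roots:
  assumes abc: "a \<in> carrier R" "b \<in> carrier R" "c \<in> carrier R" and xy: "x \<in> carrier R" "y \<in> carrier R" "x \<noteq> y"
    and r: "cubic a b c x = \<zero>" "cubic a b c y = \<zero>"
  shows "(a, b, c) = sym3 x y (a \<ominus> x \<ominus> y)"
proof -
  define z where "z = a \<ominus> x \<ominus> y"
  have z: "z \<in> carrier R" unfolding z_def using abc xy by simp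
  have a: "a = x \<oplus> y \<oplus> z" unfolding z_def using abc(1) xy(1,2) by - (rule ring_eqI, (rule reify)+, simp_all)
  have d: "cubic a b c x \<ominus> cubic a b c y = (x \<ominus> y) \<otimes> (b \<ominus> (x \<otimes> y \<oplus> y \<otimes> z \<oplus> z \<otimes> x))"
    unfolding cubic_def a using abc(2,3) xy(1,2) z by - (rule ring_eqI, (rule reify)+, simp_all)
  have "(x \<ominus> y) \<otimes> (b \<ominus> (x \<otimes> y \<oplus> y \<otimes> z \<oplus> z \<otimes> x)) = \<zero>" unfolding d[symmetric] r by simp
  then have b: "b = x \<otimes> y \<oplus> y \<otimes> z \<oplus> z \<otimes> x"
    using integral[of "x \<ominus> y" "b \<ominus> (x \<otimes> y \<oplus> y \<otimes> z \<oplus> z \<otimes> x)"] abc xy z by auto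
  have "c = c \<oplus> cubic a b c x" using r abc by simp
  also have "\<dots> = x \<otimes> y \<otimes> z" unfolding cubic_def a b using abc(3) xy(1,2) z by - (rule ring_eqI, (rule reify)+, simp_all)
  finally show ?thesis using a b unfolding z_def[symmetric] sym3_def by simp
qed

definition roots3 :: "'a \<times> 'a \<times> 'a \<Rightarrow> 'a set" where
  "roots3 = (\<lambda>(a, b, c). {x \<in> K. cubic a b c x = \<zero>})"

lemma sym3_K: "x \<in> K \<Longrightarrow> y \<in> K \<Longrightarrow> z \<in> K \<Longrightarrow> sym3 x y z \<in> K \<times> K \<times> K"
  unfolding sym3_def by (auto intro!: K_closed)

lemma finite_roots3: "finite (roots3 e)"
  by (cases e) (auto simp: roots3_def finite_K intro: finite_subset[OF _ finite_K])

lemma roots3_mem: "x \<in> roots3 (a, b, c) \<longleftrightarrow> x \<in> K \<and> cubic a b c x = \<zero>"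
  by (simp add: roots3_def)

lemma roots3_sym3:
  assumes "x \<in> K" "y \<in> K" "z \<in> K"
  shows "roots3 (sym3 x y z) = {x, y, z}"
proof -
  obtain a b c where e: "(a, b, c) = sym3 x y z" by (metis prod_cases3)
  show ?thesis unfolding e[symmetric]
    using cubic_sym3_root[OF _ _ _ _ e] assms K_carrier by (auto simp: roots3_mem)
qed

lemma roots3_two:
  assumes e: "e \<in> K \<times> K \<times> K" and xy: "x \<in> roots3 e" "y \<in> roots3 e" "x \<noteq> y"
  shows "\<exists>z\<in>K. e = sym3 x y z"
proof -
  obtain a b c where abc: "e = (a, b, c)" "a \<in> K" "b \<in> K" "c \<in> K" using e by auto
  have x: "x \<in> K" "cubic a b c x = \<zero>" "y \<in> K" "cubic a b c y = \<zero>" using xy abc(1) by (auto simp: roots3_mem)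
  have "e = sym3 x y (a \<ominus> x \<ominus> y)"
    unfolding abc(1) by (rule cubic_two_roots) (use abc x xy(3) K_carrier in auto)
  moreover have "a \<ominus> x \<ominus> y \<in> K" by (intro K_closed abc x)
  ultimately show ?thesis by blast
qed

lemma card_roots3_le: "e \<in> K \<times> K \<times> K \<Longrightarrow> card (roots3 e) \<le> 3"
proof (cases "card (roots3 e) \<le> 1")
  case False
  assume e: "e \<in> K \<times> K \<times> K"
  obtain x y where xy: "x \<in> roots3 e" "y \<in> roots3 e" "x \<noteq> y"
    using False finite_roots3[of e] by (metis One_nat_def card_le_Suc0_iff_eq)
  obtain z where z: "z \<in> K" "e = sym3 x y z" using roots3_two[OF e xy] by blast
  have K: "x \<in> K" "y \<in> K" using xy e by (auto simp: roots3_mem)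
  have "roots3 e = {x, y, z}" unfolding z(2) by (rule roots3_sym3[OF K z(1)])
  then show ?thesis using card_insert_le_m1[of 3 "{y, z}" x] by (simp add: card_insert_if)
qed simp

text \<open>Rootless cubics are counted by inclusion-exclusion over subsets of the root set.\<close>

lemma card_rootless: "3 * card {e \<in> K \<times> K \<times> K. roots3 e = {}} + q \<le> q ^ 3"
proof -
  let ?E = "K \<times> K \<times> K"
  have finE: "finite ?E" using finite_K by simp
  have cardE: "card ?E = q ^ 3" using cardK by (simp add: card_cartesian_product power3_eq_cube)
  define r where "r e = int (card (roots3 e))" for e
  \<comment> \<open>These sets count cubics with one, two or three marked distinct roots, in order.
    They enter with alternating signs, so lower bounds for the outer two and an upper bound for the
    middle one bound the rootless cubics from above.\<close>
  define S1 where "S1 = (SIGMA e:?E. roots3 e)"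
  define S2 where "S2 = (SIGMA e:?E. SIGMA x:roots3 e. roots3 e - {x})"
  define S3 where "S3 = (SIGMA e:?E. SIGMA x:roots3 e. SIGMA y:roots3 e - {x}. roots3 e - {x, y})"
  have c2: "card (SIGMA x:roots3 e. roots3 e - {x}) = card (roots3 e) * (card (roots3 e) - 1)" for e
    using finite_roots3[of e] by (subst card_SigmaI) auto
  have c3: "card (SIGMA x:roots3 e. SIGMA y:roots3 e - {x}. roots3 e - {x, y}) = card (roots3 e) * ((card (roots3 e) - 1) * (card (roots3 e) - 2))" for e
  proof -
    have "card (SIGMA y:roots3 e - {x}. roots3 e - {x, y}) = (card (roots3 e) - 1) * (card (roots3 e) - 2)" if x: "x \<in> roots3 e" for x
    proof -
      have "card (roots3 e - {x, y}) = card (roots3 e) - 2" if "y \<in> roots3 e - {x}" for y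
        using x that by (subst card_Diff_subset) auto
      then show ?thesis using finite_roots3[of e] x by (subst card_SigmaI) auto
    qed
    then show ?thesis using finite_roots3[of e] by (subst card_SigmaI) auto
  qed
  have S: "card S1 = (\<Sum>e\<in>?E. card (roots3 e))"
    "card S2 = (\<Sum>e\<in>?E. card (roots3 e) * (card (roots3 e) - 1))"
    "card S3 = (\<Sum>e\<in>?E. card (roots3 e) * ((card (roots3 e) - 1) * (card (roots3 e) - 2)))"
    unfolding S1_def S2_def S3_def using finE finite_roots3
    by (subst card_SigmaI; auto simp: c2 c3)+
  have S1: "card S1 \<ge> q * (q * q)"
  proof -
    let ?f = "\<lambda>(x, a, b). ((a, b, x \<otimes> x \<otimes> x \<ominus> a \<otimes> x \<otimes> x \<oplus> b \<otimes> x), x)"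
    have "inj_on ?f ?E" by (auto simp: inj_on_def)
    moreover have "?f ` ?E \<subseteq> S1"
    proof (rule image_subsetI)
      fix e assume "e \<in> ?E"
      then obtain x a b where e: "e = (x, a, b)" "x \<in> K" "a \<in> K" "b \<in> K" by auto
      have "x \<otimes> x \<otimes> x \<ominus> a \<otimes> x \<otimes> x \<oplus> b \<otimes> x \<in> K" by (intro K_closed e)
      then show "?f e \<in> S1" using e K_carrier[of "x \<otimes> x \<otimes> x \<ominus> a \<otimes> x \<otimes> x \<oplus> b \<otimes> x"] by (simp add: S1_def roots3_mem cubic_def)
    qed
    moreover have "finite S1" unfolding S1_def using finE finite_roots3 by auto
    ultimately have "card ?E \<le> card S1" by (meson card_inj_on_le)
    then show ?thesis unfolding cardE by (simp add: power3_eq_cube)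
  qed
  have S2: "card S2 \<le> q * (q - 1) * q"
  proof -
    let ?A = "SIGMA x:K. (K - {x}) \<times> K"
    let ?f = "\<lambda>(x, y, z). (sym3 x y z, x, y)"
    have "S2 \<subseteq> ?f ` ?A"
    proof
      fix s assume "s \<in> S2"
      then obtain e x y where s: "s = (e, x, y)" "e \<in> ?E" "x \<in> roots3 e" "y \<in> roots3 e" "y \<noteq> x"
        unfolding S2_def by (cases s) fastforce
      then obtain z where z: "z \<in> K" "e = sym3 x y z" using roots3_two[of e x y] by blast
      have "x \<in> K" "y \<in> K" using s by (auto simp: roots3_mem)
      then have "(x, y, z) \<in> ?A" using s z by auto
      then show "s \<in> ?f ` ?A" using s(1) z(2) by force
    qed
    moreover have finA: "finite ?A" using finite_K by auto
    ultimately have "card S2 \<le> card (?f ` ?A)" by (intro card_mono) auto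
    also have "\<dots> \<le> card ?A" by (rule card_image_le[OF finA])
    also have "\<dots> = (\<Sum>x\<in>K. (q - 1) * q)"
      using finite_K cardK by (subst card_SigmaI) (auto simp: card_cartesian_product)
    finally show ?thesis using cardK by simp
  qed
  have S3: "card S3 \<ge> q * ((q - 1) * (q - 2))"
  proof -
    let ?A = "SIGMA x:K. SIGMA y:K - {x}. K - {x, y}"
    let ?f = "\<lambda>(x, y, z). (sym3 x y z, x, y, z)"
    have "card (SIGMA y:K - {x}. K - {x, y}) = (q - 1) * (q - 2)" if x: "x \<in> K" for x
    proof -
      have "card (K - {x, y}) = q - 2" if "y \<in> K - {x}" for y
        using x that cardK by (subst card_Diff_subset) auto
      then show ?thesis using finite_K cardK x by (subst card_SigmaI) auto
    qed
    then have cA: "card ?A = q * ((q - 1) * (q - 2))"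
      using finite_K cardK by (subst card_SigmaI) auto
    have "inj_on ?f ?A" by (auto simp: inj_on_def)
    moreover have "?f ` ?A \<subseteq> S3"
    proof (rule image_subsetI)
      fix p assume "p \<in> ?A"
      then obtain x y z where p: "p = (x, y, z)" "x \<in> K" "y \<in> K" "z \<in> K" "y \<noteq> x" "z \<noteq> x" "z \<noteq> y" by auto
      show "?f p \<in> S3"
        unfolding S3_def p(1) using p(2-) roots3_sym3[OF p(2-4)] sym3_K[OF p(2-4)] by simp
    qed
    moreover have "finite S3" unfolding S3_def using finE finite_roots3 by auto
    ultimately have "card ?A \<le> card S3" by (intro card_inj_on_le) auto
    then show ?thesis unfolding cA .
  qed
  \<comment> \<open>Six times the alternating sum of the binomial coefficients of r up to order
    three, which is (1 - 1)^r because r \<le> 3.\<close>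
  have six: "6 * of_bool (roots3 e = {}) = 6 - 6 * r e + 3 * (r e * (r e - 1)) - r e * ((r e - 1) * (r e - 2))"
    if e: "e \<in> ?E" for e
  proof -
    have "card (roots3 e) = 0 \<or> card (roots3 e) = 1 \<or> card (roots3 e) = 2 \<or> card (roots3 e) = 3"
      using card_roots3_le[OF e] by linarith
    moreover have "roots3 e = {} \<longleftrightarrow> card (roots3 e) = 0" using finite_roots3[of e] by simp
    ultimately show ?thesis unfolding r_def by auto
  qed
  have t2: "int (n * (n - 1)) = int n * (int n - 1)" for n :: nat
    by (cases n) (auto simp: algebra_simps distrib_right)
  have t3: "int (n * ((n - 1) * (n - 2))) = int n * ((int n - 1) * (int n - 2))" for n :: nat
    by (cases n; cases "n - 1") (auto simp: algebra_simps)
  have "6 * int (card {e \<in> ?E. roots3 e = {}}) = (\<Sum>e\<in>?E. 6 * of_bool (roots3 e = {}))"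
    using finE by (simp add: sum_distrib_left[symmetric] sum_of_bool_eq Int_def)
  also have "\<dots> = (\<Sum>e\<in>?E. 6 - 6 * r e + 3 * (r e * (r e - 1)) - r e * ((r e - 1) * (r e - 2)))"
    by (rule sum.cong[OF refl six])
  also have "\<dots> = 6 * int (card ?E) - 6 * int (card S1) + 3 * int (card S2) - int (card S3)"
    unfolding S of_nat_sum r_def t2[symmetric] t3[symmetric] by (simp add: sum.distrib sum_subtractf sum_distrib_left)
  finally have "6 * int (card {e \<in> ?E. roots3 e = {}}) \<le> 6 * int (q ^ 3) - 6 * int (q * (q * q)) + 3 * int (q * (q - 1) * q) - int (q * ((q - 1) * (q - 2)))"
    using S1 S2 S3 unfolding cardE by linarith
  also have "\<dots> = 2 * int q ^ 3 - 2 * int q"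
  proof -
    have "int (q * (q - 1) * q) = int q * (int q * (int q - 1))" using t2[of q] by (simp add: algebra_simps)
    then show ?thesis unfolding t3 by (simp add: power3_eq_cube algebra_simps)
  qed
  finally have "3 * int (card {e \<in> ?E. roots3 e = {}}) + int q \<le> int (q ^ 3)" by simp
  then show ?thesis by linarith
qed

section \<open>The quadratic character of the base field\<close>

abbreviation etaK :: "'a \<Rightarrow> int" where "etaK \<equiv> quad_char R K"

lemma finite_field_K: "finite_field (R\<lparr>carrier := K\<rparr>)"
  by (rule finite_field_subfield[OF subK])

lemma etaK_eq: "quad_char (R\<lparr>carrier := K\<rparr>) K x = etaK x"
  by (simp add: quad_char_def)

lemma card_sqrt_K:
  assumes "odd q" "x \<in> K"
  shows "int (card {y \<in> K. y \<otimes> y = x}) = 1 + etaK x"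
  using finite_field.card_sqrt[OF finite_field_K, of x] assms cardK by (simp add: etaK_eq)

lemma card_affine_K:
  assumes "a \<in> K" "a \<noteq> \<zero>" "b \<in> K"
  shows "card {x \<in> K. Q (a \<otimes> x \<oplus> b)} = card {x \<in> K. Q x}"
  using finite_field.card_affine[OF finite_field_K, of a b Q] assms by simp

text \<open>The character sum bound for \<open>K\<close> as a field in its own right, expressed in
  the operations of the large field.\<close>

lemma K_quartic_sum:
  assumes "odd q" "a0 \<in> K" "a1 \<in> K" "a2 \<in> K" "a3 \<in> K" "a4 \<in> K" "a4 \<noteq> \<zero>"
    and "\<not> (\<exists>b\<in>K. \<exists>q0\<in>K. \<exists>q1\<in>K. \<exists>q2\<in>K.
      a0 = b \<otimes> (q0 \<otimes> q0) \<and> a1 = b \<otimes> (q1 \<otimes> q0 \<oplus> q0 \<otimes> q1) \<and>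
      a2 = b \<otimes> (q2 \<otimes> q0 \<oplus> (q1 \<otimes> q1 \<oplus> q0 \<otimes> q2)) \<and> a3 = b \<otimes> (q2 \<otimes> q1 \<oplus> q1 \<otimes> q2) \<and>
      a4 = b \<otimes> (q2 \<otimes> q2))"
  shows "\<bar>real_of_int (\<Sum>x\<in>K. etaK (a0 \<oplus> x \<otimes> (a1 \<oplus> x \<otimes> (a2 \<oplus> x \<otimes> (a3 \<oplus> x \<otimes> a4)))))\<bar> \<le> 29 * sqrt (real q)"
  using finite_field.quartic_char_sum[OF finite_field_K, of a0 a1 a2 a3 a4] assms pp cardK
  unfolding finite_field.quartic_square_def[OF finite_field_K] by (simp add: etaK_eq)

lemma etaK_mult_square:
  assumes "x \<in> K" "g \<in> K" "g \<noteq> \<zero>"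
  shows "etaK (x \<otimes> (g \<otimes> g)) = etaK x"
proof -
  have R: "x \<in> carrier R" "g \<in> carrier R" using assms K_carrier by auto
  obtain i where i: "i = inv g" "i \<in> carrier R" "g \<otimes> i = \<one>" using inv_nonzero[OF R(2) assms(3)] by blast
  have iK: "i \<in> K" unfolding i(1) using assms K_closed(7) by blast
  have gg: "g \<otimes> g \<noteq> \<zero>" using integral_iff[OF R(2) R(2)] assms by simp
  then have z: "x \<otimes> (g \<otimes> g) = \<zero> \<longleftrightarrow> x = \<zero>" using integral_iff[of x "g \<otimes> g"] R by simp
  have "(\<exists>y\<in>K. x \<otimes> (g \<otimes> g) = y \<otimes> y) \<longleftrightarrow> (\<exists>y\<in>K. x = y \<otimes> y)"
  proof safe
    fix y assume y: "y \<in> K" "x \<otimes> (g \<otimes> g) = y \<otimes> y"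
    have yR: "y \<in> carrier R" using y K_carrier by auto
    have "x = x \<otimes> (g \<otimes> i) \<otimes> (g \<otimes> i)" using i R by simp
    also have "\<dots> = (x \<otimes> (g \<otimes> g)) \<otimes> (i \<otimes> i)" using R i(2) by - (rule ring_eqI, (rule reify)+, simp_all)
    also have "\<dots> = (y \<otimes> i) \<otimes> (y \<otimes> i)" unfolding y(2) using yR i(2) by - (rule ring_eqI, (rule reify)+, simp_all)
    finally show "\<exists>y\<in>K. x = y \<otimes> y" using K_closed(4)[OF y(1) iK] by blast
  next
    fix y assume y: "y \<in> K" "x = y \<otimes> y"
    have yR: "y \<in> carrier R" using y K_carrier by auto
    have "(y \<otimes> y) \<otimes> (g \<otimes> g) = (y \<otimes> g) \<otimes> (y \<otimes> g)" using yR R(2) by - (rule ring_eqI, (rule reify)+, simp_all)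
    then show "\<exists>z\<in>K. y \<otimes> y \<otimes> (g \<otimes> g) = z \<otimes> z" using K_closed(4)[OF y(1) assms(2)] by blast
  qed
  then show ?thesis unfolding quad_char_def z by simp
qed

lemma etaK_square: "y \<in> K \<Longrightarrow> y \<noteq> \<zero> \<Longrightarrow> etaK (y \<otimes> y) = 1"
  using integral_iff[of y y] K_carrier by (auto simp: quad_char_def)

section \<open>Conjugates in the cubic extension\<close>

text \<open>Up to sign, the coefficients of the characteristic polynomial of Z over \<open>K\<close>
  when n = 3.\<close>

definition conj_sym :: "'a \<Rightarrow> 'a \<times> 'a \<times> 'a" where
  "conj_sym Z = sym3 Z (Z [^] q) ((Z [^] q) [^] q)"

lemma conj_cycle:
  assumes "n = 3" "Z \<in> carrier R"
  shows "((Z [^] q) [^] q) [^] q = Z"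
proof -
  have "((Z [^] q) [^] q) [^] q = Z [^] card (carrier R)"
    unfolding cardL using assms by (simp add: nat_pow_pow power3_eq_cube)
  then show ?thesis using pow_card assms by simp
qed

lemma frob1: "x \<in> carrier R \<Longrightarrow> y \<in> carrier R \<Longrightarrow> (x \<oplus> y) [^] q = x [^] q \<oplus> y [^] q"
  "x \<in> carrier R \<Longrightarrow> y \<in> carrier R \<Longrightarrow> (x \<ominus> y) [^] q = x [^] q \<ominus> y [^] q"
  using frob_add[of x y 1] frob_minus[of x y 1] by simp_all

text \<open>Frobenius permutes the three conjugates cyclically, so if it fixes one of them they all
  coincide.\<close>

lemma conj_K:
  assumes n: "n = 3" and Z: "Z \<in> carrier R" and w: "w \<in> K" "w = Z \<or> w = Z [^] q \<or> w = (Z [^] q) [^] q"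
  shows "w = Z"
proof -
  have wq: "w [^] q = w" using w K_iff K_carrier by blast
  show ?thesis using w(2) wq conj_cycle[OF n Z] by metis
qed

lemma conj_sym_K:
  assumes n: "n = 3" and Z: "Z \<in> carrier R"
  shows "conj_sym Z \<in> K \<times> K \<times> K"
proof -
  define Y where "Y = Z [^] q"
  define X where "X = Y [^] q"
  have R: "Y \<in> carrier R" "X \<in> carrier R" unfolding X_def Y_def using Z by simp_all
  have c: "Z [^] q = Y" "Y [^] q = X" "X [^] q = Z" unfolding X_def Y_def using conj_cycle[OF n Z] by simp_all
  have "(Z \<oplus> Y \<oplus> X) [^] q = Y \<oplus> X \<oplus> Z" using Z R c by (simp add: frob1)
  also have "\<dots> = Z \<oplus> Y \<oplus> X" using Z R by - (rule ring_eqI, (rule reify)+, simp_all)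
  finally have 1: "Z \<oplus> Y \<oplus> X \<in> K" using K_iff Z R by simp
  have "(Z \<otimes> Y \<oplus> Y \<otimes> X \<oplus> X \<otimes> Z) [^] q = Y \<otimes> X \<oplus> X \<otimes> Z \<oplus> Z \<otimes> Y" using Z R c by (simp add: frob1 nat_pow_distrib)
  also have "\<dots> = Z \<otimes> Y \<oplus> Y \<otimes> X \<oplus> X \<otimes> Z" using Z R by - (rule ring_eqI, (rule reify)+, simp_all)
  finally have 2: "Z \<otimes> Y \<oplus> Y \<otimes> X \<oplus> X \<otimes> Z \<in> K" using K_iff Z R by simp
  have "(Z \<otimes> Y \<otimes> X) [^] q = Y \<otimes> X \<otimes> Z" using Z R c by (simp add: nat_pow_distrib)
  also have "\<dots> = Z \<otimes> Y \<otimes> X" using Z R by - (rule ring_eqI, (rule reify)+, simp_all)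
  finally have 3: "Z \<otimes> Y \<otimes> X \<in> K" using K_iff Z R by simp
  show ?thesis unfolding conj_sym_def sym3_def Y_def[symmetric] X_def[symmetric] using 1 2 3 by simp
qed

lemma conj_sym_root:
  assumes "Z \<in> carrier R" "w \<in> carrier R" "(a, b, c) = conj_sym Z"
  shows "cubic a b c w = \<zero> \<longleftrightarrow> w = Z \<or> w = Z [^] q \<or> w = (Z [^] q) [^] q"
  by (rule cubic_sym3_root) (use assms in \<open>simp_all add: conj_sym_def\<close>)

lemma conj_sym_fibre:
  assumes "Z \<in> carrier R" "W \<in> carrier R" "conj_sym W = conj_sym Z"
  shows "W = Z \<or> W = Z [^] q \<or> W = (Z [^] q) [^] q"
proof -
  obtain a b c where e: "(a, b, c) = conj_sym W" by (metis prod_cases3)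
  have "cubic a b c W = \<zero>" using conj_sym_root[OF assms(2,2) e] by simp
  then show ?thesis using conj_sym_root[of Z W a b c] assms e by simp
qed

text \<open>Roots are found by counting. The q^3 - q elements outside \<open>K\<close> yield
  rootless cubics, each at most three times, hence at least (q^3 - q)/3 of them; by
  \<open>card_rootless\<close> there are no others.\<close>

lemma rootless_conj_sym:
  assumes n: "n = 3" and e: "e \<in> K \<times> K \<times> K" "roots3 e = {}"
  shows "\<exists>Z\<in>carrier R. Z \<notin> K \<and> e = conj_sym Z"
proof -
  define A where "A = carrier R - K"
  define N where "N = {e \<in> K \<times> K \<times> K. roots3 e = {}}"
  have finA: "finite A" unfolding A_def using finite_carrier by simp
  have finN: "finite N" unfolding N_def using finite_K by simp
  have KR: "K \<subseteq> carrier R" using K_carrier by auto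
  have cA: "card A + q = q ^ 3"
    unfolding A_def using card_Diff_subset[OF finite_K KR] card_mono[OF finite_carrier KR] cardK cardL n by simp
  have sub: "conj_sym ` A \<subseteq> N"
  proof (rule image_subsetI)
    fix Z assume "Z \<in> A"
    then have Z: "Z \<in> carrier R" "Z \<notin> K" unfolding A_def by auto
    obtain a b c where abc: "(a, b, c) = conj_sym Z" by (metis prod_cases3)
    have "x \<notin> roots3 (conj_sym Z)" for x
    proof
      assume "x \<in> roots3 (conj_sym Z)"
      then have x: "x \<in> K" "cubic a b c x = \<zero>" unfolding abc[symmetric] by (auto simp: roots3_mem)
      then have "x = Z" using conj_sym_root[OF Z(1) _ abc] conj_K[OF n Z(1)] K_carrier by blast
      then show False using x Z by simp
    qed
    then show "conj_sym Z \<in> N" unfolding N_def using conj_sym_K[OF n Z(1)] by blast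
  qed
  have fib: "card {Z \<in> A. conj_sym Z = y} \<le> 3" if "y \<in> conj_sym ` A" for y
  proof -
    obtain Z where Z: "Z \<in> A" "y = conj_sym Z" using \<open>y \<in> conj_sym ` A\<close> by blast
    have "{W \<in> A. conj_sym W = y} \<subseteq> {Z, Z [^] q, (Z [^] q) [^] q}"
      using conj_sym_fibre[of Z] Z unfolding A_def by blast
    then have "card {W \<in> A. conj_sym W = y} \<le> card {Z, Z [^] q, (Z [^] q) [^] q}" by (intro card_mono) auto
    also have "\<dots> \<le> 3" by (simp add: card_insert_if)
    finally show ?thesis .
  qed
  have "card A = card (\<Union>y\<in>conj_sym ` A. {Z \<in> A. conj_sym Z = y})" by (rule arg_cong[of _ _ card]) auto
  also have "\<dots> \<le> (\<Sum>y\<in>conj_sym ` A. card {Z \<in> A. conj_sym Z = y})" using finA by (intro card_UN_le) simp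
  also have "\<dots> \<le> (\<Sum>y\<in>conj_sym ` A. 3)" by (rule sum_mono) (rule fib)
  finally have "card A \<le> 3 * card (conj_sym ` A)" by simp
  then have "card N \<le> card (conj_sym ` A)" using card_rootless cA unfolding N_def by linarith
  then have "conj_sym ` A = N" using sub finN by (intro card_seteq)
  moreover have "e \<in> N" unfolding N_def using e by simp
  ultimately show ?thesis unfolding A_def by blast
qed

text \<open>A cubic over \<open>K\<close> either splits off a root in \<open>K\<close>, and then everything reduces to the
  discriminant of a quadratic, or its roots are three conjugates in the cubic extension, and then
  the difference product lies in \<open>K\<close>.\<close>

lemma cubic_root_count:
  assumes n: "n = 3" and q: "odd q" and abc: "a \<in> K" "b \<in> K" "c \<in> K"
  shows "int (card {Z \<in> carrier R. conj_sym Z = (a, b, c)}) + int (card (roots3 (a, b, c)))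
    = 2 + etaK (cubic_disc a b c)"
proof (cases "roots3 (a, b, c) = {}")
  case True
  obtain Z where Z: "Z \<in> carrier R" "Z \<notin> K" "(a, b, c) = conj_sym Z"
    using rootless_conj_sym[OF n _ True] abc by auto
  define Y where "Y = Z [^] q"
  define X where "X = Y [^] q"
  have R: "Y \<in> carrier R" "X \<in> carrier R" unfolding X_def Y_def using Z by simp_all
  have c: "Z [^] q = Y" "Y [^] q = X" "X [^] q = Z" unfolding X_def Y_def using conj_cycle[OF n Z(1)] by simp_all
  have ZY: "Z \<noteq> Y" using Z(1,2) c(1) K_iff by auto
  have YX: "Y \<noteq> X" using ZY c by metis
  have XZ: "X \<noteq> Z" using YX c by metis
  have cyc: "conj_sym Y = (a, b, c)" "conj_sym X = (a, b, c)"
  proof -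
    have "sym3 Y X Z = sym3 Z Y X" "sym3 X Z Y = sym3 Z Y X" unfolding sym3_def
      using Z(1) R by (simp_all add: a_ac m_ac)
    then show "conj_sym Y = (a, b, c)" "conj_sym X = (a, b, c)" unfolding Z(3) conj_sym_def c by simp_all
  qed
  have "{W \<in> carrier R. conj_sym W = (a, b, c)} = {Z, Y, X}"
    using conj_sym_fibre[OF Z(1)] Z R cyc unfolding Y_def[symmetric] X_def[symmetric] by auto
  then have 1: "card {W \<in> carrier R. conj_sym W = (a, b, c)} = 3" using ZY YX XZ by simp
  \<comment> \<open>Frobenius permutes the factors of the difference product cyclically and thus
    fixes it. So the discriminant is a non-zero square in \<open>K\<close>, in accordance with three
    elements Z and no root in \<open>K\<close>.\<close>
  define \<delta> where "\<delta> = (Z \<ominus> Y) \<otimes> (Y \<ominus> X) \<otimes> (X \<ominus> Z)"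
  have dR: "\<delta> \<in> carrier R" unfolding \<delta>_def using Z(1) R by simp
  have "\<delta> [^] q = (Y \<ominus> X) \<otimes> (X \<ominus> Z) \<otimes> (Z \<ominus> Y)"
    unfolding \<delta>_def using Z(1) R by (simp add: nat_pow_distrib frob1 c)
  also have "\<dots> = \<delta>" unfolding \<delta>_def using Z(1) R by - (rule ring_eqI, (rule reify)+, simp_all)
  finally have dK: "\<delta> \<in> K" using K_iff dR by simp
  have d0: "\<delta> \<noteq> \<zero>" unfolding \<delta>_def using ZY YX XZ Z(1) R by (simp add: integral_iff)
  have "cubic_disc a b c = \<delta> \<otimes> \<delta>" unfolding \<delta>_def
    by (rule cubic_disc_sym3) (use Z R in \<open>simp_all add: conj_sym_def c\<close>)
  then have "etaK (cubic_disc a b c) = 1" using etaK_square[OF dK d0] by simp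
  then show ?thesis using True 1 by simp
next
  case False
  then obtain t where t: "t \<in> K" "cubic a b c t = \<zero>" by (auto simp: roots3_mem)
  have tR: "t \<in> carrier R" using t K_carrier by auto
  have R: "a \<in> carrier R" "b \<in> carrier R" "c \<in> carrier R" using abc K_carrier by auto
  \<comment> \<open>The cofactor of x - t is x^2 + \<beta> x + \<gamma>, with discriminant \<Delta>.
    The discriminant of the cubic is \<Delta> times the square of the cofactor's value
    \<open>g\<close> at t.\<close>
  define \<beta> where "\<beta> = t \<ominus> a"
  define \<gamma> where "\<gamma> = b \<oplus> t \<otimes> \<beta>"
  have bg: "\<beta> \<in> K" "\<gamma> \<in> K" unfolding \<gamma>_def \<beta>_def by (intro K_closed abc t)+
  have bgR: "\<beta> \<in> carrier R" "\<gamma> \<in> carrier R" using bg K_carrier by auto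
  have a: "a = t \<ominus> \<beta>" unfolding \<beta>_def using R(1) tR by - (rule ring_eqI, (rule reify)+, simp_all)
  have b: "b = \<gamma> \<ominus> t \<otimes> \<beta>" unfolding \<gamma>_def using R(2) tR bgR(1) by - (rule ring_eqI, (rule reify)+, simp_all)
  have "c = c \<oplus> cubic a b c t" using t R by simp
  also have "\<dots> = t \<otimes> \<gamma>" unfolding cubic_def a b using R(3) tR bgR by - (rule ring_eqI, (rule reify)+, simp_all)
  finally have c: "c = t \<otimes> \<gamma>" .
  define qd where "qd x = x \<otimes> x \<oplus> \<beta> \<otimes> x \<oplus> \<gamma>" for x
  have qdR: "qd x \<in> carrier R" if "x \<in> carrier R" for x unfolding qd_def using that bgR by simp
  have fac: "cubic a b c x = (x \<ominus> t) \<otimes> qd x" if x: "x \<in> carrier R" for x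
    unfolding cubic_def qd_def a b c using x tR bgR by - (rule ring_eqI, (rule reify)+, simp_all)
  define \<Delta> where "\<Delta> = \<beta> \<otimes> \<beta> \<ominus> \<guillemotleft>4\<guillemotright> \<otimes> \<gamma>"
  have four: "\<guillemotleft>4\<guillemotright> = (\<one> \<oplus> \<one>) \<otimes> (\<one> \<oplus> \<one>)" by (rule ring_eqI, (rule reify)+, simp_all)
  have DK: "\<Delta> \<in> K" unfolding \<Delta>_def four by (intro K_closed bg)
  have DR: "\<Delta> \<in> carrier R" using DK K_carrier by auto
  define Qd where "Qd = {x \<in> K. qd x = \<zero>}"
  note two = odd_q_facts[OF q]
  have twoR: "\<one> \<oplus> \<one> \<in> carrier R" by simp
  have cQd: "int (card Qd) = 1 + etaK \<Delta>"
  proof -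
    have "Qd = {x \<in> K. ((\<one> \<oplus> \<one>) \<otimes> x \<oplus> \<beta>) \<otimes> ((\<one> \<oplus> \<one>) \<otimes> x \<oplus> \<beta>) = \<Delta>}" unfolding Qd_def
    proof (rule Collect_cong, rule conj_cong[OF refl])
      fix x assume "x \<in> K"
      then have x: "x \<in> carrier R" using K_carrier by auto
      have e: "((\<one> \<oplus> \<one>) \<otimes> x \<oplus> \<beta>) \<otimes> ((\<one> \<oplus> \<one>) \<otimes> x \<oplus> \<beta>) \<ominus> \<Delta> = (\<one> \<oplus> \<one>) \<otimes> ((\<one> \<oplus> \<one>) \<otimes> qd x)"
        unfolding qd_def \<Delta>_def using x bgR by - (rule ring_eqI, (rule reify)+, simp_all)
      have "((\<one> \<oplus> \<one>) \<otimes> x \<oplus> \<beta>) \<otimes> ((\<one> \<oplus> \<one>) \<otimes> x \<oplus> \<beta>) = \<Delta> \<longleftrightarrow> (\<one> \<oplus> \<one>) \<otimes> ((\<one> \<oplus> \<one>) \<otimes> qd x) = \<zero>"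
        using r_right_minus_eq[of "((\<one> \<oplus> \<one>) \<otimes> x \<oplus> \<beta>) \<otimes> ((\<one> \<oplus> \<one>) \<otimes> x \<oplus> \<beta>)" \<Delta>] x bgR(1) DR unfolding e by simp
      also have "\<dots> \<longleftrightarrow> qd x = \<zero>" using qdR[OF x] two(2) twoR by (metis integral_iff m_closed)
      finally show "qd x = \<zero> \<longleftrightarrow> ((\<one> \<oplus> \<one>) \<otimes> x \<oplus> \<beta>) \<otimes> ((\<one> \<oplus> \<one>) \<otimes> x \<oplus> \<beta>) = \<Delta>" ..
    qed
    then have "card Qd = card {y \<in> K. y \<otimes> y = \<Delta>}"
      using card_affine_K[OF two(3,2) bg(1), of "\<lambda>y. y \<otimes> y = \<Delta>"] by simp
    then show ?thesis using card_sqrt_K[OF q DK] by simp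
  qed
  have finQd: "finite Qd" unfolding Qd_def using finite_K by simp
  define g where "g = qd t"
  have gK: "g \<in> K" unfolding g_def qd_def by (intro K_closed bg t)
  have gR: "g \<in> carrier R" using gK K_carrier by auto
  have disc: "cubic_disc a b c = \<Delta> \<otimes> (g \<otimes> g)"
    unfolding cubic_disc_def \<Delta>_def g_def qd_def a b c using tR bgR by - (rule ring_eqI, (rule reify)+, simp_all)
  have rts: "roots3 (a, b, c) = insert t Qd"
  proof -
    have "cubic a b c x = \<zero> \<longleftrightarrow> x = t \<or> qd x = \<zero>" if "x \<in> K" for x
      using fac[of x] integral_iff[of "x \<ominus> t" "qd x"] qdR[of x] K_carrier[OF that] tR by simp
    then show ?thesis unfolding Qd_def using t(1) by (auto simp: roots3_mem)
  qed
  have tQd: "t \<in> Qd \<longleftrightarrow> g = \<zero>" unfolding Qd_def g_def using t by simp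
  define V where "V = {Z \<in> carrier R. conj_sym Z = (a, b, c)}"
  \<comment> \<open>The root t is one of the conjugates of Z and lies in \<open>K\<close>, so it
    equals Z.\<close>
  have V: "Z = t" if "Z \<in> V" for Z
  proof -
    have Z: "Z \<in> carrier R" "(a, b, c) = conj_sym Z" using that unfolding V_def by auto
    have "t = Z" using conj_K[OF n Z(1) t(1)] conj_sym_root[OF Z(1) tR Z(2)] t(2) by blast
    then show ?thesis by simp
  qed
  have ct: "conj_sym t = sym3 t t t" unfolding conj_sym_def using K_iff[OF tR] t(1) by simp
  have tV: "t \<in> V \<longleftrightarrow> \<beta> \<oplus> t \<oplus> t = \<zero> \<and> g = \<zero>"
  proof
    assume "t \<in> V"
    then have "conj_sym t = (a, b, c)" unfolding V_def by simp
    then have e: "a = t \<oplus> t \<oplus> t" "b = t \<otimes> t \<oplus> t \<otimes> t \<oplus> t \<otimes> t" unfolding ct sym3_def by auto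
    have "\<beta> \<oplus> t \<oplus> t = \<zero>" unfolding \<beta>_def e(1) using tR by - (rule ring_eqI, (rule reify)+, simp_all)
    moreover have "g = \<zero>" unfolding g_def qd_def \<gamma>_def e(2) \<beta>_def e(1) using tR by - (rule ring_eqI, (rule reify)+, simp_all)
    ultimately show "\<beta> \<oplus> t \<oplus> t = \<zero> \<and> g = \<zero>" ..
  next
    assume h: "\<beta> \<oplus> t \<oplus> t = \<zero> \<and> g = \<zero>"
    have "\<beta> = \<beta> \<ominus> (\<beta> \<oplus> t \<oplus> t)" using h bgR by (simp add: a_minus_def)
    also have "\<dots> = \<ominus> (t \<oplus> t)" using tR bgR(1) by - (rule ring_eqI, (rule reify)+, simp_all)
    finally have be: "\<beta> = \<ominus> (t \<oplus> t)" .
    have "\<gamma> = \<gamma> \<ominus> g" using h bgR by (simp add: a_minus_def)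
    also have "\<dots> = t \<otimes> t" unfolding g_def qd_def be using tR bgR(2) by - (rule ring_eqI, (rule reify)+, simp_all)
    finally have ga: "\<gamma> = t \<otimes> t" .
    have "a = t \<oplus> t \<oplus> t" unfolding a be using tR by - (rule ring_eqI, (rule reify)+, simp_all)
    moreover have "b = t \<otimes> t \<oplus> t \<otimes> t \<oplus> t \<otimes> t" unfolding b be ga using tR by - (rule ring_eqI, (rule reify)+, simp_all)
    moreover have "c = t \<otimes> t \<otimes> t" unfolding c ga using tR by (simp add: m_assoc)
    ultimately have "conj_sym t = (a, b, c)" unfolding ct sym3_def by simp
    then show "t \<in> V" unfolding V_def using tR by simp
  qed
  have Vc: "card V = of_bool (t \<in> V)"
  proof (cases "t \<in> V")
    case True
    then have "V = {t}" using V by blast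
    then show ?thesis by simp
  next
    case False
    then have "V = {}" using V by blast
    then show ?thesis by simp
  qed
  \<comment> \<open>If \<open>g\<close> is non-zero, then \<open>V\<close> is empty and there are 1
    + (1 + \<eta>(\<Delta>)) roots. If \<open>g\<close> is zero, the discriminant vanishes and two
    cases remain: t is a triple root and adds 1 to each count, or \<Delta> is the non-zero square of
    \<beta> + 2t, \<open>V\<close> is empty and there are two roots.\<close>
  show ?thesis
  proof (cases "g = \<zero>")
    case False
    then have "card V = 0" "card (roots3 (a, b, c)) = Suc (card Qd)" using Vc tV tQd finQd rts by simp_all
    moreover have "etaK (cubic_disc a b c) = etaK \<Delta>" unfolding disc by (rule etaK_mult_square[OF DK gK False])
    ultimately show ?thesis using cQd V_def by simp
  next
    case True
    have rc: "roots3 (a, b, c) = Qd" using rts tQd True by auto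
    have e0: "etaK (cubic_disc a b c) = 0" unfolding disc True using DR by (simp add: quad_char_def)
    have "\<Delta> = \<Delta> \<oplus> \<guillemotleft>4\<guillemotright> \<otimes> g" unfolding True using DR by simp
    also have "\<dots> = (\<beta> \<oplus> t \<oplus> t) \<otimes> (\<beta> \<oplus> t \<oplus> t)"
      unfolding \<Delta>_def g_def qd_def using tR bgR by - (rule ring_eqI, (rule reify)+, simp_all)
    finally have De: "\<Delta> = (\<beta> \<oplus> t \<oplus> t) \<otimes> (\<beta> \<oplus> t \<oplus> t)" .
    have sK: "\<beta> \<oplus> t \<oplus> t \<in> K" by (intro K_closed bg t)
    show ?thesis
    proof (cases "\<beta> \<oplus> t \<oplus> t = \<zero>")
      case z: True
      have "etaK \<Delta> = 0" unfolding De z by (simp add: quad_char_def)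
      then show ?thesis using Vc tV z True rc cQd e0 V_def by simp
    next
      case z: False
      have "etaK \<Delta> = 1" unfolding De by (rule etaK_square[OF sK z])
      then show ?thesis using Vc tV z rc cQd e0 V_def by simp
    qed
  qed
qed

section \<open>The pencil of cubics with prescribed norms\<close>

definition pencil_disc :: "'a \<Rightarrow> 'a \<Rightarrow> 'a \<Rightarrow> 'a" where
  "pencil_disc c e s = cubic_disc s (e \<ominus> s) c"

text \<open>N(Z + 1) is 1 plus the three elementary symmetric functions of the conjugates of Z.
  Given N(Z) = c1, the trace s therefore determines the whole cubic, and
  \<open>cubic_root_count\<close> applies for each s. The constants 2 add up to 2q, and the members
  of the pencil have q - 2 roots altogether, which leaves q + 2.\<close>

lemma norm_count_cubic:
  assumes n: "n = 3" and q: "odd q" and c: "c1 \<in> K" "c1 \<noteq> \<zero>" "c2 \<in> K" "c2 \<noteq> \<zero>"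
  shows "int (norm_count c1 c2) = int q + 2 + (\<Sum>s\<in>K. etaK (pencil_disc c1 (c2 \<ominus> c1 \<ominus> \<one>) s))"
proof -
  define e where "e = c2 \<ominus> c1 \<ominus> \<one>"
  have eK: "e \<in> K" unfolding e_def by (intro K_closed c)
  have R: "c1 \<in> carrier R" "c2 \<in> carrier R" "e \<in> carrier R" using c eK K_carrier by auto
  define V where "V s = {Z \<in> carrier R. conj_sym Z = (s, e \<ominus> s, c1)}" for s
  have "{Z \<in> carrier R. nm Z = c1 \<and> nm (Z \<oplus> \<one>) = c2} = (\<Union>s\<in>K. V s)"
  proof (rule Set.set_eqI)
    fix Z
    show "Z \<in> {Z \<in> carrier R. nm Z = c1 \<and> nm (Z \<oplus> \<one>) = c2} \<longleftrightarrow> Z \<in> (\<Union>s\<in>K. V s)"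
    proof (cases "Z \<in> carrier R")
      case Z: True
      define Y where "Y = Z [^] q"
      define X where "X = Y [^] q"
      have YX: "Y \<in> carrier R" "X \<in> carrier R" unfolding X_def Y_def using Z by simp_all
      have ne: "norm_exp = Suc (q + q * q)" unfolding norm_exp_def by (simp add: n numeral_3_eq_3)
      have nm3: "nm W = W \<otimes> W [^] q \<otimes> (W [^] q) [^] q" if "W \<in> carrier R" for W
        unfolding nm_def ne using that by (simp add: nat_pow_mult[symmetric] nat_pow_pow m_ac)
      have nZ: "nm Z = Z \<otimes> Y \<otimes> X" using nm3[OF Z] unfolding Y_def X_def .
      have "((Z \<oplus> \<one>) [^] q) = Y \<oplus> \<one>" "(Y \<oplus> \<one>) [^] q = X \<oplus> \<one>"
        unfolding X_def using frob1(1)[OF Z one_closed] frob1(1)[OF YX(1) one_closed] by (simp_all add: Y_def)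
      then have nZ1: "nm (Z \<oplus> \<one>) = (Z \<oplus> \<one>) \<otimes> (Y \<oplus> \<one>) \<otimes> (X \<oplus> \<one>)" using nm3[of "Z \<oplus> \<one>"] Z by simp
      have cs: "conj_sym Z = (Z \<oplus> Y \<oplus> X, Z \<otimes> Y \<oplus> Y \<otimes> X \<oplus> X \<otimes> Z, Z \<otimes> Y \<otimes> X)"
        unfolding conj_sym_def sym3_def Y_def X_def ..
      have sK: "Z \<oplus> Y \<oplus> X \<in> K" using conj_sym_K[OF n Z] unfolding cs by simp
      have i1: "(Z \<oplus> \<one>) \<otimes> (Y \<oplus> \<one>) \<otimes> (X \<oplus> \<one>) \<ominus> c2 = (Z \<otimes> Y \<oplus> Y \<otimes> X \<oplus> X \<otimes> Z) \<ominus> (e \<ominus> (Z \<oplus> Y \<oplus> X)) \<oplus> (Z \<otimes> Y \<otimes> X \<ominus> c1)"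
        unfolding e_def using Z YX R(1,2) by - (rule ring_eqI, (rule reify)+, simp_all)
      have iff: "Z \<otimes> Y \<otimes> X = c1 \<Longrightarrow> (Z \<oplus> \<one>) \<otimes> (Y \<oplus> \<one>) \<otimes> (X \<oplus> \<one>) = c2 \<longleftrightarrow> Z \<otimes> Y \<oplus> Y \<otimes> X \<oplus> X \<otimes> Z = e \<ominus> (Z \<oplus> Y \<oplus> X)"
      proof -
        assume h: "Z \<otimes> Y \<otimes> X = c1"
        have cl: "(Z \<oplus> \<one>) \<otimes> (Y \<oplus> \<one>) \<otimes> (X \<oplus> \<one>) \<in> carrier R" "Z \<otimes> Y \<oplus> Y \<otimes> X \<oplus> X \<otimes> Z \<in> carrier R"
          "e \<ominus> (Z \<oplus> Y \<oplus> X) \<in> carrier R" using Z YX R by simp_all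
        have "(Z \<oplus> \<one>) \<otimes> (Y \<oplus> \<one>) \<otimes> (X \<oplus> \<one>) \<ominus> c2 = (Z \<otimes> Y \<oplus> Y \<otimes> X \<oplus> X \<otimes> Z) \<ominus> (e \<ominus> (Z \<oplus> Y \<oplus> X))"
          unfolding i1 h using R(1) cl by simp
        then show ?thesis using r_right_minus_eq[OF cl(1) R(2)] r_right_minus_eq[OF cl(2,3)] by simp
      qed
      have "Z \<in> (\<Union>s\<in>K. V s) \<longleftrightarrow> Z \<otimes> Y \<oplus> Y \<otimes> X \<oplus> X \<otimes> Z = e \<ominus> (Z \<oplus> Y \<oplus> X) \<and> Z \<otimes> Y \<otimes> X = c1"
        using Z sK unfolding V_def by (auto simp: cs)
      also have "\<dots> \<longleftrightarrow> nm Z = c1 \<and> nm (Z \<oplus> \<one>) = c2"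
        unfolding nZ nZ1 by (rule trans[OF conj_commute conj_cong[OF refl iff[symmetric]]])
      finally show ?thesis using Z by simp
    qed (auto simp: V_def)
  qed
  then have "norm_count c1 c2 = card (\<Union>s\<in>K. V s)" unfolding norm_count_def by simp
  also have "\<dots> = (\<Sum>s\<in>K. card (V s))"
  proof (rule card_UN_disjoint[OF finite_K])
    show "\<forall>s\<in>K. finite (V s)" unfolding V_def using finite_carrier by simp
    show "\<forall>s\<in>K. \<forall>s'\<in>K. s \<noteq> s' \<longrightarrow> V s \<inter> V s' = {}" unfolding V_def by auto
  qed
  finally have nc: "int (norm_count c1 c2) = (\<Sum>s\<in>K. int (card (V s)))" by simp
  \<comment> \<open>In the equation of the pencil s is linear with coefficient -x (x + 1), so each x
    in \<open>K\<close> other than 0 and -1 is a root of exactly one member. At 0 and -1 all members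
    take the non-zero values -c1 and -c2.\<close>
  have rts: "(\<Sum>s\<in>K. card (roots3 (s, e \<ominus> s, c1))) = q - 2"
  proof -
    define S where "S = (SIGMA s:K. roots3 (s, e \<ominus> s, c1))"
    have m1K: "\<ominus> \<one> \<in> K" by (intro K_closed)
    have m1: "\<ominus> \<one> \<noteq> \<zero>" by (metis minus_minus minus_zero one_closed one_not_zero)
    have dec: "cubic s (e \<ominus> s) c1 x = (x \<otimes> x \<otimes> x \<oplus> e \<otimes> x \<ominus> c1) \<ominus> s \<otimes> (x \<otimes> (x \<oplus> \<one>))"
      if "s \<in> carrier R" "x \<in> carrier R" for s x
      unfolding cubic_def using that R by - (rule ring_eqI, (rule reify)+, simp_all)
    have xx: "x \<otimes> (x \<oplus> \<one>) \<noteq> \<zero>" if "x \<in> K - {\<zero>, \<ominus> \<one>}" for x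
      using that integral_iff[of x "x \<oplus> \<one>"] K_carrier[of x] minus_equality[of x \<one>] by auto
    have root_iff: "cubic s (e \<ominus> s) c1 x = \<zero> \<longleftrightarrow> s = (x \<otimes> x \<otimes> x \<oplus> e \<otimes> x \<ominus> c1) \<otimes> inv (x \<otimes> (x \<oplus> \<one>))"
      if s: "s \<in> carrier R" and x: "x \<in> K - {\<zero>, \<ominus> \<one>}" for s x
    proof -
      have xR: "x \<in> carrier R" using x K_carrier by auto
      have "cubic s (e \<ominus> s) c1 x = \<zero> \<longleftrightarrow> s \<otimes> (x \<otimes> (x \<oplus> \<one>)) = x \<otimes> x \<otimes> x \<oplus> e \<otimes> x \<ominus> c1"
        unfolding dec[OF s xR] using s xR R r_right_minus_eq[of "x \<otimes> x \<otimes> x \<oplus> e \<otimes> x \<ominus> c1" "s \<otimes> (x \<otimes> (x \<oplus> \<one>))"]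
        by (simp add: eq_commute)
      then show ?thesis using eq_div_iff[of "x \<otimes> (x \<oplus> \<one>)" s "x \<otimes> x \<otimes> x \<oplus> e \<otimes> x \<ominus> c1"] xx[OF x] s xR R by simp
    qed
    have c0: "cubic s (e \<ominus> s) c1 \<zero> \<noteq> \<zero>" if "s \<in> carrier R" for s
    proof -
      have "cubic s (e \<ominus> s) c1 \<zero> = \<ominus> c1" unfolding cubic_def using that R by - (rule ring_eqI, (rule reify)+, simp_all)
      then show ?thesis using c(2) R by (metis minus_minus minus_zero)
    qed
    have c3: "cubic s (e \<ominus> s) c1 (\<ominus> \<one>) \<noteq> \<zero>" if "s \<in> carrier R" for s
    proof -
      have "cubic s (e \<ominus> s) c1 (\<ominus> \<one>) = \<ominus> c2" unfolding cubic_def e_def using that R(1,2) by - (rule ring_eqI, (rule reify)+, simp_all)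
      then show ?thesis using c(4) R by (metis minus_minus minus_zero)
    qed
    have "bij_betw snd S (K - {\<zero>, \<ominus> \<one>})"
    proof (rule bij_betw_imageI)
      have mem: "s \<in> carrier R \<and> x \<in> K - {\<zero>, \<ominus> \<one>} \<and> cubic s (e \<ominus> s) c1 x = \<zero>" if "(s, x) \<in> S" for s x
        using that c0[of s] c3[of s] K_carrier[of s] unfolding S_def by (auto simp: roots3_mem)
      show "inj_on snd S"
      proof (rule inj_onI)
        fix p p' assume h: "p \<in> S" "p' \<in> S" "snd p = snd p'"
        obtain s x s' x' where p: "p = (s, x)" "p' = (s', x')" by fastforce
        have "x = x'" using h(3) p by simp
        then show "p = p'" using mem[of s x] mem[of s' x'] root_iff[of s x] root_iff[of s' x] h(1,2) unfolding p by simp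
      qed
      show "snd ` S = K - {\<zero>, \<ominus> \<one>}"
      proof
        show "snd ` S \<subseteq> K - {\<zero>, \<ominus> \<one>}" using mem by auto
        show "K - {\<zero>, \<ominus> \<one>} \<subseteq> snd ` S"
        proof
          fix x assume x: "x \<in> K - {\<zero>, \<ominus> \<one>}"
          define s where "s = (x \<otimes> x \<otimes> x \<oplus> e \<otimes> x \<ominus> c1) \<otimes> inv (x \<otimes> (x \<oplus> \<one>))"
          have xK: "x \<in> K" using x by auto
          have xx1: "x \<otimes> (x \<oplus> \<one>) \<in> K" by (intro K_closed xK)
          have "s \<in> K" unfolding s_def by (intro K_closed xK eK c xx1 xx[OF x])
          moreover have "cubic s (e \<ominus> s) c1 x = \<zero>"
            using root_iff[OF _ x, of s] K_carrier[OF \<open>s \<in> K\<close>] s_def by simp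
          ultimately have "(s, x) \<in> S" unfolding S_def using xK by (simp add: roots3_mem)
          then show "x \<in> snd ` S" by force
        qed
      qed
    qed
    then have "card S = card (K - {\<zero>, \<ominus> \<one>})" by (rule bij_betw_same_card)
    also have "\<dots> = q - 2"
    proof -
      have "card {\<zero>, \<ominus> \<one>} = 2" using m1[symmetric] by simp
      then show ?thesis using m1K K_closed(1) cardK by (simp add: card_Diff_subset)
    qed
    finally show ?thesis unfolding S_def using finite_K finite_roots3 by (subst (asm) card_SigmaI) auto
  qed
  have "(\<Sum>s\<in>K. int (card (V s))) = (\<Sum>s\<in>K. 2 + etaK (pencil_disc c1 e s) - int (card (roots3 (s, e \<ominus> s, c1))))"
  proof (rule sum.cong[OF refl])
    fix s assume s: "s \<in> K"
    have "e \<ominus> s \<in> K" by (intro K_closed eK s)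
    then show "int (card (V s)) = 2 + etaK (pencil_disc c1 e s) - int (card (roots3 (s, e \<ominus> s, c1)))"
      using cubic_root_count[OF n q s _ c(1), of "e \<ominus> s"] unfolding V_def pencil_disc_def by simp
  qed
  also have "\<dots> = 2 * int q + (\<Sum>s\<in>K. etaK (pencil_disc c1 e s)) - int (q - 2)"
    unfolding rts[symmetric] by (simp add: sum.distrib sum_subtractf cardK)
  finally show ?thesis unfolding nc e_def[symmetric] using q_ge_2 by simp
qed

lemma pencil_disc_quartic:
  assumes "c \<in> carrier R" "e \<in> carrier R" "s \<in> carrier R"
  shows "pencil_disc c e s =
    (\<ominus> (\<guillemotleft>4\<guillemotright> \<otimes> e \<otimes> e \<otimes> e) \<ominus> \<guillemotleft>27\<guillemotright> \<otimes> c \<otimes> c) \<oplus> s \<otimes> ((\<guillemotleft>12\<guillemotright> \<otimes> e \<otimes> e \<oplus> \<guillemotleft>18\<guillemotright> \<otimes> e \<otimes> c) \<oplus>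
    s \<otimes> ((e \<otimes> e \<ominus> \<guillemotleft>12\<guillemotright> \<otimes> e \<ominus> \<guillemotleft>18\<guillemotright> \<otimes> c) \<oplus> s \<otimes> ((\<guillemotleft>4\<guillemotright> \<ominus> \<guillemotleft>2\<guillemotright> \<otimes> e \<ominus> \<guillemotleft>4\<guillemotright> \<otimes> c) \<oplus> s \<otimes> \<one>)))"
  unfolding pencil_disc_def cubic_disc_def using assms by - (rule ring_eqI, (rule reify)+, simp_all)

lemma of_nat_K: "\<guillemotleft>int k\<guillemotright> \<in> K"
proof -
  have "\<guillemotleft>k\<guillemotright>\<^sub>\<nat> \<in> K" by (induction k) (auto intro: K_closed)
  then show ?thesis by (simp add: of_integer_def)
qed

lemma numeral_K: "\<guillemotleft>numeral k\<guillemotright> \<in> K"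
  using of_nat_K[of "numeral k"] by simp

text \<open>Since b q2^2 = 1, the quartic is the square of s^2 + u s + v with u = b q1 q2 and v = b
  q0 q2. The coefficients of s^3 and s^2 determine u and v; that of s gives (2c + e + 1) (c - 1) (c
  + e + 2) = 0 after cancelling 4; in each of the three cases the constant coefficient forces the
  claim. Here e = -3 means c2 = -1.\<close>

lemma pencil_disc_square:
  assumes q: "odd q" and c: "c \<in> carrier R" "c \<noteq> \<zero>" and e: "e \<in> carrier R" "c \<oplus> e \<oplus> \<one> \<noteq> \<zero>"
    and bq: "b \<in> carrier R" "q0 \<in> carrier R" "q1 \<in> carrier R" "q2 \<in> carrier R"
    and a0: "\<ominus> (\<guillemotleft>4\<guillemotright> \<otimes> e \<otimes> e \<otimes> e) \<ominus> \<guillemotleft>27\<guillemotright> \<otimes> c \<otimes> c = b \<otimes> (q0 \<otimes> q0)"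
    and a1: "\<guillemotleft>12\<guillemotright> \<otimes> e \<otimes> e \<oplus> \<guillemotleft>18\<guillemotright> \<otimes> e \<otimes> c = b \<otimes> (q1 \<otimes> q0 \<oplus> q0 \<otimes> q1)"
    and a2: "e \<otimes> e \<ominus> \<guillemotleft>12\<guillemotright> \<otimes> e \<ominus> \<guillemotleft>18\<guillemotright> \<otimes> c = b \<otimes> (q2 \<otimes> q0 \<oplus> (q1 \<otimes> q1 \<oplus> q0 \<otimes> q2))"
    and a3: "\<guillemotleft>4\<guillemotright> \<ominus> \<guillemotleft>2\<guillemotright> \<otimes> e \<ominus> \<guillemotleft>4\<guillemotright> \<otimes> c = b \<otimes> (q2 \<otimes> q1 \<oplus> q1 \<otimes> q2)"
    and a4: "\<one> = b \<otimes> (q2 \<otimes> q2)"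
  shows "c = \<one> \<and> e = \<ominus> \<guillemotleft>3\<guillemotright>"
proof -
  note two = odd_q_facts[OF q]
  define T where "T = \<one> \<oplus> \<one>"
  have T: "T \<in> carrier R" "T \<noteq> \<zero>" unfolding T_def using two by auto
  have canc: "x = \<zero>" if "T \<otimes> x = \<zero>" "x \<in> carrier R" for x using integral_iff[OF T(1) that(2)] that T by simp
  define u where "u = b \<otimes> (q1 \<otimes> q2)"
  define v where "v = b \<otimes> (q0 \<otimes> q2)"
  have uv: "u \<in> carrier R" "v \<in> carrier R" unfolding u_def v_def using bq by simp_all
  have l: "x = (b \<otimes> (q2 \<otimes> q2)) \<otimes> x" if "x \<in> carrier R" for x unfolding a4[symmetric] using that by simp
  have "b \<otimes> (q0 \<otimes> q0) = (b \<otimes> (q2 \<otimes> q2)) \<otimes> (b \<otimes> (q0 \<otimes> q0))" by (rule l) (use bq in simp)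
  also have "\<dots> = v \<otimes> v" unfolding v_def using bq by - (rule ring_eqI, (rule reify)+, simp_all)
  finally have A0: "\<ominus> (\<guillemotleft>4\<guillemotright> \<otimes> e \<otimes> e \<otimes> e) \<ominus> \<guillemotleft>27\<guillemotright> \<otimes> c \<otimes> c = v \<otimes> v" using a0 by simp
  have "b \<otimes> (q1 \<otimes> q0 \<oplus> q0 \<otimes> q1) = (b \<otimes> (q2 \<otimes> q2)) \<otimes> (b \<otimes> (q1 \<otimes> q0 \<oplus> q0 \<otimes> q1))" by (rule l) (use bq in simp)
  also have "\<dots> = T \<otimes> (u \<otimes> v)" unfolding T_def u_def v_def using bq by - (rule ring_eqI, (rule reify)+, simp_all)
  finally have A1: "\<guillemotleft>12\<guillemotright> \<otimes> e \<otimes> e \<oplus> \<guillemotleft>18\<guillemotright> \<otimes> e \<otimes> c = T \<otimes> (u \<otimes> v)" using a1 by simp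
  have "b \<otimes> (q1 \<otimes> q1) = (b \<otimes> (q2 \<otimes> q2)) \<otimes> (b \<otimes> (q1 \<otimes> q1))" by (rule l) (use bq in simp)
  also have "\<dots> = u \<otimes> u" unfolding u_def using bq by - (rule ring_eqI, (rule reify)+, simp_all)
  finally have uu: "b \<otimes> (q1 \<otimes> q1) = u \<otimes> u" .
  have "b \<otimes> (q2 \<otimes> q0 \<oplus> (q1 \<otimes> q1 \<oplus> q0 \<otimes> q2)) = T \<otimes> v \<oplus> b \<otimes> (q1 \<otimes> q1)"
    unfolding T_def v_def using bq by - (rule ring_eqI, (rule reify)+, simp_all)
  then have A2: "e \<otimes> e \<ominus> \<guillemotleft>12\<guillemotright> \<otimes> e \<ominus> \<guillemotleft>18\<guillemotright> \<otimes> c = T \<otimes> v \<oplus> u \<otimes> u" using a2 uu by simp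
  have "b \<otimes> (q2 \<otimes> q1 \<oplus> q1 \<otimes> q2) = T \<otimes> u" unfolding T_def u_def using bq by - (rule ring_eqI, (rule reify)+, simp_all)
  then have A3: "\<guillemotleft>4\<guillemotright> \<ominus> \<guillemotleft>2\<guillemotright> \<otimes> e \<ominus> \<guillemotleft>4\<guillemotright> \<otimes> c = T \<otimes> u" using a3 by simp
  have "T \<otimes> (u \<ominus> (\<guillemotleft>2\<guillemotright> \<ominus> e \<ominus> \<guillemotleft>2\<guillemotright> \<otimes> c)) = T \<otimes> u \<ominus> (\<guillemotleft>4\<guillemotright> \<ominus> \<guillemotleft>2\<guillemotright> \<otimes> e \<ominus> \<guillemotleft>4\<guillemotright> \<otimes> c)"
    unfolding T_def using uv c(1) e(1) by - (rule ring_eqI, (rule reify)+, simp_all)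
  also have "\<dots> = \<zero>" unfolding A3 using T uv by simp
  finally have u: "u = \<guillemotleft>2\<guillemotright> \<ominus> e \<ominus> \<guillemotleft>2\<guillemotright> \<otimes> c"
    using canc[of "u \<ominus> (\<guillemotleft>2\<guillemotright> \<ominus> e \<ominus> \<guillemotleft>2\<guillemotright> \<otimes> c)"] uv c e by simp
  define v' where "v' = \<ominus> (\<guillemotleft>4\<guillemotright> \<otimes> e) \<ominus> \<guillemotleft>5\<guillemotright> \<otimes> c \<ominus> \<guillemotleft>2\<guillemotright> \<ominus> \<guillemotleft>2\<guillemotright> \<otimes> c \<otimes> c \<ominus> \<guillemotleft>2\<guillemotright> \<otimes> e \<otimes> c"
  have v'R: "v' \<in> carrier R" unfolding v'_def using c e by simp
  have "T \<otimes> (v \<ominus> v') = (T \<otimes> v \<oplus> u \<otimes> u) \<ominus> (e \<otimes> e \<ominus> \<guillemotleft>12\<guillemotright> \<otimes> e \<ominus> \<guillemotleft>18\<guillemotright> \<otimes> c)"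
    unfolding T_def u v'_def using uv(2) c(1) e(1) by - (rule ring_eqI, (rule reify)+, simp_all)
  also have "\<dots> = \<zero>" unfolding A2 using T uv by simp
  finally have v: "v = v'" using canc[of "v \<ominus> v'"] uv v'R by simp
  have "T \<otimes> (T \<otimes> ((\<guillemotleft>2\<guillemotright> \<otimes> c \<oplus> e \<oplus> \<one>) \<otimes> ((c \<ominus> \<one>) \<otimes> (c \<oplus> e \<oplus> \<guillemotleft>2\<guillemotright>))))
      = T \<otimes> (u \<otimes> v) \<ominus> (\<guillemotleft>12\<guillemotright> \<otimes> e \<otimes> e \<oplus> \<guillemotleft>18\<guillemotright> \<otimes> e \<otimes> c)"
    unfolding T_def u v v'_def using c(1) e(1) by - (rule ring_eqI, (rule reify)+, simp_all)
  also have "\<dots> = \<zero>" unfolding A1 using T uv by simp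
  finally have "(\<guillemotleft>2\<guillemotright> \<otimes> c \<oplus> e \<oplus> \<one>) \<otimes> ((c \<ominus> \<one>) \<otimes> (c \<oplus> e \<oplus> \<guillemotleft>2\<guillemotright>)) = \<zero>"
    using canc c(1) e(1) T(1) by simp
  then consider "\<guillemotleft>2\<guillemotright> \<otimes> c \<oplus> e \<oplus> \<one> = \<zero>" | "c \<ominus> \<one> = \<zero>" | "c \<oplus> e \<oplus> \<guillemotleft>2\<guillemotright> = \<zero>"
    using integral_iff[of "\<guillemotleft>2\<guillemotright> \<otimes> c \<oplus> e \<oplus> \<one>" "(c \<ominus> \<one>) \<otimes> (c \<oplus> e \<oplus> \<guillemotleft>2\<guillemotright>)"]
      integral_iff[of "c \<ominus> \<one>" "c \<oplus> e \<oplus> \<guillemotleft>2\<guillemotright>"] c(1) e(1) by auto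
  then show ?thesis
  proof cases
    case 1
    have "e = (\<guillemotleft>2\<guillemotright> \<otimes> c \<oplus> e \<oplus> \<one>) \<ominus> \<guillemotleft>2\<guillemotright> \<otimes> c \<ominus> \<one>" using c(1) e(1) by - (rule ring_eqI, (rule reify)+, simp_all)
    then have e': "e = \<ominus> (\<guillemotleft>2\<guillemotright> \<otimes> c) \<ominus> \<one>" unfolding 1 using c(1) by (simp add: a_minus_def)
    have "T \<otimes> (T \<otimes> (c \<otimes> ((c \<ominus> \<one>) \<otimes> ((c \<ominus> \<one>) \<otimes> (c \<ominus> \<one>))))) = v \<otimes> v \<ominus> (\<ominus> (\<guillemotleft>4\<guillemotright> \<otimes> e \<otimes> e \<otimes> e) \<ominus> \<guillemotleft>27\<guillemotright> \<otimes> c \<otimes> c)"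
      unfolding T_def v v'_def e' using c(1) by - (rule ring_eqI, (rule reify)+, simp_all)
    also have "\<dots> = \<zero>" unfolding A0 using uv by simp
    finally have "c \<otimes> ((c \<ominus> \<one>) \<otimes> ((c \<ominus> \<one>) \<otimes> (c \<ominus> \<one>))) = \<zero>" using canc c(1) T(1) by simp
    then have c1: "c = \<one>" using c by (simp add: integral_iff)
    show ?thesis unfolding e' c1 by (intro conjI refl, rule ring_eqI, (rule reify)+, simp_all)
  next
    case 2
    then have c1: "c = \<one>" using c(1) by simp
    have "T \<otimes> (T \<otimes> ((e \<oplus> \<guillemotleft>3\<guillemotright>) \<otimes> ((e \<oplus> \<guillemotleft>3\<guillemotright>) \<otimes> (e \<oplus> \<guillemotleft>3\<guillemotright>)))) = v \<otimes> v \<ominus> (\<ominus> (\<guillemotleft>4\<guillemotright> \<otimes> e \<otimes> e \<otimes> e) \<ominus> \<guillemotleft>27\<guillemotright> \<otimes> c \<otimes> c)"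
      unfolding T_def v v'_def c1 using e(1) by - (rule ring_eqI, (rule reify)+, simp_all)
    also have "\<dots> = \<zero>" unfolding A0 using uv by simp
    finally have "(e \<oplus> \<guillemotleft>3\<guillemotright>) \<otimes> ((e \<oplus> \<guillemotleft>3\<guillemotright>) \<otimes> (e \<oplus> \<guillemotleft>3\<guillemotright>)) = \<zero>" using canc e(1) T(1) of_int_closed by simp
    then have "e \<oplus> \<guillemotleft>3\<guillemotright> = \<zero>" using e(1) of_int_closed by (metis a_closed integral_iff m_closed)
    then show ?thesis using c1 e(1) of_int_closed minus_equality[of e "\<guillemotleft>3\<guillemotright>"] by metis
  next
    case 3
    have "e = (c \<oplus> e \<oplus> \<guillemotleft>2\<guillemotright>) \<ominus> c \<ominus> \<guillemotleft>2\<guillemotright>" using c(1) e(1) by - (rule ring_eqI, (rule reify)+, simp_all)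
    then have e': "e = \<ominus> c \<ominus> \<guillemotleft>2\<guillemotright>" unfolding 3 using c(1) by (simp add: a_minus_def)
    have "T \<otimes> (T \<otimes> ((\<one> \<ominus> c) \<otimes> ((c \<ominus> \<one>) \<otimes> (c \<ominus> \<one>)))) = v \<otimes> v \<ominus> (\<ominus> (\<guillemotleft>4\<guillemotright> \<otimes> e \<otimes> e \<otimes> e) \<ominus> \<guillemotleft>27\<guillemotright> \<otimes> c \<otimes> c)"
      unfolding T_def v v'_def e' using c(1) by - (rule ring_eqI, (rule reify)+, simp_all)
    also have "\<dots> = \<zero>" unfolding A0 using uv by simp
    finally have "(\<one> \<ominus> c) \<otimes> ((c \<ominus> \<one>) \<otimes> (c \<ominus> \<one>)) = \<zero>" using canc c(1) T(1) by simp
    then have c1: "c = \<one>" using c by (auto simp: integral_iff)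
    show ?thesis unfolding e' c1 by (intro conjI refl, rule ring_eqI, (rule reify)+, simp_all)
  qed
qed

lemma norm_count_cubic_bound:
  assumes n: "n = 3" and q: "odd q" and c: "c1 \<in> K" "c1 \<noteq> \<zero>" "c2 \<in> K" "c2 \<noteq> \<zero>"
    and nd: "\<not> (c1 = \<one> \<and> c2 = \<ominus> \<one>)"
  shows "\<bar>real (norm_count c1 c2) - real q\<bar> \<le> 29 * sqrt (real q) + 2"
proof -
  define e where "e = c2 \<ominus> c1 \<ominus> \<one>"
  have eK: "e \<in> K" unfolding e_def by (intro K_closed c)
  have R: "c1 \<in> carrier R" "c2 \<in> carrier R" "e \<in> carrier R" using c eK K_carrier by auto
  have c2e: "c2 = c1 \<oplus> e \<oplus> \<one>" unfolding e_def using R(1,2) by - (rule ring_eqI, (rule reify)+, simp_all)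
  define a0 where "a0 = \<ominus> (\<guillemotleft>4\<guillemotright> \<otimes> e \<otimes> e \<otimes> e) \<ominus> \<guillemotleft>27\<guillemotright> \<otimes> c1 \<otimes> c1"
  define a1 where "a1 = \<guillemotleft>12\<guillemotright> \<otimes> e \<otimes> e \<oplus> \<guillemotleft>18\<guillemotright> \<otimes> e \<otimes> c1"
  define a2 where "a2 = e \<otimes> e \<ominus> \<guillemotleft>12\<guillemotright> \<otimes> e \<ominus> \<guillemotleft>18\<guillemotright> \<otimes> c1"
  define a3 where "a3 = \<guillemotleft>4\<guillemotright> \<ominus> \<guillemotleft>2\<guillemotright> \<otimes> e \<ominus> \<guillemotleft>4\<guillemotright> \<otimes> c1"
  have aK: "a0 \<in> K" "a1 \<in> K" "a2 \<in> K" "a3 \<in> K"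
    unfolding a0_def a1_def a2_def a3_def by (intro K_closed eK c numeral_K)+
  have nsq: "\<not> (\<exists>b\<in>K. \<exists>q0\<in>K. \<exists>q1\<in>K. \<exists>q2\<in>K.
      a0 = b \<otimes> (q0 \<otimes> q0) \<and> a1 = b \<otimes> (q1 \<otimes> q0 \<oplus> q0 \<otimes> q1) \<and>
      a2 = b \<otimes> (q2 \<otimes> q0 \<oplus> (q1 \<otimes> q1 \<oplus> q0 \<otimes> q2)) \<and> a3 = b \<otimes> (q2 \<otimes> q1 \<oplus> q1 \<otimes> q2) \<and>
      \<one> = b \<otimes> (q2 \<otimes> q2))"
  proof
    assume "\<exists>b\<in>K. \<exists>q0\<in>K. \<exists>q1\<in>K. \<exists>q2\<in>K.
      a0 = b \<otimes> (q0 \<otimes> q0) \<and> a1 = b \<otimes> (q1 \<otimes> q0 \<oplus> q0 \<otimes> q1) \<and>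
      a2 = b \<otimes> (q2 \<otimes> q0 \<oplus> (q1 \<otimes> q1 \<oplus> q0 \<otimes> q2)) \<and> a3 = b \<otimes> (q2 \<otimes> q1 \<oplus> q1 \<otimes> q2) \<and>
      \<one> = b \<otimes> (q2 \<otimes> q2)"
    then obtain b q0 q1 q2 where bq: "b \<in> K" "q0 \<in> K" "q1 \<in> K" "q2 \<in> K"
      and eqs: "a0 = b \<otimes> (q0 \<otimes> q0)" "a1 = b \<otimes> (q1 \<otimes> q0 \<oplus> q0 \<otimes> q1)"
      "a2 = b \<otimes> (q2 \<otimes> q0 \<oplus> (q1 \<otimes> q1 \<oplus> q0 \<otimes> q2))" "a3 = b \<otimes> (q2 \<otimes> q1 \<oplus> q1 \<otimes> q2)"
      "\<one> = b \<otimes> (q2 \<otimes> q2)" by blast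
    have "c1 = \<one> \<and> e = \<ominus> \<guillemotleft>3\<guillemotright>"
      by (rule pencil_disc_square[OF q R(1) c(2) R(3) _ bq[THEN K_carrier] eqs[unfolded a0_def a1_def a2_def a3_def]])
         (use c(4) c2e in simp)
    then have c1: "c1 = \<one>" and e': "e = \<ominus> \<guillemotleft>3\<guillemotright>" by auto
    have "c2 = \<ominus> \<one>" unfolding c2e c1 e' by (rule ring_eqI, (rule reify)+, simp_all)
    with nd c1 show False by blast
  qed
  have "(\<Sum>s\<in>K. etaK (pencil_disc c1 e s)) = (\<Sum>s\<in>K. etaK (a0 \<oplus> s \<otimes> (a1 \<oplus> s \<otimes> (a2 \<oplus> s \<otimes> (a3 \<oplus> s \<otimes> \<one>)))))"
    by (rule sum.cong[OF refl]) (simp only: pencil_disc_quartic[OF R(1,3) K_carrier] a0_def a1_def a2_def a3_def)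
  then have "\<bar>real_of_int (\<Sum>s\<in>K. etaK (pencil_disc c1 e s))\<bar> \<le> 29 * sqrt (real q)"
    using K_quartic_sum[OF q aK K_closed(2) one_not_zero nsq] by simp
  moreover have "real (norm_count c1 c2) = real q + 2 + real_of_int (\<Sum>s\<in>K. etaK (pencil_disc c1 e s))"
    using arg_cong[OF norm_count_cubic[OF n q c], of real_of_int] unfolding e_def[symmetric] by simp
  ultimately show ?thesis by linarith
qed

text \<open>For c = 1 and e = -3 the pencil discriminant is the square of s^2 + 3s + 9, so the
  character is 1 except at the 1 + \<eta>(-27) zeros of that polynomial.\<close>

lemma norm_count_cubic_exact:
  assumes n: "n = 3" and q: "odd q"
  shows "int (norm_count \<one> (\<ominus> \<one>)) = 2 * int q + 1 - etaK (\<ominus> \<guillemotleft>3\<guillemotright>)"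
proof -
  note two = odd_q_facts[OF q]
  define e where "e = \<ominus> \<one> \<ominus> \<one> \<ominus> \<one>"
  have eR: "e \<in> carrier R" unfolding e_def by simp
  have m1: "\<ominus> \<one> \<noteq> \<zero>" by (metis minus_minus minus_zero one_closed one_not_zero)
  define h where "h s = s \<otimes> s \<oplus> \<guillemotleft>3\<guillemotright> \<otimes> s \<oplus> \<guillemotleft>9\<guillemotright>" for s
  have hK: "h s \<in> K" if "s \<in> K" for s unfolding h_def by (intro K_closed that numeral_K)
  have pd: "pencil_disc \<one> e s = h s \<otimes> h s" if "s \<in> carrier R" for s
    unfolding pencil_disc_def cubic_disc_def e_def h_def using that by - (rule ring_eqI, (rule reify)+, simp_all)
  define Z where "Z = {s \<in> K. h s = \<zero>}"
  have "(\<Sum>s\<in>K. etaK (pencil_disc \<one> e s)) = (\<Sum>s\<in>K. 1 - of_bool (h s = \<zero>))"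
  proof (rule sum.cong[OF refl])
    fix s assume s: "s \<in> K"
    show "etaK (pencil_disc \<one> e s) = 1 - of_bool (h s = \<zero>)"
      using pd[OF K_carrier[OF s]] etaK_square[OF hK[OF s]] by (cases "h s = \<zero>") (auto simp: quad_char_def)
  qed
  also have "\<dots> = int q - int (card Z)"
    unfolding Z_def using finite_K cardK by (simp add: sum_subtractf sum_of_bool_eq Int_def)
  finally have s1: "(\<Sum>s\<in>K. etaK (pencil_disc \<one> e s)) = int q - int (card Z)" .
  have "int (card Z) = 1 + etaK (\<ominus> \<guillemotleft>27\<guillemotright>)"
  proof -
    have "Z = {s \<in> K. ((\<one> \<oplus> \<one>) \<otimes> s \<oplus> \<guillemotleft>3\<guillemotright>) \<otimes> ((\<one> \<oplus> \<one>) \<otimes> s \<oplus> \<guillemotleft>3\<guillemotright>) = \<ominus> \<guillemotleft>27\<guillemotright>}" unfolding Z_def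
    proof (rule Collect_cong, rule conj_cong[OF refl])
      fix s assume "s \<in> K"
      then have s: "s \<in> carrier R" "h s \<in> carrier R" using K_carrier hK by auto
      have ne: "(\<one> \<oplus> \<one>) \<otimes> (\<one> \<oplus> \<one>) \<noteq> \<zero>" using two by (simp add: integral_iff)
      have i: "((\<one> \<oplus> \<one>) \<otimes> s \<oplus> \<guillemotleft>3\<guillemotright>) \<otimes> ((\<one> \<oplus> \<one>) \<otimes> s \<oplus> \<guillemotleft>3\<guillemotright>) \<ominus> (\<ominus> \<guillemotleft>27\<guillemotright>) = (\<one> \<oplus> \<one>) \<otimes> (\<one> \<oplus> \<one>) \<otimes> h s"
        unfolding h_def using s(1) by - (rule ring_eqI, (rule reify)+, simp_all)
      have "((\<one> \<oplus> \<one>) \<otimes> s \<oplus> \<guillemotleft>3\<guillemotright>) \<otimes> ((\<one> \<oplus> \<one>) \<otimes> s \<oplus> \<guillemotleft>3\<guillemotright>) \<in> carrier R" "\<ominus> \<guillemotleft>27\<guillemotright> \<in> carrier R" using s by simp_all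
      note r_right_minus_eq[OF this, unfolded i]
      moreover have "(\<one> \<oplus> \<one>) \<otimes> (\<one> \<oplus> \<one>) \<otimes> h s = \<zero> \<longleftrightarrow> h s = \<zero>"
        using integral_iff[of "(\<one> \<oplus> \<one>) \<otimes> (\<one> \<oplus> \<one>)" "h s"] ne s by simp
      ultimately show "h s = \<zero> \<longleftrightarrow> ((\<one> \<oplus> \<one>) \<otimes> s \<oplus> \<guillemotleft>3\<guillemotright>) \<otimes> ((\<one> \<oplus> \<one>) \<otimes> s \<oplus> \<guillemotleft>3\<guillemotright>) = \<ominus> \<guillemotleft>27\<guillemotright>" by blast
    qed
    then have "card Z = card {y \<in> K. y \<otimes> y = \<ominus> \<guillemotleft>27\<guillemotright>}"
      using card_affine_K[OF two(3,2) numeral_K, of "\<lambda>y. y \<otimes> y = \<ominus> \<guillemotleft>27\<guillemotright>"] by simp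
    then show ?thesis using card_sqrt_K[OF q K_closed(5)[OF numeral_K]] by simp
  qed
  moreover have "etaK (\<ominus> \<guillemotleft>27\<guillemotright>) = etaK (\<ominus> \<guillemotleft>3\<guillemotright>)"
  proof -
    \<comment> \<open>-27 is -3 times the square of 3; if 3 = 0, both arguments are zero.\<close>
    have i: "\<ominus> \<guillemotleft>27\<guillemotright> = \<ominus> \<guillemotleft>3\<guillemotright> \<otimes> (\<guillemotleft>3\<guillemotright> \<otimes> \<guillemotleft>3\<guillemotright>)" by (rule ring_eqI, (rule reify)+, simp_all)
    show ?thesis
    proof (cases "\<guillemotleft>3\<guillemotright> = \<zero>")
      case True
      then show ?thesis unfolding i by simp
    next
      case False
      then show ?thesis unfolding i using etaK_mult_square[OF K_closed(5)[OF numeral_K] numeral_K] by blast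
    qed
  qed
  ultimately show ?thesis
    using norm_count_cubic[OF n q K_closed(2) one_not_zero K_closed(5)[OF K_closed(2)] m1] s1 unfolding e_def by simp
qed

end

section \<open>Extensions of degree four\<close>

text \<open>Let f and f' be the two quadratics, and g and h half the sum and half the difference of
  A' f and A f'. Then g^2 - h^2 = A A' f f' is the square of P x^2 + u x + v, which differs from g
  by the constant w/2; so h^2 = (w/2) (2g - w/2). If w = 0, then h = 0 and the quadratics are
  proportional. Otherwise A' f = g + h = (h + w/2)^2 / w has discriminant zero. Comparing
  coefficients of h^2 gives \<open>XX\<close>, \<open>XY\<close> and \<open>YY\<close>.\<close>

lemma (in field) product_of_quadratics_square:
  assumes two: "\<one> \<oplus> \<one> \<noteq> \<zero>"
    and cl: "A \<in> carrier R" "B \<in> carrier R" "C \<in> carrier R" "A' \<in> carrier R" "B' \<in> carrier R" "C' \<in> carrier R"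
    and bq: "b \<in> carrier R" "q0 \<in> carrier R" "q1 \<in> carrier R" "q2 \<in> carrier R"
    and nz: "A \<noteq> \<zero>" "A' \<noteq> \<zero>"
    and a0: "C \<otimes> C' = b \<otimes> (q0 \<otimes> q0)"
    and a1: "B \<otimes> C' \<oplus> C \<otimes> B' = b \<otimes> (q1 \<otimes> q0 \<oplus> q0 \<otimes> q1)"
    and a2: "A \<otimes> C' \<oplus> B \<otimes> B' \<oplus> C \<otimes> A' = b \<otimes> (q2 \<otimes> q0 \<oplus> (q1 \<otimes> q1 \<oplus> q0 \<otimes> q2))"
    and a3: "A \<otimes> B' \<oplus> B \<otimes> A' = b \<otimes> (q2 \<otimes> q1 \<oplus> q1 \<otimes> q2)"
    and a4: "A \<otimes> A' = b \<otimes> (q2 \<otimes> q2)"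
  shows "B \<otimes> B \<ominus> (\<one> \<oplus> \<one>) \<otimes> (\<one> \<oplus> \<one>) \<otimes> A \<otimes> C = \<zero> \<or> A' \<otimes> B \<ominus> A \<otimes> B' = \<zero> \<and> A' \<otimes> C \<ominus> A \<otimes> C' = \<zero>"
proof -
  define T where "T = \<one> \<oplus> \<one>"
  have T: "T \<in> carrier R" "T \<noteq> \<zero>" unfolding T_def using two by auto
  define P where "P = A \<otimes> A'"
  have P: "P \<in> carrier R" "P \<noteq> \<zero>" unfolding P_def using cl nz integral_iff[of A A'] by auto
  have cP: "x = \<zero>" if "P \<otimes> x = \<zero>" "x \<in> carrier R" for x using integral_iff[OF P(1) that(2)] that P by simp
  have cT: "x = \<zero>" if "T \<otimes> x = \<zero>" "x \<in> carrier R" for x using integral_iff[OF T(1) that(2)] that T by simp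
  define M0 where "M0 = A' \<otimes> C \<oplus> A \<otimes> C'"
  define M1 where "M1 = A' \<otimes> B \<oplus> A \<otimes> B'"
  define X where "X = A' \<otimes> B \<ominus> A \<otimes> B'"
  define Y where "Y = A' \<otimes> C \<ominus> A \<otimes> C'"
  define u where "u = b \<otimes> (q1 \<otimes> q2)"
  define v where "v = b \<otimes> (q0 \<otimes> q2)"
  have uv: "u \<in> carrier R" "v \<in> carrier R" unfolding u_def v_def using bq by simp_all
  have MX: "M0 \<in> carrier R" "M1 \<in> carrier R" "X \<in> carrier R" "Y \<in> carrier R"
    unfolding M0_def M1_def X_def Y_def using cl by simp_all
  define w where "w = M0 \<ominus> T \<otimes> v"
  have w: "w \<in> carrier R" unfolding w_def using MX T uv by simp
  have "M1 = b \<otimes> (q2 \<otimes> q1 \<oplus> q1 \<otimes> q2)" unfolding M1_def a3[symmetric] using cl by - (rule ring_eqI, (rule reify)+, simp_all)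
  also have "\<dots> = T \<otimes> u" unfolding T_def u_def using bq by - (rule ring_eqI, (rule reify)+, simp_all)
  finally have M1u: "M1 = T \<otimes> u" .
  have "X \<otimes> X = M1 \<otimes> M1 \<oplus> T \<otimes> T \<otimes> P \<otimes> M0 \<ominus> T \<otimes> T \<otimes> P \<otimes> (A \<otimes> C' \<oplus> B \<otimes> B' \<oplus> C \<otimes> A')"
    unfolding X_def M1_def M0_def P_def T_def using cl by - (rule ring_eqI, (rule reify)+, simp_all)
  also have "\<dots> = T \<otimes> T \<otimes> P \<otimes> w"
    unfolding a2 M1u w_def P_def a4 u_def v_def using bq T(1) MX(1) by - (unfold T_def, rule ring_eqI, (rule reify)+, simp_all)
  finally have XX: "X \<otimes> X = T \<otimes> T \<otimes> P \<otimes> w" .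
  have "X \<otimes> Y = M1 \<otimes> M0 \<ominus> T \<otimes> P \<otimes> (B \<otimes> C' \<oplus> C \<otimes> B')"
    unfolding X_def Y_def M1_def M0_def P_def T_def using cl by - (rule ring_eqI, (rule reify)+, simp_all)
  also have "\<dots> = M1 \<otimes> w"
    unfolding a1 M1u w_def P_def a4 u_def v_def using bq T(1) MX(1) by - (unfold T_def, rule ring_eqI, (rule reify)+, simp_all)
  finally have XY: "X \<otimes> Y = M1 \<otimes> w" .
  have "Y \<otimes> Y = M0 \<otimes> M0 \<ominus> T \<otimes> T \<otimes> P \<otimes> (C \<otimes> C')"
    unfolding Y_def M0_def P_def T_def using cl by - (rule ring_eqI, (rule reify)+, simp_all)
  also have "\<dots> = w \<otimes> (T \<otimes> M0 \<ominus> w)"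
    unfolding a0 w_def P_def a4 v_def using bq T(1) MX(1) by - (unfold T_def, rule ring_eqI, (rule reify)+, simp_all)
  finally have YY: "Y \<otimes> Y = w \<otimes> (T \<otimes> M0 \<ominus> w)" .
  have "X = \<zero> \<and> Y = \<zero> \<or> B \<otimes> B \<ominus> T \<otimes> T \<otimes> A \<otimes> C = \<zero>"
  proof (cases "w = \<zero>")
    case True
    have "X \<otimes> X = \<zero>" "Y \<otimes> Y = \<zero>" unfolding XX YY True using T MX P by simp_all
    then show ?thesis using integral_iff MX by simp
  next
    case False
    have TTPw: "T \<otimes> T \<otimes> P \<otimes> w \<noteq> \<zero>" using T P False w by (simp add: integral_iff)
    then have X0: "X \<noteq> \<zero>" using XX by auto
    have "X \<otimes> (T \<otimes> T \<otimes> P \<otimes> Y \<ominus> M1 \<otimes> X) = T \<otimes> T \<otimes> P \<otimes> (X \<otimes> Y) \<ominus> M1 \<otimes> (X \<otimes> X)"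
      using MX T(1) P(1) by - (rule ring_eqI, (rule reify)+, simp_all)
    also have "\<dots> = \<zero>" unfolding XX XY using MX T(1) P(1) w by - (rule ring_eqI, (rule reify)+, simp_all)
    finally have e1: "T \<otimes> T \<otimes> P \<otimes> Y \<ominus> M1 \<otimes> X = \<zero>" using X0 MX T P by (simp add: integral_iff)
    have "(w \<otimes> w) \<otimes> (M1 \<otimes> M1 \<ominus> T \<otimes> T \<otimes> P \<otimes> (T \<otimes> M0 \<ominus> w)) = (M1 \<otimes> w) \<otimes> (M1 \<otimes> w) \<ominus> (T \<otimes> T \<otimes> P \<otimes> w) \<otimes> (w \<otimes> (T \<otimes> M0 \<ominus> w))"
      using MX T(1) P(1) w by - (rule ring_eqI, (rule reify)+, simp_all)
    also have "\<dots> = \<zero>" unfolding XX[symmetric] XY[symmetric] YY[symmetric] using MX by - (rule ring_eqI, (rule reify)+, simp_all)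
    finally have e2: "M1 \<otimes> M1 \<ominus> T \<otimes> T \<otimes> P \<otimes> (T \<otimes> M0 \<ominus> w) = \<zero>" using False w MX T P by (simp add: integral_iff)
    have XXw: "X \<otimes> X \<ominus> T \<otimes> T \<otimes> P \<otimes> w = \<zero>" unfolding XX using T P w by simp
    have "T \<otimes> T \<otimes> A' \<otimes> A' \<otimes> (B \<otimes> B \<ominus> T \<otimes> T \<otimes> A \<otimes> C)
      = (M1 \<oplus> X) \<otimes> (M1 \<oplus> X) \<ominus> T \<otimes> T \<otimes> T \<otimes> P \<otimes> (M0 \<oplus> Y)"
      unfolding M1_def M0_def X_def Y_def P_def T_def using cl by - (rule ring_eqI, (rule reify)+, simp_all)
    also have "\<dots> = (M1 \<otimes> M1 \<ominus> T \<otimes> T \<otimes> P \<otimes> (T \<otimes> M0 \<ominus> w)) \<oplus> (X \<otimes> X \<ominus> T \<otimes> T \<otimes> P \<otimes> w) \<ominus> T \<otimes> (T \<otimes> T \<otimes> P \<otimes> Y \<ominus> M1 \<otimes> X)"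
      using MX P(1) w unfolding T_def by - (rule ring_eqI, (rule reify)+, simp_all)
    also have "\<dots> = \<zero>" unfolding e1 e2 XXw using T by simp
    finally show ?thesis using T cl nz by (simp add: integral_iff)
  qed
  then show ?thesis unfolding X_def Y_def T_def by blast
qed

text \<open>The circle over \<open>K\<close> is parametrised by \<open>(s + w') / (s + w)\<close>, so quadratic functions on it become
  binary quadratic forms in \<open>s + w'\<close> and \<open>s + w\<close>, with conjugation exchanging the two.\<close>

lemma (in field) circle_quartic_not_square:
  assumes two: "\<one> \<oplus> \<one> \<noteq> \<zero>"
    and cl: "p \<in> carrier R" "m \<in> carrier R" "r \<in> carrier R" "p' \<in> carrier R" "m' \<in> carrier R" "r' \<in> carrier R"
    and w: "w \<in> carrier R" "w' \<in> carrier R" "w \<noteq> w'"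
    and bq: "b \<in> carrier R" "q0 \<in> carrier R" "q1 \<in> carrier R" "q2 \<in> carrier R"
    and A: "A = p \<ominus> (\<one> \<oplus> \<one>) \<otimes> m \<oplus> r" "A \<noteq> \<zero>"
    and A': "A' = p' \<ominus> (\<one> \<oplus> \<one>) \<otimes> m' \<oplus> r'" "A' \<noteq> \<zero>"
    and B: "B = (\<one> \<oplus> \<one>) \<otimes> (p \<otimes> w' \<ominus> m \<otimes> (w \<oplus> w') \<oplus> r \<otimes> w)"
    and B': "B' = (\<one> \<oplus> \<one>) \<otimes> (p' \<otimes> w' \<ominus> m' \<otimes> (w \<oplus> w') \<oplus> r' \<otimes> w)"
    and C: "C = p \<otimes> w' \<otimes> w' \<ominus> (\<one> \<oplus> \<one>) \<otimes> m \<otimes> w \<otimes> w' \<oplus> r \<otimes> w \<otimes> w"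
    and C': "C' = p' \<otimes> w' \<otimes> w' \<ominus> (\<one> \<oplus> \<one>) \<otimes> m' \<otimes> w \<otimes> w' \<oplus> r' \<otimes> w \<otimes> w"
    and disc: "m \<otimes> m \<ominus> p \<otimes> r \<noteq> \<zero>" and np: "p \<otimes> m' \<noteq> p' \<otimes> m"
    and a0: "C \<otimes> C' = b \<otimes> (q0 \<otimes> q0)"
    and a1: "B \<otimes> C' \<oplus> C \<otimes> B' = b \<otimes> (q1 \<otimes> q0 \<oplus> q0 \<otimes> q1)"
    and a2: "A \<otimes> C' \<oplus> B \<otimes> B' \<oplus> C \<otimes> A' = b \<otimes> (q2 \<otimes> q0 \<oplus> (q1 \<otimes> q1 \<oplus> q0 \<otimes> q2))"
    and a3: "A \<otimes> B' \<oplus> B \<otimes> A' = b \<otimes> (q2 \<otimes> q1 \<oplus> q1 \<otimes> q2)"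
    and a4: "A \<otimes> A' = b \<otimes> (q2 \<otimes> q2)"
  shows False
proof -
  define T where "T = \<one> \<oplus> \<one>"
  have T: "T \<in> carrier R" "T \<noteq> \<zero>" unfolding T_def using two by auto
  define D where "D = (w' \<ominus> w) \<otimes> (w' \<ominus> w)"
  have "w' \<ominus> w \<noteq> \<zero>" using w r_right_minus_eq[of w' w] by auto
  then have D: "D \<in> carrier R" "D \<noteq> \<zero>" unfolding D_def using w by (simp_all add: integral_iff)
  have R: "A \<in> carrier R" "B \<in> carrier R" "C \<in> carrier R" "A' \<in> carrier R" "B' \<in> carrier R" "C' \<in> carrier R"
    unfolding A B C A' B' C' using cl w by simp_all
  \<comment> \<open>A linear substitution multiplies the discriminant of a binary quadratic form by
    the square of its determinant, here w' - w, so the alternative of a zero discriminant is ruled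
    out.\<close>
  have "B \<otimes> B \<ominus> T \<otimes> T \<otimes> A \<otimes> C = T \<otimes> T \<otimes> (m \<otimes> m \<ominus> p \<otimes> r) \<otimes> D"
    unfolding A B C T_def D_def using cl w(1,2) by - (rule ring_eqI, (rule reify)+, simp_all)
  moreover have "\<dots> \<noteq> \<zero>" using T D disc cl by (simp add: integral_iff)
  ultimately have h: "A' \<otimes> B \<ominus> A \<otimes> B' = \<zero>" "A' \<otimes> C \<ominus> A \<otimes> C' = \<zero>"
    using product_of_quadratics_square[OF two R bq A(2) A'(2) a0 a1 a2 a3 a4] unfolding T_def by auto
  \<comment> \<open>Inverting the substitution carries the proportionality from (A, B, C) over to
    (p, m, r), against \<open>np\<close>.\<close>
  have "D \<otimes> (A' \<otimes> p \<ominus> A \<otimes> p') = (A' \<otimes> C \<ominus> A \<otimes> C') \<ominus> (A' \<otimes> B \<ominus> A \<otimes> B') \<otimes> w"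
    unfolding A(1) B C A'(1) B' C' D_def using cl w(1,2) by - (rule ring_eqI, (rule reify)+, simp_all)
  also have "\<dots> = \<zero>" unfolding h using w by simp
  finally have hp: "A' \<otimes> p \<ominus> A \<otimes> p' = \<zero>" using D cl R by (simp add: integral_iff)
  have "D \<otimes> (A' \<otimes> r \<ominus> A \<otimes> r') = (A' \<otimes> C \<ominus> A \<otimes> C') \<ominus> (A' \<otimes> B \<ominus> A \<otimes> B') \<otimes> w'"
    unfolding A(1) B C A'(1) B' C' D_def using cl w(1,2) by - (rule ring_eqI, (rule reify)+, simp_all)
  also have "\<dots> = \<zero>" unfolding h using w by simp
  finally have hr: "A' \<otimes> r \<ominus> A \<otimes> r' = \<zero>" using D cl R by (simp add: integral_iff)
  have "T \<otimes> (A' \<otimes> m \<ominus> A \<otimes> m') = (A' \<otimes> p \<ominus> A \<otimes> p') \<oplus> (A' \<otimes> r \<ominus> A \<otimes> r')"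
    unfolding A(1) A'(1) T_def using cl by - (rule ring_eqI, (rule reify)+, simp_all)
  also have "\<dots> = \<zero>" unfolding hp hr by simp
  finally have hm: "A' \<otimes> m \<ominus> A \<otimes> m' = \<zero>" using T cl R by (simp add: integral_iff)
  have "A \<otimes> (p \<otimes> m' \<ominus> p' \<otimes> m) = (A' \<otimes> p \<ominus> A \<otimes> p') \<otimes> m \<ominus> (A' \<otimes> m \<ominus> A \<otimes> m') \<otimes> p"
    using R(1,4) cl by - (rule ring_eqI, (rule reify)+, simp_all)
  also have "\<dots> = \<zero>" unfolding hp hm using cl by simp
  finally have "p \<otimes> m' \<ominus> p' \<otimes> m = \<zero>" using A(2) cl R by (simp add: integral_iff)
  then show False using np cl by simp
qed

context norm_ext
begin

section \<open>The intermediate field of order q^2\<close>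

definition quad_ext :: "'a set" where
  "quad_ext = {x \<in> carrier R. (x [^] q) [^] q = x}"

text \<open>The non-zero fixed points of the power q^2 solve x^(q^2 - 1) = 1. As q^2 - 1 divides q^4
  - 1, \<open>card_pow_fibre\<close> counts them exactly.\<close>

lemma norm_ext_quad_ext:
  assumes n: "n = 4"
  shows "norm_ext R quad_ext (q * q) 2"
proof -
  have pp2: "x [^] (q * q) = (x [^] q) [^] q" if "x \<in> carrier R" for x using that by (simp add: nat_pow_pow)
  have mem: "x \<in> quad_ext \<longleftrightarrow> x [^] (q ^ 2) = x" if "x \<in> carrier R" for x
    unfolding quad_ext_def using that pp2 by (simp add: monoid_mult_class.power2_eq_square)
  have sub: "quad_ext \<subseteq> carrier R" unfolding quad_ext_def by auto
  have q0: "q ^ 2 > 0" using q_ge_2 by simp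
  have z: "\<zero> [^] (q ^ 2) = \<zero>" using q0 by (simp add: nat_pow_zero)
  have "subring quad_ext R"
  proof (rule subringI[OF sub])
    show "\<one> \<in> quad_ext" using mem by simp
    show "\<ominus> h \<in> quad_ext" if h: "h \<in> quad_ext" for h
    proof -
      have hR: "h \<in> carrier R" using h sub by auto
      then have "(\<zero> \<ominus> h) [^] (q ^ 2) = \<zero> \<ominus> h" using frob_minus[of \<zero> h 2] h mem[of h] z by simp
      then show ?thesis using hR mem[of "\<ominus> h"] by (simp add: a_minus_def)
    qed
    show "h1 \<otimes> h2 \<in> quad_ext" if h: "h1 \<in> quad_ext" "h2 \<in> quad_ext" for h1 h2
    proof -
      have hR: "h1 \<in> carrier R" "h2 \<in> carrier R" using h sub by auto
      then show ?thesis using h mem[of h1] mem[of h2] mem[of "h1 \<otimes> h2"] nat_pow_distrib[of h1 h2 "q ^ 2"] by simp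
    qed
    show "h1 \<oplus> h2 \<in> quad_ext" if h: "h1 \<in> quad_ext" "h2 \<in> quad_ext" for h1 h2
    proof -
      have hR: "h1 \<in> carrier R" "h2 \<in> carrier R" using h sub by auto
      then show ?thesis using h mem[of h1] mem[of h2] mem[of "h1 \<oplus> h2"] frob_add[of h1 h2 2] by simp
    qed
  qed
  then have sf: "subfield quad_ext R"
  proof (rule subfieldI')
    fix k assume k: "k \<in> quad_ext - {\<zero>}"
    then have kR: "k \<in> carrier R" "k \<noteq> \<zero>" using sub by auto
    obtain i where i: "i = inv k" "i \<in> carrier R" "k \<otimes> i = \<one>" using inv_nonzero[OF kR] by blast
    have "k \<otimes> i [^] (q ^ 2) = (k \<otimes> i) [^] (q ^ 2)" using k mem[OF kR(1)] kR i(2) by (simp add: nat_pow_distrib)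
    also have "\<dots> = k \<otimes> i" unfolding i(3) by simp
    finally have "i [^] (q ^ 2) = i" using m_lcancel[OF kR(2,1), of "i [^] (q ^ 2)" i] i(2) by simp
    then show "inv k \<in> quad_ext" using mem[OF i(2)] i(1) by simp
  qed
  have "q \<noteq> 0" using q_ge_2 by simp
  then obtain d where d: "q ^ 2 = Suc d" using q0 by (metis Suc_pred')
  have "q ^ 4 = q ^ 2 * q ^ 2" by (simp flip: power_add)
  then have dd: "card (carrier R) - 1 = d * (d + 2)" unfolding cardL n d by simp
  have "(1 :: nat) < 2 ^ 2" by simp
  also have "(2 :: nat) ^ 2 \<le> q ^ 2" using q_ge_2 by (rule power_mono) simp
  finally have d0: "d > 0" using d by simp
  have "quad_ext = insert \<zero> {x \<in> carrier R. x [^] d = \<one>}"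
  proof (rule Set.set_eqI)
    fix x
    show "x \<in> quad_ext \<longleftrightarrow> x \<in> insert \<zero> {x \<in> carrier R. x [^] d = \<one>}"
    proof (cases "x \<in> carrier R")
      case x: True
      show ?thesis
      proof (cases "x = \<zero>")
        case True
        then show ?thesis using mem[of \<zero>] z by simp
      next
        case False
        have "x [^] (q ^ 2) = x \<otimes> x [^] d" unfolding d using x by (simp add: m_comm)
        then show ?thesis using m_lcancel[OF False x, of "x [^] d" \<one>] mem[OF x] x False by simp
      qed
    qed (use sub in auto)
  qed
  moreover have "\<zero> \<notin> {x \<in> carrier R. x [^] d = \<one>}" using d0 by (simp add: nat_pow_zero)
  moreover have "card {x \<in> carrier R. x [^] d = \<one>} = d" using card_pow_fibre[OF dd, of \<one>] by simp
  ultimately have c: "card quad_ext = q * q" using finite_carrier d by (simp add: monoid_mult_class.power2_eq_square)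
  obtain p k where pk: "prime p" "k > 0" "q = p ^ k" using pp unfolding primepow_def by auto
  then have "q * q = p ^ (k + k)" by (simp add: power_add)
  then have "primepow (q * q)" using pk(1,2) unfolding primepow_def by (metis add_gr_0)
  moreover have "card (carrier R) = (q * q) ^ 2" unfolding cardL n by (simp add: monoid_mult_class.power2_eq_square power4_eq_xxxx mult.assoc)
  ultimately show ?thesis using sf c by (intro norm_ext.intro finite_field_axioms norm_ext_axioms.intro) simp_all
qed

text \<open>Euler's criterion with (q^2 - 1)/2 = (q + 1) (q - 1)/2: the power q + 1 is the norm down
  to \<open>K\<close>, and what remains is the exponent of the criterion in
  \<open>K\<close>.\<close>

lemma quad_char_quad_ext:
  assumes n: "n = 4" and q: "odd q" and x: "x \<in> quad_ext"
  shows "quad_char R quad_ext x = etaK (x \<otimes> x [^] q)"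
proof -
  interpret F: norm_ext R quad_ext "q * q" 2 by (rule norm_ext_quad_ext[OF n])
  have xR: "x \<in> carrier R" "(x [^] q) [^] q = x" using x unfolding quad_ext_def by auto
  define y where "y = x \<otimes> x [^] q"
  have yR: "y \<in> carrier R" unfolding y_def using xR by simp
  have "y [^] q = y" unfolding y_def using xR by (simp add: nat_pow_distrib m_comm)
  then have yK: "y \<in> K" using K_iff[OF yR] by simp
  obtain c where c: "q = 2 * c + 1" using q by (elim oddE)
  show ?thesis
  proof (cases "x = \<zero>")
    case True
    have "y = \<zero>" unfolding y_def True by simp
    then show ?thesis unfolding y_def[symmetric] True by (simp add: quad_char_def)
  next
    case False
    then have y0: "y \<noteq> \<zero>" unfolding y_def using xR pow_eq_zeroD[of x q] by (auto simp: integral_iff)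
    have qq: "q * q = 2 * ((q + 1) * c) + 1" unfolding c by (simp add: algebra_simps)
    have cF: "card (carrier (R\<lparr>carrier := quad_ext\<rparr>)) = 2 * ((q + 1) * c) + 1"
      using F.cardK unfolding qq by simp
    have "quad_char R quad_ext x = 1 \<longleftrightarrow> x [^] ((q + 1) * c) = \<one>"
      using finite_field.euler_criterion(1)[OF F.finite_field_K cF, of x] x False
      by (simp add: F.etaK_eq nat_pow_consistent[symmetric])
    also have "x [^] ((q + 1) * c) = y [^] c" 
    proof -
      have "y = x [^] (q + 1)" unfolding y_def using xR by (simp add: m_comm)
      then show ?thesis using xR by (simp only: nat_pow_pow)
    qed
    also have "y [^] c = \<one> \<longleftrightarrow> etaK y = 1"
      using finite_field.euler_criterion(1)[OF finite_field_K, of c y] yK y0 cardK c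
      by (simp add: etaK_eq nat_pow_consistent[symmetric])
    finally show ?thesis using y0 False unfolding y_def[symmetric] by (auto simp: quad_char_def split: if_splits)
  qed
qed

section \<open>Character sums over circles\<close>

text \<open>Frobenius exchanges s + w and its conjugate, so their quotient has relative norm 1 and
  the image lies on the circle. The map restricts a Moebius transformation sending infinity to v0;
  it is injective on \<open>K\<close> and misses v0, and both sides have q elements.\<close>

lemma circle_bij:
  assumes w: "w \<in> carrier R" "(w [^] q) [^] q = w" "w [^] q \<noteq> w"
    and v0: "v0 \<in> carrier R" "v0 \<noteq> \<zero>"
    and V: "V = {v \<in> carrier R. v [^] (q + 1) = v0 [^] (q + 1)}" "card V = q + 1"
  shows "bij_betw (\<lambda>s. v0 \<otimes> (s \<oplus> w [^] q) \<otimes> inv (s \<oplus> w)) K (V - {v0})"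
    and "s \<in> K \<Longrightarrow> s \<oplus> w \<noteq> \<zero>"
proof -
  define w' where "w' = w [^] q"
  have w': "w' \<in> carrier R" "w' \<noteq> w" "w' [^] q = w" unfolding w'_def using w by auto
  have nz: "s \<oplus> w \<noteq> \<zero>" if s: "s \<in> K" for s
  proof
    assume "s \<oplus> w = \<zero>"
    then have "w = \<ominus> s" using minus_equality[of w s] s K_carrier[OF s] w(1) a_comm[of s w] by simp
    then have "w \<in> K" using K_closed(5)[OF s] by simp
    then show False using K_iff[OF w(1)] w(3) by simp
  qed
  then show "s \<in> K \<Longrightarrow> s \<oplus> w \<noteq> \<zero>" .
  define \<phi> where "\<phi> s = v0 \<otimes> (s \<oplus> w') \<otimes> inv (s \<oplus> w)" for s
  have \<phi>: "\<phi> s \<in> carrier R \<and> \<phi> s \<otimes> (s \<oplus> w) = v0 \<otimes> (s \<oplus> w')" if s: "s \<in> K" for s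
  proof -
    have sR: "s \<in> carrier R" using s K_carrier by auto
    have y: "s \<oplus> w \<in> carrier R" using sR w by simp
    obtain i where i: "i = inv (s \<oplus> w)" "i \<in> carrier R" "(s \<oplus> w) \<otimes> i = \<one>" using inv_nonzero[OF y nz[OF s]] by blast
    have e: "\<phi> s = v0 \<otimes> (s \<oplus> w') \<otimes> i" unfolding \<phi>_def i(1) ..
    have "\<phi> s \<otimes> (s \<oplus> w) = v0 \<otimes> (s \<oplus> w') \<otimes> ((s \<oplus> w) \<otimes> i)"
      unfolding e using sR w(1) w'(1) i(2) v0(1) by - (rule ring_eqI, (rule reify)+, simp_all)
    then show ?thesis unfolding e i(3) using sR w'(1) i(2) v0(1) by simp
  qed
  have q1: "x [^] (q + 1) = x [^] q \<otimes> x" if "x \<in> carrier R" for x using that by simp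
  have mem: "\<phi> s \<in> V - {v0}" if s: "s \<in> K" for s
  proof -
    have sR: "s \<in> carrier R" "s [^] q = s" using s K_carrier K_iff by auto
    define f where "f = \<phi> s"
    have fR: "f \<in> carrier R" "f \<otimes> (s \<oplus> w) = v0 \<otimes> (s \<oplus> w')" using \<phi>[OF s] unfolding f_def by auto
    have q2: "(s \<oplus> w) [^] q = s \<oplus> w'" "(s \<oplus> w') [^] q = s \<oplus> w"
      using frob1(1)[OF sR(1) w(1)] frob1(1)[OF sR(1) w'(1)] sR(2) w'(3) unfolding w'_def by simp_all
    have m: "(s \<oplus> w') \<otimes> (s \<oplus> w) \<noteq> \<zero>"
    proof -
      have "s \<oplus> w' \<noteq> \<zero>" using nz[OF s] q2(1) sR w pow_eq_zeroD[of "s \<oplus> w" q] by auto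
      then show ?thesis using nz[OF s] sR w w' by (simp add: integral_iff)
    qed
    have "f [^] (q + 1) \<otimes> ((s \<oplus> w') \<otimes> (s \<oplus> w)) = (f \<otimes> (s \<oplus> w)) [^] (q + 1)"
      using fR(1) sR(1) w(1) w'(1) by (simp add: nat_pow_distrib q2 m_ac)
    also have "\<dots> = v0 [^] (q + 1) \<otimes> ((s \<oplus> w') \<otimes> (s \<oplus> w))"
      unfolding fR(2) using v0(1) sR(1) w(1) w'(1) by (simp add: nat_pow_distrib q2 m_ac)
    finally have "f [^] (q + 1) = v0 [^] (q + 1)"
      using m_rcancel[OF m, of "f [^] (q + 1)" "v0 [^] (q + 1)"] fR(1) v0(1) sR(1) w(1) w'(1) by simp
    moreover have "f \<noteq> v0"
    proof
      assume "f = v0"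
      then have "s \<oplus> w = s \<oplus> w'" using fR(2) m_lcancel[OF v0(2,1), of "s \<oplus> w" "s \<oplus> w'"] sR(1) w(1) w'(1) by simp
      then have "(s \<oplus> w) \<ominus> (s \<oplus> w') = \<zero>" using sR(1) w'(1) by simp
      moreover have "(s \<oplus> w) \<ominus> (s \<oplus> w') = w \<ominus> w'" using sR(1) w(1) w'(1) by - (rule ring_eqI, (rule reify)+, simp_all)
      ultimately show False using r_right_minus_eq[OF w(1) w'(1)] w'(2) by simp
    qed
    ultimately show ?thesis using fR(1) unfolding V(1) f_def by simp
  qed
  have inj: "inj_on \<phi> K"
  proof (rule inj_onI)
    fix s r assume s: "s \<in> K" and r: "r \<in> K" and e: "\<phi> s = \<phi> r"
    have R: "s \<in> carrier R" "r \<in> carrier R" using s r K_carrier by auto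
    define f where "f = \<phi> s"
    have f: "f \<in> carrier R" "f \<otimes> (s \<oplus> w) = v0 \<otimes> (s \<oplus> w')" "f \<otimes> (r \<oplus> w) = v0 \<otimes> (r \<oplus> w')"
      using \<phi>[OF s] \<phi>[OF r] e unfolding f_def by auto
    have "v0 \<otimes> ((s \<ominus> r) \<otimes> (w \<ominus> w')) = (v0 \<otimes> (s \<oplus> w')) \<otimes> (r \<oplus> w) \<ominus> (v0 \<otimes> (r \<oplus> w')) \<otimes> (s \<oplus> w)"
      using R v0(1) w(1) w'(1) by - (rule ring_eqI, (rule reify)+, simp_all)
    also have "\<dots> = \<zero>" unfolding f(2,3)[symmetric] using R f(1) w(1) by - (rule ring_eqI, (rule reify)+, simp_all)
    finally have "s \<ominus> r = \<zero> \<or> w \<ominus> w' = \<zero>" using v0 R w w' by (simp add: integral_iff)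
    then show "s = r" using r_right_minus_eq[OF R] r_right_minus_eq[OF w(1) w'(1)] w'(2) by auto
  qed
  have finV: "finite (V - {v0})" using finite_carrier unfolding V(1) by simp
  have "card (\<phi> ` K) = card (V - {v0})"
    using card_image[OF inj] cardK V v0 finite_carrier by (simp add: card_Diff_singleton)
  moreover have "\<phi> ` K \<subseteq> V - {v0}" using mem by auto
  ultimately have "\<phi> ` K = V - {v0}" using card_subset_eq[OF finV] by blast
  then show "bij_betw (\<lambda>s. v0 \<otimes> (s \<oplus> w [^] q) \<otimes> inv (s \<oplus> w)) K (V - {v0})"
    using inj unfolding bij_betw_def \<phi>_def w'_def by blast
qed

text \<open>The sum becomes a quartic sum over \<open>K\<close> together with the term of the one
  point missed by the parametrisation, whence the summand 1. The condition \<open>good\<close>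
  prevents the quadratic form and its conjugate from being proportional, in which case their product
  could be a multiple of a square.\<close>

lemma circle_sum:
  assumes n: "n = 4" and q: "odd q"
    and u: "u \<in> carrier R" "u [^] (q + 1) = c1" "u \<noteq> \<zero>"
    and c: "c1 \<in> K" "c2 \<in> K" "c2 \<noteq> \<zero>"
    and V: "V = {v \<in> carrier R. v [^] (q + 1) = c2}" "card V = q + 1" "V \<subseteq> quad_ext"
    and uF: "u \<in> quad_ext"
    and good: "(c1 \<ominus> u) \<otimes> (c1 \<ominus> u) \<otimes> (u \<oplus> \<one>) \<ominus> c2 \<otimes> ((c1 \<oplus> u) \<otimes> u) \<noteq> \<zero>"
  shows "\<bar>real_of_int (\<Sum>v\<in>V. quad_char R quad_ext
    ((\<one> \<oplus> u \<ominus> v) \<otimes> (\<one> \<oplus> u \<ominus> v) \<ominus> (\<one> \<oplus> \<one>) \<otimes> (\<one> \<oplus> \<one>) \<otimes> u))\<bar> \<le> 29 * sqrt (real q) + 1"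
proof -
  interpret F: norm_ext R quad_ext "q * q" 2 by (rule norm_ext_quad_ext[OF n])
  note two = odd_q_facts[OF q]
  define T where "T = \<one> \<oplus> \<one>"
  have T: "T \<in> carrier R" "T \<noteq> \<zero>" "T \<in> K" unfolding T_def using two by auto
  define bar where "bar x = x [^] q" for x
  have barR: "bar x \<in> carrier R" if "x \<in> carrier R" for x unfolding bar_def using that by simp
  have bar_add: "bar (x \<oplus> y) = bar x \<oplus> bar y" "bar (x \<ominus> y) = bar x \<ominus> bar y" "bar (x \<otimes> y) = bar x \<otimes> bar y"
    if "x \<in> carrier R" "y \<in> carrier R" for x y
    unfolding bar_def using that frob1[OF that] by (simp_all add: nat_pow_distrib)
  have barK: "bar x = x" if "x \<in> K" for x unfolding bar_def using K_iff[OF K_carrier[OF that]] that by simp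
  have barF: "bar (bar x) = x" if "x \<in> quad_ext" for x unfolding bar_def using that unfolding quad_ext_def by simp
  have FK: "x \<in> K" if "x \<in> carrier R" "bar x = x" for x using K_iff[OF that(1)] that(2) unfolding bar_def by simp
  have KF: "x \<in> quad_ext" if "x \<in> K" for x
    unfolding quad_ext_def using K_carrier[OF that] barK[OF that] by (simp add: bar_def)
  have bar1: "bar \<one> = \<one>" "bar T = T" using barK[OF K_closed(2)] barK[OF T(3)] by auto
  define g where "g v = v \<otimes> v \<ominus> T \<otimes> ((u \<oplus> \<one>) \<otimes> v) \<oplus> (u \<ominus> \<one>) \<otimes> (u \<ominus> \<one>)" for v
  have g: "(\<one> \<oplus> u \<ominus> v) \<otimes> (\<one> \<oplus> u \<ominus> v) \<ominus> (\<one> \<oplus> \<one>) \<otimes> (\<one> \<oplus> \<one>) \<otimes> u = g v" if "v \<in> carrier R" for v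
    unfolding g_def T_def using that u(1) by - (rule ring_eqI, (rule reify)+, simp_all)
  have VR: "v \<in> carrier R" if "v \<in> V" for v using that unfolding V(1) by simp
  have gF: "g v \<in> quad_ext" if "v \<in> quad_ext" for v
    unfolding g_def by (intro F.K_closed that uF KF T)
  \<comment> \<open>The base point v0 corresponds to s = infinity, so g(v0) becomes the leading
    coefficient \<open>A\<close> and has to be non-zero. Such a point exists: g takes the non-zero
    value -4u at 1 + u, hence has at most two zeros, while \<open>V\<close> has q + 1 \<ge> 3
    elements.\<close>
  have "\<not> V \<subseteq> {v \<in> carrier R. g v = \<zero>}"
  proof
    assume sub: "V \<subseteq> {v \<in> carrier R. g v = \<zero>}"
    have pf: "polyfun R (Suc 0 + Suc 0) g" unfolding g_def
      by (intro polyfun_add polyfun_minus polyfun_mult polyfun_smult polyfun_mono[OF polyfun_id] polyfun_id polyfun_const)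
         (use T u in auto)
    have "g (\<one> \<oplus> u) = \<ominus> (T \<otimes> T \<otimes> u)" unfolding g_def T_def using u(1) by - (rule ring_eqI, (rule reify)+, simp_all)
    moreover have "T \<otimes> T \<otimes> u \<noteq> \<zero>" using T u by (simp add: integral_iff)
    ultimately have "g (\<one> \<oplus> u) \<noteq> \<zero>" using T u by (metis m_closed minus_minus minus_zero)
    then have "card {v \<in> carrier R. g v = \<zero>} \<le> Suc 0 + Suc 0"
      using polyfun_roots[OF finite_carrier pf, of "\<one> \<oplus> u"] u(1) by simp
    moreover have "card V \<le> card {v \<in> carrier R. g v = \<zero>}" using sub finite_carrier by (intro card_mono) auto
    ultimately show False using V(2) q_ge_2 by simp
  qed
  then obtain v0 where v0: "v0 \<in> V" "g v0 \<noteq> \<zero>" using VR by blast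
  have v0R: "v0 \<in> carrier R" "v0 \<in> quad_ext" "v0 [^] (q + 1) = c2"
    using VR[OF v0(1)] subsetD[OF V(3) v0(1)] v0(1) unfolding V(1) by simp_all
  have v00: "v0 \<noteq> \<zero>" using v0R(3) c(3) by (auto simp: nat_pow_zero)
  have "quad_ext - K \<noteq> {}"
  proof
    assume "quad_ext - K = {}"
    then have "card quad_ext \<le> card K" using finite_K by (intro card_mono) auto
    moreover have "q * 1 < q * q" using q_ge_2 by (intro mult_strict_left_mono) auto
    ultimately show False using F.cardK cardK by simp
  qed
  then obtain w where wF: "w \<in> quad_ext" "w \<notin> K" by blast
  define w' where "w' = bar w"
  have w: "w \<in> carrier R" "bar w' = w" "w' \<in> carrier R" "w' \<noteq> w"
    using wF barF[OF wF(1)] FK[of w] unfolding w'_def by (auto simp: barR F.K_carrier)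
  have w'F: "w' \<in> quad_ext" using barF[OF wF(1)] w unfolding quad_ext_def by (simp add: w'_def bar_def)
  define \<phi> where "\<phi> s = v0 \<otimes> (s \<oplus> w') \<otimes> inv (s \<oplus> w)" for s
  have wa: "(w [^] q) [^] q = w" "w [^] q \<noteq> w" using w unfolding w'_def bar_def by auto
  have V': "V = {v \<in> carrier R. v [^] (q + 1) = v0 [^] (q + 1)}" unfolding v0R(3) by (rule V)
  note cb = circle_bij[OF w(1) wa v0R(1) v00 V' V(2)]
  have bij: "bij_betw \<phi> K (V - {v0})" using cb(1) unfolding \<phi>_def w'_def bar_def by blast
  have nz: "s \<oplus> w \<noteq> \<zero>" if "s \<in> K" for s using cb(2)[OF that] .
  \<comment> \<open>Writing X = s + w' and Y = s + w, the value of g at the point with parameter s,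
    times Y^2, is p X^2 - 2m X Y + r Y^2. Conjugation also swaps X and Y, which is why p' is the
    conjugate of r, and r' that of p.\<close>
  define p where "p = v0 \<otimes> v0"
  define m where "m = (u \<oplus> \<one>) \<otimes> v0"
  define r where "r = (u \<ominus> \<one>) \<otimes> (u \<ominus> \<one>)"
  define p' where "p' = (bar u \<ominus> \<one>) \<otimes> (bar u \<ominus> \<one>)"
  define m' where "m' = (bar u \<oplus> \<one>) \<otimes> bar v0"
  define r' where "r' = bar v0 \<otimes> bar v0"
  have R: "p \<in> carrier R" "m \<in> carrier R" "r \<in> carrier R" "p' \<in> carrier R" "m' \<in> carrier R" "r' \<in> carrier R"
    unfolding p_def m_def r_def p'_def m'_def r'_def using u(1) v0R(1) barR by simp_all
  have brs: "bar p = r'" "bar m = m'" "bar r = p'"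
    unfolding p_def m_def r_def p'_def m'_def r'_def using u(1) v0R(1) barR by (simp_all add: bar_add bar1)
  have pF: "p \<in> quad_ext" "m \<in> quad_ext" "r \<in> quad_ext"
    unfolding p_def m_def r_def by (intro F.K_closed uF v0R)+
  define A where "A = p \<ominus> T \<otimes> m \<oplus> r"
  define B where "B = T \<otimes> (p \<otimes> w' \<ominus> m \<otimes> (w \<oplus> w') \<oplus> r \<otimes> w)"
  define C where "C = p \<otimes> w' \<otimes> w' \<ominus> T \<otimes> m \<otimes> w \<otimes> w' \<oplus> r \<otimes> w \<otimes> w"
  define A' where "A' = p' \<ominus> T \<otimes> m' \<oplus> r'"
  define B' where "B' = T \<otimes> (p' \<otimes> w' \<ominus> m' \<otimes> (w \<oplus> w') \<oplus> r' \<otimes> w)"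
  define C' where "C' = p' \<otimes> w' \<otimes> w' \<ominus> T \<otimes> m' \<otimes> w \<otimes> w' \<oplus> r' \<otimes> w \<otimes> w"
  have ABC: "A \<in> quad_ext" "B \<in> quad_ext" "C \<in> quad_ext"
    unfolding A_def B_def C_def by (intro F.K_closed pF KF[OF T(3)] wF(1) w'F)+
  have ABCR: "A \<in> carrier R" "B \<in> carrier R" "C \<in> carrier R" "A' \<in> carrier R" "B' \<in> carrier R" "C' \<in> carrier R"
    unfolding A_def B_def C_def A'_def B'_def C'_def using R w T by simp_all
  have bA: "bar A = A'"
  proof -
    have "bar A = r' \<ominus> T \<otimes> m' \<oplus> p'" unfolding A_def using R T by (simp add: bar_add bar1 brs)
    also have "\<dots> = A'" unfolding A'_def using R T(1) by - (rule ring_eqI, (rule reify)+, simp_all)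
    finally show ?thesis .
  qed
  have bB: "bar B = B'"
  proof -
    have "bar B = T \<otimes> (r' \<otimes> w \<ominus> m' \<otimes> (w' \<oplus> w) \<oplus> p' \<otimes> w')"
      unfolding B_def using R T w by (simp add: bar_add bar1 brs w'_def[symmetric])
    also have "\<dots> = B'" unfolding B'_def using R T(1) w(1,3) by - (rule ring_eqI, (rule reify)+, simp_all)
    finally show ?thesis .
  qed
  have bC: "bar C = C'"
  proof -
    have "bar C = r' \<otimes> w \<otimes> w \<ominus> T \<otimes> m' \<otimes> w' \<otimes> w \<oplus> p' \<otimes> w' \<otimes> w'"
      unfolding C_def using R T w by (simp add: bar_add bar1 brs w'_def[symmetric])
    also have "\<dots> = C'" unfolding C'_def using R T(1) w(1,3) by - (rule ring_eqI, (rule reify)+, simp_all)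
    finally show ?thesis .
  qed
  have bA': "bar A' = A" "bar B' = B" "bar C' = C"
    using barF ABC unfolding bA[symmetric] bB[symmetric] bC[symmetric] by auto
  have Ag: "A = g v0" unfolding A_def g_def p_def m_def r_def by simp
  have A0: "A \<noteq> \<zero>" using v0(2) Ag by simp
  have A'0: "A' \<noteq> \<zero>" using A0 ABCR pow_eq_zeroD[of A q] unfolding bA[symmetric] bar_def by auto
  define a0 where "a0 = C \<otimes> C'"
  define a1 where "a1 = B \<otimes> C' \<oplus> C \<otimes> B'"
  define a2 where "a2 = A \<otimes> C' \<oplus> B \<otimes> B' \<oplus> C \<otimes> A'"
  define a3 where "a3 = A \<otimes> B' \<oplus> B \<otimes> A'"
  define a4 where "a4 = A \<otimes> A'"
  have aR: "a0 \<in> carrier R" "a1 \<in> carrier R" "a2 \<in> carrier R" "a3 \<in> carrier R" "a4 \<in> carrier R"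
    unfolding a0_def a1_def a2_def a3_def a4_def using ABCR by simp_all
  have aK: "a0 \<in> K" "a1 \<in> K" "a2 \<in> K" "a3 \<in> K" "a4 \<in> K"
  proof -
    have "bar a0 = a0" unfolding a0_def using ABCR by (simp add: bar_add bC bA' m_comm)
    then show "a0 \<in> K" by (rule FK[OF aR(1)])
    have "bar a1 = B' \<otimes> C \<oplus> C' \<otimes> B" unfolding a1_def using ABCR by (simp add: bar_add bA bB bC bA')
    also have "\<dots> = a1" unfolding a1_def using ABCR by - (rule ring_eqI, (rule reify)+, simp_all)
    finally show "a1 \<in> K" by (rule FK[OF aR(2)])
    have "bar a2 = A' \<otimes> C \<oplus> B' \<otimes> B \<oplus> C' \<otimes> A" unfolding a2_def using ABCR by (simp add: bar_add bA bB bC bA')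
    also have "\<dots> = a2" unfolding a2_def using ABCR by - (rule ring_eqI, (rule reify)+, simp_all)
    finally show "a2 \<in> K" by (rule FK[OF aR(3)])
    have "bar a3 = A' \<otimes> B \<oplus> B' \<otimes> A" unfolding a3_def using ABCR by (simp add: bar_add bA bB bC bA')
    also have "\<dots> = a3" unfolding a3_def using ABCR by - (rule ring_eqI, (rule reify)+, simp_all)
    finally show "a3 \<in> K" by (rule FK[OF aR(4)])
    have "bar a4 = a4" unfolding a4_def using ABCR by (simp add: bar_add bA bA' m_comm)
    then show "a4 \<in> K" by (rule FK[OF aR(5)])
  qed
  have a40: "a4 \<noteq> \<zero>" unfolding a4_def using A0 A'0 ABCR by (simp add: integral_iff)
  have disc: "m \<otimes> m \<ominus> p \<otimes> r \<noteq> \<zero>"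
  proof -
    have "m \<otimes> m \<ominus> p \<otimes> r = T \<otimes> T \<otimes> (v0 \<otimes> v0) \<otimes> u"
      unfolding m_def p_def r_def T_def using u(1) v0R(1) by - (rule ring_eqI, (rule reify)+, simp_all)
    then show ?thesis using T u v0R v00 by (simp add: integral_iff)
  qed
  \<comment> \<open>Multiplied by u^2 and simplified with the relative norms c1 of u and c2 of v0, a
    relation p m' = p' m becomes v0 times the expression in \<open>good\<close>.\<close>
  have np: "p \<otimes> m' \<noteq> p' \<otimes> m"
  proof
    assume e: "p \<otimes> m' = p' \<otimes> m"
    obtain ub vb where bb: "bar u = ub" "bar v0 = vb" by blast
    have bu: "ub \<in> carrier R" "vb \<in> carrier R" using barR u v0R bb by auto
    have N: "c1 = u \<otimes> bar u" "c2 = v0 \<otimes> bar v0"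
      using u(1,2) v0R(1,3) unfolding bar_def by (auto simp: m_comm)
    have "v0 \<otimes> ((c1 \<ominus> u) \<otimes> (c1 \<ominus> u) \<otimes> (u \<oplus> \<one>) \<ominus> c2 \<otimes> ((c1 \<oplus> u) \<otimes> u)) = u \<otimes> u \<otimes> (p' \<otimes> m) \<ominus> u \<otimes> u \<otimes> (p \<otimes> m')"
      unfolding N p_def m_def p'_def m'_def bb using u(1) v0R(1) bu by - (rule ring_eqI, (rule reify)+, simp_all)
    also have "\<dots> = \<zero>" unfolding e using u(1) R by simp
    finally show False using good v00 v0R u c K_carrier by (simp add: integral_iff)
  qed
  have nsq: "\<not> (\<exists>b\<in>K. \<exists>q0\<in>K. \<exists>q1\<in>K. \<exists>q2\<in>K.
      a0 = b \<otimes> (q0 \<otimes> q0) \<and> a1 = b \<otimes> (q1 \<otimes> q0 \<oplus> q0 \<otimes> q1) \<and>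
      a2 = b \<otimes> (q2 \<otimes> q0 \<oplus> (q1 \<otimes> q1 \<oplus> q0 \<otimes> q2)) \<and> a3 = b \<otimes> (q2 \<otimes> q1 \<oplus> q1 \<otimes> q2) \<and>
      a4 = b \<otimes> (q2 \<otimes> q2))"
  proof
    assume "\<exists>b\<in>K. \<exists>q0\<in>K. \<exists>q1\<in>K. \<exists>q2\<in>K.
      a0 = b \<otimes> (q0 \<otimes> q0) \<and> a1 = b \<otimes> (q1 \<otimes> q0 \<oplus> q0 \<otimes> q1) \<and>
      a2 = b \<otimes> (q2 \<otimes> q0 \<oplus> (q1 \<otimes> q1 \<oplus> q0 \<otimes> q2)) \<and> a3 = b \<otimes> (q2 \<otimes> q1 \<oplus> q1 \<otimes> q2) \<and>
      a4 = b \<otimes> (q2 \<otimes> q2)"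
    then obtain b q0 q1 q2 where bq: "b \<in> K" "q0 \<in> K" "q1 \<in> K" "q2 \<in> K"
      and eqs: "a0 = b \<otimes> (q0 \<otimes> q0)" "a1 = b \<otimes> (q1 \<otimes> q0 \<oplus> q0 \<otimes> q1)"
      "a2 = b \<otimes> (q2 \<otimes> q0 \<oplus> (q1 \<otimes> q1 \<oplus> q0 \<otimes> q2))" "a3 = b \<otimes> (q2 \<otimes> q1 \<oplus> q1 \<otimes> q2)"
      "a4 = b \<otimes> (q2 \<otimes> q2)" by blast
    show False
      by (rule circle_quartic_not_square[OF two(2) R w(1,3) not_sym[OF w(4)] bq[THEN K_carrier]
        A_def[unfolded T_def] A0 A'_def[unfolded T_def] A'0 B_def[unfolded T_def] B'_def[unfolded T_def]
        C_def[unfolded T_def] C'_def[unfolded T_def] disc np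
        eqs[unfolded a0_def a1_def a2_def a3_def a4_def]])
  qed
  define h where "h s = a0 \<oplus> s \<otimes> (a1 \<oplus> s \<otimes> (a2 \<oplus> s \<otimes> (a3 \<oplus> s \<otimes> a4)))" for s
  have eta: "quad_char R quad_ext (g (\<phi> s)) = etaK (h s)" if s: "s \<in> K" for s
  proof -
    have sR: "s \<in> carrier R" using s K_carrier by auto
    define f where "f = \<phi> s"
    have fV: "f \<in> V" using bij s unfolding f_def bij_betw_def by auto
    then have fR: "f \<in> carrier R" "f \<in> quad_ext" using subsetD[OF V(3) fV] VR[OF fV] by simp_all
    define y where "y = s \<oplus> w"
    have y: "y \<in> carrier R" "y \<in> quad_ext" "y \<noteq> \<zero>"
      unfolding y_def using sR w(1) F.K_closed(3)[OF KF[OF s] wF(1)] nz[OF s] by auto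
    obtain i where i: "i = inv y" "i \<in> carrier R" "y \<otimes> i = \<one>" using inv_nonzero[OF y(1,3)] by blast
    have fy: "f \<otimes> y = v0 \<otimes> (s \<oplus> w')"
    proof -
      have "f \<otimes> y = v0 \<otimes> (s \<oplus> w') \<otimes> (y \<otimes> i)"
        unfolding f_def \<phi>_def y_def[symmetric] i(1)[symmetric] using v0R(1) sR w(3) y(1) i(2)
        by - (rule ring_eqI, (rule reify)+, simp_all)
      then show ?thesis unfolding i(3) using v0R(1) sR w(3) by simp
    qed
    have "g f \<otimes> (y \<otimes> y) = (f \<otimes> y) \<otimes> (f \<otimes> y) \<ominus> T \<otimes> ((u \<oplus> \<one>) \<otimes> ((f \<otimes> y) \<otimes> y)) \<oplus> (u \<ominus> \<one>) \<otimes> (u \<ominus> \<one>) \<otimes> (y \<otimes> y)"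
      unfolding g_def using fR(1) y(1) u(1) T(1) by - (rule ring_eqI, (rule reify)+, simp_all)
    also have "\<dots> = C \<oplus> s \<otimes> (B \<oplus> s \<otimes> A)"
      unfolding fy unfolding A_def B_def C_def p_def m_def r_def y_def T_def using u(1) v0R(1) sR w(1,3)
      by - (rule ring_eqI, (rule reify)+, simp_all)
    finally have e: "g f \<otimes> (y \<otimes> y) = C \<oplus> s \<otimes> (B \<oplus> s \<otimes> A)" .
    \<comment> \<open>Multiplying by the non-zero square y^2 does not change the character; passing
      to the norm then multiplies the quadratic in s by its conjugate, which gives a quartic over
      \<open>K\<close>.\<close>
    have "quad_char R quad_ext (g f) = quad_char R quad_ext (C \<oplus> s \<otimes> (B \<oplus> s \<otimes> A))"
      unfolding e[symmetric] by (rule F.etaK_mult_square[OF gF[OF fR(2)] y(2,3), symmetric])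
    also have "\<dots> = etaK ((C \<oplus> s \<otimes> (B \<oplus> s \<otimes> A)) \<otimes> bar (C \<oplus> s \<otimes> (B \<oplus> s \<otimes> A)))"
      unfolding bar_def by (rule quad_char_quad_ext[OF n q]) (intro F.K_closed ABC KF[OF s])
    also have "bar (C \<oplus> s \<otimes> (B \<oplus> s \<otimes> A)) = C' \<oplus> s \<otimes> (B' \<oplus> s \<otimes> A')"
      using ABCR sR by (simp add: bar_add bA bB bC barK[OF s])
    also have "(C \<oplus> s \<otimes> (B \<oplus> s \<otimes> A)) \<otimes> (C' \<oplus> s \<otimes> (B' \<oplus> s \<otimes> A')) = h s"
      unfolding h_def a0_def a1_def a2_def a3_def a4_def using ABCR sR by - (rule ring_eqI, (rule reify)+, simp_all)
    finally show ?thesis unfolding f_def .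
  qed
  have finV: "finite V" using V(1) finite_carrier by simp
  have "(\<Sum>v\<in>V. quad_char R quad_ext (g v)) = quad_char R quad_ext (g v0) + (\<Sum>v\<in>V - {v0}. quad_char R quad_ext (g v))"
    by (rule sum.remove[OF finV v0(1)])
  also have "(\<Sum>v\<in>V - {v0}. quad_char R quad_ext (g v)) = (\<Sum>s\<in>K. quad_char R quad_ext (g (\<phi> s)))"
    by (rule sum.reindex_bij_betw[OF bij, symmetric])
  also have "\<dots> = (\<Sum>s\<in>K. etaK (h s))" by (rule sum.cong[OF refl eta])
  finally have S: "(\<Sum>v\<in>V. quad_char R quad_ext (g v)) = quad_char R quad_ext (g v0) + (\<Sum>s\<in>K. etaK (h s))" .
  have "\<bar>real_of_int (\<Sum>s\<in>K. etaK (h s))\<bar> \<le> 29 * sqrt (real q)"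
    unfolding h_def by (rule K_quartic_sum[OF q aK a40 nsq])
  moreover have "\<bar>real_of_int (quad_char R quad_ext (g v0))\<bar> \<le> 1" by (simp add: quad_char_def)
  moreover have "(\<Sum>v\<in>V. quad_char R quad_ext ((\<one> \<oplus> u \<ominus> v) \<otimes> (\<one> \<oplus> u \<ominus> v) \<ominus> (\<one> \<oplus> \<one>) \<otimes> (\<one> \<oplus> \<one>) \<otimes> u))
    = (\<Sum>v\<in>V. quad_char R quad_ext (g v))" by (rule sum.cong[OF refl]) (simp only: g[OF VR])
  ultimately show ?thesis unfolding S by simp
qed

text \<open>As 1 + q + q^2 + q^3 = (1 + q^2) (1 + q), the norm is taken in two stages. The count
  splits over pairs (u, v) from two circles of q + 1 elements each, and each pair contributes 1
  minus a character value; so the main term is (q + 1)^2.\<close>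

lemma norm_count_tower:
  assumes n: "n = 4" and q: "odd q" and c: "c1 \<in> K" "c1 \<noteq> \<zero>" "c2 \<in> K" "c2 \<noteq> \<zero>"
  shows "\<bar>real (norm_count c1 c2) - real q ^ 2\<bar> \<le> 70 * (real q * sqrt (real q))"
proof -
  interpret F: norm_ext R quad_ext "q * q" 2 by (rule norm_ext_quad_ext[OF n])
  have cR: "c1 \<in> carrier R" "c2 \<in> carrier R" using c K_carrier by auto
  define U where "U b = {u \<in> carrier R. u [^] (q + 1) = b}" for b
  obtain d where d: "q = Suc d" "d > 0" using q_ge_2 by (cases q) auto
  have dd: "card (carrier R) - 1 = (q + 1) * (d * (q * q + 1))" unfolding cardL n d(1) by (simp add: power4_eq_xxxx algebra_simps)
  have dk: "b [^] d = \<one>" if "b \<in> K" "b \<noteq> \<zero>" for b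
  proof -
    have bR: "b \<in> carrier R" using that K_carrier by auto
    then have "b \<otimes> b [^] d = b \<otimes> \<one>" using K_iff[OF bR] that(1) unfolding d(1) by (simp add: m_comm)
    then show ?thesis using m_lcancel[OF that(2) bR, of "b [^] d" \<one>] bR by simp
  qed
  have U: "card (U b) = q + 1" "U b \<subseteq> quad_ext" if b: "b \<in> K" "b \<noteq> \<zero>" for b
  proof -
    have bR: "b \<in> carrier R" using b K_carrier by auto
    have "b [^] (d * (q * q + 1)) = \<one>" 
    proof -
      have "b [^] (d * (q * q + 1)) = (b [^] d) [^] (q * q + 1)" using bR by (simp only: nat_pow_pow)
      then show ?thesis unfolding dk[OF b] by simp
    qed
    then show "card (U b) = q + 1" unfolding U_def using card_pow_fibre[OF dd bR b(2)] by simp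
    show "U b \<subseteq> quad_ext"
    proof
      fix u assume "u \<in> U b"
      then have u: "u \<in> carrier R" "u [^] (q + 1) = b" unfolding U_def by auto
      have "q * q = Suc ((q + 1) * d)" unfolding d(1) by simp
      then have "(u [^] q) [^] q = u [^] Suc ((q + 1) * d)" using u(1) by (simp only: nat_pow_pow)
      also have "\<dots> = (u [^] (q + 1)) [^] d \<otimes> u" using u(1) by (simp only: nat_pow_Suc nat_pow_pow)
      also have "\<dots> = u" unfolding u(2) dk[OF b] using u(1) by simp
      finally show "u \<in> quad_ext" unfolding quad_ext_def using u(1) by simp
    qed
  qed
  have finU: "finite (U b)" for b unfolding U_def using finite_carrier by simp
  have Unz: "u \<noteq> \<zero>" if "u \<in> U b" "b \<noteq> \<zero>" for u b using that unfolding U_def by (auto simp: nat_pow_zero)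
  have UR: "u \<in> carrier R" "u [^] (q + 1) = b" if "u \<in> U b" for u b using that unfolding U_def by auto
  have Fn: "nm Z = F.nm Z [^] (q + 1)" if "Z \<in> carrier R" for Z
  proof -
    have "F.norm_exp = 1 + q * q" unfolding F.norm_exp_def by (simp add: numeral_2_eq_2)
    moreover have "norm_exp = 1 + q + q * q + q * q * q" unfolding norm_exp_def
      by (simp add: n numeral_eq_Suc algebra_simps)
    ultimately have "norm_exp = F.norm_exp * (q + 1)" by (simp add: algebra_simps)
    then show ?thesis unfolding nm_def F.nm_def using that by (simp only: nat_pow_pow)
  qed
  define W where "W p = {Z \<in> carrier R. F.nm Z = fst p \<and> F.nm (Z \<oplus> \<one>) = snd p}" for p
  have "{Z \<in> carrier R. nm Z = c1 \<and> nm (Z \<oplus> \<one>) = c2} = (\<Union>p\<in>U c1 \<times> U c2. W p)"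
  proof (rule Set.set_eqI)
    fix Z
    show "Z \<in> {Z \<in> carrier R. nm Z = c1 \<and> nm (Z \<oplus> \<one>) = c2} \<longleftrightarrow> Z \<in> (\<Union>p\<in>U c1 \<times> U c2. W p)"
    proof (cases "Z \<in> carrier R")
      case True
      have "F.nm Z \<in> carrier R" "F.nm (Z \<oplus> \<one>) \<in> carrier R"
        using F.nm_in_K[of Z] F.nm_in_K[of "Z \<oplus> \<one>"] F.K_carrier True by auto
      then show ?thesis unfolding W_def U_def using True Fn[of Z] Fn[of "Z \<oplus> \<one>"] by force
    qed (auto simp: W_def)
  qed
  then have "norm_count c1 c2 = card (\<Union>p\<in>U c1 \<times> U c2. W p)" unfolding norm_count_def by simp
  also have "\<dots> = (\<Sum>p\<in>U c1 \<times> U c2. card (W p))"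
  proof (rule card_UN_disjoint)
    show "finite (U c1 \<times> U c2)" using finU by simp
    show "\<forall>p\<in>U c1 \<times> U c2. finite (W p)" unfolding W_def using finite_carrier by simp
    show "\<forall>p\<in>U c1 \<times> U c2. \<forall>r\<in>U c1 \<times> U c2. p \<noteq> r \<longrightarrow> W p \<inter> W r = {}"
      unfolding W_def by (auto simp: prod_eq_iff)
  qed
  also have "\<dots> = (\<Sum>u\<in>U c1. \<Sum>v\<in>U c2. F.norm_count u v)"
    unfolding sum.cartesian_product by (rule sum.cong[OF refl]) (auto simp: W_def F.norm_count_def)
  finally have nc: "norm_count c1 c2 = (\<Sum>u\<in>U c1. \<Sum>v\<in>U c2. F.norm_count u v)" .
  define e where "e u v = quad_char R quad_ext
    ((\<one> \<oplus> u \<ominus> v) \<otimes> (\<one> \<oplus> u \<ominus> v) \<ominus> (\<one> \<oplus> \<one>) \<otimes> (\<one> \<oplus> \<one>) \<otimes> u)" for u v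
  have qq: "odd (q * q)" using q by simp
  have "int (norm_count c1 c2) = (\<Sum>u\<in>U c1. \<Sum>v\<in>U c2. 1 - e u v)" unfolding nc of_nat_sum
  proof (intro sum.cong refl)
    fix u v assume "u \<in> U c1" "v \<in> U c2"
    then have "u \<in> quad_ext" "v \<in> quad_ext" using U(2) c by auto
    then show "int (F.norm_count u v) = 1 - e u v" unfolding e_def by (rule F.norm_count_quadratic[OF refl qq])
  qed
  also have "\<dots> = int ((q + 1) * (q + 1)) - (\<Sum>u\<in>U c1. \<Sum>v\<in>U c2. e u v)"
    using U c by (simp add: sum_subtractf algebra_simps)
  finally have Z: "int (norm_count c1 c2) = int ((q + 1) * (q + 1)) - (\<Sum>u\<in>U c1. \<Sum>v\<in>U c2. e u v)" .
  have N: "real (norm_count c1 c2) = (real q + 1) * (real q + 1) - (\<Sum>u\<in>U c1. real_of_int (\<Sum>v\<in>U c2. e u v))"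
    using arg_cong[OF Z, of real_of_int] by (simp add: algebra_simps)
  define f where "f u = (c1 \<ominus> u) \<otimes> (c1 \<ominus> u) \<otimes> (u \<oplus> \<one>) \<ominus> c2 \<otimes> ((c1 \<oplus> u) \<otimes> u)" for u
  define Bd where "Bd = {u \<in> carrier R. f u = \<zero>}"
  have Bd: "card Bd \<le> 3" "finite Bd"
  proof -
    have pf1: "polyfun R (Suc 0 + Suc 0 + Suc 0) (\<lambda>u. (c1 \<ominus> u) \<otimes> (c1 \<ominus> u) \<otimes> (u \<oplus> \<one>))"
      by (intro polyfun_mult polyfun_minus polyfun_add polyfun_id polyfun_const cR one_closed)
    have pf2: "polyfun R (Suc 0 + Suc 0) (\<lambda>u. c2 \<otimes> ((c1 \<oplus> u) \<otimes> u))"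
      by (intro polyfun_smult polyfun_mult polyfun_add polyfun_id polyfun_const cR)
    have pf: "polyfun R 3 f" unfolding f_def
      by (rule polyfun_minus[OF polyfun_mono[OF pf1] polyfun_mono[OF pf2]]) simp_all
    have "f \<zero> = c1 \<otimes> c1" unfolding f_def using cR by (simp add: a_minus_def)
    then have "f \<zero> \<noteq> \<zero>" using c cR by (simp add: integral_iff)
    then show "card Bd \<le> 3" unfolding Bd_def using polyfun_roots[OF finite_carrier pf zero_closed] by blast
    show "finite Bd" unfolding Bd_def using finite_carrier by simp
  qed
  have qr: "real q \<ge> 2" using q_ge_2 by simp
  define y where "y = sqrt (real q)"
  have y: "y * y = real q" "y \<ge> 1" "y \<le> real q"
    unfolding y_def using qr by (simp_all add: real_le_lsqrt monoid_mult_class.power2_eq_square)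
  have each: "\<bar>real_of_int (\<Sum>v\<in>U c2. e u v)\<bar> \<le> (29 * y + 1) + (if u \<in> Bd then real q + 1 else 0)" if u: "u \<in> U c1" for u
  proof (cases "u \<in> Bd")
    case True
    have "\<bar>real_of_int (\<Sum>v\<in>U c2. e u v)\<bar> \<le> (\<Sum>v\<in>U c2. \<bar>real_of_int (e u v)\<bar>)" by (simp only: of_int_sum sum_abs)
    also have "\<dots> \<le> (\<Sum>v\<in>U c2. 1)" unfolding e_def by (rule sum_mono) (simp add: quad_char_def)
    also have "\<dots> = real q + 1" using U(1)[OF c(3,4)] by simp
    finally show ?thesis using True y by simp
  next
    case False
    then have good: "(c1 \<ominus> u) \<otimes> (c1 \<ominus> u) \<otimes> (u \<oplus> \<one>) \<ominus> c2 \<otimes> ((c1 \<oplus> u) \<otimes> u) \<noteq> \<zero>"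
      unfolding Bd_def f_def using UR[OF u] by simp
    have "\<bar>real_of_int (\<Sum>v\<in>U c2. e u v)\<bar> \<le> 29 * y + 1" unfolding e_def y_def
      by (rule circle_sum[OF n q UR[OF u] Unz[OF u c(2)] c(1,3,4) U_def U(1)[OF c(3,4)] U(2)[OF c(3,4)] _ good])
         (use u U(2)[OF c(1,2)] in auto)
    then show ?thesis using False by simp
  qed
  have "\<bar>\<Sum>u\<in>U c1. real_of_int (\<Sum>v\<in>U c2. e u v)\<bar> \<le> (\<Sum>u\<in>U c1. (29 * y + 1) + (if u \<in> Bd then real q + 1 else 0))"
    by (rule order_trans[OF sum_abs sum_mono[OF each]])
  also have "\<dots> = (real q + 1) * (29 * y + 1) + real (card (U c1 \<inter> Bd)) * (real q + 1)"
    using U(1)[OF c(1,2)] finU by (simp add: sum.distrib sum.If_cases)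
  also have "\<dots> \<le> (real q + 1) * (29 * y + 1) + 3 * (real q + 1)"
  proof -
    have "card (U c1 \<inter> Bd) \<le> 3" using card_mono[OF Bd(2), of "U c1 \<inter> Bd"] Bd(1) by auto
    then show ?thesis by (intro add_left_mono mult_right_mono) auto
  qed
  finally have S: "\<bar>\<Sum>u\<in>U c1. real_of_int (\<Sum>v\<in>U c2. e u v)\<bar> \<le> (real q + 1) * (29 * y + 4)" by (simp add: algebra_simps)
  \<comment> \<open>The character sums cost 66 and the difference (q + 1)^2 - q^2 costs 3, both in
    units of q sqrt q.\<close>
  have "(real q + 1) * (29 * y + 4) \<le> (2 * real q) * (33 * y)" using qr y by (intro mult_mono) auto
  moreover have "2 * real q + 1 \<le> 3 * (real q * y)"
  proof -
    have "real q * 1 \<le> real q * y" using y qr by (intro mult_left_mono) auto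
    then show ?thesis using qr by linarith
  qed
  ultimately have "\<bar>real (norm_count c1 c2) - real q * real q\<bar> \<le> 70 * (real q * y)"
    using S unfolding N by (simp add: algebra_simps)
  then show ?thesis unfolding y_def monoid_mult_class.power2_eq_square .
qed

section \<open>Asymptotics and the theorem\<close>

text \<open>For n \<ge> 5 the deviation from the mean is at most q^(n/2) \<le> q^(n - 5/2), and the
  mean (q^n - 2) / (q - 1)^2 lies within 8 q^(n - 3) of q^(n - 2). The constant 70 comes from n = 4
  and covers the other cases.\<close>

lemma norm_count_asymptotic:
  assumes n: "n \<ge> 3" and q: "odd q" and c: "c1 \<in> K" "c1 \<noteq> \<zero>" "c2 \<in> K" "c2 \<noteq> \<zero>"
    and nd: "\<not> (n = 3 \<and> c1 = \<one> \<and> c2 = \<ominus> \<one>)"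
  shows "\<bar>real (norm_count c1 c2) - real q ^ (n - 2)\<bar> \<le> 70 * real q powr (real n - 5 / 2)"
proof -
  define x where "x = real q"
  have x: "x \<ge> 2" unfolding x_def using q_ge_2 by simp
  have sq: "sqrt x = x powr (1 / 2)" using x by (simp add: powr_half_sqrt)
  consider "n = 3" | "n = 4" | "n \<ge> 5" using n by linarith
  then show ?thesis
  proof cases
    case 1
    have "1 \<le> sqrt x" using x by simp
    then have "29 * sqrt x + 2 \<le> 70 * sqrt x" by linarith
    moreover have "real n - 5 / 2 = 1 / 2" "n - 2 = 1" using 1 by simp_all
    moreover have "\<bar>real (norm_count c1 c2) - x\<bar> \<le> 29 * sqrt x + 2"
      unfolding x_def by (rule norm_count_cubic_bound[OF 1 q c]) (use nd 1 in blast)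
    ultimately show ?thesis unfolding x_def[symmetric] sq by (simp add: \<open>n - 2 = 1\<close>)
  next
    case 2
    have "real n - 5 / 2 = 1 + 1 / 2" "n - 2 = 2" using 2 by simp_all
    moreover have "x powr (1 + 1 / 2) = x * sqrt x" unfolding sq powr_add using x by simp
    ultimately show ?thesis using norm_count_tower[OF 2 q c] unfolding x_def[symmetric] by simp
  next
    case 3
    define M where "M = (x ^ n - 2) / (x - 1)\<^sup>2"
    define k where "k = n - 3"
    have nk: "n = k + 3" "n - 2 = k + 1" "2 \<le> k" unfolding k_def using 3 by simp_all
    have xp: "x ^ k \<ge> 1" using x by simp
    have "(real (norm_count c1 c2) - M)\<^sup>2 \<le> x ^ n" unfolding M_def x_def by (rule norm_count_variance[OF c])
    then have "\<bar>real (norm_count c1 c2) - M\<bar> \<le> sqrt (x ^ n)" using real_sqrt_le_mono by fastforce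
    also have "sqrt (x ^ n) = x powr (real n / 2)"
      using x by (simp add: powr_half_sqrt[symmetric] powr_realpow[symmetric] powr_powr)
    also have "\<dots> \<le> x powr (real n - 5 / 2)" using x 3 by (intro powr_mono) auto
    finally have 1: "\<bar>real (norm_count c1 c2) - M\<bar> \<le> x powr (real n - 5 / 2)" .
    have d: "(x - 1)\<^sup>2 > 0" using x by simp
    have "\<bar>M - x ^ (k + 1)\<bar> \<le> 8 * x ^ k"
    proof -
      have "x ^ n - 2 - x ^ (k + 1) * (x - 1)\<^sup>2 = x ^ k * (2 * x * x - x) - 2"
        unfolding nk(1) power_add by (simp add: algebra_simps monoid_mult_class.power2_eq_square power3_eq_cube)
      moreover have "M - x ^ (k + 1) = (x ^ n - 2 - x ^ (k + 1) * (x - 1)\<^sup>2) / (x - 1)\<^sup>2"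
        unfolding M_def using d by (simp add: field_simps)
      ultimately have e: "M - x ^ (k + 1) = (x ^ k * (2 * x * x - x) - 2) / (x - 1)\<^sup>2" by simp
      have "2 * x \<le> x * x" using x by (intro mult_right_mono) auto
      then have "2 \<le> 2 * x * x - x" using x by linarith
      then have "1 * 2 \<le> x ^ k * (2 * x * x - x)" using xp by (intro mult_mono) auto
      then have "0 \<le> M - x ^ (k + 1)" unfolding e using d by simp
      moreover have "M - x ^ (k + 1) \<le> 8 * x ^ k"
      proof -
        \<comment> \<open>This gives 2x^2 - x \<le> 8 (x - 1)^2 for x \<ge> 2; the constant has to
          cover x = 2, where the quotient is 6.\<close>
        have "0 \<le> (x - 2) * (6 * x - 3)" using x by simp
        then have "2 * x * x - x \<le> 8 * (x - 1)\<^sup>2"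
          by (simp add: algebra_simps monoid_mult_class.power2_eq_square)
        then have "x ^ k * (2 * x * x - x) \<le> x ^ k * (8 * (x - 1)\<^sup>2)" using xp by (intro mult_left_mono) auto
        then show ?thesis unfolding e using d by (simp add: divide_le_eq algebra_simps)
      qed
      ultimately show ?thesis by linarith
    qed
    also have "8 * x ^ k = 8 * x powr real k" using x by (simp add: powr_realpow)
    also have "\<dots> \<le> 8 * x powr (real n - 5 / 2)" unfolding nk(1) using x by (intro mult_left_mono powr_mono) auto
    finally have 2: "\<bar>M - x ^ (n - 2)\<bar> \<le> 8 * x powr (real n - 5 / 2)" unfolding nk(2) .
    have "0 \<le> x powr (real n - 5 / 2)" by simp
    then show ?thesis using 1 2 unfolding x_def[symmetric] by linarith
  qed
qed

text \<open>Links the repeated sums in the theorem with the numerals and products in which the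
  counts are expressed.\<close>

lemma natural_multiples:
  assumes "x \<in> carrier R"
  shows "[(3::nat)] \<cdot> x = \<guillemotleft>3\<guillemotright> \<otimes> x" "[(4::nat)] \<cdot> x = (\<one> \<oplus> \<one>) \<otimes> (\<one> \<oplus> \<one>) \<otimes> x"
proof -
  have "[(3::nat)] \<cdot> x = x \<oplus> x \<oplus> x" "[(4::nat)] \<cdot> x = x \<oplus> x \<oplus> x \<oplus> x"
    using assms by (simp_all add: numeral_eq_Suc)
  moreover have "x \<oplus> x \<oplus> x = \<guillemotleft>3\<guillemotright> \<otimes> x" using assms by - (rule ring_eqI, (rule reify)+, simp_all)
  moreover have "x \<oplus> x \<oplus> x \<oplus> x = (\<one> \<oplus> \<one>) \<otimes> (\<one> \<oplus> \<one>) \<otimes> x" using assms by - (rule ring_eqI, (rule reify)+, simp_all)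
  ultimately show "[(3::nat)] \<cdot> x = \<guillemotleft>3\<guillemotright> \<otimes> x" "[(4::nat)] \<cdot> x = (\<one> \<oplus> \<one>) \<otimes> (\<one> \<oplus> \<one>) \<otimes> x" by simp_all
qed

end

lemma xi_cases: "xi T = 0 \<or> xi T = 1"
  by (simp add: xi_def)

theorem mainTheorem1:
  fixes t :: nat
  assumes "t \<ge> 2"
  shows "\<exists>C::real. \<forall>(L :: 'a ring) (K :: 'a set) (q :: nat) (T :: ('a \<times> 'a) set).
    primepow q \<longrightarrow> finite_field_ext L K q t \<longrightarrow> T \<subseteq> ng_verts L K \<longrightarrow> generic T \<longrightarrow>
      (card T = 2 \<longrightarrow>
         real (ng_deg L K q t T) = (real q ^ (t - 1) - 1) / (real q - 1) - of_int (xi T))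
    \<and> (card T = 3 \<longrightarrow> odd q \<longrightarrow>
         (\<forall>v1 v2 v3 c1 c2. T = {v1, v2, v3} \<longrightarrow>
            c1 = ng_c1 L q t v1 v2 v3 \<longrightarrow> c2 = ng_c2 L q t v1 v2 v3 \<longrightarrow>
              (t = 3 \<longrightarrow>
                 int (ng_deg L K q t T) =
                   1 - quad_char L K
                         ((\<one>\<^bsub>L\<^esub> \<oplus>\<^bsub>L\<^esub> c1 \<ominus>\<^bsub>L\<^esub> c2) [^]\<^bsub>L\<^esub> (2::nat) \<ominus>\<^bsub>L\<^esub> ([(4::nat)] \<cdot>\<^bsub>L\<^esub> c1))
                     - xi T)
            \<and> (t = 4 \<and> c1 = \<one>\<^bsub>L\<^esub> \<and> c2 = \<ominus>\<^bsub>L\<^esub> \<one>\<^bsub>L\<^esub> \<longrightarrow>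
                 int (ng_deg L K q t T) =
                   2 * int q + 1 - quad_char L K (\<ominus>\<^bsub>L\<^esub> ([(3::nat)] \<cdot>\<^bsub>L\<^esub> \<one>\<^bsub>L\<^esub>)) - xi T)
            \<and> (t \<ge> 4 \<and> \<not> (t = 4 \<and> c1 = \<one>\<^bsub>L\<^esub> \<and> c2 = \<ominus>\<^bsub>L\<^esub> \<one>\<^bsub>L\<^esub>) \<longrightarrow>
                 \<bar>real (ng_deg L K q t T) - real q ^ (t - 3)\<bar> \<le> C * real q powr (real t - 3.5))))
    \<and> (card T = 4 \<longrightarrow> t \<ge> 4 \<longrightarrow> ng_deg L K q t T \<le> 6 * (\<Sum>i=0..t - 4. q ^ i))"
proof (rule exI[of _ 71], intro allI impI)
  fix L :: "'a ring" and K :: "'a set" and q :: nat and T :: "('a \<times> 'a) set"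
  assume pp: "primepow q" and ext: "finite_field_ext L K q t" and T: "T \<subseteq> ng_verts L K" "generic T"
  obtain n where tn: "t = Suc n" "n > 0" using assms by (cases t) auto
  interpret norm_ext L K q n
    using ext pp tn unfolding finite_field_ext_def
    by (auto intro!: norm_ext.intro finite_field.intro finite_field_axioms.intro norm_ext_axioms.intro)
  note xi = xi_cases[of T]
  have pair: "real (ng_deg L K q t T) = (real q ^ (t - 1) - 1) / (real q - 1) - of_int (xi T)" if T2: "card T = 2"
  proof -
    have "q ^ n = norm_exp * (q - 1) + 1" using geometric[of n] unfolding norm_exp_def by simp
    moreover obtain d where "q = Suc d" using q_ge_2 by (cases q) auto
    moreover have "real (q ^ n) = real q ^ n" by simp
    ultimately have "real q ^ n = real norm_exp * (real q - 1) + 1" by simp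
    then have "real norm_exp = (real q ^ (t - 1) - 1) / (real q - 1)"
      using q_ge_2 unfolding tn(1) by (simp add: field_simps)
    moreover have "real (ng_deg L K q t T) = real_of_int (int norm_exp - xi T)"
      using ng_deg_2[OF T T2] unfolding tn(1) by (metis of_int_of_nat_eq)
    ultimately show ?thesis by simp
  qed
  have triple: "(t = 3 \<longrightarrow>
                 int (ng_deg L K q t T) =
                   1 - quad_char L K
                         ((\<one>\<^bsub>L\<^esub> \<oplus>\<^bsub>L\<^esub> c1 \<ominus>\<^bsub>L\<^esub> c2) [^]\<^bsub>L\<^esub> (2::nat) \<ominus>\<^bsub>L\<^esub> ([(4::nat)] \<cdot>\<^bsub>L\<^esub> c1))
                     - xi T)
            \<and> (t = 4 \<and> c1 = \<one>\<^bsub>L\<^esub> \<and> c2 = \<ominus>\<^bsub>L\<^esub> \<one>\<^bsub>L\<^esub> \<longrightarrow>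
                 int (ng_deg L K q t T) =
                   2 * int q + 1 - quad_char L K (\<ominus>\<^bsub>L\<^esub> ([(3::nat)] \<cdot>\<^bsub>L\<^esub> \<one>\<^bsub>L\<^esub>)) - xi T)
            \<and> (t \<ge> 4 \<and> \<not> (t = 4 \<and> c1 = \<one>\<^bsub>L\<^esub> \<and> c2 = \<ominus>\<^bsub>L\<^esub> \<one>\<^bsub>L\<^esub>) \<longrightarrow>
                 \<bar>real (ng_deg L K q t T) - real q ^ (t - 3)\<bar> \<le> 71 * real q powr (real t - 3.5))"
    if T3: "card T = 3" "odd q" "T = {v1, v2, v3}" "c1 = ng_c1 L q t v1 v2 v3" "c2 = ng_c2 L q t v1 v2 v3"
    for v1 v2 v3 c1 c2
  proof (intro conjI impI)
    note d = ng_deg_3[OF T T3(1,3), folded tn(1), folded T3(4,5)]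
    have cR: "c1 \<in> carrier L" "c2 \<in> carrier L" using d(1,3) K_carrier by auto
    note nat_mult = natural_multiples[OF cR(1)] natural_multiples[OF one_closed]
    show "int (ng_deg L K q t T) = 1 - quad_char L K
        ((\<one>\<^bsub>L\<^esub> \<oplus>\<^bsub>L\<^esub> c1 \<ominus>\<^bsub>L\<^esub> c2) [^]\<^bsub>L\<^esub> (2::nat) \<ominus>\<^bsub>L\<^esub> ([(4::nat)] \<cdot>\<^bsub>L\<^esub> c1)) - xi T" if t: "t = 3"
    proof -
      have "(\<one>\<^bsub>L\<^esub> \<oplus>\<^bsub>L\<^esub> c1 \<ominus>\<^bsub>L\<^esub> c2) [^]\<^bsub>L\<^esub> (2::nat) = (\<one>\<^bsub>L\<^esub> \<oplus>\<^bsub>L\<^esub> c1 \<ominus>\<^bsub>L\<^esub> c2) \<otimes>\<^bsub>L\<^esub> (\<one>\<^bsub>L\<^esub> \<oplus>\<^bsub>L\<^esub> c1 \<ominus>\<^bsub>L\<^esub> c2)"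
        using cR by (simp add: numeral_2_eq_2)
      moreover have "n = 2" using t tn by simp
      ultimately show ?thesis using d(5) norm_count_quadratic[OF _ T3(2) d(1,3)] unfolding nat_mult by simp
    qed
    show "int (ng_deg L K q t T) = 2 * int q + 1 - quad_char L K (\<ominus>\<^bsub>L\<^esub> ([(3::nat)] \<cdot>\<^bsub>L\<^esub> \<one>\<^bsub>L\<^esub>)) - xi T"
      if h: "t = 4 \<and> c1 = \<one>\<^bsub>L\<^esub> \<and> c2 = \<ominus>\<^bsub>L\<^esub> \<one>\<^bsub>L\<^esub>"
    proof -
      have "n = 3" using h tn by simp
      then show ?thesis using d(5) norm_count_cubic_exact[OF _ T3(2)] h unfolding nat_mult by simp
    qed
    show "\<bar>real (ng_deg L K q t T) - real q ^ (t - 3)\<bar> \<le> 71 * real q powr (real t - 3.5)"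
      if h: "t \<ge> 4 \<and> \<not> (t = 4 \<and> c1 = \<one>\<^bsub>L\<^esub> \<and> c2 = \<ominus>\<^bsub>L\<^esub> \<one>\<^bsub>L\<^esub>)"
    proof -
      have n: "n \<ge> 3" "\<not> (n = 3 \<and> c1 = \<one>\<^bsub>L\<^esub> \<and> c2 = \<ominus>\<^bsub>L\<^esub> \<one>\<^bsub>L\<^esub>)" using h tn by auto
      have e: "real t - 3.5 = real n - 5 / 2" "t - 3 = n - 2" unfolding tn(1) by simp_all
      \<comment> \<open>Because this power is at least 1, the term \<xi>(T) raises the constant from
        70 only to 71.\<close>
      have "1 \<le> real q powr (real n - 5 / 2)" using q_ge_2 n(1) by (intro ge_one_powr_ge_zero) auto
      moreover have "real (ng_deg L K q t T) = real_of_int (int (norm_count c1 c2) - xi T)"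
        using d(5) by (metis of_int_of_nat_eq)
      ultimately show ?thesis
        using norm_count_asymptotic[OF n(1) T3(2) d(1-4) n(2)] xi unfolding e by auto
    qed
  qed
  have quadruple: "ng_deg L K q t T \<le> 6 * (\<Sum>i=0..t - 4. q ^ i)" if T4: "card T = 4" "t \<ge> 4"
  proof -
    have n: "n = Suc (Suc (t - 3))" "t - 3 > 0" using T4(2) tn by auto
    \<comment> \<open>The bound for four vertices sums n - 2 = t - 3 powers, those with exponents 0
      to t - 4.\<close>
    have "{0..t - 4} = {..<t - 3}" using T4(2) by auto
    then show ?thesis using ng_deg_4[OF T T4(1) n] unfolding tn(1) by simp
  qed
  show "(card T = 2 \<longrightarrow>
         real (ng_deg L K q t T) = (real q ^ (t - 1) - 1) / (real q - 1) - of_int (xi T))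
    \<and> (card T = 3 \<longrightarrow> odd q \<longrightarrow>
         (\<forall>v1 v2 v3 c1 c2. T = {v1, v2, v3} \<longrightarrow>
            c1 = ng_c1 L q t v1 v2 v3 \<longrightarrow> c2 = ng_c2 L q t v1 v2 v3 \<longrightarrow>
              (t = 3 \<longrightarrow>
                 int (ng_deg L K q t T) =
                   1 - quad_char L K
                         ((\<one>\<^bsub>L\<^esub> \<oplus>\<^bsub>L\<^esub> c1 \<ominus>\<^bsub>L\<^esub> c2) [^]\<^bsub>L\<^esub> (2::nat) \<ominus>\<^bsub>L\<^esub> ([(4::nat)] \<cdot>\<^bsub>L\<^esub> c1))
                     - xi T)
            \<and> (t = 4 \<and> c1 = \<one>\<^bsub>L\<^esub> \<and> c2 = \<ominus>\<^bsub>L\<^esub> \<one>\<^bsub>L\<^esub> \<longrightarrow>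
                 int (ng_deg L K q t T) =
                   2 * int q + 1 - quad_char L K (\<ominus>\<^bsub>L\<^esub> ([(3::nat)] \<cdot>\<^bsub>L\<^esub> \<one>\<^bsub>L\<^esub>)) - xi T)
            \<and> (t \<ge> 4 \<and> \<not> (t = 4 \<and> c1 = \<one>\<^bsub>L\<^esub> \<and> c2 = \<ominus>\<^bsub>L\<^esub> \<one>\<^bsub>L\<^esub>) \<longrightarrow>
                 \<bar>real (ng_deg L K q t T) - real q ^ (t - 3)\<bar> \<le> 71 * real q powr (real t - 3.5))))
    \<and> (card T = 4 \<longrightarrow> t \<ge> 4 \<longrightarrow> ng_deg L K q t T \<le> 6 * (\<Sum>i=0..t - 4. q ^ i))"
    by (intro conjI impI allI pair quadruple triple)
qed

end
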